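(* Let $(M^n,g)$ be a compact $n$-dimensional Riemannian manifold without boundary, let $\alpha\in(0,n)$, $1<p<\frac n\alpha$, and let $q$ be given by $\frac1q=\frac1p-\frac\alpha n$. If $N_{p,\alpha,M}>N_{p,\alpha}$, then the supremum defining $N_{p,\alpha,M}$ is attained, i.e., there exists a function $f\in L^p(M^n)\setminus\{0\}$ such that $$N_{p,\alpha,M}=\frac{\|I_\alpha f\|_{L^q(M^n)}}{\|f\|_{L^p(M^n)}}.$$
   Context: For $x,y\in M^n$, $|x-y|_g$ denotes the distance from $x$ to $y$ on $M^n$ under the metric $g$, and $dV$ (written $dV_x$, $dV_y$ according to the integration variable) is the Riemannian volume measure of $g$. $L^p(M^n)$ is the Lebesgue space with respect to $dV$. For $f\in L^p(M^n)$, $$I_\alpha f(x)=\int_{M^n}\frac{f(y)}{|x-y|_g^{n-\alpha}}\,dV_y .$$ It is known that $I_\alpha$ is bounded from $L^p(M^n)$ to $L^q(M^n)$ (Hardy-Littlewood-Sobolev inequality on $M^n$). The sharp constant is $$N_{p,\alpha,M}:=\sup\Bigl\{\frac{\|I_\alpha f\|_{L^q(M^n)}}{\|f\|_{L^p(M^n)}}:\ f\in L^p(M^n)\setminus\{0\}\Bigr\}.$$ $N_{p,\alpha}$ denotes the corresponding sharp constant on Euclidean $\mathbb{R}^n$ (with Euclidean distance and Lebesgue measure): $$N_{p,\alpha}:=\sup\Bigl\{\frac{\bigl\|\int_{\mathbb{R}^n}f(y)\,|x-y|^{\alpha-n}\,dy\bigr\|_{L^q(\mathbb{R}^n)}}{\|f\|_{L^p(\mathbb{R}^n)}}:\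 f\in L^p(\mathbb{R}^n)\setminus\{0\}\Bigr\}.$$ *)

theory Defs
  imports "HOL-Analysis.Analysis"
begin

section \<open>Smooth maps\<close>

text \<open>Intended for open \<open>S\<close>: all iterated directional derivatives up to order \<open>k\<close> exist and
  are continuous.\<close>

primrec Ck_on ::
    "nat \<Rightarrow> 'a::euclidean_space set \<Rightarrow> ('a \<Rightarrow> 'b::real_normed_vector) \<Rightarrow> bool" where
  "Ck_on 0 S f \<longleftrightarrow> continuous_on S f"
| "Ck_on (Suc k) S f \<longleftrightarrow> (\<forall>x\<in>S. f differentiable (at x)) \<and>
     (\<forall>v. Ck_on k S (\<lambda>x. frechet_derivative f (at x) v))"

definition smooth_on ::
    "'a::euclidean_space set \<Rightarrow> ('a \<Rightarrow> 'b::real_normed_vector) \<Rightarrow> bool" where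
  "smooth_on S f \<longleftrightarrow> (\<forall>k. Ck_on k S f)"


section \<open>Smooth manifolds and Riemannian metrics\<close>

text \<open>A manifold is a subset \<open>M\<close> of a Hausdorff space with its subspace topology, together with
  a (not necessarily maximal) smooth atlas. A chart is a pair \<open>(U, \<phi>)\<close>, where \<open>\<phi>\<close> is relevant
  only on \<open>U\<close>. All charts map onto open subsets of \<open>real ^ 'n\<close>, so there is no boundary and the
  dimension is \<open>CARD('n)\<close>.\<close>

type_synonym ('m, 'n) chart = "'m set \<times> ('m \<Rightarrow> real ^ 'n)"

definition chart_inv :: "('m, 'n) chart \<Rightarrow> real ^ 'n \<Rightarrow> 'm" where
  "chart_inv c = inv_into (fst c) (snd c)"

definition is_chart :: "'m::topological_space set \<Rightarrow> ('m, 'n::finite) chart \<Rightarrow> bool" where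
  "is_chart M c \<longleftrightarrow> openin (top_of_set M) (fst c) \<and> open (snd c ` fst c) \<and>
     homeomorphism (fst c) (snd c ` fst c) (snd c) (chart_inv c)"

definition transition_map :: "('m, 'n) chart \<Rightarrow> ('m, 'n) chart \<Rightarrow> real ^ 'n \<Rightarrow> real ^ 'n" where
  "transition_map c d = snd d \<circ> chart_inv c"

definition smooth_manifold ::
    "'m::t2_space set \<Rightarrow> ('m, 'n::finite) chart set \<Rightarrow> bool" where
  "smooth_manifold M A \<longleftrightarrow>
     second_countable (top_of_set M) \<and>
     (\<forall>c\<in>A. is_chart M c) \<and>
     (\<Union>c\<in>A. fst c) = M \<and>
     (\<forall>c\<in>A. \<forall>d\<in>A. smooth_on (snd c ` (fst c \<inter> fst d)) (transition_map c d))"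

text \<open>A metric tensor is given by its coefficient matrices: \<open>g c x\<close> is the matrix
  \<open>(g\<^sub>i\<^sub>j)\<close> at the point \<open>x\<close> in the coordinates of the chart \<open>c\<close>. The last condition is the
  transformation law of a covariant 2-tensor.\<close>

type_synonym ('m, 'n) metric_tensor = "('m, 'n) chart \<Rightarrow> 'm \<Rightarrow> real ^ 'n ^ 'n"

definition riemannian_metric ::
    "('m, 'n::finite) chart set \<Rightarrow> ('m, 'n) metric_tensor \<Rightarrow> bool" where
  "riemannian_metric A g \<longleftrightarrow>
     (\<forall>c\<in>A. smooth_on (snd c ` fst c) (\<lambda>z. g c (chart_inv c z))) \<and>
     (\<forall>c\<in>A. \<forall>x\<in>fst c. transpose (g c x) = g c x \<and> (\<forall>v. v \<noteq> 0 \<longrightarrow> v \<bullet> (g c x *v v) > 0)) \<and>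
     (\<forall>c\<in>A. \<forall>d\<in>A. \<forall>x\<in>fst c \<inter> fst d.
        let J = matrix (frechet_derivative (transition_map c d) (at (snd c x)))
        in g c x = transpose J ** g d x ** J)"

definition riemannian_manifold ::
    "'m::t2_space set \<Rightarrow> ('m, 'n::finite) chart set \<Rightarrow> ('m, 'n) metric_tensor \<Rightarrow> bool" where
  "riemannian_manifold M A g \<longleftrightarrow> smooth_manifold M A \<and> riemannian_metric A g"


section \<open>Riemannian distance\<close>

definition piecewise_C1_curve ::
    "'m::t2_space set \<Rightarrow> ('m, 'n::finite) chart set \<Rightarrow> (real \<Rightarrow> 'm) \<Rightarrow> bool" where
  "piecewise_C1_curve M A \<gamma> \<longleftrightarrow> path \<gamma> \<and> path_image \<gamma> \<subseteq> M \<and>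
     (\<forall>c\<in>A. \<forall>a b. {a..b} \<subseteq> {0..1} \<and> \<gamma> ` {a..b} \<subseteq> fst c \<longrightarrow>
        (snd c \<circ> \<gamma>) piecewise_C1_differentiable_on {a..b})"

text \<open>By the transformation law, \<open>|\<gamma>'(t)|\<^sub>g\<close> does not depend on the chart around \<open>\<gamma> t\<close> in which
  it is computed, except at the finitely many \<open>t\<close> where \<open>\<gamma>\<close> is not differentiable.\<close>

definition speed ::
    "('m, 'n::finite) chart set \<Rightarrow> ('m, 'n) metric_tensor \<Rightarrow> (real \<Rightarrow> 'm) \<Rightarrow> real \<Rightarrow> real" where
  "speed A g \<gamma> t =
     (let c = (SOME c. c \<in> A \<and> \<gamma> t \<in> fst c);
          v = vector_derivative (snd c \<circ> \<gamma>) (at t within {0..1})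
      in sqrt (v \<bullet> (g c (\<gamma> t) *v v)))"

definition curve_length ::
    "('m, 'n::finite) chart set \<Rightarrow> ('m, 'n) metric_tensor \<Rightarrow> (real \<Rightarrow> 'm) \<Rightarrow> ennreal" where
  "curve_length A g \<gamma> = (\<integral>\<^sup>+ t\<in>{0..1}. ennreal (speed A g \<gamma> t) \<partial>lborel)"

text \<open>\<open>M\<close> is not required to be connected. Points in different components, for which the infimum
  is \<open>\<infinity>\<close>, get the value 0 here. Since \<open>0 powr a = 0\<close> and \<open>r / 0 = 0\<close>, the kernel
  \<open>1 / riemannian_dist M A g x y powr (n - \<alpha>)\<close> used below vanishes at such pairs, as it should
  for infinite distance. (It also vanishes on the diagonal, which is a null set.)\<close>

definition riemannian_dist ::
    "'m::t2_space set \<Rightarrow> ('m, 'n::finite) chart set \<Rightarrow> ('m, 'n) metric_tensor \<Rightarrow>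
     'm \<Rightarrow> 'm \<Rightarrow> real" where
  "riemannian_dist M A g x y =
     enn2real (INF \<gamma>\<in>{\<gamma>. piecewise_C1_curve M A \<gamma> \<and> pathstart \<gamma> = x \<and> pathfinish \<gamma> = y}.
                 curve_length A g \<gamma>)"


section \<open>Riemannian volume measure\<close>

text \<open>The unique Borel measure on \<open>M\<close> given in every chart by \<open>dV = sqrt (det g) dz\<close>.\<close>

definition riemannian_volume ::
    "'m::t2_space set \<Rightarrow> ('m, 'n::finite) chart set \<Rightarrow> ('m, 'n) metric_tensor \<Rightarrow>
     'm measure" where
  "riemannian_volume M A g =
     (THE V. space V = M \<and> sets V = sets (restrict_space borel M) \<and>
        (\<forall>c\<in>A. \<forall>B\<in>sets V. B \<subseteq> fst c \<longrightarrow>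
           emeasure V B =
             (\<integral>\<^sup>+ z\<in>snd c ` B. ennreal (sqrt (det (g c (chart_inv c z)))) \<partial>lborel)))"


section \<open>Lebesgue spaces, Riesz potentials, sharp constants\<close>

definition Lp_norm :: "real \<Rightarrow> 'a measure \<Rightarrow> ('a \<Rightarrow> real) \<Rightarrow> ennreal" where
  "Lp_norm p V f =
     (let I = (\<integral>\<^sup>+ x. ennreal (\<bar>f x\<bar> powr p) \<partial>V)
      in if I = \<infinity> then \<infinity> else ennreal (enn2real I powr (1 / p)))"

text \<open>The representatives of the nonzero elements of \<open>L\<^sup>p\<close>.\<close>

definition Lp_nonzero :: "real \<Rightarrow> 'a measure \<Rightarrow> ('a \<Rightarrow> real) set" where
  "Lp_nonzero p V =
     {f \<in> borel_measurable V. Lp_norm p V f < \<infinity> \<and> \<not> (AE x in V. f x = 0)}"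

text \<open>In the following, \<open>d\<close> is the distance function, \<open>V\<close> the volume measure and \<open>n\<close> the dimension
  of the underlying space.\<close>

definition riesz_potential ::
    "'a measure \<Rightarrow> ('a \<Rightarrow> 'a \<Rightarrow> real) \<Rightarrow> nat \<Rightarrow> real \<Rightarrow> ('a \<Rightarrow> real) \<Rightarrow> 'a \<Rightarrow> real" where
  "riesz_potential V d n \<alpha> f x = (\<integral>y. f y / d x y powr (real n - \<alpha>) \<partial>V)"

definition HLS_quotient ::
    "'a measure \<Rightarrow> ('a \<Rightarrow> 'a \<Rightarrow> real) \<Rightarrow> nat \<Rightarrow> real \<Rightarrow> real \<Rightarrow> real \<Rightarrow> ('a \<Rightarrow> real) \<Rightarrow> ennreal" where
  "HLS_quotient V d n \<alpha> p q f = Lp_norm q V (riesz_potential V d n \<alpha> f) / Lp_norm p V f"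

definition HLS_constant ::
    "'a measure \<Rightarrow> ('a \<Rightarrow> 'a \<Rightarrow> real) \<Rightarrow> nat \<Rightarrow> real \<Rightarrow> real \<Rightarrow> real \<Rightarrow> ennreal" where
  "HLS_constant V d n \<alpha> p q = (SUP f\<in>Lp_nonzero p V. HLS_quotient V d n \<alpha> p q f)"

end

(* A maximizing sequence for I_alpha : L^p(M) -> L^q(M) may be replaced by one of the form
   f_j = (I_alpha h_j)^(p'-1) with (h_j) bounded in L^q', because one step of the power method for
   I_alpha and its transpose does not decrease the quotient. As I_alpha : L^q' -> L^1 is compact, f_j
   converges almost everywhere to some f along a subsequence. The Brezis-Lieb lemma splits both
   |f_j|_p^p and |I_alpha f_j|_q^q into the contribution of f and that of the remainder f_j - f, which
   tends to 0 in L^1. In normalized coordinates around a point the manifold is almost Euclidean, so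
   multipliers phi_i with sum phi_i^p = 1 and small supports give, for every C > N_{p,alpha},
     |I_alpha u|_q <= C |u|_p + K |u|_1.
   Hence the remainder contributes at most C^q (|f_j - f|_p^p)^(q/p). Since q/p > 1 and C can be chosen
   below N_{p,alpha,M}, the remainder must tend to 0 in L^p, and f is a maximizer. *)

theory Submission
  imports Defs "HOL-Library.Diagonal_Subsequence"
begin

text \<open>At the critical exponent compactness fails: a sequence bounded in L^p may concentrate at
  points, and weak convergence alone gives no convergence almost everywhere, which the Brezis-Lieb
  splitting requires and which a nonlocal operator does not provide by itself. The power step
  supplies it, as the new sequence consists of powers of potentials and these are compact in an L^1
  target, below the exponent p'. Mass can then be lost through concentration only, where the flat
  constant governs. The kernel is nonnegative and |I_alpha f| <= I_alpha |f|, so the analysis is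
  done for functions with values in [0,\<infinity>]; the real-valued statement returns at the end.
  Analysis and geometry meet in the locale \<open>riesz_space\<close>: a finite measure, an extended
  distance with finite covers by balls, and a local estimate with a constant \<open>C\<close>. The
  kernel decreases with the distance, so the geometric input is a lower bound for the Riemannian
  distance and two-sided bounds for the volume density. Finiteness of N_{p,alpha} is read off from
  the strict inequality in the hypothesis and passes to the manifold through the local
  estimates.\<close>

section \<open>Powers and Lebesgue norms of extended nonnegative functions\<close>

text \<open>Working in [0,\<infinity>] keeps all integrals and powers total. The value at
  \<infinity> is the one used for the root in \<open>Lp_norm\<close>, so that \<open>nrm\<close>
  below extends that norm to functions with infinite values. The laws are meant for positive
  exponents.\<close>

definition epow :: "ennreal \<Rightarrow> real \<Rightarrow> ennreal" where
  "epow x a = (if x = \<infinity> then \<infinity> else ennreal (enn2real x powr a))"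

lemma epow_ennreal [simp]: "0 \<le> r \<Longrightarrow> epow (ennreal r) a = ennreal (r powr a)"
  by (simp add: epow_def)

lemma epow_top [simp]: "epow \<infinity> a = \<infinity>" "epow top a = \<infinity>"
  by (simp_all add: epow_def)

lemma epow_0 [simp]: "epow 0 a = 0"
  by (simp add: epow_def)

lemma epow_1 [simp]: "epow 1 a = 1" "epow x 1 = x"
  by (cases x; simp add: epow_def)+

lemma epow_mono: "x \<le> y \<Longrightarrow> 0 < a \<Longrightarrow> epow x a \<le> epow y a"
  by (cases x; cases y) (auto simp: powr_mono2 ennreal_leI top_unique)

lemma epow_epow: "0 < a \<Longrightarrow> 0 < b \<Longrightarrow> epow (epow x a) b = epow x (a * b)"
  by (cases x) (auto simp: powr_powr)

lemma epow_add: "0 < a \<Longrightarrow> 0 < b \<Longrightarrow> epow x a * epow x b = epow x (a + b)"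
  by (cases x) (auto simp: powr_add ennreal_mult'' ennreal_top_mult)

lemma epow_eq_0_iff [simp]: "epow x a = 0 \<longleftrightarrow> x = 0"
  by (cases x) (auto simp: ennreal_eq_0_iff)

lemma epow_eq_top_iff [simp]: "epow x a = \<infinity> \<longleftrightarrow> x = \<infinity>"
  by (cases x) auto

lemma epow_eq_top_iff' [simp]: "epow x a = top \<longleftrightarrow> x = top"
  by (cases x) auto

lemma epow_less_top_iff [simp]: "epow x a < top \<longleftrightarrow> x < top"
  by (cases x) auto

lemma epow_mult: "0 < a \<Longrightarrow> epow (x * y) a = epow x a * epow y a"
proof -
  assume a: "0 < a"
  have *: "epow (top * z) a = epow top a * epow z a" for z
    by (cases "z = 0") (auto simp: ennreal_top_mult)
  show ?thesis
    using * [of x] * [of y]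
    by (cases x; cases y) (auto simp: ennreal_mult'[symmetric] powr_mult mult.commute)
qed

lemma epow_le_iff: "0 < a \<Longrightarrow> epow x a \<le> y \<longleftrightarrow> x \<le> epow y (1 / a)"
  using epow_mono[of "epow x a" y "1 / a"] epow_mono[of x "epow y (1 / a)" a]
  by (auto simp: epow_epow)

lemma le_epow_iff: "0 < a \<Longrightarrow> y \<le> epow x a \<longleftrightarrow> epow y (1 / a) \<le> x"
  using epow_le_iff[of "1 / a" y x] by simp

text \<open>By \<open>epow_le_iff\<close> and \<open>le_epow_iff\<close> the power is an order
  isomorphism of [0,\<infinity>] with inverse the power 1 / a.\<close>

lemma epow_SUP: "0 < a \<Longrightarrow> epow (SUP i\<in>I. f i) a = (SUP i\<in>I. epow (f i) a)"
proof (rule antisym)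
  assume a: "0 < a"
  show "epow (SUP i\<in>I. f i) a \<le> (SUP i\<in>I. epow (f i) a)"
    unfolding epow_le_iff[OF a] by (rule SUP_least) (auto simp: epow_le_iff[OF a, symmetric] intro: SUP_upper)
  show "(SUP i\<in>I. epow (f i) a) \<le> epow (SUP i\<in>I. f i) a"
    by (intro SUP_least epow_mono SUP_upper a)
qed

lemma measurable_epow [measurable]:
  assumes [measurable]: "f \<in> borel_measurable M"
  shows "(\<lambda>x. epow (f x) a) \<in> borel_measurable M"
  unfolding epow_def by measurable

definition nrm :: "real \<Rightarrow> 'a measure \<Rightarrow> ('a \<Rightarrow> ennreal) \<Rightarrow> ennreal" where
  "nrm a M f = epow (\<integral>\<^sup>+x. epow (f x) a \<partial>M) (1 / a)"

lemma nrm_powr: "0 < a \<Longrightarrow> epow (nrm a M f) a = (\<integral>\<^sup>+x. epow (f x) a \<partial>M)"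
  by (simp add: nrm_def epow_epow)

lemma nrm_le_iff: "0 < a \<Longrightarrow> nrm a M f \<le> c \<longleftrightarrow> (\<integral>\<^sup>+x. epow (f x) a \<partial>M) \<le> epow c a"
  using epow_le_iff[of "1 / a" _ c] by (simp add: nrm_def)

lemma nrm_mono_AE: "0 < a \<Longrightarrow> (AE x in M. f x \<le> g x) \<Longrightarrow> nrm a M f \<le> nrm a M g"
  unfolding nrm_def by (intro epow_mono nn_integral_mono_AE) (auto elim!: AE_mp simp: epow_mono)

lemma nrm_mono: "0 < a \<Longrightarrow> (\<And>x. x \<in> space M \<Longrightarrow> f x \<le> g x) \<Longrightarrow> nrm a M f \<le> nrm a M g"
  by (rule nrm_mono_AE) auto

lemma nrm_cong: "(\<And>x. x \<in> space M \<Longrightarrow> f x = g x) \<Longrightarrow> nrm a M f = nrm a M g"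
  unfolding nrm_def by (metis (mono_tags, lifting) nn_integral_cong)

lemma nrm_eq_0_iff:
  "0 < a \<Longrightarrow> f \<in> borel_measurable M \<Longrightarrow> nrm a M f = 0 \<longleftrightarrow> (AE x in M. f x = 0)"
  by (simp add: nrm_def nn_integral_0_iff_AE)

lemma nrm_cmult: "0 < a \<Longrightarrow> f \<in> borel_measurable M \<Longrightarrow> nrm a M (\<lambda>x. c * f x) = c * nrm a M f"
  by (simp add: nrm_def epow_mult nn_integral_cmult epow_epow)

lemma nrm_const: "0 < a \<Longrightarrow> nrm a M (\<lambda>x. c) = c * epow (emeasure M (space M)) (1 / a)"
  by (simp add: nrm_def epow_mult epow_epow)

lemma nrm_epow: "0 < a \<Longrightarrow> 0 < b \<Longrightarrow> nrm a M (\<lambda>x. epow (f x) b) = epow (nrm (a * b) M f) b"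
  by (simp add: nrm_def epow_epow mult.commute)

lemma nrm_SUP:
  assumes "0 < a" "incseq f" "\<And>i. f i \<in> borel_measurable M"
  shows "nrm a M (\<lambda>x. SUP i::nat. f i x) = (SUP i. nrm a M (f i))"
  using assms unfolding nrm_def
  by (subst epow_SUP[OF assms(1)], subst nn_integral_monotone_convergence_SUP)
     (auto simp: epow_SUP incseq_def le_fun_def intro!: epow_mono)

section \<open>Hoelder and Minkowski inequalities for functions with values in
  [0,\<infinity>]\<close>

lemma Young_ennreal:
  assumes "1 < p" "1 < p'" "1 / p + 1 / p' = 1" "0 < t" "0 < u"
  shows "x * y \<le> ennreal (t * u) * (ennreal (1 / (p * t powr p)) * epow x p
                                  + ennreal (1 / (p' * u powr p')) * epow y p')"
proof (cases "x = 0 \<or> y = 0 \<or> x = \<infinity> \<or> y = \<infinity>")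
  case True
  have "0 < 1 / (p * t powr p)" "0 < 1 / (p' * u powr p')" using assms by auto
  then show ?thesis using True assms(4,5) by (auto simp: ennreal_mult_top)
next
  case False
  then obtain a b where ab: "x = ennreal a" "y = ennreal b" "0 < a" "0 < b"
    by (cases x; cases y; simp add: less_le)
  have "(a / t) * (b / u) \<le> (a / t) powr p / p + (b / u) powr p' / p'"
    using ab assms by (intro Youngs_inequality) auto
  also have "\<dots> = 1 / (p * t powr p) * a powr p + 1 / (p' * u powr p') * b powr p'"
    using ab assms by (simp add: powr_divide mult.commute)
  finally have "a * b \<le> t * u * (1 / (p * t powr p) * a powr p + 1 / (p' * u powr p') * b powr p')"
    using assms by (simp add: field_simps)
  then show ?thesis
    using ab assms by (simp add: ennreal_mult'[symmetric] ennreal_plus[symmetric] del: ennreal_plus)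
qed

text \<open>Young's inequality is applied to f / t and g / u with t, u the two norms, which is the
  scaling built into \<open>Young_ennreal\<close>; integration then leaves t u (1 / p + 1 / p').
  Zero and infinite norms are split off because that scaling divides by them.\<close>

lemma Holder_nrm:
  assumes [measurable]: "f \<in> borel_measurable M" "g \<in> borel_measurable M"
    and p: "1 < p" "1 < p'" "1 / p + 1 / p' = 1"
  shows "(\<integral>\<^sup>+x. f x * g x \<partial>M) \<le> nrm p M f * nrm p' M g"
proof -
  consider "nrm p M f = 0" | "nrm p' M g = 0" | "nrm p M f = \<infinity>" "nrm p' M g \<noteq> 0"
    | "nrm p' M g = \<infinity>" "nrm p M f \<noteq> 0"
    | "nrm p M f \<noteq> 0" "nrm p' M g \<noteq> 0" "nrm p M f \<noteq> \<infinity>" "nrm p' M g \<noteq> \<infinity>" by blast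
  then show ?thesis
  proof cases
    case 1
    then have "AE x in M. f x * g x = 0" using p by (auto simp: nrm_eq_0_iff)
    then have "(\<integral>\<^sup>+x. f x * g x \<partial>M) = (\<integral>\<^sup>+x. 0 \<partial>M)" by (rule nn_integral_cong_AE)
    then show ?thesis by simp
  next
    case 2
    then have "AE x in M. f x * g x = 0" using p by (auto simp: nrm_eq_0_iff)
    then have "(\<integral>\<^sup>+x. f x * g x \<partial>M) = (\<integral>\<^sup>+x. 0 \<partial>M)" by (rule nn_integral_cong_AE)
    then show ?thesis by simp
  next
    case 3
    then show ?thesis by (simp add: ennreal_top_mult)
  next
    case 4
    then show ?thesis by (simp add: ennreal_mult_top)
  next
    case 5
    then obtain t u where tu: "nrm p M f = ennreal t" "nrm p' M g = ennreal u" "0 < t" "0 < u"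
      by (cases "nrm p M f"; cases "nrm p' M g"; simp add: less_le)
    have F: "(\<integral>\<^sup>+x. epow (f x) p \<partial>M) = ennreal (t powr p)"
      using nrm_powr[of p M f] p tu by simp
    have G: "(\<integral>\<^sup>+x. epow (g x) p' \<partial>M) = ennreal (u powr p')"
      using nrm_powr[of p' M g] p tu by simp
    have "(\<integral>\<^sup>+x. f x * g x \<partial>M) \<le> (\<integral>\<^sup>+x. ennreal (t * u) * (ennreal (1 / (p * t powr p)) * epow (f x) p
                                  + ennreal (1 / (p' * u powr p')) * epow (g x) p') \<partial>M)"
      by (intro nn_integral_mono Young_ennreal p tu)
    also have "\<dots> = ennreal (t * u) * (ennreal (1 / (p * t powr p)) * ennreal (t powr p)
                                  + ennreal (1 / (p' * u powr p')) * ennreal (u powr p'))"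
      by (simp add: nn_integral_cmult nn_integral_add F G)
    also have "\<dots> = ennreal (t * u) * (ennreal (1 / p) + ennreal (1 / p'))"
      using tu p by (simp add: ennreal_mult'[symmetric])
    also have "\<dots> = ennreal (t * u)"
      using p by (simp add: ennreal_plus[symmetric] del: ennreal_plus)
    finally show ?thesis using tu by (simp add: ennreal_mult')
  qed
qed

text \<open>Convexity of \<open>t \<mapsto> t\<^sup>q\<close>, applied to the points \<open>x / a\<close>, \<open>y / b\<close> with weights
  \<open>a / (a + b)\<close>, \<open>b / (a + b)\<close>.\<close>

lemma powr_add_le:
  fixes x y a b q :: real
  assumes "0 \<le> x" "0 \<le> y" "0 < a" "0 < b" "1 \<le> q"
  shows "(x + y) powr q \<le> (a + b) powr (q - 1) * (a powr (1 - q) * x powr q + b powr (1 - q) * y powr q)"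
proof -
  \<comment> \<open>Used when one of the two summands vanishes: there monotonicity of the power with
    exponent q - 1 replaces convexity.\<close>
  have one: "z powr q \<le> (a + b) powr (q - 1) * (c powr (1 - q) * z powr q)" if "0 \<le> z" "0 < c" "c \<le> a + b" for z c
  proof -
    have "c powr (q - 1) \<le> (a + b) powr (q - 1)"
      using that assms by (intro powr_mono2) auto
    then have "1 \<le> (a + b) powr (q - 1) * c powr (1 - q)"
      using that mult_right_mono[of "c powr (q - 1)" "(a + b) powr (q - 1)" "c powr (1 - q)"]
      by (simp add: powr_add[symmetric])
    then show ?thesis
      using mult_right_mono[of 1 "(a + b) powr (q - 1) * c powr (1 - q)" "z powr q"] by (simp add: ac_simps)
  qed
  consider "x = 0" | "y = 0" | "0 < x" "0 < y" using assms by linarith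
  then show ?thesis
  proof cases
    case 1 then show ?thesis using one[of y b] assms by simp
  next
    case 2 then show ?thesis using one[of x a] assms by simp
  next
    case 3
    define s where "s = a + b"
    have s: "0 < s" using assms by (simp add: s_def)
    have ab1: "a / s + b / s = 1" using s by (simp add: s_def add_divide_distrib[symmetric])
    have "((a / s) *\<^sub>R (x / a) + (b / s) *\<^sub>R (y / b)) powr q
        \<le> (a / s) * (x / a) powr q + (b / s) * (y / b) powr q"
    proof -
      have "1 - b / s = a / s" using ab1 by simp
      then show ?thesis
        using convex_onD[OF powr_convex[OF assms(5)], of "b / s" "x / a" "y / b"] 3 assms s by (auto simp: s_def)
    qed
    then have "((x + y) / s) powr q \<le> (a / s) * (x powr q / a powr q) + (b / s) * (y powr q / b powr q)"
      using 3 assms by (simp add: powr_divide add_divide_distrib)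
    then have "(x + y) powr q / s powr q \<le> ((a powr (1 - q)) * x powr q + b powr (1 - q) * y powr q) / s"
    proof -
      have "(a / s) * (x powr q / a powr q) + (b / s) * (y powr q / b powr q)
        = ((a powr (1 - q)) * x powr q + b powr (1 - q) * y powr q) / s"
        using 3 assms s by (simp add: powr_diff add_divide_distrib mult.commute)
      moreover have "(x + y) powr q / s powr q = ((x + y) / s) powr q"
        using 3 s by (simp add: powr_divide)
      ultimately show ?thesis
        using \<open>((x + y) / s) powr q \<le> (a / s) * (x powr q / a powr q) + (b / s) * (y powr q / b powr q)\<close> by simp
    qed
    then have "(x + y) powr q \<le> s powr q * (((a powr (1 - q)) * x powr q + b powr (1 - q) * y powr q) / s)"
      using s by (simp add: pos_divide_le_eq mult.commute)
    also have "\<dots> = s powr (q - 1) * ((a powr (1 - q)) * x powr q + b powr (1 - q) * y powr q)"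
      using s by (simp add: powr_diff)
    finally show ?thesis by (simp add: s_def)
  qed
qed

text \<open>With a, b the norms of f and g as weights, the convexity inequality
  \<open>powr_add_le\<close> integrates to (a + b)^(q-1) (a + b). Norms equal to 0 or \<infinity>
  cannot serve as weights and are treated apart.\<close>

lemma Minkowski_nrm:
  assumes [measurable]: "f \<in> borel_measurable M" "g \<in> borel_measurable M" and q: "1 \<le> q"
  shows "nrm q M (\<lambda>x. f x + g x) \<le> nrm q M f + nrm q M g"
proof -
  consider "nrm q M f = 0" | "nrm q M g = 0" | "nrm q M f = \<infinity> \<or> nrm q M g = \<infinity>"
    | "nrm q M f \<noteq> 0" "nrm q M g \<noteq> 0" "nrm q M f \<noteq> \<infinity>" "nrm q M g \<noteq> \<infinity>" by blast
  then show ?thesis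
  proof cases
    case 1
    then have "AE x in M. f x = 0" using q by (auto simp: nrm_eq_0_iff)
    then have "nrm q M (\<lambda>x. f x + g x) \<le> nrm q M g" using q by (intro nrm_mono_AE) auto
    then show ?thesis using 1 by simp
  next
    case 2
    then have "AE x in M. g x = 0" using q by (auto simp: nrm_eq_0_iff)
    then have "nrm q M (\<lambda>x. f x + g x) \<le> nrm q M f" using q by (intro nrm_mono_AE) auto
    then show ?thesis using 2 by simp
  next
    case 3
    then show ?thesis by auto
  next
    case 4
    then obtain a b where ab: "nrm q M f = ennreal a" "nrm q M g = ennreal b" "0 < a" "0 < b"
      by (cases "nrm q M f"; cases "nrm q M g"; simp add: less_le)
    have F: "(\<integral>\<^sup>+x. epow (f x) q \<partial>M) = ennreal (a powr q)"
      using nrm_powr[of q M f] q ab by simp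
    have G: "(\<integral>\<^sup>+x. epow (g x) q \<partial>M) = ennreal (b powr q)"
      using nrm_powr[of q M g] q ab by simp
    have *: "epow (x + y) q \<le> ennreal ((a + b) powr (q - 1)) *
      (ennreal (a powr (1 - q)) * epow x q + ennreal (b powr (1 - q)) * epow y q)" for x y
    proof (cases "x = \<infinity> \<or> y = \<infinity>")
      case True
      then show ?thesis using ab by (auto simp: ennreal_mult_top)
    next
      case False
      then obtain x' y' where "x = ennreal x'" "y = ennreal y'" "0 \<le> x'" "0 \<le> y'"
        by (cases x; cases y; simp)
      then show ?thesis using powr_add_le[of x' y' a b q] ab q
        by (simp add: ennreal_mult'[symmetric] ennreal_plus[symmetric] ennreal_leI del: ennreal_plus)
    qed
    have "(\<integral>\<^sup>+x. epow (f x + g x) q \<partial>M) \<le> (\<integral>\<^sup>+x. ennreal ((a + b) powr (q - 1)) *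
      (ennreal (a powr (1 - q)) * epow (f x) q + ennreal (b powr (1 - q)) * epow (g x) q) \<partial>M)"
      by (intro nn_integral_mono *)
    also have "\<dots> = ennreal ((a + b) powr (q - 1)) *
      (ennreal (a powr (1 - q)) * ennreal (a powr q) + ennreal (b powr (1 - q)) * ennreal (b powr q))"
      by (simp add: nn_integral_cmult nn_integral_add F G)
    also have "\<dots> = ennreal ((a + b) powr (q - 1) * (a powr (1 - q) * a powr q + b powr (1 - q) * b powr q))"
      using ab by (simp add: ennreal_mult'[symmetric] ennreal_plus[symmetric] del: ennreal_plus)
    also have "(a + b) powr (q - 1) * (a powr (1 - q) * a powr q + b powr (1 - q) * b powr q) = (a + b) powr q"
      using ab by (simp add: powr_add[symmetric]) (simp add: powr_diff)
    finally have "nrm q M (\<lambda>x. f x + g x) \<le> ennreal (a + b)"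
      using q ab by (simp add: nrm_le_iff del: ennreal_plus)
    then show ?thesis using ab by simp
  qed
qed

lemma Minkowski_nrm_sum:
  assumes "finite I" and [measurable]: "\<And>i. i \<in> I \<Longrightarrow> f i \<in> borel_measurable M" and q: "1 \<le> q"
  shows "nrm q M (\<lambda>x. \<Sum>i\<in>I. f i x) \<le> (\<Sum>i\<in>I. nrm q M (f i))"
  using assms(1,2)
proof (induction I rule: finite_induct)
  case empty
  then show ?case using q by (simp add: nrm_def)
next
  case (insert i I)
  have "nrm q M (\<lambda>x. f i x + (\<Sum>i\<in>I. f i x)) \<le> nrm q M (f i) + nrm q M (\<lambda>x. \<Sum>i\<in>I. f i x)"
    by (rule Minkowski_nrm[OF _ _ q]) (auto intro!: insert.prems borel_measurable_sum)
  also have "\<dots> \<le> nrm q M (f i) + (\<Sum>i\<in>I. nrm q M (f i))"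
    using insert by (intro add_left_mono) auto
  finally show ?case using insert.hyps by simp
qed


subsection \<open>The Brezis-Lieb lemma\<close>

lemma powr_perturb_upper:
  fixes p e :: real
  assumes "1 < p" "0 < e"
  obtains K where "0 \<le> K" "\<And>x y. 0 \<le> x \<Longrightarrow> 0 \<le> y \<Longrightarrow> (x + y) powr p \<le> (1 + e) * x powr p + K * y powr p"
proof -
  \<comment> \<open>Chosen so that a^(1-p) = 1 + e: with weights a and 1 - a the convexity
    inequality has exactly this coefficient in front of x^p, and K is (1 - a)^(1-p).\<close>
  define a where "a = (1 + e) powr (1 / (1 - p))"
  have a: "0 < a" "a < 1" using assms by (auto simp: a_def powr_less_one)
  have "a powr (1 - p) = 1 + e" using assms by (simp add: a_def powr_powr)
  then have "(x + y) powr p \<le> (1 + e) * x powr p + (1 - a) powr (1 - p) * y powr p"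
    if "0 \<le> x" "0 \<le> y" for x y
    using powr_add_le[of x y a "1 - a" p] a that assms by simp
  then show ?thesis by (intro that[of "(1 - a) powr (1 - p)"]) auto
qed

text \<open>The pointwise inequality behind the Brezis-Lieb lemma. The upper half is
  \<open>powr_perturb_upper\<close>; the lower half is the same bound for the decomposition a = (a +
  b) + (- b), solved for |a + b|^p.\<close>

lemma powr_perturb_abs:
  fixes p e :: real
  assumes "1 < p" "0 < e"
  obtains K where "0 \<le> K"
    "\<And>a b. \<bar>\<bar>a + b\<bar> powr p - \<bar>a\<bar> powr p - \<bar>b\<bar> powr p\<bar> \<le> e * \<bar>a\<bar> powr p + K * \<bar>b\<bar> powr p"
proof -
  obtain K where K: "0 \<le> K"
    "\<And>x y. 0 \<le> x \<Longrightarrow> 0 \<le> y \<Longrightarrow> (x + y) powr p \<le> (1 + e) * x powr p + K * y powr p"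
    using powr_perturb_upper[OF assms] by blast
  have up: "\<bar>a + b\<bar> powr p \<le> (1 + e) * \<bar>a\<bar> powr p + K * \<bar>b\<bar> powr p" for a b :: real
  proof -
    have "\<bar>a + b\<bar> powr p \<le> (\<bar>a\<bar> + \<bar>b\<bar>) powr p"
      using assms by (intro powr_mono2) auto
    then show ?thesis using K(2)[of "\<bar>a\<bar>" "\<bar>b\<bar>"] by simp
  qed
  have "\<bar>\<bar>a + b\<bar> powr p - \<bar>a\<bar> powr p - \<bar>b\<bar> powr p\<bar> \<le> e * \<bar>a\<bar> powr p + (K + 1) * \<bar>b\<bar> powr p" for a b :: real
  proof -
    define A B S where "A = \<bar>a\<bar> powr p" and "B = \<bar>b\<bar> powr p" and "S = \<bar>a + b\<bar> powr p"
    have nn: "0 \<le> A" "0 \<le> B" "0 \<le> S" by (auto simp: A_def B_def S_def)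
    have 1: "S \<le> (1 + e) * A + K * B" using up[of a b] by (simp add: A_def B_def S_def)
    have 2: "A \<le> (1 + e) * S + K * B" using up[of "a + b" "- b"] by (simp add: A_def B_def S_def)
    \<comment> \<open>For e < 1, multiply by 1 - e and use (1 - e)(1 + e) <= 1; for e >= 1 the left
      side is not positive.\<close>
    have "A - K * B - e * A \<le> S"
    proof (cases "A - K * B - e * A \<le> 0")
      case False
      have "(1 - e) * A - (1 - e) * (K * B) \<le> S" if "e < 1"
      proof -
        have "(1 - e) * (A - K * B) \<le> (1 - e) * ((1 + e) * S)"
          using 2 that by (intro mult_left_mono) auto
        also have "\<dots> = S - e * e * S" by (simp add: algebra_simps)
        also have "\<dots> \<le> S" using nn by simp
        finally show ?thesis by (simp add: algebra_simps)
      qed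
      moreover have "e < 1"
      proof (rule ccontr)
        assume "\<not> e < 1"
        then have "1 * A \<le> e * A" using nn by (intro mult_right_mono) auto
        moreover have "0 \<le> K * B" using nn K by simp
        ultimately show False using False by simp
      qed
      moreover have "(1 - e) * (K * B) \<le> K * B"
        using nn K assms by (intro mult_left_le_one_le) (auto simp: \<open>e < 1\<close> less_imp_le)
      ultimately show ?thesis by (simp add: algebra_simps)
    qed (use nn in auto)
    then have "\<bar>S - A - B\<bar> \<le> e * A + (K + 1) * B"
      using 1 nn by (simp add: abs_le_iff algebra_simps)
    then show ?thesis by (simp add: A_def B_def S_def)
  qed
  then show ?thesis using K by (intro that[of "K + 1"]) auto
qed

text \<open>The defect \<open>W\<close> is at most e |u_j - v|^p plus an excess \<open>Z\<close>.
  The excess is dominated by the fixed integrable function K |v|^p and tends to 0 by dominated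
  convergence; the other part is small uniformly in j because the p-norms stay bounded.
  Integrability of v itself comes from Fatou's lemma.\<close>

lemma Brezis_Lieb:
  fixes u :: "nat \<Rightarrow> 'a \<Rightarrow> real"
  assumes [measurable]: "\<And>j. u j \<in> borel_measurable M" "v \<in> borel_measurable M"
    and p: "1 < p"
    and lim: "AE x in M. (\<lambda>j. u j x) \<longlonglongrightarrow> v x"
    and int: "\<And>j. integrable M (\<lambda>x. \<bar>u j x\<bar> powr p)"
    and bd: "\<And>j. (\<integral>x. \<bar>u j x\<bar> powr p \<partial>M) \<le> B"
  shows "integrable M (\<lambda>x. \<bar>v x\<bar> powr p)"
    and "\<And>j. integrable M (\<lambda>x. \<bar>u j x - v x\<bar> powr p)"
    and "\<And>j. (\<integral>x. \<bar>u j x - v x\<bar> powr p \<partial>M) \<le> 2 powr p * B"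
    and "(\<lambda>j. (\<integral>x. \<bar>u j x\<bar> powr p \<partial>M) - (\<integral>x. \<bar>u j x - v x\<bar> powr p \<partial>M))
           \<longlonglongrightarrow> (\<integral>x. \<bar>v x\<bar> powr p \<partial>M)"
proof -
  have nn: "(\<integral>\<^sup>+x. ennreal (\<bar>v x\<bar> powr p) \<partial>M) \<le> ennreal B"
  proof -
    have "(\<integral>\<^sup>+x. ennreal (\<bar>v x\<bar> powr p) \<partial>M) \<le> (\<integral>\<^sup>+x. liminf (\<lambda>j. ennreal (\<bar>u j x\<bar> powr p)) \<partial>M)"
    proof (intro nn_integral_mono_AE, use lim in eventually_elim)
      case (elim x)
      have "(\<lambda>j. ennreal (\<bar>u j x\<bar> powr p)) \<longlonglongrightarrow> ennreal (\<bar>v x\<bar> powr p)"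
        using elim p by (intro tendsto_intros tendsto_powr') auto
      then show ?case using lim_imp_Liminf[of sequentially] by force
    qed
    also have "\<dots> \<le> liminf (\<lambda>j. \<integral>\<^sup>+x. ennreal (\<bar>u j x\<bar> powr p) \<partial>M)"
      by (rule nn_integral_liminf) measurable
    also have "\<dots> \<le> limsup (\<lambda>j. \<integral>\<^sup>+x. ennreal (\<bar>u j x\<bar> powr p) \<partial>M)"
      by (rule Liminf_le_Limsup) simp
    also have "\<dots> \<le> ennreal B"
      using int bd by (intro Limsup_bounded always_eventually allI) (simp add: nn_integral_eq_integral ennreal_leI)
    finally show ?thesis .
  qed
  show iv: "integrable M (\<lambda>x. \<bar>v x\<bar> powr p)"
    by (rule integrableI_bounded) (use nn in \<open>auto intro: le_less_trans\<close>)
  have B0: "0 \<le> B" using bd[of 0] by (meson Bochner_Integration.integral_nonneg order_trans powr_ge_zero)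
  have ivB: "(\<integral>x. \<bar>v x\<bar> powr p \<partial>M) \<le> B"
    using nn iv B0 by (simp add: nn_integral_eq_integral)
  have pw: "\<bar>a - b\<bar> powr p \<le> 2 powr (p - 1) * (\<bar>a\<bar> powr p + \<bar>b\<bar> powr p)" for a b :: real
  proof -
    have "\<bar>a - b\<bar> powr p \<le> (\<bar>a\<bar> + \<bar>b\<bar>) powr p" using p by (intro powr_mono2) auto
    then show ?thesis using powr_add_le[of "\<bar>a\<bar>" "\<bar>b\<bar>" 1 1 p] p by simp
  qed
  show iuv: "integrable M (\<lambda>x. \<bar>u j x - v x\<bar> powr p)" for j
  proof (rule Bochner_Integration.integrable_bound)
    show "integrable M (\<lambda>x. 2 powr (p - 1) * (\<bar>u j x\<bar> powr p + \<bar>v x\<bar> powr p))"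
      using int iv by auto
  qed (use pw in \<open>auto simp: abs_of_nonneg\<close>)
  show bd': "(\<integral>x. \<bar>u j x - v x\<bar> powr p \<partial>M) \<le> 2 powr p * B" for j
  proof -
    have "(\<integral>x. \<bar>u j x - v x\<bar> powr p \<partial>M) \<le> (\<integral>x. 2 powr (p - 1) * (\<bar>u j x\<bar> powr p + \<bar>v x\<bar> powr p) \<partial>M)"
      using int iv iuv by (intro integral_mono pw) auto
    also have "\<dots> = 2 powr (p - 1) * ((\<integral>x. \<bar>u j x\<bar> powr p \<partial>M) + (\<integral>x. \<bar>v x\<bar> powr p \<partial>M))"
      using int iv by simp
    also have "\<dots> \<le> 2 powr (p - 1) * (B + B)"
      using bd[of j] ivB by (intro mult_left_mono add_mono) auto
    finally show ?thesis by (simp add: powr_diff)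
  qed
  define W where "W j x = \<bar>\<bar>u j x\<bar> powr p - \<bar>u j x - v x\<bar> powr p - \<bar>v x\<bar> powr p\<bar>" for j x
  have iW: "integrable M (W j)" for j unfolding W_def using int iv iuv by auto
  have [measurable]: "W j \<in> borel_measurable M" for j using iW by auto
  have W0: "0 \<le> (\<integral>x. W j x \<partial>M)" for j by (simp add: W_def)
  have W: "(\<lambda>j. \<integral>x. W j x \<partial>M) \<longlonglongrightarrow> 0"
  proof (rule LIMSEQ_I)
    fix r :: real assume r: "0 < r"
    \<comment> \<open>Here 2^p B bounds the integral of |u_j - v|^p, so that this part stays below r
      / 2; the summand 1 covers B = 0.\<close>
    define e where "e = r / (2 * (2 powr p * B + 1))"
    have "0 \<le> 2 powr p * B" using B0 by simp
    then have e: "0 < e" "e * (2 powr p * B) \<le> r / 2"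
      using r by (auto simp: e_def field_simps)
    obtain K where K: "0 \<le> K"
      "\<And>a b. \<bar>\<bar>a + b\<bar> powr p - \<bar>a\<bar> powr p - \<bar>b\<bar> powr p\<bar> \<le> e * \<bar>a\<bar> powr p + K * \<bar>b\<bar> powr p"
      using powr_perturb_abs[OF p e(1)] by blast
    define Z where "Z j x = max 0 (W j x - e * \<bar>u j x - v x\<bar> powr p)" for j x
    have [measurable]: "Z j \<in> borel_measurable M" for j unfolding Z_def by measurable
    \<comment> \<open>The perturbation inequality for a = u_j - v and b = v: what exceeds e |a|^p is
      a multiple of the fixed function |v|^p.\<close>
    have Zb: "\<bar>Z j x\<bar> \<le> K * \<bar>v x\<bar> powr p" for j x
      using K(2)[of "u j x - v x" "v x"] K(1) by (auto simp: Z_def W_def)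
    have iZ: "integrable M (Z j)" for j
      by (rule Bochner_Integration.integrable_bound[of _ "\<lambda>x. K * \<bar>v x\<bar> powr p"]) (use iv Zb K in \<open>auto simp: abs_of_nonneg\<close>)
    have "(\<lambda>j. \<integral>x. Z j x \<partial>M) \<longlonglongrightarrow> (\<integral>x. 0 \<partial>M)"
    proof (rule integral_dominated_convergence[where w = "\<lambda>x. K * \<bar>v x\<bar> powr p"])
      show "AE x in M. (\<lambda>j. Z j x) \<longlonglongrightarrow> 0"
        using lim
      proof eventually_elim
        case (elim x)
        have a: "(\<lambda>j. \<bar>u j x\<bar> powr p) \<longlonglongrightarrow> \<bar>v x\<bar> powr p"
          using elim p by (intro tendsto_intros tendsto_powr') auto
        have b: "(\<lambda>j. \<bar>u j x - v x\<bar> powr p) \<longlonglongrightarrow> \<bar>v x - v x\<bar> powr p"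
          using elim p by (intro tendsto_intros tendsto_powr') auto
        have "(\<lambda>j. Z j x) \<longlonglongrightarrow> max 0 (\<bar>\<bar>v x\<bar> powr p - \<bar>v x - v x\<bar> powr p - \<bar>v x\<bar> powr p\<bar> - e * \<bar>v x - v x\<bar> powr p)"
          unfolding Z_def W_def by (intro tendsto_intros a b)
        then show ?case by simp
      qed
    qed (use iv Zb in auto)
    then have "eventually (\<lambda>j. (\<integral>x. Z j x \<partial>M) < r / 2) sequentially"
      using r by (intro order_tendstoD) auto
    then obtain J where J: "\<And>j. j \<ge> J \<Longrightarrow> (\<integral>x. Z j x \<partial>M) < r / 2"
      by (auto simp: eventually_sequentially)
    show "\<exists>no. \<forall>n\<ge>no. norm ((\<integral>x. W n x \<partial>M) - 0) < r"
    proof (intro exI allI impI)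
      fix j assume "J \<le> j"
      have "(\<integral>x. W j x \<partial>M) \<le> (\<integral>x. Z j x + e * \<bar>u j x - v x\<bar> powr p \<partial>M)"
        using iW iZ iuv by (intro integral_mono) (auto simp: Z_def)
      also have "\<dots> = (\<integral>x. Z j x \<partial>M) + e * (\<integral>x. \<bar>u j x - v x\<bar> powr p \<partial>M)"
        using iZ iuv by simp
      also have "\<dots> < r / 2 + e * (2 powr p * B)"
        using J[OF \<open>J \<le> j\<close>] bd'[of j] e by (intro add_less_le_mono mult_left_mono) auto
      finally show "norm ((\<integral>x. W j x \<partial>M) - 0) < r" using W0[of j] e by simp
    qed
  qed
  have "(\<lambda>j. ((\<integral>x. \<bar>u j x\<bar> powr p \<partial>M) - (\<integral>x. \<bar>u j x - v x\<bar> powr p \<partial>M)) - (\<integral>x. \<bar>v x\<bar> powr p \<partial>M)) \<longlonglongrightarrow> 0"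
  proof (rule Lim_null_comparison[OF _ W], rule always_eventually, rule allI)
    fix j
    have "((\<integral>x. \<bar>u j x\<bar> powr p \<partial>M) - (\<integral>x. \<bar>u j x - v x\<bar> powr p \<partial>M)) - (\<integral>x. \<bar>v x\<bar> powr p \<partial>M)
      = (\<integral>x. \<bar>u j x\<bar> powr p - \<bar>u j x - v x\<bar> powr p - \<bar>v x\<bar> powr p \<partial>M)"
      using int iv iuv by simp
    also have "norm \<dots> \<le> (\<integral>x. norm (\<bar>u j x\<bar> powr p - \<bar>u j x - v x\<bar> powr p - \<bar>v x\<bar> powr p) \<partial>M)"
      by (rule integral_norm_bound)
    finally show "norm ((\<integral>x. \<bar>u j x\<bar> powr p \<partial>M) - (\<integral>x. \<bar>u j x - v x\<bar> powr p \<partial>M) - (\<integral>x. \<bar>v x\<bar> powr p \<partial>M))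
       \<le> (\<integral>x. W j x \<partial>M)"
      by (simp add: W_def)
  qed
  then show "(\<lambda>j. (\<integral>x. \<bar>u j x\<bar> powr p \<partial>M) - (\<integral>x. \<bar>u j x - v x\<bar> powr p \<partial>M))
           \<longlonglongrightarrow> (\<integral>x. \<bar>v x\<bar> powr p \<partial>M)"
    by (simp add: LIM_zero_iff)
qed

section \<open>Riesz potentials on compact spaces with a local estimate\<close>

text \<open>The distance may be infinite; then, and on the diagonal, the kernel \<open>k\<close> vanishes.\<close>

locale riesz_space = finite_measure V for V :: "'a measure" +
  fixes D :: "'a \<Rightarrow> 'a \<Rightarrow> ennreal" and s p q C :: real
  assumes s_pos: "0 < s" and p_gt1: "1 < p" and p_less_q: "p < q" and C_nonneg: "0 \<le> C"
    and D_refl: "x \<in> space V \<Longrightarrow> D x x = 0"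
    and D_sym: "x \<in> space V \<Longrightarrow> y \<in> space V \<Longrightarrow> D x y = D y x"
    and D_tri: "x \<in> space V \<Longrightarrow> y \<in> space V \<Longrightarrow> z \<in> space V \<Longrightarrow> D x z \<le> D x y + D y z"
    and ball_sets: "x \<in> space V \<Longrightarrow> {y \<in> space V. D x y < r} \<in> sets V"
    and ball_cover: "(\<And>x. x \<in> space V \<Longrightarrow> 0 < \<rho> x) \<Longrightarrow>
      \<exists>F. finite F \<and> F \<subseteq> space V \<and> (\<forall>x\<in>space V. \<exists>y\<in>F. D y x < ennreal (\<rho> y))"
    and local_bound: "x \<in> space V \<Longrightarrow> \<exists>r>0. \<forall>f\<in>borel_measurable V.
      (\<forall>y\<in>space V. ennreal r \<le> D x y \<longrightarrow> f y = 0) \<longrightarrow>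
      nrm q V (\<lambda>z. indicator {z \<in> space V. D x z < ennreal r} z *
          (\<integral>\<^sup>+y. ennreal (1 / enn2real (D z y) powr s) * f y \<partial>V)) \<le> ennreal C * nrm p V f"
begin

definition k :: "'a \<Rightarrow> 'a \<Rightarrow> real" where
  "k x y = 1 / enn2real (D x y) powr s"

definition T :: "('a \<Rightarrow> ennreal) \<Rightarrow> 'a \<Rightarrow> ennreal" where
  "T f x = (\<integral>\<^sup>+y. ennreal (k x y) * f y \<partial>V)"

section \<open>Conjugate exponents, measurability and symmetry of the operator\<close>

definition p' :: real where "p' = p / (p - 1)"
definition q' :: real where "q' = q / (q - 1)"

lemma q_gt1: "1 < q"
  using p_gt1 p_less_q by simp

lemma p'_gt1: "1 < p'" and p'_conj: "1 / p + 1 / p' = 1"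
  using p_gt1 by (simp_all add: p'_def field_simps)

lemma q'_gt1: "1 < q'" and q'_conj: "1 / q + 1 / q' = 1"
  using q_gt1 by (simp_all add: q'_def field_simps)

text \<open>These identities put the powers of the power method into the right spaces: (T f)^(q-1)
  into L^q' when T f is in L^q, and (T h)^(p'-1) into L^p when T h is in L^p'.\<close>

lemma exponents: "(p' - 1) * p = p'" "(q - 1) * q' = q"
  using p_gt1 q_gt1 by (simp_all add: p'_def q'_def field_simps)

text \<open>Total boundedness: \<open>ball_cover\<close> with the constant radii 1 / (n + 1). The
  set serves for the measurability of \<open>D\<close> and for the diagonal argument in
  \<open>T_compact\<close>.\<close>

lemma ex_countable_dense:
  obtains A where "countable A" "A \<subseteq> space V"
    "\<And>x e. x \<in> space V \<Longrightarrow> 0 < e \<Longrightarrow> \<exists>a\<in>A. D a x < ennreal e"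
proof -
  have "\<forall>n. \<exists>F. finite F \<and> F \<subseteq> space V \<and> (\<forall>x\<in>space V. \<exists>y\<in>F. D y x < ennreal (1 / real (Suc n)))"
    by (intro allI ball_cover) auto
  then obtain F where F: "\<And>n. finite (F n)" "\<And>n. F n \<subseteq> space V"
    "\<And>n x. x \<in> space V \<Longrightarrow> \<exists>y\<in>F n. D y x < ennreal (1 / real (Suc n))"
    by metis
  show ?thesis
  proof (rule that[of "\<Union>n. F n"])
    fix x and e :: real assume x: "x \<in> space V" and "0 < e"
    then obtain n where "1 / real (Suc n) < e"
      by (metis nat_approx_posE)
    then have "ennreal (1 / real (Suc n)) \<le> ennreal e" by (intro ennreal_leI) simp
    with F(3)[OF x, of n] show "\<exists>a\<in>\<Union>n. F n. D a x < ennreal e"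
      by (meson UN_I UNIV_I order_less_le_trans)
  qed (use F in \<open>auto intro: countable_finite\<close>)
qed

text \<open>The triangle inequality writes D x y as the infimum of D a x + D a y over a countable
  dense set of points a, and each single function D a is measurable by \<open>ball_sets\<close>.
  Joint measurability is what Fubini's theorem requires.\<close>

lemma D_measurable [measurable (raw)]:
  assumes [measurable]: "f \<in> measurable N V" "g \<in> measurable N V"
  shows "(\<lambda>w. D (f w) (g w)) \<in> borel_measurable N"
proof (cases "space V = {}")
  case True
  then have "space N = {}" using measurable_space[OF assms(1)] by auto
  then have "{w \<in> space N. D (f w) (g w) < y} \<in> sets N" for y
    by (metis (no_types, lifting) Collect_empty_eq empty_iff sets.empty_sets)
  then show ?thesis by (rule borel_measurableI_less)
next
  case False
  obtain A where A: "countable A" "A \<subseteq> space V"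
    "\<And>x e. x \<in> space V \<Longrightarrow> 0 < e \<Longrightarrow> \<exists>a\<in>A. D a x < ennreal e"
    using ex_countable_dense by blast
  have one: "D a \<in> borel_measurable V" if "a \<in> A" for a
    using ball_sets A that by (intro borel_measurableI_less) auto
  have eq: "D x y = (INF a\<in>A. D a x + D a y)" if x: "x \<in> space V" and y: "y \<in> space V" for x y
  proof (rule antisym)
    show "D x y \<le> (INF a\<in>A. D a x + D a y)"
    proof (rule INF_greatest)
      fix a assume "a \<in> A"
      then have a: "a \<in> space V" using A by auto
      show "D x y \<le> D a x + D a y" using D_tri[OF x a y] D_sym[OF x a] by simp
    qed
    show "(INF a\<in>A. D a x + D a y) \<le> D x y"
    proof (rule ennreal_le_epsilon)
      fix e :: real assume e: "0 < e"
      obtain a where a: "a \<in> A" "D a x < ennreal (e / 2)" using A(3)[OF x, of "e / 2"] e by auto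
      have "(INF a\<in>A. D a x + D a y) \<le> D a x + D a y" using a by (intro INF_lower)
      also have "\<dots> \<le> D a x + (D a x + D x y)" using a A x y by (intro add_left_mono D_tri) auto
      also have "\<dots> \<le> ennreal (e / 2) + (ennreal (e / 2) + D x y)" using a by (intro add_mono) auto
      also have "\<dots> = D x y + (ennreal (e / 2) + ennreal (e / 2))" by (simp only: ac_simps)
      also have "ennreal (e / 2) + ennreal (e / 2) = ennreal e"
        using e by (simp add: ennreal_plus[symmetric] del: ennreal_plus)
      finally show "(INF a\<in>A. D a x + D a y) \<le> D x y + ennreal e" .
    qed
  qed
  have "(\<lambda>w. INF a\<in>A. D a (f w) + D a (g w)) \<in> borel_measurable N"
    using A by (intro borel_measurable_INF borel_measurable_add measurable_compose[OF _ one]) auto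
  then show ?thesis
    by (subst measurable_cong[OF eq]) (auto intro: measurable_space[OF assms(1)] measurable_space[OF assms(2)])
qed

lemma k_measurable [measurable (raw)]:
  "f \<in> measurable N V \<Longrightarrow> g \<in> measurable N V \<Longrightarrow> (\<lambda>w. k (f w) (g w)) \<in> borel_measurable N"
  unfolding k_def by measurable

lemma k_nonneg [simp]: "0 \<le> k x y" by (simp add: k_def)

lemma k_sym: "x \<in> space V \<Longrightarrow> y \<in> space V \<Longrightarrow> k x y = k y x"
  by (simp add: k_def D_sym)

lemma T_measurable [measurable]:
  assumes [measurable]: "f \<in> borel_measurable V"
  shows "T f \<in> borel_measurable V"
  unfolding T_def[abs_def] by measurable

text \<open>At infinite distance the kernel is 1 / 0 = 0, so the bound extends to pairs in different
  components.\<close>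

lemma k_far: "0 < d \<Longrightarrow> ennreal d \<le> D x y \<Longrightarrow> k x y \<le> d powr (- s)"
proof (cases "D x y")
  case (real r)
  assume "0 < d" "ennreal d \<le> D x y"
  with real s_pos have "d powr s \<le> r powr s" "0 < r" by (auto intro!: powr_mono2)
  then show ?thesis using real \<open>0 < d\<close> by (simp add: k_def powr_minus divide_simps)
qed (simp add: k_def)

lemma T_mono: "(\<And>y. y \<in> space V \<Longrightarrow> f y \<le> g y) \<Longrightarrow> T f x \<le> T g x"
  unfolding T_def by (intro nn_integral_mono mult_left_mono) auto

lemma T_cong_AE: "(AE y in V. f y = g y) \<Longrightarrow> T f x = T g x"
  unfolding T_def by (intro nn_integral_cong_AE) auto

lemma T_add: "x \<in> space V \<Longrightarrow> f \<in> borel_measurable V \<Longrightarrow> g \<in> borel_measurable V \<Longrightarrow>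
    T (\<lambda>y. f y + g y) x = T f x + T g x"
  unfolding T_def by (subst nn_integral_add[symmetric]) (auto simp: distrib_left)

text \<open>Fubini's theorem and \<open>k_sym\<close>: \<open>T\<close> is its own transpose, and
  the same operator serves in both halves of the power step.\<close>

lemma T_symmetric:
  assumes [measurable]: "f \<in> borel_measurable V" "g \<in> borel_measurable V"
  shows "(\<integral>\<^sup>+x. g x * T f x \<partial>V) = (\<integral>\<^sup>+x. f x * T g x \<partial>V)"
proof -
  interpret pair_sigma_finite V V ..
  have "(\<integral>\<^sup>+x. g x * T f x \<partial>V) = (\<integral>\<^sup>+x. (\<integral>\<^sup>+y. g x * (ennreal (k x y) * f y) \<partial>V) \<partial>V)"
    unfolding T_def by (intro nn_integral_cong nn_integral_cmult[symmetric]) measurable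
  also have "\<dots> = (\<integral>\<^sup>+y. (\<integral>\<^sup>+x. g x * (ennreal (k x y) * f y) \<partial>V) \<partial>V)"
    by (rule Fubini'[symmetric]) measurable
  also have "\<dots> = (\<integral>\<^sup>+y. (\<integral>\<^sup>+x. f y * (ennreal (k y x) * g x) \<partial>V) \<partial>V)"
    by (intro nn_integral_cong) (simp add: k_sym ac_simps)
  also have "\<dots> = (\<integral>\<^sup>+y. f y * T g y \<partial>V)"
    unfolding T_def by (intro nn_integral_cong nn_integral_cmult) measurable
  finally show ?thesis .
qed

lemma L1_le_nrm:
  assumes [measurable]: "f \<in> borel_measurable V" and "1 < a"
  shows "(\<integral>\<^sup>+x. f x \<partial>V) \<le> nrm a V f * epow (emeasure V (space V)) (1 - 1 / a)"
proof -
  have e: "1 / (a / (a - 1)) = 1 - 1 / a" "1 < a / (a - 1)" "1 / a + 1 / (a / (a - 1)) = 1"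
    using assms(2) by (simp_all add: field_simps)
  show ?thesis
    using Holder_nrm[of f V "\<lambda>x. 1" a "a / (a - 1)"] e assms(2) nrm_const[of "a / (a - 1)" V 1] by simp
qed

section \<open>Boundedness from L^p to L^q by a finite cover\<close>

lemma ball_tri:
  assumes "x \<in> space V" "y \<in> space V" "z \<in> space V" "D x y < ennreal (r / 2)" "ennreal r \<le> D x z" "0 < r"
  shows "ennreal (r / 2) \<le> D y z"
proof (rule ccontr)
  assume "\<not> ?thesis"
  then have "D x y + D y z < ennreal (r / 2) + ennreal (r / 2)"
    using assms by (intro add_strict_mono) auto
  also have "\<dots> = ennreal r" using assms by (simp add: ennreal_plus[symmetric] del: ennreal_plus)
  finally show False using D_tri[OF assms(1-3)] assms(5) by simp
qed

lemma T_far_bound: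
  assumes [measurable]: "f \<in> borel_measurable V" and "0 < d" "x \<in> space V"
    and "\<And>y. y \<in> space V \<Longrightarrow> D x y < ennreal d \<Longrightarrow> f y = 0"
  shows "T f x \<le> ennreal (d powr (- s)) * (\<integral>\<^sup>+y. f y \<partial>V)"
proof -
  have "T f x \<le> (\<integral>\<^sup>+y. ennreal (d powr (- s)) * f y \<partial>V)"
    unfolding T_def
  proof (rule nn_integral_mono)
    fix y assume y: "y \<in> space V"
    show "ennreal (k x y) * f y \<le> ennreal (d powr (- s)) * f y"
    proof (cases "D x y < ennreal d")
      case True then show ?thesis using assms(4)[OF y] by simp
    next
      case False
      then show ?thesis using k_far[OF assms(2), of x y] by (intro mult_right_mono ennreal_leI) auto
    qed
  qed
  also have "\<dots> = ennreal (d powr (- s)) * (\<integral>\<^sup>+y. f y \<partial>V)" by (rule nn_integral_cmult) measurable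
  finally show ?thesis .
qed

lemma ex_local_radius:
  obtains \<rho> where "\<And>x. x \<in> space V \<Longrightarrow> 0 < \<rho> x"
    "\<And>x f. x \<in> space V \<Longrightarrow> f \<in> borel_measurable V \<Longrightarrow>
      (\<And>y. y \<in> space V \<Longrightarrow> ennreal (\<rho> x) \<le> D x y \<Longrightarrow> f y = 0) \<Longrightarrow>
      nrm q V (\<lambda>z. indicator {z \<in> space V. D x z < ennreal (\<rho> x)} z * T f z) \<le> ennreal C * nrm p V f"
proof -
  have "\<forall>x\<in>space V. \<exists>r>0. \<forall>f\<in>borel_measurable V.
      (\<forall>y\<in>space V. ennreal r \<le> D x y \<longrightarrow> f y = 0) \<longrightarrow>
      nrm q V (\<lambda>z. indicator {z \<in> space V. D x z < ennreal r} z * T f z) \<le> ennreal C * nrm p V f"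
    unfolding T_def k_def using local_bound by blast
  from bchoice[OF this] obtain \<rho> where \<rho>: "\<forall>x\<in>space V. 0 < \<rho> x \<and> (\<forall>f\<in>borel_measurable V.
      (\<forall>y\<in>space V. ennreal (\<rho> x) \<le> D x y \<longrightarrow> f y = 0) \<longrightarrow>
      nrm q V (\<lambda>z. indicator {z \<in> space V. D x z < ennreal (\<rho> x)} z * T f z) \<le> ennreal C * nrm p V f)"
    by blast
  show ?thesis by (rule that[of \<rho>]) (use \<rho> in auto)
qed

text \<open>At a point of the half ball around a centre a, f is split into its part in the full
  ball, to which the local bound applies, and the rest, which is at distance at least \<rho> a / 2
  from the point and contributes a multiple of its L^1 norm. The constant grows with the number of
  balls; the constant \<open>C\<close> is recovered, up to \<eta>, in
  \<open>localized_bound\<close>.\<close>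

lemma T_bounded:
  obtains B where "0 \<le> B" "\<And>f. f \<in> borel_measurable V \<Longrightarrow> nrm q V (T f) \<le> ennreal B * nrm p V f"
proof -
  obtain \<rho> where \<rho>: "\<And>x. x \<in> space V \<Longrightarrow> 0 < \<rho> x"
    "\<And>x f. x \<in> space V \<Longrightarrow> f \<in> borel_measurable V \<Longrightarrow>
      (\<And>y. y \<in> space V \<Longrightarrow> ennreal (\<rho> x) \<le> D x y \<Longrightarrow> f y = 0) \<Longrightarrow>
      nrm q V (\<lambda>z. indicator {z \<in> space V. D x z < ennreal (\<rho> x)} z * T f z) \<le> ennreal C * nrm p V f"
    using ex_local_radius by blast
  obtain F where F: "finite F" "F \<subseteq> space V" "\<And>x. x \<in> space V \<Longrightarrow> \<exists>y\<in>F. D y x < ennreal (\<rho> y / 2)"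
    using ball_cover[of "\<lambda>x. \<rho> x / 2"] \<rho>(1) by auto
  define W where "W = epow (emeasure V (space V)) (1 / q)"
  define W' where "W' = epow (emeasure V (space V)) (1 - 1 / p)"
  \<comment> \<open>The second summand belongs to a constant function: \<open>W\<close> is the L^q
    norm of 1, and \<open>W'\<close> is the factor that bounds L^1 norms by L^p norms.\<close>
  define BB where "BB = (\<Sum>a\<in>F. ennreal C + ennreal ((\<rho> a / 2) powr (- s)) * W' * W)"
  have fin: "W < top" "W' < top" by (auto simp: W_def W'_def less_top[symmetric] emeasure_finite)
  have BB: "BB < top" using F(1) fin by (auto simp: BB_def ennreal_mult_less_top)
  have main: "nrm q V (T f) \<le> BB * nrm p V f" if [measurable]: "f \<in> borel_measurable V" for f
  proof -
    define U where "U a = {z \<in> space V. D a z < ennreal (\<rho> a)}" for a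
    have [measurable]: "U a \<in> sets V" if "a \<in> F" for a
      unfolding U_def using ball_sets F that by auto
    define g where "g a x = indicator (U a) x * T (\<lambda>y. indicator (U a) y * f y) x
      + ennreal ((\<rho> a / 2) powr (- s)) * (\<integral>\<^sup>+y. f y \<partial>V)" for a x
    have [measurable]: "g a \<in> borel_measurable V" if [simp]: "a \<in> F" for a unfolding g_def by measurable
    have pw: "T f x \<le> (\<Sum>a\<in>F. g a x)" if x: "x \<in> space V" for x
    proof -
      obtain a where a: "a \<in> F" "D a x < ennreal (\<rho> a / 2)" using F(3)[OF x] by blast
      have aV: "a \<in> space V" using a F by auto
      have xU: "x \<in> U a"
      proof -
        have "ennreal (\<rho> a / 2) \<le> ennreal (\<rho> a)" using \<rho>(1)[OF aV] by (intro ennreal_leI) simp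
        then show ?thesis using a x by (simp add: U_def)
      qed
      have "T f x = T (\<lambda>y. indicator (U a) y * f y + indicator (- U a) y * f y) x"
        by (rule arg_cong[of _ _ "\<lambda>f. T f x"]) (auto simp: indicator_def)
      also have "\<dots> = T (\<lambda>y. indicator (U a) y * f y) x + T (\<lambda>y. indicator (- U a) y * f y) x"
        by (rule T_add[OF x]) (use a in measurable)
      also have "T (\<lambda>y. indicator (- U a) y * f y) x
          \<le> ennreal ((\<rho> a / 2) powr (- s)) * (\<integral>\<^sup>+y. indicator (- U a) y * f y \<partial>V)"
      proof (rule T_far_bound)
        fix y assume y: "y \<in> space V" "D x y < ennreal (\<rho> a / 2)"
        have "\<not> ennreal (\<rho> a) \<le> D a y"
          using ball_tri[OF aV x y(1) a(2)] y \<rho>(1)[OF aV] by auto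
        then show "indicator (- U a) y * f y = 0" using y by (simp add: U_def indicator_def not_le)
      next
        show "(\<lambda>y. indicator (- U a) y * f y) \<in> borel_measurable V" using a by measurable
      qed (use x \<rho>(1)[OF aV] in auto)
      also have "(\<integral>\<^sup>+y. indicator (- U a) y * f y \<partial>V) \<le> (\<integral>\<^sup>+y. f y \<partial>V)"
        by (intro nn_integral_mono) (auto simp: indicator_def)
      finally have "T f x \<le> g a x" using xU by (simp add: g_def mult_left_mono)
      also have "\<dots> \<le> (\<Sum>a\<in>F. g a x)" using a F by (intro member_le_sum) auto
      finally show ?thesis .
    qed
    have "nrm q V (T f) \<le> nrm q V (\<lambda>x. \<Sum>a\<in>F. g a x)"
      using q_gt1 by (intro nrm_mono pw) auto
    also have "\<dots> \<le> (\<Sum>a\<in>F. nrm q V (g a))"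
      using q_gt1 F by (intro Minkowski_nrm_sum) auto
    also have "\<dots> \<le> (\<Sum>a\<in>F. (ennreal C + ennreal ((\<rho> a / 2) powr (- s)) * W' * W) * nrm p V f)"
    proof (rule sum_mono)
      fix a assume a: "a \<in> F"
      then have aV: "a \<in> space V" using F by auto
      have [measurable]: "U a \<in> sets V" using a by measurable
      have "nrm q V (g a) \<le> nrm q V (\<lambda>x. indicator (U a) x * T (\<lambda>y. indicator (U a) y * f y) x)
        + nrm q V (\<lambda>x. ennreal ((\<rho> a / 2) powr (- s)) * (\<integral>\<^sup>+y. f y \<partial>V))"
        unfolding g_def using q_gt1 by (intro Minkowski_nrm) auto
      also have "nrm q V (\<lambda>x. indicator (U a) x * T (\<lambda>y. indicator (U a) y * f y) x)
          \<le> ennreal C * nrm p V (\<lambda>y. indicator (U a) y * f y)"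
        unfolding U_def by (intro \<rho>(2) aV) (use \<open>U a \<in> sets V\<close> in \<open>auto simp: U_def indicator_def not_le\<close>)
      also have "nrm p V (\<lambda>y. indicator (U a) y * f y) \<le> nrm p V f"
        using p_gt1 by (intro nrm_mono) (auto simp: indicator_def)
      also have "nrm q V (\<lambda>x. ennreal ((\<rho> a / 2) powr (- s)) * (\<integral>\<^sup>+y. f y \<partial>V))
         = ennreal ((\<rho> a / 2) powr (- s)) * (\<integral>\<^sup>+y. f y \<partial>V) * W"
        using q_gt1 by (simp add: nrm_const W_def)
      also have "(\<integral>\<^sup>+y. f y \<partial>V) \<le> nrm p V f * W'"
        unfolding W'_def by (rule L1_le_nrm) (use p_gt1 in auto)
      finally have "nrm q V (g a) \<le> ennreal C * nrm p V f
         + ennreal ((\<rho> a / 2) powr (- s)) * (nrm p V f * W') * W"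
        by (simp add: mult_left_mono mult_right_mono add_mono)
      then show "nrm q V (g a) \<le> (ennreal C + ennreal ((\<rho> a / 2) powr (- s)) * W' * W) * nrm p V f"
        by (simp add: algebra_simps)
    qed
    also have "\<dots> = BB * nrm p V f" by (simp add: BB_def sum_distrib_right)
    finally show ?thesis .
  qed
  show ?thesis
    by (rule that[of "enn2real BB"]) (use main BB in auto)
qed

end

lemma tendsto_epow_0:
  assumes "0 < a" "(f \<longlongrightarrow> 0) F"
  shows "((\<lambda>x. epow (f x) a) \<longlongrightarrow> 0) F"
proof (rule order_tendstoI)
  fix c :: ennreal assume "0 < c"
  then have "0 < epow c (1 / a)" by (simp add: zero_less_iff_neq_zero)
  with assms(2) have "eventually (\<lambda>x. f x < epow c (1 / a)) F" by (rule order_tendstoD)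
  then show "eventually (\<lambda>x. epow (f x) a < c) F"
    by eventually_elim (use le_epow_iff[OF assms(1)] in \<open>auto simp: not_le[symmetric]\<close>)
qed simp

context riesz_space
begin

subsection \<open>Duality and compactness\<close>

lemma total_finite [simp]: "emeasure V (space V) < top" "emeasure V (space V) \<noteq> top"
  using emeasure_finite[of "space V"] by (simp_all only: less_top infinity_ennreal_def not_False_eq_True simp_thms)

text \<open>With m = min (T h) i and the test function F = m^(p'-1), whose L^p norm is the power p'
  - 1 of the L^p' norm of m, moving \<open>T\<close> from h onto F gives |m|^p' <= N |h| |m|^(p'-1)
  for the norms. The truncation at i makes |m| finite, so that its power may be cancelled; monotone
  convergence then removes i.\<close>

lemma T_dual_bound:
  assumes N: "0 \<le> N" "\<And>f. f \<in> borel_measurable V \<Longrightarrow> nrm q V (T f) \<le> ennreal N * nrm p V f"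
    and [measurable]: "h \<in> borel_measurable V"
  shows "nrm p' V (T h) \<le> ennreal N * nrm q' V h"
proof (cases "ennreal N * nrm q' V h = \<infinity>")
  case False
  define c where "c = ennreal N * nrm q' V h"
  define m where "m i x = min (T h x) (of_nat i)" for i :: nat and x
  have [measurable]: "m i \<in> borel_measurable V" for i unfolding m_def by measurable
  have "nrm p' V (m i) \<le> c" for i
  proof -
    define F where "F x = epow (m i x) (p' - 1)" for x
    have [measurable]: "F \<in> borel_measurable V" unfolding F_def by measurable
    have "(\<integral>\<^sup>+x. epow (m i x) p' \<partial>V) \<le> (\<integral>\<^sup>+x. epow (of_nat i) p' \<partial>V)"
      using p'_gt1 by (intro nn_integral_mono epow_mono) (auto simp: m_def)
    also have "\<dots> < top" by (auto simp: ennreal_mult_less_top ennreal_of_nat_eq_real_of_nat)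
    finally have fin: "nrm p' V (m i) < top" by (simp add: nrm_def)
    have F: "nrm p V F = epow (nrm p' V (m i)) (p' - 1)"
      unfolding F_def using p_gt1 p'_gt1 exponents by (subst nrm_epow) (auto simp: mult.commute)
    have "epow (nrm p' V (m i)) p' = (\<integral>\<^sup>+x. epow (m i x) (p' - 1) * epow (m i x) 1 \<partial>V)"
      using p'_gt1 by (simp add: nrm_powr epow_add del: epow_1)
    also have "\<dots> \<le> (\<integral>\<^sup>+x. F x * T h x \<partial>V)"
      by (intro nn_integral_mono) (auto simp: F_def m_def intro!: mult_left_mono)
    also have "\<dots> = (\<integral>\<^sup>+x. h x * T F x \<partial>V)" by (rule T_symmetric) measurable
    also have "\<dots> \<le> nrm q' V h * nrm q V (T F)"
      using q'_gt1 q_gt1 q'_conj by (intro Holder_nrm) auto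
    also have "\<dots> \<le> nrm q' V h * (ennreal N * nrm p V F)"
      by (intro mult_left_mono N) auto
    also have "\<dots> = c * epow (nrm p' V (m i)) (p' - 1)" by (simp add: F c_def ac_simps)
    finally have *: "epow (nrm p' V (m i)) p' \<le> c * epow (nrm p' V (m i)) (p' - 1)" .
    show ?thesis
    proof (cases "nrm p' V (m i) = 0")
      case F: False
      then obtain t where t: "nrm p' V (m i) = ennreal t" "0 < t"
        using fin by (cases "nrm p' V (m i)") (auto simp: less_le)
      obtain c' where c': "c = ennreal c'" "0 \<le> c'" using False by (cases c) (auto simp: c_def)
      have "t powr p' \<le> c' * t powr (p' - 1)"
        using * t c' by (simp add: ennreal_mult'[symmetric])
      then have "t * t powr (p' - 1) \<le> c' * t powr (p' - 1)"
        using t by (simp add: powr_diff)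
      then show ?thesis using t c' by (simp add: ennreal_leI)
    qed simp
  qed
  moreover have "T h x = (SUP i. m i x)" for x
  proof (rule antisym)
    show "T h x \<le> (SUP i. m i x)"
    proof (cases "T h x")
      case (real r)
      obtain i where "r \<le> real i" using real_arch_simple by blast
      then have "m i x = T h x" using real by (simp add: m_def ennreal_of_nat_eq_real_of_nat min_absorb1)
      then show ?thesis by (metis SUP_upper UNIV_I)
    next
      case top
      then have "(SUP i. m i x) = (SUP i. of_nat i)" by (simp add: m_def)
      also have "\<dots> = top" by (rule ennreal_SUP_of_nat_eq_top)
      finally show ?thesis by (metis top_greatest)
    qed
  qed (auto intro: SUP_least simp: m_def)
  moreover have "nrm p' V (\<lambda>x. SUP i. m i x) = (SUP i. nrm p' V (m i))"
    using p'_gt1 by (intro nrm_SUP) (auto simp: incseq_def le_fun_def m_def min_def intro: order_trans)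
  ultimately show ?thesis
    by (simp add: c_def[symmetric] SUP_le_iff cong: nrm_cong)
qed simp

text \<open>A Lipschitz truncation of \<open>t \<mapsto> t\<^sup>-\<^sup>s\<close> vanishing at 0, hence also at infinite
  distance.\<close>

definition trunc :: "real \<Rightarrow> real \<Rightarrow> real" where
  "trunc d t = (if t < d then d powr (- s - 1) * t else t powr (- s))"

lemma trunc_bounds:
  assumes "0 < d" "0 \<le> t"
  shows "0 \<le> trunc d t" "trunc d t \<le> d powr (- s)" "trunc d t \<le> 1 / t powr s"
proof -
  show "0 \<le> trunc d t" using assms by (simp add: trunc_def)
  have mono: "u powr (- s) \<le> v powr (- s)" if "0 < v" "v \<le> u" for u v
    using that s_pos by (intro powr_mono2') auto
  have 1: "d powr (- s - 1) * t \<le> d powr (- s)" if "t < d"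
  proof -
    have "d powr (- s - 1) * t \<le> d powr (- s - 1) * d" using that by (intro mult_left_mono) auto
    then show ?thesis using assms by (simp add: powr_diff)
  qed
  show "trunc d t \<le> d powr (- s)" using 1 mono[of d t] assms by (simp add: trunc_def)
  show "trunc d t \<le> 1 / t powr s"
  proof (cases "t < d \<and> 0 < t")
    case True
    then have "trunc d t \<le> d powr (- s)" using 1 by (simp add: trunc_def)
    also have "\<dots> \<le> t powr (- s)" using True by (intro mono) auto
    finally show ?thesis by (simp add: powr_minus divide_inverse)
  next
    case False
    then show ?thesis using assms by (auto simp: trunc_def powr_minus divide_inverse not_less)
  qed
qed

text \<open>The linear branch has slope d^(-s-1), and by the mean value theorem the other branch has
  slope at most s d^(-s-1) in absolute value. The branches agree at d, so a pair on different sides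
  of d is compared through d.\<close>

lemma trunc_lipschitz:
  assumes "0 < d" "0 \<le> t" "0 \<le> u"
  shows "\<bar>trunc d t - trunc d u\<bar> \<le> (1 + s) * d powr (- s - 1) * \<bar>t - u\<bar>"
proof -
  define c where "c = d powr (- s - 1)"
  have c: "0 < c" using assms by (simp add: c_def)
  have far: "\<bar>t powr (- s) - u powr (- s)\<bar> \<le> s * c * (u - t)" if "d \<le> t" "t \<le> u" for t u
  proof (cases "t = u")
    case False
    have "\<exists>z>t. z < u \<and> u powr (- s) - t powr (- s) = (u - t) * (- s * z powr (- s - 1))"
      by (rule MVT2) (use that assms False in \<open>auto intro!: derivative_eq_intros\<close>)
    then obtain z where z: "t < z" "z < u" "u powr (- s) - t powr (- s) = (u - t) * (- s * z powr (- s - 1))"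
      by auto
    have "z powr (- s - 1) \<le> c"
      unfolding c_def using z that assms s_pos by (intro powr_mono2') auto
    then have "(u - t) * s * z powr (- s - 1) \<le> (u - t) * s * c"
      using that s_pos by (intro mult_left_mono) auto
    moreover have "\<bar>t powr (- s) - u powr (- s)\<bar> = (u - t) * s * z powr (- s - 1)"
      using z that s_pos by (simp add: abs_minus_commute[of "t powr (- s)"] abs_mult)
    ultimately show ?thesis by (simp add: ac_simps)
  qed simp
  have dd: "c * d = d powr (- s)" using assms by (simp add: c_def powr_diff)
  have main: "\<bar>trunc d t - trunc d u\<bar> \<le> (1 + s) * c * (u - t)" if "0 \<le> t" "t \<le> u" for t u
  proof -
    have e: "(1 + s) * c * (u - t) = c * (u - t) + s * c * (u - t)" by (simp add: algebra_simps)
    have nn: "0 \<le> c * (u - t)" "0 \<le> s * c * (u - t)" using that c s_pos by auto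
    consider "u < d" | "d \<le> t" | "t < d" "d \<le> u" by linarith
    then show ?thesis
    proof cases
      case 1
      then have "\<bar>trunc d t - trunc d u\<bar> = c * (u - t)"
        using that c by (simp add: trunc_def c_def[symmetric] right_diff_distrib[symmetric] abs_mult)
      then show ?thesis using e nn by simp
    next
      case 2
      then show ?thesis using far[of t u] that e nn by (simp add: trunc_def)
    next
      case 3
      have "\<bar>trunc d t - trunc d u\<bar> \<le> \<bar>c * t - c * d\<bar> + \<bar>d powr (- s) - u powr (- s)\<bar>"
        using 3 by (simp add: trunc_def c_def[symmetric] dd)
      also have "\<bar>c * t - c * d\<bar> = c * (d - t)"
        using 3 c by (simp add: right_diff_distrib[symmetric] abs_mult)
      also have "\<bar>d powr (- s) - u powr (- s)\<bar> \<le> s * c * (u - d)" using far[of d u] 3 by simp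
      also have "c * (d - t) + s * c * (u - d) \<le> c * (u - t) + s * c * (u - t)"
        using 3 c s_pos by (intro add_mono mult_left_mono) auto
      finally show ?thesis using e by simp
    qed
  qed
  show ?thesis
  proof (cases "t \<le> u")
    case True
    then show ?thesis using main[of t u] assms by (simp add: c_def)
  next
    case False
    then have "\<bar>trunc d u - trunc d t\<bar> \<le> (1 + s) * c * \<bar>t - u\<bar>" using main[of u t] assms by simp
    then show ?thesis by (simp only: c_def abs_minus_commute[of "trunc d u"])
  qed
qed

section \<open>The truncated kernel and the part cut off\<close>

definition kt :: "real \<Rightarrow> 'a \<Rightarrow> 'a \<Rightarrow> real" where
  "kt d x y = trunc d (enn2real (D x y))"

lemma kt_measurable [measurable (raw)]:
  assumes [measurable]: "f \<in> measurable N V" "g \<in> measurable N V"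
  shows "(\<lambda>w. kt d (f w) (g w)) \<in> borel_measurable N"
proof -
  have "trunc d \<in> borel_measurable borel" unfolding trunc_def[abs_def] by measurable
  then show ?thesis unfolding kt_def by (rule measurable_compose[rotated]) measurable
qed

lemma kt_bounds: "0 < d \<Longrightarrow> 0 \<le> kt d x y" "0 < d \<Longrightarrow> kt d x y \<le> d powr (- s)" "0 < d \<Longrightarrow> kt d x y \<le> k x y"
  using trunc_bounds[of d "enn2real (D x y)"] unfolding kt_def k_def by simp_all

text \<open>Beyond distance d both kernels coincide, and at infinite distance both vanish.\<close>

lemma k_minus_kt:
  "0 < d \<Longrightarrow> k x y \<le> kt d x y + (if D x y < ennreal d then k x y else 0)"
proof (cases "D x y < ennreal d")
  case False
  assume d: "0 < d"
  then have "kt d x y = k x y"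
    using False by (cases "D x y") (auto simp: kt_def k_def trunc_def powr_minus divide_inverse ennreal_less_iff)
  then show ?thesis by simp
qed (use kt_bounds in auto)

text \<open>As D x x' is finite, D x y and D x' y are both finite or both infinite. In the second
  case both values of the kernel are \<open>trunc d 0\<close> = 0; this is why the truncation was
  made to vanish at 0.\<close>

lemma kt_lipschitz:
  assumes "0 < d" "x \<in> space V" "x' \<in> space V" "y \<in> space V" "0 \<le> e" "D x x' < ennreal e"
  shows "\<bar>kt d x y - kt d x' y\<bar> \<le> (1 + s) * d powr (- s - 1) * e"
proof -
  have fin: "D x x' < top" using assms(6) by (rule less_trans) simp
  have le: "D x y \<le> D x x' + D x' y" "D x' y \<le> D x x' + D x y"
    using D_tri[of x x' y] D_tri[of x' x y] D_sym[of x x'] assms by auto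
  show ?thesis
  proof (cases "D x y = top")
    case True
    then have "D x' y = top" using le(1) fin by (auto simp: ennreal_add_eq_top top_unique)
    then show ?thesis using True assms s_pos by (simp add: kt_def)
  next
    case False
    then have "D x' y \<noteq> top" using le(2) fin by (auto simp: ennreal_add_eq_top top_unique)
    with False obtain a b c where abc: "D x y = ennreal a" "D x' y = ennreal b" "D x x' = ennreal c" "0 \<le> a" "0 \<le> b" "0 \<le> c"
      using fin by (cases "D x y"; cases "D x' y"; cases "D x x'"; simp)
    then have "a \<le> c + b" "b \<le> c + a" "c < e"
      using le assms by (simp_all add: ennreal_plus[symmetric] ennreal_less_iff del: ennreal_plus)
    then have "\<bar>a - b\<bar> \<le> e" by auto
    then have "(1 + s) * d powr (- s - 1) * \<bar>a - b\<bar> \<le> (1 + s) * d powr (- s - 1) * e"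
      using s_pos by (intro mult_left_mono) auto
    then show ?thesis using trunc_lipschitz[of d a b] abc assms by (simp add: kt_def)
  qed
qed

text \<open>By \<open>k_minus_kt\<close> this dominates the integral of k - kt in one variable,
  hence measures the error of the truncation.\<close>

definition tail :: "real \<Rightarrow> 'a \<Rightarrow> ennreal" where
  "tail d x = (\<integral>\<^sup>+y. ennreal (k x y) * indicator {y. D x y < ennreal d} y \<partial>V)"

lemma tail_measurable [measurable]: "tail d \<in> borel_measurable V"
proof -
  have "tail d = (\<lambda>x. \<integral>\<^sup>+y. (if D x y < ennreal d then ennreal (k x y) else 0) \<partial>V)"
    unfolding tail_def by (intro ext nn_integral_cong) (auto simp: indicator_def)
  also have "\<dots> \<in> borel_measurable V" by measurable
  finally show ?thesis .
qed

text \<open>T 1 lies in L^q by \<open>T_bounded\<close> and dominates every tail, so dominated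
  convergence applies twice: in y for almost every x, then in x.\<close>

lemma nrm_tail_tendsto:
  "(\<lambda>m. nrm q V (tail (1 / real (Suc m)))) \<longlonglongrightarrow> 0"
proof -
  obtain B where B: "0 \<le> B" "\<And>f. f \<in> borel_measurable V \<Longrightarrow> nrm q V (T f) \<le> ennreal B * nrm p V f"
    using T_bounded by blast
  have "nrm q V (T (\<lambda>_. 1)) \<le> ennreal B * nrm p V (\<lambda>_. 1)" by (rule B) simp
  also have "\<dots> < top" using p_gt1 by (simp add: nrm_const ennreal_mult_less_top)
  finally have T1: "(\<integral>\<^sup>+x. epow (T (\<lambda>_. 1) x) q \<partial>V) < top" using q_gt1 by (simp add: nrm_def)
  have AE: "AE x in V. epow (T (\<lambda>_. 1) x) q \<noteq> \<infinity>" by (rule nn_integral_PInf_AE) (use T1 in auto)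
  have le: "tail d x \<le> T (\<lambda>_. 1) x" for d x
    unfolding tail_def T_def by (intro nn_integral_mono) (auto simp: indicator_def)
  have pw: "(\<lambda>m. tail (1 / real (Suc m)) x) \<longlonglongrightarrow> 0" if fin: "T (\<lambda>_. 1) x < top" and x: "x \<in> space V" for x
  proof -
    have "(\<lambda>m. tail (1 / real (Suc m)) x) \<longlonglongrightarrow> (\<integral>\<^sup>+y. 0 \<partial>V)"
      unfolding tail_def
    proof (rule nn_integral_dominated_convergence[where w = "\<lambda>y. ennreal (k x y)"])
      show "AE y in V. (\<lambda>i. ennreal (k x y) * indicator {y. D x y < ennreal (1 / real (Suc i))} y) \<longlonglongrightarrow> 0"
      proof (rule AE_I2)
        fix y assume "y \<in> space V"
        show "(\<lambda>i. ennreal (k x y) * indicator {y. D x y < ennreal (1 / real (Suc i))} y) \<longlonglongrightarrow> 0"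
        \<comment> \<open>Points at distance 0 belong to all the balls, but there the kernel is 1 /
          0 = 0.\<close>
        proof (cases "D x y = 0")
          case True
          then show ?thesis by (simp add: k_def)
        next
          case False
          then obtain e where e: "0 < e" "ennreal e \<le> D x y"
            by (cases "D x y") (auto intro: that[of 1] simp: less_le)
          obtain m where m: "1 / real (Suc m) < e" using e nat_approx_posE by blast
          have "eventually (\<lambda>i. ennreal (k x y) * indicator {y. D x y < ennreal (1 / real (Suc i))} y = 0) sequentially"
          proof (rule eventually_sequentiallyI[of m])
            fix i assume "m \<le> i"
            then have "1 / real (Suc i) \<le> 1 / real (Suc m)" by (intro divide_left_mono) auto
            then have "ennreal (1 / real (Suc i)) \<le> ennreal e" using m by (intro ennreal_leI) simp
            then have "\<not> D x y < ennreal (1 / real (Suc i))" using e by (meson leD order_trans)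
            then show "ennreal (k x y) * indicator {y. D x y < ennreal (1 / real (Suc i))} y = 0" by simp
          qed
          then show ?thesis by (rule tendsto_eventually)
        qed
      qed
      show "(\<lambda>y. ennreal (k x y) * indicator {y. D x y < ennreal (1 / real (Suc i))} y) \<in> borel_measurable V" for i
      proof -
        have "(\<lambda>y. ennreal (k x y) * indicator {y. D x y < ennreal (1 / real (Suc i))} y)
          = (\<lambda>y. if D x y < ennreal (1 / real (Suc i)) then ennreal (k x y) else 0)"
          by (auto simp: indicator_def)
        also have "\<dots> \<in> borel_measurable V" using x by measurable
        finally show ?thesis .
      qed
    qed (use fin x in \<open>auto simp: indicator_def T_def\<close>)
    then show ?thesis by simp
  qed
  have "(\<lambda>m. \<integral>\<^sup>+x. epow (tail (1 / real (Suc m)) x) q \<partial>V) \<longlonglongrightarrow> (\<integral>\<^sup>+x. 0 \<partial>V)"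
  proof (rule nn_integral_dominated_convergence[where w = "\<lambda>x. epow (T (\<lambda>_. 1) x) q"])
    show "AE x in V. (\<lambda>m. epow (tail (1 / real (Suc m)) x) q) \<longlonglongrightarrow> 0"
      using AE AE_space
    proof eventually_elim
      case (elim x)
      have *: "(\<lambda>m. tail (1 / real (Suc m)) x) \<longlonglongrightarrow> 0" using elim by (intro pw) (auto simp: less_top)
      show ?case using * q_gt1 by (intro tendsto_epow_0) auto
    qed
  qed (use T1 le q_gt1 in \<open>auto intro!: epow_mono AE_I2\<close>)
  then have "(\<lambda>m. \<integral>\<^sup>+x. epow (tail (1 / real (Suc m)) x) q \<partial>V) \<longlonglongrightarrow> 0" by simp
  then show ?thesis unfolding nrm_def using q_gt1 by (intro tendsto_epow_0) auto
qed

lemma T_finite_AE: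
  assumes "0 \<le> N" "\<And>f. f \<in> borel_measurable V \<Longrightarrow> nrm q V (T f) \<le> ennreal N * nrm p V f"
    and [measurable]: "h \<in> borel_measurable V" and "nrm q' V h < top"
  shows "(\<integral>\<^sup>+x. T h x \<partial>V) < top" "AE x in V. T h x < top"
proof -
  have "nrm p' V (T h) \<le> ennreal N * nrm q' V h" by (rule T_dual_bound[OF assms(1-3)])
  also have "\<dots> < top" using assms(4) by (simp add: ennreal_mult_less_top)
  finally have "nrm p' V (T h) < top" .
  then have "nrm p' V (T h) * epow (emeasure V (space V)) (1 - 1 / p') < top"
    by (simp add: ennreal_mult_less_top)
  moreover have "(\<integral>\<^sup>+x. T h x \<partial>V) \<le> nrm p' V (T h) * epow (emeasure V (space V)) (1 - 1 / p')"
    by (rule L1_le_nrm) (use p'_gt1 in auto)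
  ultimately show *: "(\<integral>\<^sup>+x. T h x \<partial>V) < top" by (rule le_less_trans[rotated])
  then have "AE x in V. T h x \<noteq> \<infinity>" by (intro nn_integral_PInf_AE) auto
  then show "AE x in V. T h x < top" by eventually_elim (simp add: less_top)
qed

text \<open>Potentials with the truncated kernel approximate \<open>T (h j)\<close> in L^1 uniformly
  in j: by Fubini and Hoelder the error is at most the L^q' norm of \<open>h j\<close> times the L^q
  norm of the tail. For a fixed truncation they are bounded and equi-Lipschitz, so as in
  Arzela-Ascoli a diagonal subsequence converges at every point, and in L^1 since the measure is
  finite. Along it \<open>T (h j)\<close> is Cauchy in L^1, and a further subsequence converges
  almost everywhere.\<close>

lemma T_compact:
  assumes h[measurable]: "\<And>j. h j \<in> borel_measurable V" and H: "\<And>j. nrm q' V (h j) \<le> ennreal H"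
  obtains r u where "strict_mono (r::nat \<Rightarrow> nat)" "u \<in> borel_measurable V"
    "AE x in V. (\<lambda>j. enn2real (T (h (r j)) x)) \<longlonglongrightarrow> u x"
proof -
  obtain B where B: "0 \<le> B" "\<And>f. f \<in> borel_measurable V \<Longrightarrow> nrm q V (T f) \<le> ennreal B * nrm p V f"
    using T_bounded by blast
  define W where "W = epow (emeasure V (space V)) (1 - 1 / q')"
  define H1 where "H1 = enn2real (ennreal H * W)"
  have Hfin: "ennreal H * W < top" by (simp add: W_def ennreal_mult_less_top)
  have H1: "0 \<le> H1" "(\<integral>\<^sup>+x. h j x \<partial>V) \<le> ennreal H1" for j
  proof -
    have "(\<integral>\<^sup>+x. h j x \<partial>V) \<le> nrm q' V (h j) * W"
      unfolding W_def by (rule L1_le_nrm) (use q'_gt1 in auto)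
    also have "\<dots> \<le> ennreal H * W" using H by (intro mult_right_mono) auto
    finally show "(\<integral>\<^sup>+x. h j x \<partial>V) \<le> ennreal H1" using Hfin by (simp add: H1_def)
  qed (simp add: H1_def)
  define S where "S d j x = (\<integral>\<^sup>+y. ennreal (kt d x y) * h j y \<partial>V)" for d j x
  define \<sigma> where "\<sigma> d j x = enn2real (S d j x)" for d j x
  have [measurable]: "S d j \<in> borel_measurable V" for d j unfolding S_def[abs_def] by measurable
  have [measurable]: "\<sigma> d j \<in> borel_measurable V" for d j unfolding \<sigma>_def[abs_def] by measurable
  have Sb: "S d j x \<le> ennreal (d powr (- s) * H1)" if "0 < d" for d j x
  proof -
    have "S d j x \<le> (\<integral>\<^sup>+y. ennreal (d powr (- s)) * h j y \<partial>V)"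
      unfolding S_def using kt_bounds that by (intro nn_integral_mono mult_right_mono ennreal_leI) auto
    also have "\<dots> = ennreal (d powr (- s)) * (\<integral>\<^sup>+y. h j y \<partial>V)" by (rule nn_integral_cmult) measurable
    also have "\<dots> \<le> ennreal (d powr (- s)) * ennreal H1" using H1 by (intro mult_left_mono) auto
    also have "\<dots> = ennreal (d powr (- s) * H1)" using H1(1) by (intro ennreal_mult[symmetric]) auto
    finally show ?thesis .
  qed
  have S\<sigma>: "S d j x = ennreal (\<sigma> d j x)" if "0 < d" for d j x
    using Sb[OF that, of j x] unfolding \<sigma>_def by (metis ennreal_enn2real ennreal_less_top le_less_trans)
  have \<sigma>0: "0 \<le> \<sigma> d j x" for d j x by (simp add: \<sigma>_def)
  have \<sigma>b: "\<sigma> d j x \<le> d powr (- s) * H1" if "0 < d" for d j x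
    using Sb[OF that, of j x] H1(1) unfolding S\<sigma>[OF that] by simp
  have \<sigma>lip: "\<sigma> d j x \<le> \<sigma> d j x' + (1 + s) * d powr (- s - 1) * e * H1"
    if d: "0 < d" and x: "x \<in> space V" "x' \<in> space V" and e: "0 \<le> e" "D x x' < ennreal e" for d j x x' e
  proof -
    define l where "l = (1 + s) * d powr (- s - 1) * e"
    have l: "0 \<le> l" using s_pos e by (simp add: l_def)
    have "S d j x \<le> (\<integral>\<^sup>+y. ennreal (kt d x' y) * h j y + ennreal l * h j y \<partial>V)"
      unfolding S_def
    proof (rule nn_integral_mono)
      fix y assume y: "y \<in> space V"
      have "kt d x y \<le> kt d x' y + l" using kt_lipschitz[OF d x y e] by (simp add: l_def abs_le_iff)
      then have "ennreal (kt d x y) \<le> ennreal (kt d x' y) + ennreal l"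
        using kt_bounds(1)[OF d] l by (simp add: ennreal_plus[symmetric] ennreal_leI del: ennreal_plus)
      then show "ennreal (kt d x y) * h j y \<le> ennreal (kt d x' y) * h j y + ennreal l * h j y"
        unfolding distrib_right[symmetric] by (rule mult_right_mono) simp
    qed
    also have "\<dots> = S d j x' + ennreal l * (\<integral>\<^sup>+y. h j y \<partial>V)"
      unfolding S_def using x by (subst nn_integral_add) (auto simp: nn_integral_cmult)
    also have "\<dots> \<le> S d j x' + ennreal l * ennreal H1" using H1 by (intro add_left_mono mult_left_mono) auto
    finally have "ennreal (\<sigma> d j x) \<le> ennreal (\<sigma> d j x' + l * H1)"
      using l H1(1) \<sigma>0 by (simp add: S\<sigma>[OF d] ennreal_mult'[symmetric] ennreal_plus[symmetric] del: ennreal_plus)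
    then have "\<sigma> d j x \<le> \<sigma> d j x' + l * H1"
      using l H1(1) \<sigma>0[of d j x'] by (subst (asm) ennreal_le_iff) auto
    then show ?thesis by (simp add: l_def)
  qed
  obtain A where A: "countable A" "A \<subseteq> space V"
    "\<And>x e. x \<in> space V \<Longrightarrow> 0 < e \<Longrightarrow> \<exists>a\<in>A. D a x < ennreal e"
    using ex_countable_dense by blast
  define \<delta> where "\<delta> m = 1 / real (Suc m)" for m
  have \<delta>: "0 < \<delta> m" for m by (simp add: \<delta>_def)
  \<comment> \<open>The index n encodes a pair of a truncation scale and a point of the dense set,
    so that one diagonal sequence serves all pairs.\<close>
  define P where "P n r \<longleftrightarrow> convergent (\<lambda>j. \<sigma> (\<delta> (fst (prod_decode n))) (r j) (from_nat_into A (snd (prod_decode n))))"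
    for n and r :: "nat \<Rightarrow> nat"
  interpret subseqs P
  proof
    fix n and r :: "nat \<Rightarrow> nat"
    define f where "f j = \<sigma> (\<delta> (fst (prod_decode n))) (r j) (from_nat_into A (snd (prod_decode n)))" for j
    have "bounded (range f)"
      by (rule boundedI[where B = "\<delta> (fst (prod_decode n)) powr (- s) * H1"])
         (use \<sigma>0 \<sigma>b \<delta> in \<open>auto simp: f_def\<close>)
    then obtain l r' where "strict_mono r'" "(f \<circ> r') \<longlonglongrightarrow> l"
      using bounded_imp_convergent_subsequence by blast
    then show "\<exists>r'. strict_mono r' \<and> P n (r \<circ> r')"
      by (auto simp: P_def convergent_def f_def[abs_def] o_def)
  qed
  define r where "r = diagseq"
  have r: "strict_mono r" by (simp add: r_def subseq_diagseq)
  have Pst: "P n (s' \<circ> r')" if "strict_mono r'" "P n s'" for r' s' n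
    using convergent_subseq_convergent[OF that(2)[unfolded P_def] that(1)]
    by (simp add: P_def o_def)
  have conv_dense: "convergent (\<lambda>j. \<sigma> (\<delta> m) (r j) a)" if "a \<in> A" for m a
  proof -
    from from_nat_into_surj[OF A(1) that] obtain i where i: "from_nat_into A i = a" by blast
    define n where "n = prod_encode (m, i)"
    \<comment> \<open>The diagonal sequence is under control of property n from index n + 1 on,
      hence the shift, which does not affect convergence.\<close>
    have "P n (diagseq \<circ> ((+) (Suc n)))" by (rule diagseq_holds) (rule Pst)
    then have "convergent (\<lambda>j. \<sigma> (\<delta> m) (r (j + Suc n)) a)"
      by (simp add: P_def n_def i r_def o_def add.commute)
    then show ?thesis using convergent_ignore_initial_segment[of "\<lambda>j. \<sigma> (\<delta> m) (r j) a" "Suc n"] by simp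
  qed
  have conv: "convergent (\<lambda>j. \<sigma> (\<delta> m) (r j) x)" if x: "x \<in> space V" for m x
  proof (rule Cauchy_convergent, rule CauchyI)
    fix e :: real assume e: "0 < e"
    define L where "L = (1 + s) * \<delta> m powr (- s - 1) * H1"
    have L: "0 \<le> L" using s_pos H1 by (simp add: L_def)
    \<comment> \<open>\<open>L\<close> is 0 if \<open>H1\<close> is, so L + 1 is the divisor; the
      factor 1/4 keeps L e' strictly below e / 3.\<close>
    define e' where "e' = e / 4 / (L + 1)"
    have "0 < e'" using L e by (simp add: e'_def)
    moreover have "(L + 1) * e' = e / 4" using L by (auto simp: e'_def divide_eq_eq algebra_simps)
    ultimately have e': "0 < e'" "L * e' < e / 3" using e by (simp_all add: distrib_right)
    obtain a where a: "a \<in> A" "D a x < ennreal e'" using A(3)[OF x e'(1)] by blast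
    have aV: "a \<in> space V" using a A by auto
    have close: "\<bar>\<sigma> (\<delta> m) j x - \<sigma> (\<delta> m) j a\<bar> < e / 3" for j
    proof -
      have "\<sigma> (\<delta> m) j x \<le> \<sigma> (\<delta> m) j a + (1 + s) * \<delta> m powr (- s - 1) * e' * H1"
        by (rule \<sigma>lip) (use \<delta> x aV e' a D_sym in auto)
      moreover have "\<sigma> (\<delta> m) j a \<le> \<sigma> (\<delta> m) j x + (1 + s) * \<delta> m powr (- s - 1) * e' * H1"
        by (rule \<sigma>lip) (use \<delta> x aV e' a in auto)
      moreover have "(1 + s) * \<delta> m powr (- s - 1) * e' * H1 = L * e'" by (simp add: L_def)
      ultimately show ?thesis using e'(2) by linarith
    qed
    obtain J where J: "\<And>i j. i \<ge> J \<Longrightarrow> j \<ge> J \<Longrightarrow> \<bar>\<sigma> (\<delta> m) (r i) a - \<sigma> (\<delta> m) (r j) a\<bar> < e / 3"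
      using CauchyD[OF convergent_Cauchy[OF conv_dense[OF a(1), of m]], of "e / 3"] e by auto
    show "\<exists>M. \<forall>i\<ge>M. \<forall>j\<ge>M. norm (\<sigma> (\<delta> m) (r i) x - \<sigma> (\<delta> m) (r j) x) < e"
    proof (intro exI[of _ J] allI impI)
      fix i j assume "J \<le> i" "J \<le> j"
      then show "norm (\<sigma> (\<delta> m) (r i) x - \<sigma> (\<delta> m) (r j) x) < e"
        using J[of i j] close[of "r i"] close[of "r j"] unfolding real_norm_def abs_less_iff by linarith
    qed
  qed
  define w where "w m x = lim (\<lambda>j. \<sigma> (\<delta> m) (r j) x)" for m x
  have [measurable]: "w m \<in> borel_measurable V" for m unfolding w_def[abs_def] by measurable
  have w: "(\<lambda>j. \<sigma> (\<delta> m) (r j) x) \<longlonglongrightarrow> w m x" if "x \<in> space V" for m x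
    using conv[OF that, of m] unfolding w_def by (simp add: convergent_LIMSEQ_iff)
  have wL: "(\<lambda>j. \<integral>\<^sup>+x. ennreal \<bar>\<sigma> (\<delta> m) (r j) x - w m x\<bar> \<partial>V) \<longlonglongrightarrow> 0" for m
  proof -
    have wb: "0 \<le> w m x" "w m x \<le> \<delta> m powr (- s) * H1" if "x \<in> space V" for x
      using LIMSEQ_le_const[OF w[OF that]] LIMSEQ_le_const2[OF w[OF that]] \<sigma>0 \<sigma>b[OF \<delta>] by auto
    have "(\<lambda>j. \<integral>\<^sup>+x. ennreal \<bar>\<sigma> (\<delta> m) (r j) x - w m x\<bar> \<partial>V) \<longlonglongrightarrow> (\<integral>\<^sup>+x. 0 \<partial>V)"
    proof (rule nn_integral_dominated_convergence[where w = "\<lambda>_. ennreal (2 * (\<delta> m powr (- s) * H1))"])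
      show "AE x in V. ennreal \<bar>\<sigma> (\<delta> m) (r j) x - w m x\<bar> \<le> ennreal (2 * (\<delta> m powr (- s) * H1))" for j
      proof (rule AE_I2)
        fix x assume "x \<in> space V"
        then show "ennreal \<bar>\<sigma> (\<delta> m) (r j) x - w m x\<bar> \<le> ennreal (2 * (\<delta> m powr (- s) * H1))"
          using wb[of x] \<sigma>0[of "\<delta> m" "r j" x] \<sigma>b[OF \<delta>[of m], of "r j" x] by (intro ennreal_leI) auto
      qed
      show "AE x in V. (\<lambda>j. ennreal \<bar>\<sigma> (\<delta> m) (r j) x - w m x\<bar>) \<longlonglongrightarrow> 0"
      proof (rule AE_I2)
        fix x assume "x \<in> space V"
        have "(\<lambda>j. ennreal \<bar>\<sigma> (\<delta> m) (r j) x - w m x\<bar>) \<longlonglongrightarrow> ennreal \<bar>w m x - w m x\<bar>"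
          by (intro tendsto_intros w \<open>x \<in> space V\<close>)
        then show "(\<lambda>j. ennreal \<bar>\<sigma> (\<delta> m) (r j) x - w m x\<bar>) \<longlonglongrightarrow> 0" by simp
      qed
    qed (auto simp: ennreal_mult_less_top)
    then show ?thesis by simp
  qed
  have q'H: "nrm q' V (h j) < top" for j using H[of j] by (rule le_less_trans) simp
  have fin: "(\<integral>\<^sup>+x. T (h j) x \<partial>V) < top" "AE x in V. T (h j) x < top" for j
    using T_finite_AE[of B "h j"] B h q'H by blast+
  define v where "v j x = enn2real (T (h j) x)" for j x
  have [measurable]: "v j \<in> borel_measurable V" for j unfolding v_def[abs_def] by measurable
  have v0: "0 \<le> v j x" for j x by (simp add: v_def)
  have Tv: "AE x in V. T (h j) x = ennreal (v j x)" for j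
    using fin(2)[of j] by eventually_elim (simp add: v_def)
  have vint: "integrable V (v j)" for j
  proof (rule integrableI_bounded)
    have "(\<integral>\<^sup>+x. ennreal (norm (v j x)) \<partial>V) = (\<integral>\<^sup>+x. T (h j) x \<partial>V)"
      by (rule nn_integral_cong_AE) (use Tv[of j] in \<open>eventually_elim, simp add: v0\<close>)
    then show "(\<integral>\<^sup>+x. ennreal (norm (v j x)) \<partial>V) < \<infinity>" using fin(1) by simp
  qed measurable
  \<comment> \<open>The truncation error is nonnegative, so its L^1 norm is the integral of its
    kernel against \<open>h j\<close>; interchanging the integrals turns it into the pairing of
    \<open>h j\<close> with \<open>tail\<close>.\<close>
  have vs: "(\<integral>\<^sup>+x. ennreal \<bar>v j x - \<sigma> (\<delta> m) j x\<bar> \<partial>V) \<le> ennreal H * nrm q V (tail (\<delta> m))" for m j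
  proof -
    define R where "R x = (\<integral>\<^sup>+y. ennreal (if D x y < ennreal (\<delta> m) then k x y else 0) * h j y \<partial>V)" for x
    have [measurable]: "R \<in> borel_measurable V" unfolding R_def[abs_def] by measurable
    have "(\<integral>\<^sup>+x. ennreal \<bar>v j x - \<sigma> (\<delta> m) j x\<bar> \<partial>V) \<le> (\<integral>\<^sup>+x. R x \<partial>V)"
    proof (rule nn_integral_mono_AE)
      show "AE x in V. ennreal \<bar>v j x - \<sigma> (\<delta> m) j x\<bar> \<le> R x"
        using Tv[of j] AE_space
      proof eventually_elim
        case (elim x)
        have "T (h j) x \<le> (\<integral>\<^sup>+y. ennreal (kt (\<delta> m) x y) * h j y
             + ennreal (if D x y < ennreal (\<delta> m) then k x y else 0) * h j y \<partial>V)"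
          unfolding T_def
        proof (rule nn_integral_mono)
          fix y
          have "ennreal (k x y) \<le> ennreal (kt (\<delta> m) x y) + ennreal (if D x y < ennreal (\<delta> m) then k x y else 0)"
            using ennreal_leI[OF k_minus_kt[OF \<delta>[of m], of x y]] kt_bounds(1)[OF \<delta>[of m], of x y]
            by (subst (asm) ennreal_plus) simp_all
          then show "ennreal (k x y) * h j y \<le> ennreal (kt (\<delta> m) x y) * h j y
             + ennreal (if D x y < ennreal (\<delta> m) then k x y else 0) * h j y"
            unfolding distrib_right[symmetric] by (rule mult_right_mono) simp
        qed
        also have "\<dots> = S (\<delta> m) j x + R x"
          unfolding S_def R_def using elim(2) by (intro nn_integral_add) measurable
        finally have 1: "ennreal (v j x) \<le> ennreal (\<sigma> (\<delta> m) j x) + R x"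
          using elim(1) S\<sigma>[OF \<delta>] by simp
        have "S (\<delta> m) j x \<le> T (h j) x"
          unfolding S_def T_def using kt_bounds(3)[OF \<delta>] by (intro nn_integral_mono mult_right_mono ennreal_leI) auto
        then have 2: "\<sigma> (\<delta> m) j x \<le> v j x"
          using elim(1) S\<sigma>[OF \<delta>] v0 by (metis ennreal_le_iff)
        show "ennreal \<bar>v j x - \<sigma> (\<delta> m) j x\<bar> \<le> R x"
        proof (cases "R x")
          case (real c)
          then have "v j x \<le> \<sigma> (\<delta> m) j x + c"
            using 1 \<sigma>0[of "\<delta> m" j x] by (simp add: ennreal_plus[symmetric] del: ennreal_plus)
          then show ?thesis using 2 real by (auto intro!: ennreal_leI)
        qed simp
      qed
    qed
    also have "\<dots> = (\<integral>\<^sup>+x. h j x * tail (\<delta> m) x \<partial>V)"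
    proof -
      interpret V2: pair_sigma_finite V V ..
      have "(\<integral>\<^sup>+x. R x \<partial>V) = (\<integral>\<^sup>+y. (\<integral>\<^sup>+x. ennreal (if D x y < ennreal (\<delta> m) then k x y else 0) * h j y \<partial>V) \<partial>V)"
        unfolding R_def by (rule V2.Fubini'[symmetric]) measurable
      also have "\<dots> = (\<integral>\<^sup>+y. (\<integral>\<^sup>+x. h j y * (ennreal (k y x) * indicator {x. D y x < ennreal (\<delta> m)} x) \<partial>V) \<partial>V)"
        by (intro nn_integral_cong) (auto simp: k_sym D_sym indicator_def mult.commute)
      also have "\<dots> = (\<integral>\<^sup>+y. h j y * tail (\<delta> m) y \<partial>V)"
      proof (intro nn_integral_cong)
        fix y assume y: "y \<in> space V"
        have "(\<lambda>x. ennreal (k y x) * indicator {x. D y x < ennreal (\<delta> m)} x)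
           = (\<lambda>x. if D y x < ennreal (\<delta> m) then ennreal (k y x) else 0)" by (auto simp: indicator_def)
        also have "\<dots> \<in> borel_measurable V" using y by measurable
        finally show "(\<integral>\<^sup>+x. h j y * (ennreal (k y x) * indicator {x. D y x < ennreal (\<delta> m)} x) \<partial>V) = h j y * tail (\<delta> m) y"
          unfolding tail_def by (rule nn_integral_cmult)
      qed
      finally show ?thesis .
    qed
    also have "\<dots> \<le> nrm q' V (h j) * nrm q V (tail (\<delta> m))"
      using q_gt1 q'_gt1 q'_conj by (intro Holder_nrm) auto
    also have "\<dots> \<le> ennreal H * nrm q V (tail (\<delta> m))" using H by (intro mult_right_mono) auto
    finally show ?thesis .
  qed
  obtain r' where r': "strict_mono r'" "AE x in V. Cauchy (\<lambda>i. v (r (r' i)) x)"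
  proof (rule cauchy_L1_AE_cauchy_subseq[of V "\<lambda>j. v (r j)"])
    fix e :: real assume e: "0 < e"
    \<comment> \<open>Four errors below e / 5 will be added: two truncation errors and two distances
      to the limit \<open>w m\<close>. Their sum stays strictly below e.\<close>
    have "(\<lambda>m. ennreal H * nrm q V (tail (\<delta> m))) \<longlonglongrightarrow> ennreal H * 0"
      unfolding \<delta>_def by (intro ennreal_tendsto_cmult nrm_tail_tendsto) simp
    then have "eventually (\<lambda>m. ennreal H * nrm q V (tail (\<delta> m)) < ennreal (e / 5)) sequentially"
      using e by (intro order_tendstoD(2)[of _ 0]) auto
    then obtain m where m: "ennreal H * nrm q V (tail (\<delta> m)) < ennreal (e / 5)"
      by (auto simp: eventually_sequentially)
    have "eventually (\<lambda>j. (\<integral>\<^sup>+x. ennreal \<bar>\<sigma> (\<delta> m) (r j) x - w m x\<bar> \<partial>V) < ennreal (e / 5)) sequentially"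
      using e by (intro order_tendstoD(2)[OF wL]) auto
    then obtain J where J: "\<And>j. j \<ge> J \<Longrightarrow> (\<integral>\<^sup>+x. ennreal \<bar>\<sigma> (\<delta> m) (r j) x - w m x\<bar> \<partial>V) < ennreal (e / 5)"
      by (auto simp: eventually_sequentially)
    show "\<exists>N. \<forall>i\<ge>N. \<forall>j\<ge>N. (LINT x|V. norm (v (r i) x - v (r j) x)) < e"
    proof (intro exI[of _ J] allI impI)
      fix i j assume ij: "J \<le> i" "J \<le> j"
      have "ennreal (LINT x|V. norm (v (r i) x - v (r j) x)) = (\<integral>\<^sup>+x. ennreal (norm (v (r i) x - v (r j) x)) \<partial>V)"
        by (rule nn_integral_eq_integral[symmetric]) (use vint in auto)
      also have "\<dots> \<le> (\<integral>\<^sup>+x. (ennreal \<bar>v (r i) x - \<sigma> (\<delta> m) (r i) x\<bar> + ennreal \<bar>\<sigma> (\<delta> m) (r i) x - w m x\<bar>)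
         + (ennreal \<bar>v (r j) x - \<sigma> (\<delta> m) (r j) x\<bar> + ennreal \<bar>\<sigma> (\<delta> m) (r j) x - w m x\<bar>) \<partial>V)"
        by (rule nn_integral_mono) (simp add: ennreal_plus[symmetric] ennreal_leI del: ennreal_plus)
      also have "\<dots> = ((\<integral>\<^sup>+x. ennreal \<bar>v (r i) x - \<sigma> (\<delta> m) (r i) x\<bar> \<partial>V) + (\<integral>\<^sup>+x. ennreal \<bar>\<sigma> (\<delta> m) (r i) x - w m x\<bar> \<partial>V))
         + ((\<integral>\<^sup>+x. ennreal \<bar>v (r j) x - \<sigma> (\<delta> m) (r j) x\<bar> \<partial>V) + (\<integral>\<^sup>+x. ennreal \<bar>\<sigma> (\<delta> m) (r j) x - w m x\<bar> \<partial>V))"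
        by (simp add: nn_integral_add)
      also have "\<dots> \<le> (ennreal (e / 5) + ennreal (e / 5)) + (ennreal (e / 5) + ennreal (e / 5))"
        using vs[of _ m] m J[OF ij(1)] J[OF ij(2)] by (intro add_mono) (auto intro: order_trans less_imp_le)
      also have "\<dots> = ennreal (e / 5 * 4)" using e by (simp add: ennreal_plus[symmetric] del: ennreal_plus)
      finally have "(LINT x|V. norm (v (r i) x - v (r j) x)) \<le> e / 5 * 4" using e by simp
      then show "(LINT x|V. norm (v (r i) x - v (r j) x)) < e" using e by simp
    qed
  qed (use vint in auto)
  show ?thesis
  proof (rule that[of "r \<circ> r'" "\<lambda>x. lim (\<lambda>i. v (r (r' i)) x)"])
    show "AE x in V. (\<lambda>j. enn2real (T (h ((r \<circ> r') j)) x)) \<longlonglongrightarrow> lim (\<lambda>i. v (r (r' i)) x)"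
      using r'(2)
    proof eventually_elim
      case (elim x)
      then have "convergent (\<lambda>i. v (r (r' i)) x)" by (rule Cauchy_convergent)
      then show ?case by (simp add: convergent_LIMSEQ_iff v_def)
    qed
  qed (use r r' in \<open>auto intro: strict_mono_o\<close>)
qed

text \<open>Split at height 1. The product of min (G j) 1 and w is dominated by w. Where G j > 1,
  Hoelder leaves P times the L^p' norm of w on that set, and the indicator of the set tends to 0
  almost everywhere.\<close>

lemma weak_null:
  assumes [measurable]: "\<And>j. G j \<in> borel_measurable V" "w \<in> borel_measurable V"
    and G: "AE x in V. (\<lambda>j. G j x) \<longlonglongrightarrow> (0::ennreal)"
    and P: "\<And>j. nrm p V (G j) \<le> ennreal P" and w: "nrm p' V w < top"
  shows "(\<lambda>j. \<integral>\<^sup>+x. G j x * w x \<partial>V) \<longlonglongrightarrow> 0"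
proof -
  have "(\<integral>\<^sup>+x. w x \<partial>V) \<le> nrm p' V w * epow (emeasure V (space V)) (1 - 1 / p')"
    by (rule L1_le_nrm) (use p'_gt1 in auto)
  also have "\<dots> < top" using w by (simp add: ennreal_mult_less_top)
  finally have w1: "(\<integral>\<^sup>+x. w x \<partial>V) < top" .
  have "AE x in V. w x \<noteq> \<infinity>" by (rule nn_integral_PInf_AE) (use w1 in auto)
  then have wfin: "AE x in V. w x < top" by eventually_elim (simp add: less_top)
  have wp: "(\<integral>\<^sup>+x. epow (w x) p' \<partial>V) < top" using w by (simp add: nrm_def)
  define E where "E j x = (if G j x > 1 then w x else 0)" for j x
  have [measurable]: "E j \<in> borel_measurable V" for j unfolding E_def by measurable
  have A: "(\<lambda>j. \<integral>\<^sup>+x. min (G j x) 1 * w x \<partial>V) \<longlonglongrightarrow> (\<integral>\<^sup>+x. 0 \<partial>V)"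
  proof (rule nn_integral_dominated_convergence[where w = w])
    show "AE x in V. (\<lambda>j. min (G j x) 1 * w x) \<longlonglongrightarrow> 0"
      using G wfin
    proof eventually_elim
      case (elim x)
      have "(\<lambda>j. min (G j x) 1) \<longlonglongrightarrow> min 0 1" by (intro tendsto_intros elim)
      then have "(\<lambda>j. w x * min (G j x) 1) \<longlonglongrightarrow> w x * min 0 1" using elim(2) by (intro ennreal_tendsto_cmult) auto
      then show ?case by (simp add: mult.commute)
    qed
    show "AE x in V. min (G j x) 1 * w x \<le> w x" for j
      using mult_right_mono[of "min (G j _) 1" 1 "w _"] by (intro AE_I2) auto
  qed (use w1 in auto)
  have "(\<lambda>j. \<integral>\<^sup>+x. epow (E j x) p' \<partial>V) \<longlonglongrightarrow> (\<integral>\<^sup>+x. 0 \<partial>V)"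
  proof (rule nn_integral_dominated_convergence[where w = "\<lambda>x. epow (w x) p'"])
    show "AE x in V. (\<lambda>j. epow (E j x) p') \<longlonglongrightarrow> 0"
      using G
    proof eventually_elim
      case (elim x)
      have "eventually (\<lambda>j. G j x < 1) sequentially" by (rule order_tendstoD(2)[OF elim]) simp
      then have "eventually (\<lambda>j. epow (E j x) p' = 0) sequentially"
        by eventually_elim (auto simp: E_def)
      then show ?case by (rule tendsto_eventually)
    qed
  qed (use wp p'_gt1 in \<open>auto simp: E_def\<close>)
  then have E: "(\<lambda>j. nrm p' V (E j)) \<longlonglongrightarrow> 0"
    unfolding nrm_def using p'_gt1 by (intro tendsto_epow_0) auto
  have "(\<lambda>j. (\<integral>\<^sup>+x. min (G j x) 1 * w x \<partial>V) + ennreal P * nrm p' V (E j)) \<longlonglongrightarrow> 0 + ennreal P * 0"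
    using A E by (intro tendsto_add ennreal_tendsto_cmult) auto
  then have lim: "(\<lambda>j. (\<integral>\<^sup>+x. min (G j x) 1 * w x \<partial>V) + ennreal P * nrm p' V (E j)) \<longlonglongrightarrow> 0" by simp
  show ?thesis
  proof (rule tendsto_sandwich[OF _ _ tendsto_const lim])
    show "eventually (\<lambda>j. (\<integral>\<^sup>+x. G j x * w x \<partial>V) \<le> (\<integral>\<^sup>+x. min (G j x) 1 * w x \<partial>V) + ennreal P * nrm p' V (E j)) sequentially"
    proof (rule always_eventually, rule allI)
      fix j
      have "(\<integral>\<^sup>+x. G j x * w x \<partial>V) \<le> (\<integral>\<^sup>+x. min (G j x) 1 * w x + G j x * E j x \<partial>V)"
        by (intro nn_integral_mono) (auto simp: E_def min_def)
      also have "\<dots> = (\<integral>\<^sup>+x. min (G j x) 1 * w x \<partial>V) + (\<integral>\<^sup>+x. G j x * E j x \<partial>V)"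
        by (intro nn_integral_add) measurable
      also have "(\<integral>\<^sup>+x. G j x * E j x \<partial>V) \<le> nrm p V (G j) * nrm p' V (E j)"
        using p_gt1 p'_gt1 p'_conj by (intro Holder_nrm) auto
      also have "\<dots> \<le> ennreal P * nrm p' V (E j)" using P by (intro mult_right_mono) auto
      finally show "(\<integral>\<^sup>+x. G j x * w x \<partial>V) \<le> (\<integral>\<^sup>+x. min (G j x) 1 * w x \<partial>V) + ennreal P * nrm p' V (E j)"
        by (simp add: add_left_mono)
    qed
  qed simp
qed

subsection \<open>Localization\<close>

text \<open>Uniform continuity with respect to \<open>D\<close>, spelled out since \<open>D\<close>
  is an extended distance on a bare type.\<close>

definition ucont :: "('a \<Rightarrow> real) \<Rightarrow> bool" where
  "ucont f \<longleftrightarrow> (\<forall>e>0. \<exists>d>0. \<forall>x\<in>space V. \<forall>y\<in>space V. D x y < ennreal d \<longrightarrow> \<bar>f x - f y\<bar> < e)"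

lemma ucontD:
  assumes "ucont f" "0 < e"
  obtains d where "0 < d" "\<And>x y. x \<in> space V \<Longrightarrow> y \<in> space V \<Longrightarrow> D x y < ennreal d \<Longrightarrow> \<bar>f x - f y\<bar> < e"
  using assms unfolding ucont_def by blast

lemma ucont_compose:
  assumes f: "ucont f" and g: "continuous_on S g" "compact S" "\<And>x. x \<in> space V \<Longrightarrow> f x \<in> S"
  shows "ucont (\<lambda>x. g (f x))"
  unfolding ucont_def
proof (intro allI impI)
  fix e :: real assume "0 < e"
  have "uniformly_continuous_on S g" using g by (intro compact_uniformly_continuous)
  then obtain d where d: "0 < d" "\<And>u v. u \<in> S \<Longrightarrow> v \<in> S \<Longrightarrow> dist v u < d \<Longrightarrow> dist (g v) (g u) < e"
    using \<open>0 < e\<close> unfolding uniformly_continuous_on_def by metis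
  obtain d' where "0 < d'" "\<And>x y. x \<in> space V \<Longrightarrow> y \<in> space V \<Longrightarrow> D x y < ennreal d' \<Longrightarrow> \<bar>f x - f y\<bar> < d"
    using ucontD[OF f d(1)] by blast
  then show "\<exists>d>0. \<forall>x\<in>space V. \<forall>y\<in>space V. D x y < ennreal d \<longrightarrow> \<bar>g (f x) - g (f y)\<bar> < e"
    using d g(3) by (intro exI[of _ d']) (auto simp: dist_real_def)
qed

lemma ucont_add:
  assumes "ucont f" "ucont g" shows "ucont (\<lambda>x. f x + g x)"
  unfolding ucont_def
proof (intro allI impI)
  fix e :: real assume e: "0 < e"
  obtain d where d: "0 < d" "\<And>x y. x \<in> space V \<Longrightarrow> y \<in> space V \<Longrightarrow> D x y < ennreal d \<Longrightarrow> \<bar>f x - f y\<bar> < e / 2"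
    using ucontD[OF assms(1), of "e / 2"] e by auto
  obtain d' where d': "0 < d'" "\<And>x y. x \<in> space V \<Longrightarrow> y \<in> space V \<Longrightarrow> D x y < ennreal d' \<Longrightarrow> \<bar>g x - g y\<bar> < e / 2"
    using ucontD[OF assms(2), of "e / 2"] e by auto
  show "\<exists>d>0. \<forall>x\<in>space V. \<forall>y\<in>space V. D x y < ennreal d \<longrightarrow> \<bar>f x + g x - (f y + g y)\<bar> < e"
  proof (intro exI[of _ "min d d'"] conjI ballI impI)
    fix x y assume x: "x \<in> space V" "y \<in> space V" "D x y < ennreal (min d d')"
    have D: "D x y < ennreal d" "D x y < ennreal d'"
      using less_le_trans[OF x(3), of "ennreal d"] less_le_trans[OF x(3), of "ennreal d'"]
      by (simp_all only: ennreal_leI min.cobounded1 min.cobounded2)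
    show "\<bar>f x + g x - (f y + g y)\<bar> < e"
      using d(2)[OF x(1,2) D(1)] d'(2)[OF x(1,2) D(2)] by linarith
  qed (use d d' in auto)
qed

lemma ucont_mult:
  assumes "ucont f" "ucont g" and b: "\<And>x. x \<in> space V \<Longrightarrow> \<bar>f x\<bar> \<le> b" "\<And>x. x \<in> space V \<Longrightarrow> \<bar>g x\<bar> \<le> b"
  shows "ucont (\<lambda>x. f x * g x)"
  unfolding ucont_def
proof (intro allI impI)
  fix e :: real assume e: "0 < e"
  define c where "c = e / 2 / (\<bar>b\<bar> + 1)"
  have "0 < c" using e by (simp add: c_def)
  moreover have "(\<bar>b\<bar> + 1) * c = e / 2" using abs_ge_zero[of b] by (auto simp: c_def divide_eq_eq algebra_simps)
  ultimately have c: "0 < c" "\<bar>b\<bar> * c < e / 2" by (simp_all add: distrib_right)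
  obtain d where d: "0 < d" "\<And>x y. x \<in> space V \<Longrightarrow> y \<in> space V \<Longrightarrow> D x y < ennreal d \<Longrightarrow> \<bar>f x - f y\<bar> < c"
    using ucontD[OF assms(1) c(1)] by blast
  obtain d' where d': "0 < d'" "\<And>x y. x \<in> space V \<Longrightarrow> y \<in> space V \<Longrightarrow> D x y < ennreal d' \<Longrightarrow> \<bar>g x - g y\<bar> < c"
    using ucontD[OF assms(2) c(1)] by blast
  show "\<exists>d>0. \<forall>x\<in>space V. \<forall>y\<in>space V. D x y < ennreal d \<longrightarrow> \<bar>f x * g x - f y * g y\<bar> < e"
  proof (intro exI[of _ "min d d'"] conjI ballI impI)
    fix x y assume x: "x \<in> space V" "y \<in> space V" "D x y < ennreal (min d d')"
    have D: "D x y < ennreal d" "D x y < ennreal d'"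
      using less_le_trans[OF x(3), of "ennreal d"] less_le_trans[OF x(3), of "ennreal d'"]
      by (simp_all only: ennreal_leI min.cobounded1 min.cobounded2)
    have "f x * g x - f y * g y = f x * (g x - g y) + g y * (f x - f y)" by (simp add: algebra_simps)
    also have "\<bar>\<dots>\<bar> \<le> \<bar>f x\<bar> * \<bar>g x - g y\<bar> + \<bar>g y\<bar> * \<bar>f x - f y\<bar>"
      by (metis abs_mult abs_triangle_ineq)
    also have "\<dots> \<le> \<bar>b\<bar> * c + \<bar>b\<bar> * c"
      using b[OF x(1)] b[OF x(2)] d(2)[OF x(1,2) D(1)] d'(2)[OF x(1,2) D(2)]
      by (intro add_mono mult_mono) auto
    finally show "\<bar>f x * g x - f y * g y\<bar> < e" using c by (simp add: mult.commute)
  qed (use d d' in auto)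
qed

lemma ucont_const: "ucont (\<lambda>_. c)"
  by (auto simp: ucont_def intro: exI[of _ 1])

lemma ucont_sum: "finite F \<Longrightarrow> (\<And>a. a \<in> F \<Longrightarrow> ucont (f a)) \<Longrightarrow> ucont (\<lambda>x. \<Sum>a\<in>F. f a x)"
  by (induction F rule: finite_induct) (auto intro: ucont_const ucont_add)

text \<open>A tent over the ball of radius \<rho>. Infinite distance needs a case of its own:
  \<open>enn2real\<close> sends it to 0, where the tent has its maximum.\<close>

definition bump :: "'a \<Rightarrow> real \<Rightarrow> 'a \<Rightarrow> real" where
  "bump a \<rho> x = (if D a x = \<infinity> then 0 else max 0 (1 - enn2real (D a x) / \<rho>))"

lemma bump_bounds: "0 < \<rho> \<Longrightarrow> 0 \<le> bump a \<rho> x" "0 < \<rho> \<Longrightarrow> bump a \<rho> x \<le> 1"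
  by (auto simp: bump_def)

lemma bump_eq_0: "0 < \<rho> \<Longrightarrow> ennreal \<rho> \<le> D a x \<Longrightarrow> bump a \<rho> x = 0"
  by (cases "D a x") (auto simp: bump_def)

lemma bump_ge: "0 < \<rho> \<Longrightarrow> D a x < ennreal (\<rho> / 2) \<Longrightarrow> 1 / 2 \<le> bump a \<rho> x"
  by (cases "D a x") (auto simp: bump_def field_simps ennreal_less_iff)

lemma bump_measurable [measurable]: "a \<in> space V \<Longrightarrow> bump a \<rho> \<in> borel_measurable V"
  unfolding bump_def[abs_def] by measurable

lemma ucont_bump:
  assumes "a \<in> space V" "0 < \<rho>"
  shows "ucont (bump a \<rho>)"
  unfolding ucont_def
proof (intro allI impI)
  fix e :: real assume e: "0 < e"
  show "\<exists>d>0. \<forall>x\<in>space V. \<forall>y\<in>space V. D x y < ennreal d \<longrightarrow> \<bar>bump a \<rho> x - bump a \<rho> y\<bar> < e"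
  proof (intro exI[of _ "e * \<rho>"] conjI ballI impI)
    fix x y assume x: "x \<in> space V" "y \<in> space V" "D x y < ennreal (e * \<rho>)"
    have le: "D a x \<le> D a y + D x y" "D a y \<le> D a x + D x y"
      using D_tri[of a y x] D_tri[of a x y] D_sym[of x y] assms x by auto
    have fin: "D x y < top" using x(3) by (rule less_trans) simp
    show "\<bar>bump a \<rho> x - bump a \<rho> y\<bar> < e"
    proof (cases "D a x = top")
      case True
      then have "D a y = top" using le(1) fin by (auto simp: ennreal_add_eq_top top_unique)
      then show ?thesis using True e by (simp add: bump_def)
    next
      case False
      then have "D a y \<noteq> top" using le(2) fin by (auto simp: ennreal_add_eq_top top_unique)
      with False obtain u v w where uv: "D a x = ennreal u" "D a y = ennreal v" "D x y = ennreal w" "0 \<le> u" "0 \<le> v" "0 \<le> w"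
        using fin by (cases "D a x"; cases "D a y"; cases "D x y"; simp)
      then have "u \<le> v + w" "v \<le> u + w" "w < e * \<rho>"
        using le x(3) by (simp_all add: ennreal_plus[symmetric] ennreal_less_iff del: ennreal_plus)
      then have "\<bar>u - v\<bar> < e * \<rho>" by auto
      then have "\<bar>u / \<rho> - v / \<rho>\<bar> < e"
        using assms by (simp add: diff_divide_distrib[symmetric] abs_divide pos_divide_less_eq)
      then show ?thesis using uv by (auto simp: bump_def)
    qed
  qed (use e assms in auto)
qed

text \<open>The commutator of \<open>T\<close> with a multiplier \<open>\<phi>\<close> is of lower order: the kernel is multiplied by
  \<open>\<phi> x - \<phi> y\<close>, which is small where the kernel is large.\<close>

lemma T_commutator:
  assumes [measurable]: "G \<in> borel_measurable V" "\<phi> \<in> borel_measurable V"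
    and \<phi>: "\<And>x. 0 \<le> \<phi> x" "\<And>x. x \<in> space V \<Longrightarrow> \<phi> x \<le> 1"
    and d: "0 < d" "\<And>x y. x \<in> space V \<Longrightarrow> y \<in> space V \<Longrightarrow> D x y < ennreal d \<Longrightarrow> \<bar>\<phi> x - \<phi> y\<bar> < e"
    and x: "x \<in> space V" and e: "0 \<le> e"
  shows "ennreal (\<phi> x) * T G x \<le> T (\<lambda>y. ennreal (\<phi> y) * G y) x + ennreal e * T G x
    + ennreal (d powr (- s)) * (\<integral>\<^sup>+y. G y \<partial>V)"
proof -
  have "ennreal (\<phi> x) * T G x = (\<integral>\<^sup>+y. ennreal (\<phi> x) * (ennreal (k x y) * G y) \<partial>V)"
    unfolding T_def using x by (intro nn_integral_cmult[symmetric]) measurable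
  also have "\<dots> \<le> (\<integral>\<^sup>+y. ennreal (k x y) * (ennreal (\<phi> y) * G y) + ennreal e * (ennreal (k x y) * G y)
     + ennreal (d powr (- s)) * G y \<partial>V)"
  proof (rule nn_integral_mono)
    fix y assume y: "y \<in> space V"
    have "\<phi> x * k x y \<le> k x y * \<phi> y + e * k x y + d powr (- s)"
    proof (cases "D x y < ennreal d")
      case True
      then have "\<phi> x \<le> \<phi> y + e" using d(2)[OF x y] by auto
      then have "\<phi> x * k x y \<le> (\<phi> y + e) * k x y" by (intro mult_right_mono) auto
      also have "\<dots> = k x y * \<phi> y + e * k x y" by (simp add: algebra_simps)
      finally show ?thesis using powr_ge_zero[of d "- s"] by linarith
    next
      case False
      then have "k x y \<le> d powr (- s)" using d(1) by (intro k_far) auto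
      moreover have "\<phi> x * k x y \<le> 1 * k x y" using \<phi>(2)[OF x] by (intro mult_right_mono) auto
      moreover have "0 \<le> k x y * \<phi> y" "0 \<le> e * k x y" using \<phi> e by auto
      ultimately show ?thesis by linarith
    qed
    then have "ennreal (\<phi> x * k x y) \<le> ennreal (k x y * \<phi> y + e * k x y + d powr (- s))"
      by (rule ennreal_leI)
    also have "\<dots> = ennreal (k x y) * ennreal (\<phi> y) + ennreal e * ennreal (k x y) + ennreal (d powr (- s))"
      using \<phi> e by (simp add: ennreal_mult ennreal_plus)
    finally have "ennreal (\<phi> x) * ennreal (k x y) * G y
       \<le> (ennreal (k x y) * ennreal (\<phi> y) + ennreal e * ennreal (k x y) + ennreal (d powr (- s))) * G y"
      using \<phi> by (intro mult_right_mono) (auto simp: ennreal_mult)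
    then show "ennreal (\<phi> x) * (ennreal (k x y) * G y) \<le> ennreal (k x y) * (ennreal (\<phi> y) * G y)
      + ennreal e * (ennreal (k x y) * G y) + ennreal (d powr (- s)) * G y"
      by (simp add: distrib_right mult.assoc)
  qed
  also have "\<dots> = T (\<lambda>y. ennreal (\<phi> y) * G y) x + ennreal e * T G x + ennreal (d powr (- s)) * (\<integral>\<^sup>+y. G y \<partial>V)"
    unfolding T_def using x by (subst nn_integral_add, measurable)+ (simp add: nn_integral_cmult)
  finally show ?thesis .
qed

text \<open>As the p-th powers of the multipliers \<phi> sum to 1, the p-th power of the L^q norm of
  T G is the L^(q/p) norm of the sum of the functions (\<phi> T G)^p, and Minkowski in L^(q/p)
  separates the balls. After the commutator estimate the main terms are C times the L^p norms of
  \<phi> G, and their p-th powers sum exactly to the p-th power of C times the norm of G. Thus the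
  number of balls affects the error terms alone; these are either small through e or of L^1
  type.\<close>

lemma localized_bound:
  assumes \<eta>: "0 < \<eta>"
  obtains K where "0 \<le> K" "\<And>G. G \<in> borel_measurable V \<Longrightarrow>
    nrm q V (T G) \<le> ennreal (C + \<eta>) * nrm p V G + ennreal K * (\<integral>\<^sup>+x. G x \<partial>V)"
proof -
  obtain B where B: "0 \<le> B" "\<And>f. f \<in> borel_measurable V \<Longrightarrow> nrm q V (T f) \<le> ennreal B * nrm p V f"
    using T_bounded by blast
  obtain \<rho> where \<rho>: "\<And>x. x \<in> space V \<Longrightarrow> 0 < \<rho> x"
    "\<And>x f. x \<in> space V \<Longrightarrow> f \<in> borel_measurable V \<Longrightarrow>
      (\<And>y. y \<in> space V \<Longrightarrow> ennreal (\<rho> x) \<le> D x y \<Longrightarrow> f y = 0) \<Longrightarrow>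
      nrm q V (\<lambda>z. indicator {z \<in> space V. D x z < ennreal (\<rho> x)} z * T f z) \<le> ennreal C * nrm p V f"
    using ex_local_radius by blast
  obtain F where F: "finite F" "F \<subseteq> space V" "\<And>x. x \<in> space V \<Longrightarrow> \<exists>y\<in>F. D y x < ennreal (\<rho> y / 2)"
    using ball_cover[of "\<lambda>x. \<rho> x / 2"] \<rho>(1) by auto
  have FV: "a \<in> space V" "0 < \<rho> a" if "a \<in> F" for a using F \<rho> that by auto
  define \<psi> where "\<psi> a = bump a (\<rho> a)" for a
  have \<psi>: "0 \<le> \<psi> a x" "\<psi> a x \<le> 1" if "a \<in> F" for a x
    using bump_bounds[of "\<rho> a" a x] FV[OF that] by (auto simp: \<psi>_def)
  define \<sigma> where "\<sigma> x = (\<Sum>a\<in>F. \<psi> a x powr p)" for x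
  have [measurable]: "\<psi> a \<in> borel_measurable V" if "a \<in> F" for a
    unfolding \<psi>_def using FV[OF that] by measurable
  have [measurable]: "\<sigma> \<in> borel_measurable V" unfolding \<sigma>_def[abs_def] by measurable
  \<comment> \<open>Every point lies in some half ball, where the tent is at least 1/2. The positive
    lower bound keeps the normalized multipliers uniformly continuous.\<close>
  have \<sigma>_ge: "(1 / 2) powr p \<le> \<sigma> x" if x: "x \<in> space V" for x
  proof -
    obtain a where a: "a \<in> F" "D a x < ennreal (\<rho> a / 2)" using F(3)[OF x] by blast
    have "(1 / 2) powr p \<le> \<psi> a x powr p"
      unfolding \<psi>_def using bump_ge[OF FV(2)[OF a(1)] a(2)] p_gt1 by (intro powr_mono2) auto
    also have "\<dots> \<le> \<sigma> x" unfolding \<sigma>_def using a F \<psi> by (intro member_le_sum) auto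
    finally show ?thesis .
  qed
  have \<sigma>_le: "\<sigma> x \<le> real (card F)" for x
    unfolding \<sigma>_def using sum_mono[of F "\<lambda>a. \<psi> a x powr p" "\<lambda>_. 1"] \<psi> p_gt1 by (auto simp: powr_le1)
  define \<phi> where "\<phi> a x = \<psi> a x * \<sigma> x powr (- 1 / p)" for a x
  have \<phi>0: "0 \<le> \<phi> a x" if "a \<in> F" for a x using \<psi>[OF that] by (simp add: \<phi>_def)
  have [measurable]: "\<phi> a \<in> borel_measurable V" if [simp]: "a \<in> F" for a unfolding \<phi>_def[abs_def] by measurable
  have \<phi>p: "\<phi> a x powr p = \<psi> a x powr p / \<sigma> x" if "a \<in> F" "x \<in> space V" for a x
  proof -
    have "0 < \<sigma> x" using \<sigma>_ge[OF that(2)] by (rule less_le_trans[rotated]) simp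
    moreover have "\<phi> a x powr p = \<psi> a x powr p * (\<sigma> x powr (- 1 / p)) powr p"
      unfolding \<phi>_def using \<psi>[OF that(1), of x] by (intro powr_mult)
    moreover have "(\<sigma> x powr (- 1 / p)) powr p = 1 / \<sigma> x"
      using \<open>0 < \<sigma> x\<close> p_gt1 by (subst powr_powr) (simp add: powr_minus_divide)
    ultimately show ?thesis by simp
  qed
  have sum1: "(\<Sum>a\<in>F. \<phi> a x powr p) = 1" if x: "x \<in> space V" for x
  proof -
    have "0 < \<sigma> x" using \<sigma>_ge[OF x] by (rule less_le_trans[rotated]) simp
    moreover have "(\<Sum>a\<in>F. \<phi> a x powr p) = (\<Sum>a\<in>F. \<psi> a x powr p) / \<sigma> x"
      unfolding sum_divide_distrib using x by (intro sum.cong \<phi>p) auto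
    ultimately show ?thesis by (simp add: \<sigma>_def)
  qed
  have \<phi>1: "\<phi> a x \<le> 1" if "a \<in> F" "x \<in> space V" for a x
  proof -
    have "\<phi> a x powr p \<le> 1"
      using member_le_sum[of a F "\<lambda>a. \<phi> a x powr p"] sum1[OF that(2)] F that by simp
    then show ?thesis using p_gt1 powr_less_mono2[of p 1 "\<phi> a x"] by (force simp: not_less[symmetric])
  qed
  have ucont: "ucont (\<phi> a)" if a: "a \<in> F" for a
    unfolding \<phi>_def[abs_def]
  proof (rule ucont_mult)
    show "ucont (\<psi> a)" unfolding \<psi>_def using FV[OF a] by (rule ucont_bump)
    have "ucont (\<lambda>x. \<psi> b x powr p)" if b: "b \<in> F" for b
    proof (rule ucont_compose[where S = "{0..1}" and f = "\<psi> b" and g = "\<lambda>t. t powr p"])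
      show "ucont (\<psi> b)" unfolding \<psi>_def using FV[OF b] by (rule ucont_bump)
      show "continuous_on {0..1::real} (\<lambda>t. t powr p)"
        using p_gt1 by (intro continuous_on_powr' continuous_intros) auto
    qed (use \<psi>[OF b] in auto)
    then have u: "ucont \<sigma>" unfolding \<sigma>_def[abs_def] by (intro ucont_sum F)
    show "ucont (\<lambda>x. \<sigma> x powr (- 1 / p))"
    proof (rule ucont_compose[OF u, where S = "{(1 / 2) powr p..real (card F)}" and g = "\<lambda>t. t powr (- 1 / p)"])
      have "0 < t" if "(1 / 2) powr p \<le> t" for t :: real using that by (rule less_le_trans[rotated]) simp
      then show "continuous_on {(1 / 2) powr p..real (card F)} (\<lambda>t. t powr (- 1 / p))"
        by (intro continuous_on_powr' continuous_intros) force+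
    qed (use \<sigma>_ge \<sigma>_le in auto)
    fix x assume x: "x \<in> space V"
    show "\<bar>\<psi> a x\<bar> \<le> 2" using \<psi>[OF a, of x] by simp
    have "\<sigma> x powr (- 1 / p) \<le> ((1 / 2) powr p) powr (- 1 / p)"
      using \<sigma>_ge[OF x] p_gt1 by (intro powr_mono2') auto
    also have "\<dots> = 2" using p_gt1 by (simp add: powr_powr powr_minus)
    finally show "\<bar>\<sigma> x powr (- 1 / p)\<bar> \<le> 2" by simp
  qed
  \<comment> \<open>\<open>c\<close> is the l^p norm of the constant 1 on the centres, the price for
    one error term per ball. The choice of e then brings c e B below \<eta>.\<close>
  define c where "c = real (card F) powr (1 / p)"
  define e where "e = \<eta> / (c * B + 1)"
  have c0: "0 \<le> c" by (simp add: c_def)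
  have cB: "0 \<le> c * B" using c0 B by simp
  have "0 < e" using \<eta> cB by (simp add: e_def)
  moreover have "(c * B + 1) * e = \<eta>" using cB by (auto simp: e_def divide_eq_eq algebra_simps)
  ultimately have e: "0 < e" "c * (e * B) \<le> \<eta>" by (simp_all add: distrib_right mult.assoc mult.commute[of B e])
  have "\<forall>a\<in>F. \<exists>d>0. \<forall>x\<in>space V. \<forall>y\<in>space V. D x y < ennreal d \<longrightarrow> \<bar>\<phi> a x - \<phi> a y\<bar> < e"
    using ucont e unfolding ucont_def by blast
  then obtain d where d: "\<And>a. a \<in> F \<Longrightarrow> 0 < d a" "\<And>a x y. a \<in> F \<Longrightarrow> x \<in> space V \<Longrightarrow> y \<in> space V \<Longrightarrow>
      D x y < ennreal (d a) \<Longrightarrow> \<bar>\<phi> a x - \<phi> a y\<bar> < e"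
    by metis
  define cd where "cd = (\<Sum>a\<in>F. d a powr (- s))"
  define W where "W = epow (emeasure V (space V)) (1 / q)"
  have W: "W < top" by (simp add: W_def)
  define K where "K = c * (cd * enn2real W)"
  have cd0: "0 \<le> cd" by (simp add: cd_def sum_nonneg)
  show ?thesis
  proof (rule that[of K])
    show "0 \<le> K" using c0 cd0 by (simp add: K_def)
    fix G :: "'a \<Rightarrow> ennreal" assume [measurable]: "G \<in> borel_measurable V"
    define R where "R = ennreal (e * B) * nrm p V G + ennreal cd * W * (\<integral>\<^sup>+x. G x \<partial>V)"
    have one: "nrm q V (\<lambda>x. ennreal (\<phi> a x) * T G x) \<le> ennreal C * nrm p V (\<lambda>x. ennreal (\<phi> a x) * G x) + R"
      if a: "a \<in> F" for a
    proof -
      define U where "U = {z \<in> space V. D a z < ennreal (\<rho> a)}"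
      have [measurable]: "U \<in> sets V" unfolding U_def using ball_sets FV[OF a] by auto
      have [measurable]: "\<phi> a \<in> borel_measurable V" using a by measurable
      have out: "\<phi> a y = 0" if "ennreal (\<rho> a) \<le> D a y" for y
        using bump_eq_0[OF FV(2)[OF a] that] by (simp add: \<phi>_def \<psi>_def)
      have "nrm q V (\<lambda>x. ennreal (\<phi> a x) * T G x)
         \<le> nrm q V (\<lambda>x. indicator U x * T (\<lambda>y. ennreal (\<phi> a y) * G y) x + (ennreal e * T G x
    + ennreal (d a powr (- s)) * (\<integral>\<^sup>+y. G y \<partial>V)))"
      proof (rule nrm_mono)
        fix x assume x: "x \<in> space V"
        show "ennreal (\<phi> a x) * T G x \<le> indicator U x * T (\<lambda>y. ennreal (\<phi> a y) * G y) x + (ennreal e * T G x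
    + ennreal (d a powr (- s)) * (\<integral>\<^sup>+y. G y \<partial>V))"
        proof (cases "x \<in> U")
          case True
          then show ?thesis
            using T_commutator[of G "\<phi> a" "d a" e x] \<phi>0[OF a] \<phi>1[OF a] d(1)[OF a] d(2)[OF a] x e(1)
            by (simp add: add.assoc)
        next
          case False
          then have "\<phi> a x = 0" using x out by (auto simp: U_def not_less)
          then show ?thesis by simp
        qed
      qed (use q_gt1 in auto)
      also have "\<dots> \<le> nrm q V (\<lambda>x. indicator U x * T (\<lambda>y. ennreal (\<phi> a y) * G y) x)
         + nrm q V (\<lambda>x. ennreal e * T G x + ennreal (d a powr (- s)) * (\<integral>\<^sup>+y. G y \<partial>V))"
        using q_gt1 by (intro Minkowski_nrm) auto
      also have "nrm q V (\<lambda>x. ennreal e * T G x + ennreal (d a powr (- s)) * (\<integral>\<^sup>+y. G y \<partial>V))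
         \<le> nrm q V (\<lambda>x. ennreal e * T G x) + nrm q V (\<lambda>x. ennreal (d a powr (- s)) * (\<integral>\<^sup>+y. G y \<partial>V))"
        using q_gt1 by (intro Minkowski_nrm) auto
      also have "nrm q V (\<lambda>x. ennreal e * T G x) = ennreal e * nrm q V (T G)"
        using q_gt1 by (intro nrm_cmult) auto
      also have "\<dots> \<le> ennreal e * (ennreal B * nrm p V G)" by (intro mult_left_mono B) auto
      also have "nrm q V (\<lambda>x. ennreal (d a powr (- s)) * (\<integral>\<^sup>+y. G y \<partial>V)) = ennreal (d a powr (- s)) * (\<integral>\<^sup>+y. G y \<partial>V) * W"
        using q_gt1 by (simp add: nrm_const W_def)
      also have "\<dots> \<le> ennreal cd * (\<integral>\<^sup>+y. G y \<partial>V) * W"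
        unfolding cd_def using a F by (intro mult_right_mono ennreal_leI member_le_sum) auto
      also have "nrm q V (\<lambda>x. indicator U x * T (\<lambda>y. ennreal (\<phi> a y) * G y) x) \<le> ennreal C * nrm p V (\<lambda>x. ennreal (\<phi> a x) * G x)"
        unfolding U_def using FV[OF a] by (intro \<rho>(2)) (auto simp: out)
      finally have "nrm q V (\<lambda>x. ennreal (\<phi> a x) * T G x) \<le> ennreal C * nrm p V (\<lambda>x. ennreal (\<phi> a x) * G x)
         + (ennreal e * (ennreal B * nrm p V G) + ennreal cd * (\<integral>\<^sup>+y. G y \<partial>V) * W)"
        by (simp add: add_mono)
      also have "ennreal e * (ennreal B * nrm p V G) + ennreal cd * (\<integral>\<^sup>+y. G y \<partial>V) * W = R"
        using e(1) B(1) by (simp add: R_def ennreal_mult ac_simps)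
      finally show ?thesis .
    qed
    have epsum: "(\<Sum>a\<in>F. epow (ennreal (\<phi> a x)) p) = 1" if "x \<in> space V" for x
    proof -
      have "(\<Sum>a\<in>F. epow (ennreal (\<phi> a x)) p) = (\<Sum>a\<in>F. ennreal (\<phi> a x powr p))"
        using \<phi>0 by (intro sum.cong) auto
      also have "\<dots> = ennreal (\<Sum>a\<in>F. \<phi> a x powr p)" by (intro sum_ennreal) auto
      finally show ?thesis using sum1[OF that] by simp
    qed
    have split: "epow z p = (\<Sum>a\<in>F. epow (ennreal (\<phi> a x) * z) p)" if "x \<in> space V" for x z
      using epsum[OF that] p_gt1 by (simp add: epow_mult sum_distrib_right[symmetric])
    have r: "1 \<le> q / p" using p_less_q p_gt1 by (simp add: field_simps)
    have "epow (nrm q V (T G)) p = nrm (q / p) V (\<lambda>x. epow (T G x) p)"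
      using p_gt1 q_gt1 by (subst nrm_epow) auto
    also have "\<dots> = nrm (q / p) V (\<lambda>x. \<Sum>a\<in>F. epow (ennreal (\<phi> a x) * T G x) p)"
      by (intro nrm_cong split)
    also have "\<dots> \<le> (\<Sum>a\<in>F. nrm (q / p) V (\<lambda>x. epow (ennreal (\<phi> a x) * T G x) p))"
      using r F by (intro Minkowski_nrm_sum) auto
    also have "\<dots> = (\<Sum>a\<in>F. epow (nrm q V (\<lambda>x. ennreal (\<phi> a x) * T G x)) p)"
      using p_gt1 q_gt1 by (intro sum.cong refl, subst nrm_epow) auto
    also have "\<dots> \<le> (\<Sum>a\<in>F. epow (ennreal C * nrm p V (\<lambda>x. ennreal (\<phi> a x) * G x) + R) p)"
      using p_gt1 one by (intro sum_mono epow_mono) auto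
    \<comment> \<open>The sum over the centres is read as an L^p norm for counting measure, so that
      Minkowski separates the main terms from the error \<open>R\<close>, which is the same for all
      centres.\<close>
    also have "\<dots> = epow (nrm p (count_space F) (\<lambda>a. ennreal C * nrm p V (\<lambda>x. ennreal (\<phi> a x) * G x) + R)) p"
      using p_gt1 F by (simp add: nrm_powr nn_integral_count_space_finite)
    finally have "nrm q V (T G) \<le>
       epow (epow (nrm p (count_space F) (\<lambda>a. ennreal C * nrm p V (\<lambda>x. ennreal (\<phi> a x) * G x) + R)) p) (1 / p)"
      using p_gt1 by (subst (asm) epow_le_iff) auto
    then have "nrm q V (T G) \<le> nrm p (count_space F) (\<lambda>a. ennreal C * nrm p V (\<lambda>x. ennreal (\<phi> a x) * G x) + R)"
      using p_gt1 by (simp add: epow_epow)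
    also have "\<dots> \<le> nrm p (count_space F) (\<lambda>a. ennreal C * nrm p V (\<lambda>x. ennreal (\<phi> a x) * G x)) + nrm p (count_space F) (\<lambda>a. R)"
      using p_gt1 by (intro Minkowski_nrm) auto
    also have "nrm p (count_space F) (\<lambda>a. ennreal C * nrm p V (\<lambda>x. ennreal (\<phi> a x) * G x)) = ennreal C * nrm p V G"
    proof -
      have "(\<Sum>a\<in>F. \<integral>\<^sup>+x. epow (ennreal (\<phi> a x) * G x) p \<partial>V) = (\<integral>\<^sup>+x. (\<Sum>a\<in>F. epow (ennreal (\<phi> a x) * G x) p) \<partial>V)"
        by (rule nn_integral_sum[symmetric]) measurable
      also have "\<dots> = (\<integral>\<^sup>+x. epow (G x) p \<partial>V)"
        by (intro nn_integral_cong split[symmetric])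
      finally have "nrm p (count_space F) (\<lambda>a. nrm p V (\<lambda>x. ennreal (\<phi> a x) * G x)) = nrm p V G"
        using p_gt1 F by (simp add: nrm_def nn_integral_count_space_finite epow_epow)
      then show ?thesis using p_gt1 by (subst nrm_cmult) auto
    qed
    also have "nrm p (count_space F) (\<lambda>a. R) = R * ennreal c"
      using p_gt1 F by (simp add: nrm_const c_def ennreal_of_nat_eq_real_of_nat)
    also have "\<dots> = ennreal (c * (e * B)) * nrm p V G + ennreal K * (\<integral>\<^sup>+x. G x \<partial>V)"
    proof -
      have "ennreal K = ennreal c * (ennreal cd * W)"
        using W c0 cd0 by (simp add: K_def ennreal_mult)
      then show ?thesis using c0 e(1) B(1) by (simp add: R_def ennreal_mult algebra_simps)
    qed
    also have "\<dots> \<le> ennreal \<eta> * nrm p V G + ennreal K * (\<integral>\<^sup>+x. G x \<partial>V)"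
      using e(2) by (intro add_mono mult_right_mono ennreal_leI) auto
    finally show "nrm q V (T G) \<le> ennreal (C + \<eta>) * nrm p V G + ennreal K * (\<integral>\<^sup>+x. G x \<partial>V)"
      using C_nonneg \<eta> by (simp add: distrib_right add.assoc add_left_mono)
  qed
qed

end

lemma nrm_real:
  assumes "0 < a" "integrable M (\<lambda>x. \<bar>g x\<bar> powr a)"
  shows "nrm a M (\<lambda>x. ennreal \<bar>g x\<bar>) = ennreal ((\<integral>x. \<bar>g x\<bar> powr a \<partial>M) powr (1 / a))"
  using assms by (simp add: nrm_def nn_integral_eq_integral)

lemma integrable_powr_nrm:
  assumes [measurable]: "g \<in> borel_measurable M" and "nrm a M (\<lambda>x. ennreal \<bar>g x\<bar>) < top"
  shows "integrable M (\<lambda>x. \<bar>g x\<bar> powr a)"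
  using assms(2) by (intro integrableI_bounded) (auto simp: nrm_def)

text \<open>Since r >= 1, x^r <= x on [0,1]; this is applied to the fractions a / (a + b) and b / (a
  + b), whose sum is 1.\<close>

lemma powr_superadditive:
  fixes a b r :: real
  assumes "0 \<le> a" "0 \<le> b" "1 \<le> r"
  shows "a powr r + b powr r \<le> (a + b) powr r"
proof (cases "a + b = 0")
  case False
  then have ab: "0 < a + b" using assms by simp
  have *: "(x / (a + b)) powr r \<le> x / (a + b)" if "0 \<le> x" "x \<le> a + b" for x
    using powr_mono'[of 1 r "x / (a + b)"] that assms ab by (cases "x = 0") auto
  have "a powr r + b powr r = (a + b) powr r * ((a / (a + b)) powr r + (b / (a + b)) powr r)"
    using assms ab by (simp add: powr_divide distrib_left)
  also have "\<dots> \<le> (a + b) powr r * (a / (a + b) + b / (a + b))"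
    using * assms by (intro mult_left_mono add_mono) auto
  also have "\<dots> = (a + b) powr r" using ab by (simp add: add_divide_distrib[symmetric])
  finally show ?thesis .
next
  case True
  then have "a = 0" "b = 0" using assms by linarith+
  then show ?thesis by simp
qed

context riesz_space
begin

subsection \<open>Existence of a maximizer\<close>

text \<open>One step of the power method for \<open>T\<close> and its transpose does not decrease the quotient.\<close>

lemma power_step:
  assumes N: "0 \<le> N" "\<And>f. f \<in> borel_measurable V \<Longrightarrow> nrm q V (T f) \<le> ennreal N * nrm p V f"
    and [measurable]: "f \<in> borel_measurable V" and f1: "nrm p V f = 1"
    and t0: "0 < t0" "ennreal t0 \<le> nrm q V (T f)"
  defines "h \<equiv> \<lambda>x. epow (T f x) (q - 1)"
  defines "F \<equiv> \<lambda>x. epow (T h x) (p' - 1)"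
  shows "nrm q' V h \<le> ennreal (N powr (q - 1))"
    and "ennreal t0 * nrm p V F \<le> nrm q V (T F)"
    and "ennreal ((t0 powr q) powr (p' - 1)) \<le> nrm p V F"
    and "nrm p V F \<le> ennreal ((N * N powr (q - 1)) powr (p' - 1))"
proof -
  have [measurable]: "h \<in> borel_measurable V" unfolding h_def by measurable
  have [measurable]: "F \<in> borel_measurable V" unfolding F_def by measurable
  have "nrm q V (T f) \<le> ennreal N" using N(2)[of f] f1 by simp
  then obtain t where t: "nrm q V (T f) = ennreal t" "0 \<le> t" "t \<le> N"
    using N(1) by (cases "nrm q V (T f)") (auto simp: top_unique)
  have t0t: "t0 \<le> t" "0 < t" using t0 t by auto
  have hn: "nrm q' V h = ennreal (t powr (q - 1))"
    unfolding h_def using q_gt1 q'_gt1 exponents t by (subst nrm_epow) (auto simp: mult.commute)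
  also have "\<dots> \<le> ennreal (N powr (q - 1))" using t q_gt1 by (intro ennreal_leI powr_mono2) auto
  finally show hN: "nrm q' V h \<le> ennreal (N powr (q - 1))" .
  have "nrm p' V (T h) \<le> ennreal N * nrm q' V h" by (rule T_dual_bound) (use N \<open>h \<in> borel_measurable V\<close> in auto)
  also have "\<dots> \<le> ennreal N * ennreal (N powr (q - 1))" using hN by (intro mult_left_mono) auto
  also have "\<dots> = ennreal (N * N powr (q - 1))" using N(1) by (simp add: ennreal_mult)
  finally have yN: "nrm p' V (T h) \<le> ennreal (N * N powr (q - 1))" .
  then obtain y where y: "nrm p' V (T h) = ennreal y" "0 \<le> y" "y \<le> N * N powr (q - 1)"
    using N(1) by (cases "nrm p' V (T h)") (auto simp: top_unique)
  have Fn: "nrm p V F = ennreal (y powr (p' - 1))"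
    unfolding F_def using p_gt1 p'_gt1 exponents y by (subst nrm_epow) (auto simp: mult.commute)
  show "nrm p V F \<le> ennreal ((N * N powr (q - 1)) powr (p' - 1))"
    unfolding Fn using y p'_gt1 by (intro ennreal_leI powr_mono2) auto
  \<comment> \<open>The power t^q is the pairing of h with T f, hence of f with T h; as f has norm 1
    this gives y >= t^q.\<close>
  have "ennreal (t powr q) = (\<integral>\<^sup>+x. epow (T f x) (q - 1) * epow (T f x) 1 \<partial>V)"
    using q_gt1 nrm_powr[of q V "T f"] t by (simp add: epow_add del: epow_1)
  also have "\<dots> = (\<integral>\<^sup>+x. h x * T f x \<partial>V)" by (simp add: h_def)
  also have "\<dots> = (\<integral>\<^sup>+x. f x * T h x \<partial>V)" by (rule T_symmetric) measurable
  also have "\<dots> \<le> nrm p V f * nrm p' V (T h)" using p_gt1 p'_gt1 p'_conj by (intro Holder_nrm) auto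
  finally have ty: "t powr q \<le> y" using f1 y by simp
  have "t0 powr q \<le> t powr q" using t0t t0 q_gt1 by (intro powr_mono2) auto
  then have "t0 powr q \<le> y" using ty by simp
  then show "ennreal ((t0 powr q) powr (p' - 1)) \<le> nrm p V F"
    unfolding Fn using p'_gt1 by (intro ennreal_leI powr_mono2) auto
  \<comment> \<open>Likewise y^p' is the pairing of F with T h, hence of h with T F, and h has norm
    t^(q-1). Combined with y >= t^q, T F has norm at least t y^(p'-1), which is t times the norm of
    F.\<close>
  have "ennreal (y powr p') = (\<integral>\<^sup>+x. epow (T h x) (p' - 1) * epow (T h x) 1 \<partial>V)"
    using p'_gt1 nrm_powr[of p' V "T h"] y by (simp add: epow_add del: epow_1)
  also have "\<dots> = (\<integral>\<^sup>+x. F x * T h x \<partial>V)" by (simp add: F_def)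
  also have "\<dots> = (\<integral>\<^sup>+x. h x * T F x \<partial>V)" by (rule T_symmetric) measurable
  also have "\<dots> \<le> nrm q' V h * nrm q V (T F)" using q_gt1 q'_gt1 q'_conj by (intro Holder_nrm) auto
  finally have *: "ennreal (y powr p') \<le> ennreal (t powr (q - 1)) * nrm q V (T F)" by (simp add: hn)
  show "ennreal t0 * nrm p V F \<le> nrm q V (T F)"
  proof (cases "nrm q V (T F)")
    case (real z)
    have "y powr p' \<le> t powr (q - 1) * z" using * real t0t by (simp add: ennreal_mult'[symmetric])
    moreover have "t powr q * y powr (p' - 1) \<le> y * y powr (p' - 1)" using ty by (intro mult_right_mono) auto
    moreover have "y * y powr (p' - 1) = y powr p'" using y(2) by (cases "y = 0") (auto simp: powr_diff)
    moreover have "t powr q = t powr (q - 1) * t" using t0t by (simp add: powr_diff)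
    ultimately have "t powr (q - 1) * (t * y powr (p' - 1)) \<le> t powr (q - 1) * z" by (simp add: mult.assoc)
    then have "t * y powr (p' - 1) \<le> z" using t0t by simp
    then have "t0 * y powr (p' - 1) \<le> z" using mult_right_mono[OF t0t(1), of "y powr (p' - 1)"] by simp
    then show ?thesis using real Fn t0 by (simp add: ennreal_mult'[symmetric] ennreal_leI)
  qed simp
qed

theorem maximizer_exists:
  assumes N: "0 \<le> N" "\<And>f. f \<in> borel_measurable V \<Longrightarrow> nrm q V (T f) \<le> ennreal N * nrm p V f"
    and sup: "\<And>e. 0 < e \<Longrightarrow> \<exists>f\<in>borel_measurable V. nrm p V f = 1 \<and> ennreal (N - e) \<le> nrm q V (T f)"
    and CN: "C < N"
  shows "\<exists>f. f \<in> borel_measurable V \<and> (\<forall>x. 0 \<le> f x) \<and> 0 < nrm p V (\<lambda>x. ennreal (f x)) \<and>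
    nrm p V (\<lambda>x. ennreal (f x)) < top \<and>
    nrm q V (T (\<lambda>x. ennreal (f x))) = ennreal N * nrm p V (\<lambda>x. ennreal (f x))"
proof -
  have N0: "0 < N" using CN C_nonneg by simp
  \<comment> \<open>These bounds tend to N from below but never drop under N / 2, so that the norms
    of the iterates \<open>F j\<close> stay above the fixed constant \<open>c\<close> defined
    below.\<close>
  define t where "t j = N - N / 2 * inverse (real (Suc j))" for j
  have t: "N / 2 \<le> t j" "0 < t j" for j
  proof -
    have "inverse (real (Suc j)) \<le> 1" by (simp add: inverse_le_1_iff)
    then have "N / 2 * inverse (real (Suc j)) \<le> N / 2 * 1" using N0 by (intro mult_left_mono) auto
    then show "N / 2 \<le> t j" unfolding t_def by linarith
    then show "0 < t j" using N0 by linarith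
  qed
  have tlim: "t \<longlonglongrightarrow> N"
  proof -
    have "(\<lambda>j. N - N / 2 * inverse (real (Suc j))) \<longlonglongrightarrow> N - N / 2 * 0"
      by (intro tendsto_intros LIMSEQ_inverse_real_of_nat)
    then show ?thesis by (simp only: t_def[abs_def] mult_zero_right diff_zero)
  qed
  have "\<forall>j. \<exists>f. f \<in> borel_measurable V \<and> nrm p V f = 1 \<and> ennreal (t j) \<le> nrm q V (T f)"
  proof
    fix j
    have "0 < N / 2 * inverse (real (Suc j))" using N0 by simp
    from sup[OF this] show "\<exists>f. f \<in> borel_measurable V \<and> nrm p V f = 1 \<and> ennreal (t j) \<le> nrm q V (T f)"
      unfolding t_def by blast
  qed
  then obtain f0 where f0: "\<And>j. f0 j \<in> borel_measurable V" "\<And>j. nrm p V (f0 j) = 1"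
    "\<And>j. ennreal (t j) \<le> nrm q V (T (f0 j))"
    by metis
  define h where "h j = (\<lambda>x. epow (T (f0 j) x) (q - 1))" for j
  note [measurable] = f0(1)
  have [measurable]: "h j \<in> borel_measurable V" for j unfolding h_def by measurable
  define F where "F j = (\<lambda>x. epow (T (h j) x) (p' - 1))" for j
  have [measurable]: "F j \<in> borel_measurable V" for j unfolding F_def by measurable
  define P where "P = (N * N powr (q - 1)) powr (p' - 1)"
  define c where "c = ((N / 2) powr q) powr (p' - 1)"
  have P0: "0 \<le> P" and c0: "0 < c" using N0 by (simp_all add: P_def c_def)
  note step = power_step[OF N f0(1) f0(2) t(2) f0(3), folded h_def, folded F_def]
  have hH: "nrm q' V (h j) \<le> ennreal (N powr (q - 1))" for j by (rule step)
  have Fq: "ennreal (t j) * nrm p V (F j) \<le> nrm q V (T (F j))" for j by (rule step)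
  have FP: "nrm p V (F j) \<le> ennreal P" for j unfolding P_def by (rule step)
  have Fc: "ennreal c \<le> nrm p V (F j)" for j
  proof -
    have "c \<le> ((t j) powr q) powr (p' - 1)"
      unfolding c_def using t(1)[of j] N0 q_gt1 p'_gt1 by (intro powr_mono2) auto
    then show ?thesis using step(3)[of j] by (meson ennreal_leI order_trans)
  qed
  obtain r u where r: "strict_mono (r::nat \<Rightarrow> nat)" and [measurable]: "u \<in> borel_measurable V"
    and ru: "AE x in V. (\<lambda>j. enn2real (T (h (r j)) x)) \<longlonglongrightarrow> u x"
    using T_compact[of h "N powr (q - 1)"] hH by auto
  have hfin: "AE x in V. T (h j) x < top" for j
  proof (rule T_finite_AE(2)[OF N])
    show "nrm q' V (h j) < top" using hH[of j] by (rule le_less_trans) simp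
  qed auto
  define g where "g j x = enn2real (T (h (r j)) x) powr (p' - 1)" for j x
  \<comment> \<open>The limit \<open>u\<close> is controlled almost everywhere; the maximum makes f
    nonnegative at every point.\<close>
  define f where "f x = (max 0 (u x)) powr (p' - 1)" for x
  have [measurable]: "g j \<in> borel_measurable V" for j unfolding g_def[abs_def] by measurable
  have [measurable]: "f \<in> borel_measurable V" unfolding f_def[abs_def] by measurable
  have g0: "0 \<le> g j x" and f0': "0 \<le> f x" for j x by (simp_all add: g_def f_def)
  have gF: "AE x in V. ennreal (g j x) = F (r j) x" for j
    using hfin[of "r j"] by eventually_elim (auto simp: g_def F_def epow_def less_top)
  have gf: "AE x in V. (\<lambda>j. g j x) \<longlonglongrightarrow> f x"
    using ru
  proof eventually_elim
    case (elim x)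
    have "(\<lambda>j. max 0 (enn2real (T (h (r j)) x)) powr (p' - 1)) \<longlonglongrightarrow> max 0 (u x) powr (p' - 1)"
      using p'_gt1 by (intro tendsto_powr' tendsto_max tendsto_const elim) auto
    then show ?case by (simp add: g_def f_def)
  qed
  have nrm_g: "nrm p V (\<lambda>x. ennreal (g j x)) = nrm p V (F (r j))" for j
    by (rule antisym; rule nrm_mono_AE) (use p_gt1 gF[of j] in \<open>auto elim: AE_mp\<close>)
  have T_g: "T (\<lambda>x. ennreal (g j x)) = T (F (r j))" for j
    by (rule ext, rule T_cong_AE, rule gF)
  have Npow: "nrm p V (\<lambda>x. ennreal (g j x)) \<le> ennreal P" for j using FP nrm_g by simp
  have ig: "integrable V (\<lambda>x. \<bar>g j x\<bar> powr p)" for j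
    by (rule integrable_powr_nrm) (use le_less_trans[OF Npow[of j]] g0 in auto)
  define A where "A j = (\<integral>x. \<bar>g j x\<bar> powr p \<partial>V)" for j
  have A0: "0 \<le> A j" for j by (simp add: A_def)
  have nA: "nrm p V (\<lambda>x. ennreal (g j x)) = ennreal (A j powr (1 / p))" for j
    using nrm_real[OF _ ig[of j]] p_gt1 g0 by (simp add: A_def)
  have AP: "A j powr (1 / p) \<le> P" "c \<le> A j powr (1 / p)" for j
    using Npow[of j] Fc[of "r j"] P0 nA[of j] nrm_g[of j] by simp_all
  have AP': "A j \<le> P powr p" for j
  proof -
    have "(A j powr (1 / p)) powr p \<le> P powr p" using AP(1) p_gt1 by (intro powr_mono2) auto
    then show ?thesis using p_gt1 A0 by (simp add: powr_powr)
  qed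
  note BLp = Brezis_Lieb[of g V f p "P powr p", OF _ _ p_gt1 gf ig AP'[unfolded A_def]]
  have if_: "integrable V (\<lambda>x. \<bar>f x\<bar> powr p)" by (rule BLp) auto
  have igf: "integrable V (\<lambda>x. \<bar>g j x - f x\<bar> powr p)" for j by (rule BLp) auto
  define a where "a = (\<integral>x. \<bar>f x\<bar> powr p \<partial>V)"
  have a0: "0 \<le> a" by (simp add: a_def)
  have nf: "nrm p V (\<lambda>x. ennreal (f x)) = ennreal (a powr (1 / p))"
    using nrm_real[OF _ if_] p_gt1 f0' by (simp add: a_def)
  define b where "b j = (\<integral>x. \<bar>g j x - f x\<bar> powr p \<partial>V)" for j
  have b0: "0 \<le> b j" for j by (simp add: b_def)
  have bP: "b j \<le> 2 powr p * P powr p" for j unfolding b_def by (rule BLp) auto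
  have Ab: "(\<lambda>j. A j - b j) \<longlonglongrightarrow> a" unfolding A_def b_def a_def by (rule BLp) auto
  define G where "G j x = ennreal \<bar>g j x - f x\<bar>" for j x
  have [measurable]: "G j \<in> borel_measurable V" for j unfolding G_def[abs_def] by measurable
  have nG: "nrm p V (G j) = ennreal (b j powr (1 / p))" for j
    using nrm_real[OF _ igf[of j]] p_gt1 by (simp add: b_def G_def[abs_def])
  have nGb: "nrm p V (G j) \<le> ennreal ((2 powr p * P powr p) powr (1 / p))" for j
    unfolding nG using bP[of j] b0[of j] p_gt1 by (intro ennreal_leI powr_mono2) auto
  have Gnull: "AE x in V. (\<lambda>j. G j x) \<longlonglongrightarrow> 0"
    using gf
  proof eventually_elim
    case (elim x)
    have "(\<lambda>j. ennreal \<bar>g j x - f x\<bar>) \<longlonglongrightarrow> ennreal \<bar>f x - f x\<bar>" by (intro tendsto_intros elim)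
    then show ?case by (simp add: G_def)
  qed
  have one_fin: "nrm e V (\<lambda>_. 1) < top" if "0 < e" for e using that by (simp add: nrm_const)
  have G1: "(\<lambda>j. \<integral>\<^sup>+x. G j x \<partial>V) \<longlonglongrightarrow> 0"
    using weak_null[of G "\<lambda>_. 1", OF _ _ Gnull nGb one_fin] p'_gt1 by simp
  \<comment> \<open>By symmetry the integral of T (G j) is that of G j against T 1, which lies in
    L^p' by duality, so \<open>weak_null\<close> applies. It is this L^1 convergence that yields a
    subsequence with T (G j) tending to 0 almost everywhere.\<close>
  have TG1: "(\<lambda>j. \<integral>\<^sup>+x. T (G j) x \<partial>V) \<longlonglongrightarrow> 0"
  proof -
    have "nrm p' V (T (\<lambda>_. 1)) \<le> ennreal N * nrm q' V (\<lambda>_. 1)" by (rule T_dual_bound[OF N]) auto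
    also have "\<dots> < top" using one_fin[of q'] q'_gt1 by (simp add: ennreal_mult_less_top)
    finally have "nrm p' V (T (\<lambda>_. 1)) < top" .
    then have "(\<lambda>j. \<integral>\<^sup>+x. G j x * T (\<lambda>_. 1) x \<partial>V) \<longlonglongrightarrow> 0"
      by (intro weak_null[OF _ _ Gnull nGb]) auto
    moreover have "(\<integral>\<^sup>+x. G j x * T (\<lambda>_. 1) x \<partial>V) = (\<integral>\<^sup>+x. T (G j) x \<partial>V)" for j
      using T_symmetric[of "G j" "\<lambda>_. 1"] by simp
    ultimately show ?thesis by simp
  qed
  have Tfin: "nrm q V (T w) < top" "AE x in V. T w x < top" "(\<integral>\<^sup>+x. T w x \<partial>V) < top"
    if [measurable]: "w \<in> borel_measurable V" and "nrm p V w < top" for w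
  proof -
    have "nrm q V (T w) \<le> ennreal N * nrm p V w" by (rule N) measurable
    also have "\<dots> < top" using that by (simp add: ennreal_mult_less_top)
    finally show *: "nrm q V (T w) < top" .
    have "(\<integral>\<^sup>+x. T w x \<partial>V) \<le> nrm q V (T w) * epow (emeasure V (space V)) (1 - 1 / q)"
      by (rule L1_le_nrm) (use q_gt1 in auto)
    also have "\<dots> < top" using * by (simp add: ennreal_mult_less_top)
    finally show **: "(\<integral>\<^sup>+x. T w x \<partial>V) < top" .
    then have "AE x in V. T w x \<noteq> \<infinity>" by (intro nn_integral_PInf_AE) auto
    then show "AE x in V. T w x < top" by eventually_elim (simp add: less_top)
  qed
  have Gfin: "nrm p V (G j) < top" for j by (simp add: nG)
  define E where "E j x = enn2real (T (G j) x)" for j x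
  have [measurable]: "E j \<in> borel_measurable V" for j unfolding E_def[abs_def] by measurable
  have ET: "AE x in V. ennreal (E j x) = T (G j) x" for j
    using Tfin(2)[OF _ Gfin[of j]] by (auto simp: E_def elim: AE_mp)
  have Enn: "(\<integral>\<^sup>+x. ennreal (norm (E j x)) \<partial>V) = (\<integral>\<^sup>+x. T (G j) x \<partial>V)" for j
    by (rule nn_integral_cong_AE) (use ET[of j] in \<open>eventually_elim, simp add: E_def\<close>)
  have iE: "integrable V (E j)" for j
    using Enn[of j] Tfin(3)[OF _ Gfin[of j]] by (intro integrableI_bounded) auto
  have "(\<lambda>j. \<integral>x. norm (E j x) \<partial>V) \<longlonglongrightarrow> 0"
  proof -
    have "(\<lambda>j. ennreal (\<integral>x. norm (E j x) \<partial>V)) \<longlonglongrightarrow> ennreal 0"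
      using TG1 by (simp add: Enn[symmetric] nn_integral_eq_integral iE integrable_norm del: norm_of_real real_norm_def)
    then show ?thesis by (subst (asm) tendsto_ennreal_iff) auto
  qed
  then obtain r2 where r2: "strict_mono (r2::nat \<Rightarrow> nat)" "AE x in V. (\<lambda>j. E (r2 j) x) \<longlonglongrightarrow> 0"
    using tendsto_L1_AE_subseq[of V E] iE by blast
  \<comment> \<open>Brezis-Lieb gives the limit of A - b; a further subsequence makes the masses b
    of the remainders converge themselves.\<close>
  have "bounded (range (\<lambda>j. b (r2 j)))"
    by (rule boundedI[where B = "2 powr p * P powr p"]) (use b0 bP in auto)
  then obtain bl r3 where r3: "strict_mono (r3::nat \<Rightarrow> nat)" "((\<lambda>j. b (r2 j)) \<circ> r3) \<longlonglongrightarrow> bl"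
    using bounded_imp_convergent_subsequence by blast
  define R where "R = r2 \<circ> r3"
  have R: "strict_mono R" unfolding R_def using r2 r3 by (intro strict_mono_o)
  have bR: "(\<lambda>j. b (R j)) \<longlonglongrightarrow> bl" using r3(2) by (simp add: R_def o_def)
  have bl0: "0 \<le> bl" using LIMSEQ_le_const[OF bR] b0 by auto
  have sub: "(\<lambda>j. X (R j)) \<longlonglongrightarrow> l" if "X \<longlonglongrightarrow> l" for X and l :: "'b::topological_space"
    using LIMSEQ_subseq_LIMSEQ[OF that R] by (simp add: o_def)
  have AR: "(\<lambda>j. A (R j)) \<longlonglongrightarrow> a + bl"
    using tendsto_add[OF sub[OF Ab] bR] by simp
  have ffin: "nrm p V (\<lambda>x. ennreal (f x)) < top" by (simp add: nf)
  have gfin: "nrm p V (\<lambda>x. ennreal (g j x)) < top" for j by (simp add: nA)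
  define w where "w j x = enn2real (T (\<lambda>x. ennreal (g j x)) x)" for j x
  define v where "v x = enn2real (T (\<lambda>x. ennreal (f x)) x)" for x
  have [measurable]: "w j \<in> borel_measurable V" for j unfolding w_def[abs_def] by measurable
  have [measurable]: "v \<in> borel_measurable V" unfolding v_def[abs_def] by measurable
  have w0: "0 \<le> w j x" and v0: "0 \<le> v x" and E0: "0 \<le> E j x" for j x by (simp_all add: w_def v_def E_def)
  have wT: "AE x in V. ennreal (w j x) = T (\<lambda>x. ennreal (g j x)) x" for j
    using Tfin(2)[OF _ gfin[of j]] by (auto simp: w_def elim: AE_mp)
  have vT: "AE x in V. ennreal (v x) = T (\<lambda>x. ennreal (f x)) x"
    using Tfin(2)[OF _ ffin] by (auto simp: v_def elim: AE_mp)
  \<comment> \<open>|T g - T f| <= T |g - f|, proved as two inequalities between sums since extended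
    values are involved.\<close>
  have wv: "AE x in V. \<bar>w j x - v x\<bar> \<le> E j x" for j
    using wT[of j] vT ET[of j] AE_space
  proof eventually_elim
    case (elim x)
    have "T (\<lambda>x. ennreal (g j x)) x \<le> T (\<lambda>x. ennreal (f x) + G j x) x"
      by (rule T_mono) (use f0' in \<open>simp add: G_def ennreal_plus[symmetric] ennreal_leI del: ennreal_plus\<close>)
    also have "\<dots> = T (\<lambda>x. ennreal (f x)) x + T (G j) x" by (rule T_add) (use elim in auto)
    finally have "ennreal (w j x) \<le> ennreal (v x + E j x)" using elim v0 E0 by simp
    then have 1: "w j x \<le> v x + E j x" using v0[of x] E0[of j x] by (subst (asm) ennreal_le_iff) auto
    have "T (\<lambda>x. ennreal (f x)) x \<le> T (\<lambda>x. ennreal (g j x) + G j x) x"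
      by (rule T_mono) (use g0 in \<open>simp add: G_def ennreal_plus[symmetric] ennreal_leI del: ennreal_plus\<close>)
    also have "\<dots> = T (\<lambda>x. ennreal (g j x)) x + T (G j) x" by (rule T_add) (use elim in auto)
    finally have "ennreal (v x) \<le> ennreal (w j x + E j x)" using elim w0 E0 by simp
    then have 2: "v x \<le> w j x + E j x" using w0[of j x] E0[of j x] by (subst (asm) ennreal_le_iff) auto
    show ?case using 1 2 by linarith
  qed
  have ER: "AE x in V. (\<lambda>j. E (R j) x) \<longlonglongrightarrow> 0"
    using r2(2) by eventually_elim (use LIMSEQ_subseq_LIMSEQ[OF _ r3(1)] in \<open>fastforce simp: R_def o_def\<close>)
  have wlim: "AE x in V. (\<lambda>j. w (R j) x) \<longlonglongrightarrow> v x"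
  proof -
    have "AE x in V. \<forall>j. \<bar>w j x - v x\<bar> \<le> E j x" using wv by (simp add: AE_all_countable)
    with ER show ?thesis
    proof eventually_elim
      case (elim x)
      have "(\<lambda>j. w (R j) x - v x) \<longlonglongrightarrow> 0"
        by (rule Lim_null_comparison[OF _ elim(1)]) (use elim(2) in auto)
      then show ?case by (simp add: LIM_zero_iff)
    qed
  qed
  have nw: "nrm q V (\<lambda>x. ennreal \<bar>w j x\<bar>) = nrm q V (T (\<lambda>x. ennreal (g j x)))" for j
    by (rule antisym; rule nrm_mono_AE) (use q_gt1 wT[of j] w0 in \<open>auto elim: AE_mp\<close>)
  have nv: "nrm q V (\<lambda>x. ennreal \<bar>v x\<bar>) = nrm q V (T (\<lambda>x. ennreal (f x)))"
    by (rule antisym; rule nrm_mono_AE) (use q_gt1 vT v0 in \<open>auto elim: AE_mp\<close>)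
  have iw: "integrable V (\<lambda>x. \<bar>w j x\<bar> powr q)" for j
    by (rule integrable_powr_nrm) (use nw[of j] Tfin(1)[OF _ gfin[of j]] in auto)
  define W where "W j = (\<integral>x. \<bar>w j x\<bar> powr q \<partial>V)" for j
  have W0: "0 \<le> W j" for j by (simp add: W_def)
  have nW: "nrm q V (T (\<lambda>x. ennreal (g j x))) = ennreal (W j powr (1 / q))" for j
    using nrm_real[OF _ iw[of j]] q_gt1 nw[of j] by (simp add: W_def)
  have Wup: "W j \<le> (N * P) powr q" for j
  proof -
    have "ennreal (W j powr (1 / q)) \<le> ennreal N * ennreal P"
      unfolding nW[symmetric] using N(2)[of "\<lambda>x. ennreal (g j x)"] mult_left_mono[OF Npow[of j], of "ennreal N"]
      by (auto intro: order_trans)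
    then have "W j powr (1 / q) \<le> N * P" using N0 P0 by (simp add: ennreal_mult'[symmetric])
    then have "(W j powr (1 / q)) powr q \<le> (N * P) powr q" using q_gt1 by (intro powr_mono2) auto
    then show ?thesis using q_gt1 W0 by (simp add: powr_powr)
  qed
  have Wlow: "(t (r j) * A j powr (1 / p)) powr q \<le> W j" for j
  proof -
    have "ennreal (t (r j) * A j powr (1 / p)) \<le> ennreal (W j powr (1 / q))"
      unfolding nW[symmetric] T_g using Fq[of "r j"] nA[of j] nrm_g[of j] t(2)[of "r j"] by (simp add: ennreal_mult)
    then have "t (r j) * A j powr (1 / p) \<le> W j powr (1 / q)" by simp
    then have "(t (r j) * A j powr (1 / p)) powr q \<le> (W j powr (1 / q)) powr q"
      using q_gt1 t(2)[of "r j"] by (intro powr_mono2) auto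
    then show ?thesis using q_gt1 W0 by (simp add: powr_powr)
  qed
  note BLq = Brezis_Lieb[of "\<lambda>j. w (R j)" V v q "(N * P) powr q", OF _ _ q_gt1 wlim iw Wup[unfolded W_def]]
  have iv: "integrable V (\<lambda>x. \<bar>v x\<bar> powr q)" by (rule BLq) auto
  have iwv: "integrable V (\<lambda>x. \<bar>w (R j) x - v x\<bar> powr q)" for j by (rule BLq) auto
  define \<tau> where "\<tau> = (\<integral>x. \<bar>v x\<bar> powr q \<partial>V)"
  have \<tau>0: "0 \<le> \<tau>" by (simp add: \<tau>_def)
  have n\<tau>: "nrm q V (T (\<lambda>x. ennreal (f x))) = ennreal (\<tau> powr (1 / q))"
    using nrm_real[OF _ iv] q_gt1 nv by (simp add: \<tau>_def)
  define d where "d j = (\<integral>x. \<bar>w (R j) x - v x\<bar> powr q \<partial>V)" for j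
  have d0: "0 \<le> d j" for j by (simp add: d_def)
  have Wd: "(\<lambda>j. W (R j) - d j) \<longlonglongrightarrow> \<tau>" unfolding W_def d_def \<tau>_def by (rule BLq) auto
  \<comment> \<open>The midpoint of C and N: \<open>localized_bound\<close> costs \<eta> = (N - C) /
    2, and a gap to N remains.\<close>
  define C' where "C' = (C + N) / 2"
  have C': "0 \<le> C'" "C' < N" "C' = C + (N - C) / 2" "0 < (N - C) / 2"
    using CN C_nonneg by (auto simp: C'_def field_simps)
  obtain K where K: "0 \<le> K" "\<And>G. G \<in> borel_measurable V \<Longrightarrow>
    nrm q V (T G) \<le> ennreal C' * nrm p V G + ennreal K * (\<integral>\<^sup>+x. G x \<partial>V)"
    using localized_bound[OF C'(4)] unfolding C'(3) by blast
  define \<gamma> where "\<gamma> j = enn2real (\<integral>\<^sup>+x. G j x \<partial>V)" for j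
  have Gint: "(\<integral>\<^sup>+x. G j x \<partial>V) < top" for j
  proof -
    have "(\<integral>\<^sup>+x. G j x \<partial>V) \<le> nrm p V (G j) * epow (emeasure V (space V)) (1 - 1 / p)"
      by (rule L1_le_nrm) (use p_gt1 in auto)
    also have "\<dots> < top" using Gfin by (simp add: ennreal_mult_less_top)
    finally show ?thesis .
  qed
  have \<gamma>lim: "\<gamma> \<longlonglongrightarrow> 0" unfolding \<gamma>_def[abs_def] by (rule tendsto_enn2real) (use G1 in auto)
  have \<gamma>0: "0 \<le> \<gamma> j" for j by (simp add: \<gamma>_def)
  have dup: "d j \<le> (C' * b (R j) powr (1 / p) + K * \<gamma> (R j)) powr q" for j
  proof -
    have "ennreal (d j powr (1 / q)) = nrm q V (\<lambda>x. ennreal \<bar>w (R j) x - v x\<bar>)"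
      using nrm_real[OF _ iwv[of j]] q_gt1 by (simp add: d_def)
    also have "\<dots> \<le> nrm q V (T (G (R j)))"
    proof (rule nrm_mono_AE)
      show "AE x in V. ennreal \<bar>w (R j) x - v x\<bar> \<le> T (G (R j)) x"
        using wv[of "R j"] ET[of "R j"] by eventually_elim (metis ennreal_leI)
    qed (use q_gt1 in auto)
    also have "\<dots> \<le> ennreal C' * nrm p V (G (R j)) + ennreal K * (\<integral>\<^sup>+x. G (R j) x \<partial>V)" by (rule K) measurable
    also have "\<dots> = ennreal (C' * b (R j) powr (1 / p) + K * \<gamma> (R j))"
      using C' K Gint[of "R j"] \<gamma>0 by (simp add: nG \<gamma>_def ennreal_mult ennreal_plus)
    finally have "d j powr (1 / q) \<le> C' * b (R j) powr (1 / p) + K * \<gamma> (R j)"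
      using C' K \<gamma>0 by (subst (asm) ennreal_le_iff) auto
    then have "(d j powr (1 / q)) powr q \<le> (C' * b (R j) powr (1 / p) + K * \<gamma> (R j)) powr q"
      using q_gt1 by (intro powr_mono2) auto
    then show ?thesis using q_gt1 d0 by (simp add: powr_powr)
  qed
  \<comment> \<open>\<open>Wlow\<close> bounds the q-mass W of T g from below, \<open>dup\<close>
    bounds the share d of the remainder from above, and W - d tends to the share \<tau> of the
    limit. The L^1 term \<gamma> disappears in the limit.\<close>
  have key: "(N * (a + bl) powr (1 / p)) powr q \<le> (C' * bl powr (1 / p)) powr q + \<tau>"
  proof (rule LIMSEQ_le)
    have "(\<lambda>j. t (r (R j))) \<longlonglongrightarrow> N" using LIMSEQ_subseq_LIMSEQ[OF tlim strict_mono_o[OF r R]] by (simp add: o_def)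
    then show "(\<lambda>j. (t (r (R j)) * A (R j) powr (1 / p)) powr q) \<longlonglongrightarrow> (N * (a + bl) powr (1 / p)) powr q"
      using p_gt1 q_gt1 A0 less_imp_le[OF t(2)] by (intro tendsto_powr' tendsto_mult AR tendsto_const) (auto intro!: always_eventually)
    have "(\<lambda>j. (C' * b (R j) powr (1 / p) + K * \<gamma> (R j)) powr q) \<longlonglongrightarrow> (C' * bl powr (1 / p) + K * 0) powr q"
      using p_gt1 q_gt1 b0 C' K \<gamma>0
      by (intro tendsto_powr' tendsto_add tendsto_mult bR sub[OF \<gamma>lim] tendsto_const) (auto intro!: always_eventually)
    then show "(\<lambda>j. (C' * b (R j) powr (1 / p) + K * \<gamma> (R j)) powr q + (W (R j) - d j)) \<longlonglongrightarrow> (C' * bl powr (1 / p)) powr q + \<tau>"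
      using Wd by (intro tendsto_add) auto
    show "\<exists>J. \<forall>j\<ge>J. (t (r (R j)) * A (R j) powr (1 / p)) powr q
       \<le> (C' * b (R j) powr (1 / p) + K * \<gamma> (R j)) powr q + (W (R j) - d j)"
      using Wlow dup by (intro exI[of _ 0] allI impI) (smt (verit))
  qed
  have \<tau>up: "\<tau> \<le> (N * a powr (1 / p)) powr q"
  proof -
    have "ennreal (\<tau> powr (1 / q)) \<le> ennreal (N * a powr (1 / p))"
      unfolding n\<tau>[symmetric] using N(2)[of "\<lambda>x. ennreal (f x)"] nf N0 by (simp add: ennreal_mult)
    then have "\<tau> powr (1 / q) \<le> N * a powr (1 / p)" using N0 by simp
    then have "(\<tau> powr (1 / q)) powr q \<le> (N * a powr (1 / p)) powr q" using q_gt1 by (intro powr_mono2) auto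
    then show ?thesis using q_gt1 \<tau>0 by (simp add: powr_powr)
  qed
  define e where "e = q / p"
  have e1: "1 \<le> e" using p_gt1 p_less_q by (simp add: e_def)
  have pw: "(z * y powr (1 / p)) powr q = z powr q * y powr e" if "0 \<le> z" "0 \<le> y" for z y
    using that p_gt1 by (simp add: powr_mult powr_powr e_def)
  have key': "N powr q * (a + bl) powr e \<le> C' powr q * bl powr e + \<tau>" "\<tau> \<le> N powr q * a powr e"
    using key \<tau>up pw N0 C'(1) a0 bl0 by auto
  \<comment> \<open>By superadditivity with e = q / p >= 1, N^q (a^e + bl^e) <= C'^q bl^e + N^q a^e.
    The terms in a cancel, and C' < N leaves only bl = 0.\<close>
  have blz: "bl = 0"
  proof (rule ccontr)
    assume "bl \<noteq> 0"
    then have b: "0 < bl powr e" by simp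
    have "N powr q * (a powr e + bl powr e) \<le> N powr q * (a + bl) powr e"
      using powr_superadditive[OF a0 bl0 e1] by (intro mult_left_mono) auto
    then have "N powr q * bl powr e \<le> C' powr q * bl powr e" using key' by (simp add: distrib_left)
    then have "N powr q \<le> C' powr q" using b by simp
    moreover have "C' powr q < N powr q" using C' q_gt1 by (intro powr_less_mono2) auto
    ultimately show False by simp
  qed
  \<comment> \<open>As no mass is lost, the lower bound \<open>c\<close> for the norms passes to the
    limit; so f is nonzero.\<close>
  have "c \<le> a powr (1 / p)"
  proof (rule LIMSEQ_le_const)
    show "(\<lambda>j. A (R j) powr (1 / p)) \<longlonglongrightarrow> a powr (1 / p)"
      using AR p_gt1 A0 blz by (intro tendsto_powr' tendsto_const) auto
  qed (use AP in auto)
  then have npos: "0 < a powr (1 / p)" by (rule less_le_trans[OF c0])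
  have "N powr q * a powr e \<le> \<tau>" using key' blz e1 by simp
  then have "(N * a powr (1 / p)) powr q \<le> \<tau>" using pw N0 a0 by simp
  then have "((N * a powr (1 / p)) powr q) powr (1 / q) \<le> \<tau> powr (1 / q)"
    using q_gt1 by (intro powr_mono2) auto
  then have "N * a powr (1 / p) \<le> \<tau> powr (1 / q)" using q_gt1 N0 by (simp add: powr_powr)
  then have "ennreal N * nrm p V (\<lambda>x. ennreal (f x)) \<le> nrm q V (T (\<lambda>x. ennreal (f x)))"
    unfolding n\<tau> nf using N0 by (simp add: ennreal_mult[symmetric] ennreal_leI)
  moreover have "nrm q V (T (\<lambda>x. ennreal (f x))) \<le> ennreal N * nrm p V (\<lambda>x. ennreal (f x))"
    by (rule N) measurable
  ultimately have "nrm q V (T (\<lambda>x. ennreal (f x))) = ennreal N * nrm p V (\<lambda>x. ennreal (f x))" by (rule antisym[rotated])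
  then show ?thesis using npos nf f0' by (intro exI[of _ f]) auto
qed

end

section \<open>Change of variables over an arbitrary finite index type\<close>

text \<open>The change of variables theorem of the library needs a well-ordered index type. Any finite
  type has a well-ordered copy, along which the theorem is transferred.\<close>

typedef 'a ord_copy = "UNIV :: 'a set" morphisms of_copy to_copy
  by simp

lemma of_copy_bij: "bij of_copy" and to_copy_bij: "bij to_copy"
  by (rule bij_betw_byWitness[where f' = to_copy] bij_betw_byWitness[where f' = of_copy];
      auto simp: to_copy_inverse of_copy_inverse)+

lemmas copy_simps [simp] = to_copy_inverse[OF UNIV_I] of_copy_inverse

instance ord_copy :: (finite) finite
proof
  have "(UNIV :: 'a ord_copy set) = range to_copy" by (metis bij_is_surj to_copy_bij)
  then show "finite (UNIV :: 'a ord_copy set)" by (metis finite finite_imageI)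
qed

instantiation ord_copy :: (finite) wellorder
begin

text \<open>Pulled back from the numbering \<open>to_nat_on UNIV\<close>, so that well-foundedness
  becomes induction on natural numbers.\<close>

definition less_eq_ord_copy :: "'a ord_copy \<Rightarrow> 'a ord_copy \<Rightarrow> bool" where
  "less_eq_ord_copy a b \<longleftrightarrow> to_nat_on UNIV (of_copy a) \<le> to_nat_on UNIV (of_copy b)"

definition less_ord_copy :: "'a ord_copy \<Rightarrow> 'a ord_copy \<Rightarrow> bool" where
  "less_ord_copy a b \<longleftrightarrow> to_nat_on UNIV (of_copy a) < to_nat_on UNIV (of_copy b)"

instance
proof
  have inj: "inj (to_nat_on (UNIV :: 'a set))" by (intro inj_on_to_nat_on countable_finite) simp
  fix x y z :: "'a ord_copy"
  show "x \<le> y \<Longrightarrow> y \<le> x \<Longrightarrow> x = y"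
    using inj by (auto simp: less_eq_ord_copy_def of_copy_inject dest: injD)
  fix P :: "'a ord_copy \<Rightarrow> bool" and a :: "'a ord_copy"
  assume step: "\<And>x. (\<And>y. y < x \<Longrightarrow> P y) \<Longrightarrow> P x"
  show "P a"
    by (induction a rule: measure_induct_rule[where f = "\<lambda>a. to_nat_on UNIV (of_copy a)"])
       (rule step, simp add: less_ord_copy_def)
qed (auto simp: less_eq_ord_copy_def less_ord_copy_def)

end

section \<open>Transport of Lebesgue measure and determinants along the relabelling of
  coordinates\<close>

definition relabel :: "real^'n::finite \<Rightarrow> real^'n ord_copy" where
  "relabel v = (\<chi> i. v $ of_copy i)"

definition unlabel :: "real^'n::finite ord_copy \<Rightarrow> real^'n" where
  "unlabel v = (\<chi> i. v $ to_copy i)"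

lemma unlabel_relabel [simp]: "unlabel (relabel v) = v" "relabel (unlabel w) = w"
  by (simp_all add: relabel_def unlabel_def vec_eq_iff)

lemma linear_relabel: "linear relabel" "linear unlabel"
  by (auto intro!: linearI simp: relabel_def unlabel_def vec_eq_iff)

lemma relabel_measurable [measurable]: "relabel \<in> borel_measurable borel" "unlabel \<in> borel_measurable borel"
  by (intro borel_measurable_continuous_onI linear_continuous_on linear_relabel[THEN linear_conv_bounded_linear[THEN iffD1]])+

lemma relabel_derivative:
  "(relabel has_derivative relabel) F" "(unlabel has_derivative unlabel) F"
  by (intro bounded_linear_imp_has_derivative linear_relabel[THEN linear_conv_bounded_linear[THEN iffD1]])+

text \<open>The two measures agree on boxes, since relabelling permutes the side lengths and leaves
  their product unchanged.\<close>

lemma distr_relabel: "distr lborel borel relabel = (lborel :: (real^'n::finite ord_copy) measure)"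
proof (rule lborel_eqI[symmetric])
  fix l u :: "real^'n ord_copy"
  assume "\<And>b. b \<in> Basis \<Longrightarrow> l \<bullet> b \<le> u \<bullet> b"
  moreover have "axis i (1::real) \<in> Basis" for i :: "'n ord_copy" by (auto simp: Basis_vec_def)
  ultimately have le: "l $ i \<le> u $ i" for i using cart_eq_inner_axis by metis
  have "relabel -` box l u = box (unlabel l) (unlabel u)"
    by (auto simp: mem_box_cart relabel_def unlabel_def) (metis copy_simps)+
  then have "emeasure (distr lborel borel relabel) (box l u) = emeasure lborel (box (unlabel l) (unlabel u))"
    by (subst emeasure_distr) auto
  also have "\<dots> = ennreal (\<Prod>b\<in>Basis. (unlabel u - unlabel l) \<bullet> b)"
    using le by (subst emeasure_lborel_box) (auto simp: Basis_vec_def inner_axis unlabel_def)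
  also have "(\<Prod>b\<in>Basis. (unlabel u - unlabel l) \<bullet> b) = (\<Prod>i\<in>UNIV. u $ i - l $ i)"
  proof -
    have "(\<Prod>b\<in>Basis. (unlabel u - unlabel l) \<bullet> b) = (\<Prod>i\<in>UNIV. (unlabel u - unlabel l) $ i)"
      by (rule prod.reindex_bij_witness[where i = "\<lambda>i. axis i 1" and j = "axis_index"])
         (auto simp: Basis_vec_def inner_axis axis_index_axis)
    also have "\<dots> = (\<Prod>i\<in>UNIV. u $ i - l $ i)"
      by (rule prod.reindex_bij_witness[where i = of_copy and j = to_copy]) (auto simp: unlabel_def)
    finally show ?thesis .
  qed
  also have "(\<Prod>i\<in>UNIV. u $ i - l $ i) = (\<Prod>b\<in>Basis. (u - l) \<bullet> b)"
    by (rule prod.reindex_bij_witness[where j = "\<lambda>i. axis i 1" and i = "axis_index"])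
       (auto simp: Basis_vec_def inner_axis axis_index_axis)
  finally show "emeasure (distr lborel borel relabel) (box l u) = ennreal (\<Prod>b\<in>Basis. (u - l) \<bullet> b)" .
qed simp

lemma nn_integral_relabel:
  assumes [measurable]: "g \<in> borel_measurable borel"
  shows "(\<integral>\<^sup>+y. g y \<partial>lborel) = (\<integral>\<^sup>+x. g (relabel x) \<partial>lborel)"
  by (subst distr_relabel[symmetric], subst nn_integral_distr) auto

text \<open>Conjugation by the relabelling turns transpositions into transpositions. Hence it
  preserves the signs in the Leibniz formula, as needed for \<open>det_relabel\<close>.\<close>

lemma swapidseq_relabel:
  "swapidseq n p \<Longrightarrow> swapidseq n (to_copy \<circ> p \<circ> of_copy)"
proof (induction rule: swapidseq.induct)
  case id
  show ?case by (simp add: comp_def id_def)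
next
  case (comp_Suc n p a b)
  have "to_copy \<circ> (Transposition.transpose a b \<circ> p) \<circ> of_copy = Transposition.transpose (to_copy a) (to_copy b) \<circ> (to_copy \<circ> p \<circ> of_copy)"
    by (auto simp: fun_eq_iff Transposition.transpose_def to_copy_inject)
  moreover have "to_copy a \<noteq> to_copy b" using comp_Suc by (simp add: to_copy_inject)
  ultimately show ?case using swapidseq.comp_Suc[OF comp_Suc.IH, of "to_copy a" "to_copy b"] by metis
qed

lemma det_relabel: "det (\<chi> i j. A $ of_copy i $ of_copy j) = det (A :: real^'n^'n::finite)"
  unfolding det_def
proof (rule sum.reindex_bij_witness[symmetric, where j = "\<lambda>p. to_copy \<circ> p \<circ> of_copy" and i = "\<lambda>p. of_copy \<circ> p \<circ> to_copy"])
  fix p :: "'n \<Rightarrow> 'n" assume "p \<in> {p. p permutes UNIV}"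
  then have p: "p permutes UNIV" by simp
  then have "bij p" by (simp add: permutes_bij)
  then have "bij (to_copy \<circ> p \<circ> of_copy)" using of_copy_bij to_copy_bij by (intro bij_comp) auto
  then show "to_copy \<circ> p \<circ> of_copy \<in> {p. p permutes UNIV}" by (simp add: permutes_univ bij_iff)
  obtain n where n: "swapidseq n p" using p permutation_permutes[of p] unfolding permutation_def by auto
  have "sign (to_copy \<circ> p \<circ> of_copy) = sign p"
    using evenperm_unique[OF n refl] evenperm_unique[OF swapidseq_relabel[OF n] refl] by (simp add: sign_def)
  moreover have "(\<Prod>i\<in>UNIV. (\<chi> i j. A $ of_copy i $ of_copy j) $ i $ (to_copy \<circ> p \<circ> of_copy) i) = (\<Prod>i\<in>UNIV. A $ i $ p i)"
    by (rule prod.reindex_bij_witness[where i = to_copy and j = of_copy]) auto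
  ultimately show "of_int (sign (to_copy \<circ> p \<circ> of_copy)) * (\<Prod>i\<in>UNIV. (\<chi> i j. A $ of_copy i $ of_copy j) $ i $ (to_copy \<circ> p \<circ> of_copy) i)
      = of_int (sign p) * (\<Prod>i\<in>UNIV. A $ i $ p i)" by simp
next
  fix p :: "'n ord_copy \<Rightarrow> 'n ord_copy" assume "p \<in> {p. p permutes UNIV}"
  then have "bij p" by (simp add: permutes_bij)
  then have "bij (of_copy \<circ> p \<circ> to_copy)" using of_copy_bij to_copy_bij by (intro bij_comp) auto
  then show "of_copy \<circ> p \<circ> to_copy \<in> {p. p permutes UNIV}" by (simp add: permutes_univ bij_iff)
qed (auto simp: fun_eq_iff)

lemma det_matrix_relabel:
  fixes A :: "real^'n::finite \<Rightarrow> real^'n"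
  shows "det (matrix (\<lambda>x. relabel (A (unlabel x)))) = det (matrix A)"
proof -
  have ax: "unlabel (axis j (1::real)) = axis (of_copy j) 1" for j :: "'n ord_copy"
    by (auto simp: unlabel_def axis_def vec_eq_iff)
  have "matrix (\<lambda>x. relabel (A (unlabel x))) = (\<chi> i j. matrix A $ of_copy i $ of_copy j)"
    by (simp add: matrix_def ax relabel_def)
  then show ?thesis by (simp add: det_relabel)
qed

text \<open>\<open>has_measure_differentiable_image\<close> equates finite measure of the image with
  existence of a gauge integral. Read in both directions it also settles the infinite case: an image
  of finite measure would force a finite integral.\<close>

lemma emeasure_image_ord:
  fixes f :: "real^'n::{finite,wellorder} \<Rightarrow> real^'n::_"
  assumes S: "S \<in> sets borel" and der: "\<And>x. x \<in> S \<Longrightarrow> (f has_derivative f' x) (at x within S)"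
    and inj: "inj_on f S" and fS: "f ` S \<in> sets borel"
    and meas: "(\<lambda>x. indicator S x * \<bar>det (matrix (f' x))\<bar>) \<in> borel_measurable borel"
  shows "emeasure lborel (f ` S) = (\<integral>\<^sup>+x. ennreal (indicator S x * \<bar>det (matrix (f' x))\<bar>) \<partial>lborel)"
proof -
  have Sl: "S \<in> sets lebesgue" using S by simp
  note * = has_measure_differentiable_image[OF Sl der inj]
  show ?thesis
  proof (cases "(\<integral>\<^sup>+x. ennreal (indicator S x * \<bar>det (matrix (f' x))\<bar>) \<partial>lborel)")
    case (real r)
    then have "((\<lambda>x. indicator S x * \<bar>det (matrix (f' x))\<bar>) has_integral r) UNIV"
      using meas by (intro nn_integral_has_integral) auto
    then have "((\<lambda>x. \<bar>det (matrix (f' x))\<bar>) has_integral r) S"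
    proof -
      have "(\<lambda>x. indicator S x * \<bar>det (matrix (f' x))\<bar>) = (\<lambda>x. if x \<in> S then \<bar>det (matrix (f' x))\<bar> else 0)"
        by (auto simp: indicator_def)
      with \<open>((\<lambda>x. indicator S x * \<bar>det (matrix (f' x))\<bar>) has_integral r) UNIV\<close> show ?thesis
        by (simp only: has_integral_restrict_UNIV)
    qed
    then have "f ` S \<in> lmeasurable" "measure lebesgue (f ` S) = r" using * by auto
    then have "emeasure lebesgue (f ` S) = ennreal r"
      using emeasure_eq_ennreal_measure[OF fmeasurableD2] by metis
    moreover have "emeasure lebesgue (f ` S) = emeasure lborel (f ` S)" using fS by simp
    ultimately show ?thesis using real by simp
  next
    case top
    have "emeasure lborel (f ` S) = top"
    proof (rule ccontr)
      assume "emeasure lborel (f ` S) \<noteq> top"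
      then have "f ` S \<in> lmeasurable" using fS by (intro fmeasurableI) (auto simp: less_top)
      then have "((\<lambda>x. \<bar>det (matrix (f' x))\<bar>) has_integral measure lebesgue (f ` S)) S" using * by auto
      then have "(\<integral>\<^sup>+x. ennreal (indicator S x * \<bar>det (matrix (f' x))\<bar>) \<partial>lborel) = ennreal (measure lebesgue (f ` S))"
        by (intro nn_integral_has_integral_lebesgue) auto
      then show False using top by simp
    qed
    then show ?thesis using top by simp
  qed
qed

lemma emeasure_image:
  fixes f :: "real^'n::finite \<Rightarrow> real^'n"
  assumes S[measurable]: "S \<in> sets borel" and der: "\<And>x. x \<in> S \<Longrightarrow> (f has_derivative f' x) (at x within S)"
    and inj: "inj_on f S" and fS[measurable]: "f ` S \<in> sets borel"
    and meas[measurable]: "(\<lambda>x. indicator S x * \<bar>det (matrix (f' x))\<bar>) \<in> borel_measurable borel"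
  shows "emeasure lborel (f ` S) = (\<integral>\<^sup>+x. ennreal (indicator S x * \<bar>det (matrix (f' x))\<bar>) \<partial>lborel)"
proof -
  define F where "F = (\<lambda>x. relabel (f (unlabel x)))"
  define F' where "F' = (\<lambda>x y. relabel (f' (unlabel x) (unlabel y)))"
  have im: "relabel ` A = unlabel -` A" for A :: "(real^'n) set"
    by (auto simp: image_iff) (metis unlabel_relabel(2))
  have bim: "relabel ` A \<in> sets borel" if "A \<in> sets borel" for A :: "(real^'n) set"
    unfolding im using measurable_sets_borel[OF relabel_measurable(2) that] by simp
  have FS: "F ` (relabel ` S) = relabel ` (f ` S)" by (simp add: F_def image_image)
  have me: "emeasure lborel (relabel ` A) = emeasure lborel A" if "A \<in> sets borel" for A :: "(real^'n) set"
  proof -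
    have "emeasure lborel (relabel ` A) = emeasure (distr lborel borel relabel) (relabel ` A)" by (simp add: distr_relabel)
    also have "\<dots> = emeasure lborel (relabel -` relabel ` A)" using bim[OF that] by (subst emeasure_distr) auto
    also have "relabel -` relabel ` A = A" by (auto, metis unlabel_relabel(1))
    finally show ?thesis .
  qed
  have ind: "indicator (relabel ` S) y = (indicator S (unlabel y) :: real)" for y
    unfolding im by (simp add: indicator_def)
  have detF: "det (matrix (F' y)) = det (matrix (f' (unlabel y)))" for y
    unfolding F'_def using det_matrix_relabel[of "f' (unlabel y)"] by simp
  have "emeasure lborel (f ` S) = emeasure lborel (F ` (relabel ` S))" by (simp only: FS me[OF fS])
  also have "\<dots> = (\<integral>\<^sup>+y. ennreal (indicator (relabel ` S) y * \<bar>det (matrix (F' y))\<bar>) \<partial>lborel)"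
  proof (rule emeasure_image_ord)
    fix y assume "y \<in> relabel ` S"
    then have y: "unlabel y \<in> S" by auto
    have "(f has_derivative f' (unlabel y)) (at (unlabel y) within unlabel ` (relabel ` S))"
      using der[OF y] by (simp add: image_image)
    then have "((\<lambda>x. f (unlabel x)) has_derivative (\<lambda>z. f' (unlabel y) (unlabel z))) (at y within relabel ` S)"
      by (rule has_derivative_in_compose[OF relabel_derivative(2)])
    then show "(F has_derivative F' y) (at y within relabel ` S)"
      unfolding F_def F'_def
      by (rule bounded_linear.has_derivative[OF linear_relabel(1)[THEN linear_conv_bounded_linear[THEN iffD1]]])
  next
    show "inj_on F (relabel ` S)"
      using inj by (auto simp: inj_on_def F_def) (metis unlabel_relabel(1))
    have "(\<lambda>y. indicator S (unlabel y) * \<bar>det (matrix (f' (unlabel y)))\<bar>) \<in> borel_measurable borel"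
      by (rule measurable_compose[OF relabel_measurable(2) meas])
    then show "(\<lambda>y. indicator (relabel ` S) y * \<bar>det (matrix (F' y))\<bar>) \<in> borel_measurable borel"
      by (simp add: ind detF)
    show "F ` relabel ` S \<in> sets borel" unfolding FS by (rule bim[OF fS])
  qed (rule bim[OF S])
  also have "\<dots> = (\<integral>\<^sup>+y. ennreal (indicator S (unlabel y) * \<bar>det (matrix (f' (unlabel y)))\<bar>) \<partial>lborel)"
    by (simp add: ind detF)
  also have "\<dots> = (\<integral>\<^sup>+x. ennreal (indicator S x * \<bar>det (matrix (f' x))\<bar>) \<partial>lborel)"
    by (subst nn_integral_relabel)
       (auto intro: measurable_compose[OF measurable_compose[OF relabel_measurable(2) meas] measurable_ennreal])
  finally show ?thesis .
qed

text \<open>Lebesgue measure on the image and the push-forward of the Jacobian density agree on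
  Borel sets by \<open>emeasure_image\<close>. The map pushed forward is \<open>h\<close>, the
  extension of f by 0, because f is known to be measurable on S, where it is continuous; the density
  vanishes off S.\<close>

lemma nn_integral_change_of_variables:
  fixes f :: "real^'n::finite \<Rightarrow> real^'n" and g :: "real^'n \<Rightarrow> ennreal"
  assumes S[measurable]: "S \<in> sets borel" and der: "\<And>x. x \<in> S \<Longrightarrow> (f has_derivative f' x) (at x within S)"
    and inj: "inj_on f S" and fS[measurable]: "f ` S \<in> sets borel"
    and meas[measurable]: "(\<lambda>x. indicator S x * \<bar>det (matrix (f' x))\<bar>) \<in> borel_measurable borel"
    and g[measurable]: "g \<in> borel_measurable borel"
  shows "(\<integral>\<^sup>+y. indicator (f ` S) y * g y \<partial>lborel)
       = (\<integral>\<^sup>+x. ennreal (indicator S x * \<bar>det (matrix (f' x))\<bar>) * g (f x) \<partial>lborel)"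
proof -
  define w where "w x = ennreal (indicator S x * \<bar>det (matrix (f' x))\<bar>)" for x
  have [measurable]: "w \<in> borel_measurable borel" unfolding w_def[abs_def] by measurable
  have w0: "w x = 0" if "x \<notin> S" for x using that by (simp add: w_def)
  define h where "h x = (if x \<in> S then f x else 0)" for x
  have "continuous_on S f" using der by (intro differentiable_imp_continuous_on) (auto simp: differentiable_on_def differentiable_def)
  then have [measurable]: "h \<in> borel_measurable borel"
    unfolding h_def[abs_def] using S by (intro borel_measurable_continuous_on_if continuous_on_const) auto
  have pre: "f -` B \<inter> S \<in> sets borel" if [measurable]: "B \<in> sets borel" for B
  proof -
    have "f -` B \<inter> S = h -` B \<inter> S" by (auto simp: h_def)
    also have "\<dots> \<in> sets borel" using measurable_sets_borel[OF \<open>h \<in> borel_measurable borel\<close> that] by auto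
    finally show ?thesis .
  qed
  have "density lborel (indicator (f ` S)) = distr (density lborel w) borel h"
  proof (rule measure_eqI)
    fix B assume "B \<in> sets (density lborel (indicator (f ` S)))"
    then have [measurable]: "B \<in> sets borel" by simp
    have pB: "f -` B \<inter> S \<in> sets borel" by (rule pre) measurable
    have fim: "f ` (f -` B \<inter> S) = f ` S \<inter> B" by auto
    have "emeasure (density lborel (indicator (f ` S))) B = emeasure lborel (f ` S \<inter> B)"
      by (simp add: emeasure_density indicator_inter_arith[symmetric])
    also have "\<dots> = emeasure lborel (f ` (f -` B \<inter> S))" by (simp add: fim)
    also have "\<dots> = (\<integral>\<^sup>+x. ennreal (indicator (f -` B \<inter> S) x * \<bar>det (matrix (f' x))\<bar>) \<partial>lborel)"
    proof (rule emeasure_image[OF pB])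
      show "inj_on f (f -` B \<inter> S)" using inj by (rule inj_on_subset) auto
      show "f ` (f -` B \<inter> S) \<in> sets borel" unfolding fim by measurable
      have "(\<lambda>x. indicator (f -` B \<inter> S) x * (indicator S x * \<bar>det (matrix (f' x))\<bar>)) \<in> borel_measurable borel"
        using pB by measurable
      then show "(\<lambda>x. indicator (f -` B \<inter> S) x * \<bar>det (matrix (f' x))\<bar>) \<in> borel_measurable borel"
        by (rule back_subst[where P = "\<lambda>f. f \<in> borel_measurable borel"]) (auto simp: indicator_def)
    qed (use der in \<open>auto intro: has_derivative_subset\<close>)
    also have "\<dots> = (\<integral>\<^sup>+x. w x * indicator (h -` B) x \<partial>lborel)"
      by (intro nn_integral_cong) (auto simp: w_def h_def indicator_def)
    also have "\<dots> = emeasure (distr (density lborel w) borel h) B"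
      using measurable_sets_borel[OF \<open>h \<in> borel_measurable borel\<close> \<open>B \<in> sets borel\<close>]
      by (simp add: emeasure_distr emeasure_density)
    finally show "emeasure (density lborel (indicator (f ` S))) B = emeasure (distr (density lborel w) borel h) B" .
  qed simp
  then have "(\<integral>\<^sup>+y. g y \<partial>density lborel (indicator (f ` S))) = (\<integral>\<^sup>+y. g y \<partial>distr (density lborel w) borel h)" by simp
  then have "(\<integral>\<^sup>+y. indicator (f ` S) y * g y \<partial>lborel) = (\<integral>\<^sup>+x. w x * g (h x) \<partial>lborel)"
    by (simp add: nn_integral_density nn_integral_distr)
  also have "\<dots> = (\<integral>\<^sup>+x. w x * g (f x) \<partial>lborel)"
    by (intro nn_integral_cong) (auto simp: h_def w_def indicator_def)
  finally show ?thesis by (simp add: w_def)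
qed

section \<open>The Riemannian distance\<close>

locale riem_manifold =
  fixes M :: "'m::t2_space set" and A :: "('m, 'n::finite) chart set" and g :: "('m, 'n) metric_tensor"
  assumes riemannian: "riemannian_manifold M A g"
begin

section \<open>Charts, transition maps and the metric in coordinates\<close>

lemma smooth_M: "smooth_manifold M A" and metric_g: "riemannian_metric A g"
  using riemannian by (auto simp: riemannian_manifold_def)

lemma chartD:
  assumes "c \<in> A"
  shows "openin (top_of_set M) (fst c)" "fst c \<subseteq> M" "open (snd c ` fst c)"
    "continuous_on (fst c) (snd c)" "continuous_on (snd c ` fst c) (chart_inv c)"
    "\<And>x. x \<in> fst c \<Longrightarrow> chart_inv c (snd c x) = x" "\<And>z. z \<in> snd c ` fst c \<Longrightarrow> snd c (chart_inv c z) = z"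
    "\<And>z. z \<in> snd c ` fst c \<Longrightarrow> chart_inv c z \<in> fst c" "inj_on (snd c) (fst c)"
proof -
  have *: "is_chart M c" using smooth_M assms by (auto simp: smooth_manifold_def)
  then show "openin (top_of_set M) (fst c)" "open (snd c ` fst c)" by (auto simp: is_chart_def)
  then show "fst c \<subseteq> M" using openin_imp_subset by blast
  have h: "homeomorphism (fst c) (snd c ` fst c) (snd c) (chart_inv c)" using * by (auto simp: is_chart_def)
  show "continuous_on (fst c) (snd c)" "continuous_on (snd c ` fst c) (chart_inv c)"
    "\<And>x. x \<in> fst c \<Longrightarrow> chart_inv c (snd c x) = x" "\<And>z. z \<in> snd c ` fst c \<Longrightarrow> snd c (chart_inv c z) = z"
    "\<And>z. z \<in> snd c ` fst c \<Longrightarrow> chart_inv c z \<in> fst c" "inj_on (snd c) (fst c)"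
    using h by (force simp: homeomorphism_def inj_on_def)+
qed

lemma chart_ex: "x \<in> M \<Longrightarrow> \<exists>c\<in>A. x \<in> fst c"
  using smooth_M by (auto simp: smooth_manifold_def)

lemma chart_sub_open:
  assumes c: "c \<in> A" and U: "openin (top_of_set M) U" "U \<subseteq> fst c"
  shows "open (snd c ` U)"
proof -
  have "openin (top_of_set (fst c)) U"
    using U chartD(2)[OF c] by (metis openin_subset_trans)
  then have "openin (top_of_set (snd c ` fst c)) (snd c ` U)"
    using homeomorphism_imp_open_map[of "fst c" "snd c ` fst c" "snd c" "chart_inv c"] smooth_M c
    by (auto simp: smooth_manifold_def is_chart_def)
  then show ?thesis using openin_open_trans chartD(3)[OF c] by blast
qed

lemma chart_inter:
  assumes "c \<in> A" "d \<in> A"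
  shows "openin (top_of_set M) (fst c \<inter> fst d)" "open (snd c ` (fst c \<inter> fst d))"
proof -
  show "openin (top_of_set M) (fst c \<inter> fst d)" using chartD(1) assms by (simp add: openin_Int)
  then show "open (snd c ` (fst c \<inter> fst d))" using assms by (intro chart_sub_open) auto
qed

abbreviation jac :: "('m, 'n) chart \<Rightarrow> ('m, 'n) chart \<Rightarrow> real^'n \<Rightarrow> real^'n \<Rightarrow> real^'n" where
  "jac c d z \<equiv> frechet_derivative (transition_map c d) (at z)"

lemma transition:
  assumes "c \<in> A" "d \<in> A"
  shows "\<And>x. x \<in> fst c \<inter> fst d \<Longrightarrow> transition_map c d (snd c x) = snd d x"
    "\<And>z. z \<in> snd c ` (fst c \<inter> fst d) \<Longrightarrow> (transition_map c d has_derivative jac c d z) (at z)"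
    "\<And>z. z \<in> snd c ` (fst c \<inter> fst d) \<Longrightarrow> linear (jac c d z)"
    "\<And>v. continuous_on (snd c ` (fst c \<inter> fst d)) (\<lambda>z. jac c d z v)"
proof -
  show "\<And>x. x \<in> fst c \<inter> fst d \<Longrightarrow> transition_map c d (snd c x) = snd d x"
    using chartD(6)[OF assms(1)] by (simp add: transition_map_def)
  have "smooth_on (snd c ` (fst c \<inter> fst d)) (transition_map c d)"
    using smooth_M assms by (auto simp: smooth_manifold_def)
  then have "Ck_on (Suc 0) (snd c ` (fst c \<inter> fst d)) (transition_map c d)"
    by (simp add: smooth_on_def del: Ck_on.simps)
  then have *: "\<And>z. z \<in> snd c ` (fst c \<inter> fst d) \<Longrightarrow> transition_map c d differentiable (at z)"
    "\<And>v. continuous_on (snd c ` (fst c \<inter> fst d)) (\<lambda>z. jac c d z v)" by auto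
  then show "\<And>z. z \<in> snd c ` (fst c \<inter> fst d) \<Longrightarrow> (transition_map c d has_derivative jac c d z) (at z)"
    "\<And>v. continuous_on (snd c ` (fst c \<inter> fst d)) (\<lambda>z. jac c d z v)"
    using frechet_derivative_works by blast+
  then show "\<And>z. z \<in> snd c ` (fst c \<inter> fst d) \<Longrightarrow> linear (jac c d z)"
    using has_derivative_linear by blast
qed

lemma g_continuous:
  assumes "c \<in> A" shows "continuous_on (snd c ` fst c) (\<lambda>z. g c (chart_inv c z))"
proof -
  have "smooth_on (snd c ` fst c) (\<lambda>z. g c (chart_inv c z))"
    using metric_g assms by (auto simp: riemannian_metric_def)
  then have "Ck_on 0 (snd c ` fst c) (\<lambda>z. g c (chart_inv c z))" by (simp add: smooth_on_def del: Ck_on.simps)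
  then show ?thesis by simp
qed

text \<open>The squared g-length of the tangent vector at x with coordinates v in the chart
  c.\<close>

definition Q :: "('m, 'n) chart \<Rightarrow> 'm \<Rightarrow> real^'n \<Rightarrow> real" where
  "Q c x v = v \<bullet> (g c x *v v)"

lemma Q_sum: "Q c x v = (\<Sum>i\<in>UNIV. \<Sum>j\<in>UNIV. v $ i * (g c x $ i $ j * v $ j))"
  by (simp add: Q_def inner_vec_def matrix_vector_mult_def sum_distrib_left)

lemma Q_pos: "c \<in> A \<Longrightarrow> x \<in> fst c \<Longrightarrow> v \<noteq> 0 \<Longrightarrow> 0 < Q c x v"
  using metric_g by (auto simp: riemannian_metric_def Q_def)

lemma Q_scale: "Q c x (r *\<^sub>R v) = r\<^sup>2 * Q c x v"
  by (simp add: Q_def matrix_vector_mult_scaleR power2_eq_square)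

lemma dot_transpose: "v \<bullet> (transpose B *v w) = (B *v v) \<bullet> w" for B :: "real^'n^'n"
  by (metis dot_lmul_matrix inner_commute vector_transpose_matrix transpose_transpose)

lemma Q_transform:
  assumes "c \<in> A" "d \<in> A" "x \<in> fst c \<inter> fst d"
  shows "Q c x v = Q d x (jac c d (snd c x) v)"
proof -
  define J where "J = matrix (jac c d (snd c x))"
  have "g c x = transpose J ** g d x ** J"
    using metric_g assms unfolding riemannian_metric_def J_def Let_def by blast
  then have "Q c x v = (J *v v) \<bullet> (g d x *v (J *v v))"
    by (simp only: Q_def matrix_vector_mul_assoc[symmetric] dot_transpose)
  moreover have "J *v v = jac c d (snd c x) v"
    unfolding J_def using transition(3)[OF assms(1,2)] assms(3) by (intro matrix_vector_mul(1)[symmetric, THEN fun_cong] | simp add: matrix_works linear_matrix_vector_mul_eq)+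
  ultimately show ?thesis by (simp add: Q_def)
qed

subsection \<open>Speed and length\<close>

lemma curve_nhd:
  assumes "path \<gamma>" "path_image \<gamma> \<subseteq> M" "openin (top_of_set M) U" "t \<in> {0..1}" "\<gamma> t \<in> U"
  obtains \<delta> where "0 < \<delta>" "\<And>s. s \<in> {0..1} \<Longrightarrow> \<bar>s - t\<bar> < \<delta> \<Longrightarrow> \<gamma> s \<in> U"
proof -
  obtain W where W: "open W" "U = M \<inter> W" using assms(3) by (auto simp: openin_open)
  have "continuous (at t within {0..1}) \<gamma>"
    using assms(1,4) by (simp add: path_def continuous_on_eq_continuous_within)
  then have "eventually (\<lambda>s. \<gamma> s \<in> W) (at t within {0..1})"
    using W assms(5) by (intro topological_tendstoD[where l = "\<gamma> t"]) (auto simp: continuous_within)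
  then obtain \<delta> where \<delta>: "0 < \<delta>" "\<And>s. s \<in> {0..1} \<Longrightarrow> s \<noteq> t \<Longrightarrow> dist s t < \<delta> \<Longrightarrow> \<gamma> s \<in> W"
    unfolding eventually_at by blast
  show ?thesis
  proof (rule that[OF \<delta>(1)])
    fix s assume s: "s \<in> {0..1}" "\<bar>s - t\<bar> < \<delta>"
    have "\<gamma> s \<in> M" using assms(2) s(1) by (auto simp: path_image_def)
    then show "\<gamma> s \<in> U" using \<delta>(2)[OF s(1)] s(2) assms(5) W by (cases "s = t") (auto simp: dist_real_def)
  qed
qed

text \<open>\<open>speed\<close> computes in a chart selected by \<open>SOME\<close>. Near t the
  curve lies in both charts, the chain rule relates the two coordinate velocities by the Jacobian of
  the transition map, and \<open>Q_transform\<close> identifies their lengths.\<close>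

lemma speed_eq:
  assumes \<gamma>: "path \<gamma>" "path_image \<gamma> \<subseteq> M" and t: "t \<in> {0..1}" and c: "c \<in> A" "\<gamma> t \<in> fst c"
    and der: "((snd c \<circ> \<gamma>) has_vector_derivative w) (at t within {0..1})"
  shows "speed A g \<gamma> t = sqrt (Q c (\<gamma> t) w)"
proof -
  define d where "d = (SOME c. c \<in> A \<and> \<gamma> t \<in> fst c)"
  have d: "d \<in> A" "\<gamma> t \<in> fst d"
    unfolding d_def using someI_ex[of "\<lambda>c. c \<in> A \<and> \<gamma> t \<in> fst c"] c by blast+
  have tin: "\<gamma> t \<in> fst c \<inter> fst d" using c d by simp
  obtain \<delta> where \<delta>: "0 < \<delta>" "\<And>s. s \<in> {0..1} \<Longrightarrow> \<bar>s - t\<bar> < \<delta> \<Longrightarrow> \<gamma> s \<in> fst c \<inter> fst d"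
    using curve_nhd[OF \<gamma> chart_inter(1)[OF c(1) d(1)] t tin] by blast
  have "((transition_map c d \<circ> (snd c \<circ> \<gamma>)) has_vector_derivative jac c d (snd c (\<gamma> t)) w) (at t within {0..1})"
    using vector_derivative_diff_chain_within[OF der, of "transition_map c d" "jac c d (snd c (\<gamma> t))"]
      transition(2)[OF c(1) d(1), of "snd c (\<gamma> t)"] tin by (auto intro: has_derivative_at_withinI)
  then have "((snd d \<circ> \<gamma>) has_vector_derivative jac c d (snd c (\<gamma> t)) w) (at t within {0..1})"
  proof (rule has_vector_derivative_transform_within[OF _ \<delta>(1) t])
    fix s :: real assume "s \<in> {0..1}" "dist s t < \<delta>"
    then have "\<gamma> s \<in> fst c \<inter> fst d" using \<delta>(2) by (simp add: dist_real_def)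
    then show "(transition_map c d \<circ> (snd c \<circ> \<gamma>)) s = (snd d \<circ> \<gamma>) s"
      using transition(1)[OF c(1) d(1)] by simp
  qed
  then have "vector_derivative (snd d \<circ> \<gamma>) (at t within {0..1}) = jac c d (snd c (\<gamma> t)) w"
    using t by (intro vector_derivative_within_closed_interval) auto
  then have "speed A g \<gamma> t = sqrt (Q d (\<gamma> t) (jac c d (snd c (\<gamma> t)) w))"
    by (simp add: speed_def d_def[symmetric] Let_def Q_def)
  then show ?thesis using Q_transform[OF c(1) d(1) tin] by simp
qed

lemma curveD:
  assumes "piecewise_C1_curve M A \<gamma>"
  shows "path \<gamma>" "path_image \<gamma> \<subseteq> M"
    "\<And>c a b. c \<in> A \<Longrightarrow> {a..b} \<subseteq> {0..1} \<Longrightarrow> \<gamma> ` {a..b} \<subseteq> fst c \<Longrightarrow> (snd c \<circ> \<gamma>) piecewise_C1_differentiable_on {a..b}"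
  using assms by (auto simp: piecewise_C1_curve_def)

lemma speed_piece:
  assumes \<gamma>: "piecewise_C1_curve M A \<gamma>" and c: "c \<in> A" "{a..b} \<subseteq> {0..1}" "\<gamma> ` {a..b} \<subseteq> fst c"
  obtains S D where "finite S" "\<And>t. t \<in> {a..b} - S \<Longrightarrow> ((snd c \<circ> \<gamma>) has_vector_derivative D t) (at t)"
    "\<And>t. t \<in> {a..b} - S \<Longrightarrow> speed A g \<gamma> t = sqrt (Q c (\<gamma> t) (D t))"
    "continuous_on ({a..b} - S) (speed A g \<gamma>)"
proof -
  obtain S where S: "finite S" "(snd c \<circ> \<gamma>) C1_differentiable_on ({a..b} - S)"
    using curveD(3)[OF \<gamma> c] by (auto simp: piecewise_C1_differentiable_on_def)
  then obtain D where D: "\<And>t. t \<in> {a..b} - S \<Longrightarrow> ((snd c \<circ> \<gamma>) has_vector_derivative D t) (at t)"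
    "continuous_on ({a..b} - S) D" unfolding C1_differentiable_on_def by metis
  have sp: "speed A g \<gamma> t = sqrt (Q c (\<gamma> t) (D t))" if t: "t \<in> {a..b} - S" for t
  proof (rule speed_eq[OF curveD(1,2)[OF \<gamma>] _ c(1) _ has_vector_derivative_at_within[OF D(1)[OF t]]])
    show "t \<in> {0..1}" using t c(2) by blast
    show "\<gamma> t \<in> fst c" using t c(3) by blast
  qed
  have "continuous_on {a..b} \<gamma>" using curveD(1)[OF \<gamma>] c(2) by (auto simp: path_def intro: continuous_on_subset)
  then have "continuous_on ({a..b} - S) (\<lambda>t. g c (chart_inv c (snd c (\<gamma> t))))"
    using c by (intro continuous_on_compose2[OF g_continuous[OF c(1)]] continuous_on_compose2[OF chartD(4)[OF c(1)]])
      (auto intro: continuous_on_subset)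
  then have gc: "continuous_on ({a..b} - S) (\<lambda>t. g c (\<gamma> t))"
  proof (rule continuous_on_eq)
    fix t assume "t \<in> {a..b} - S"
    then have "\<gamma> t \<in> fst c" using c(3) by blast
    then show "g c (chart_inv c (snd c (\<gamma> t))) = g c (\<gamma> t)" by (simp add: chartD(6)[OF c(1)])
  qed
  have "continuous_on ({a..b} - S) (\<lambda>t. sqrt (Q c (\<gamma> t) (D t)))"
    unfolding Q_sum by (intro continuous_intros gc D)
  then have "continuous_on ({a..b} - S) (speed A g \<gamma>)" by (rule continuous_on_eq) (simp add: sp)
  then show ?thesis using that S(1) D(1) sp by blast
qed

lemma curve_cover:
  assumes \<gamma>: "piecewise_C1_curve M A \<gamma>"
  obtains \<C> where "finite \<C>" "{0..1} = (\<Union>(a, b)\<in>\<C>. {a..b})"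
    "\<And>a b. (a, b) \<in> \<C> \<Longrightarrow> \<exists>c\<in>A. \<gamma> ` {a..b} \<subseteq> fst c"
proof -
  have "\<exists>\<delta>>0. \<exists>c\<in>A. \<forall>s\<in>{0..1}. \<bar>s - t\<bar> < \<delta> \<longrightarrow> \<gamma> s \<in> fst c" if t: "t \<in> {0..1}" for t
  proof -
    have "\<gamma> t \<in> M" using curveD(2)[OF \<gamma>] t by (auto simp: path_image_def)
    then obtain c where c: "c \<in> A" "\<gamma> t \<in> fst c" using chart_ex by blast
    obtain \<delta> where "0 < \<delta>" "\<And>s. s \<in> {0..1} \<Longrightarrow> \<bar>s - t\<bar> < \<delta> \<Longrightarrow> \<gamma> s \<in> fst c"
      using curve_nhd[OF curveD(1,2)[OF \<gamma>] chartD(1)[OF c(1)] t c(2)] by blast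
    then show ?thesis using c by blast
  qed
  then obtain \<delta> where \<delta>: "\<And>t. t \<in> {0..1} \<Longrightarrow> 0 < \<delta> t"
    "\<And>t. t \<in> {0..1} \<Longrightarrow> \<exists>c\<in>A. \<forall>s\<in>{0..1}. \<bar>s - t\<bar> < \<delta> t \<longrightarrow> \<gamma> s \<in> fst c" by metis
  obtain T where T: "T \<subseteq> {0..1}" "finite T" "{0..1} \<subseteq> (\<Union>t\<in>T. ball t (\<delta> t / 2))"
  proof (rule compactE_image[of "{0..1::real}" "{0..1}" "\<lambda>t. ball t (\<delta> t / 2)"])
    show "{0..1} \<subseteq> (\<Union>t\<in>{0..1}. ball t (\<delta> t / 2))" using \<delta>(1) by force
  qed auto
  \<comment> \<open>Closed intervals of half-width \<delta> t / 2 lie inside the open \<delta>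
    t-neighbourhoods, hence each is mapped into one chart, while the open intervals of the same
    half-width already cover.\<close>
  define \<C> where "\<C> = (\<lambda>t. (max 0 (t - \<delta> t / 2), min 1 (t + \<delta> t / 2))) ` T"
  show ?thesis
  proof (rule that[of \<C>])
    show "finite \<C>" using T by (simp add: \<C>_def)
    show "{0..1} = (\<Union>(a, b)\<in>\<C>. {a..b})"
    proof (rule antisym; rule subsetI)
      fix s :: real assume s: "s \<in> {0..1}"
      then obtain t where "t \<in> T" "s \<in> ball t (\<delta> t / 2)" using T by blast
      then have "\<bar>t - s\<bar> < \<delta> t / 2" "t \<in> T" by (simp_all add: dist_real_def)
      then have "t - \<delta> t / 2 \<le> s" "s \<le> t + \<delta> t / 2" by linarith+
      then show "s \<in> (\<Union>(a, b)\<in>\<C>. {a..b})"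
        using s \<open>t \<in> T\<close> by (intro UN_I[of "(max 0 (t - \<delta> t / 2), min 1 (t + \<delta> t / 2))"]) (auto simp: \<C>_def)
    qed (auto simp: \<C>_def)
    fix a b assume "(a, b) \<in> \<C>"
    then obtain t where t: "t \<in> T" "a = max 0 (t - \<delta> t / 2)" "b = min 1 (t + \<delta> t / 2)" by (auto simp: \<C>_def)
    then have t01: "t \<in> {0..1}" using T by auto
    then obtain c where c: "c \<in> A" "\<And>s. s \<in> {0..1} \<Longrightarrow> \<bar>s - t\<bar> < \<delta> t \<Longrightarrow> \<gamma> s \<in> fst c" using \<delta>(2) by blast
    have "\<gamma> ` {a..b} \<subseteq> fst c"
    proof (rule image_subsetI)
      fix s assume "s \<in> {a..b}"
      then show "\<gamma> s \<in> fst c" using \<delta>(1)[OF t01] t by (intro c(2)) (auto simp: abs_less_iff)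
    qed
    then show "\<exists>c\<in>A. \<gamma> ` {a..b} \<subseteq> fst c" using c by blast
  qed
qed

text \<open>On each chart interval the speed is continuous off a finite set; these pieces, the
  exceptional times as singletons and the complement of [0,1] form a countable measurable cover.
  Substitution and additivity of the length integral rest on this.\<close>

lemma speed_measurable:
  assumes \<gamma>: "piecewise_C1_curve M A \<gamma>"
  shows "(\<lambda>t. indicator {0..1} t * ennreal (speed A g \<gamma> t)) \<in> borel_measurable borel"
proof -
  obtain \<C> where \<C>: "finite \<C>" "{0..1} = (\<Union>(a, b)\<in>\<C>. {a..b})"
    "\<And>a b. (a, b) \<in> \<C> \<Longrightarrow> \<exists>c\<in>A. \<gamma> ` {a..b} \<subseteq> fst c" using curve_cover[OF \<gamma>] by blast
  have "\<exists>S. finite S \<and> continuous_on ({fst I..snd I} - S) (speed A g \<gamma>)" if I: "I \<in> \<C>" for I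
  proof -
    obtain a b where ab: "I = (a, b)" by (cases I)
    obtain c where c: "c \<in> A" "\<gamma> ` {a..b} \<subseteq> fst c" using \<C>(3) I ab by blast
    have sub: "{a..b} \<subseteq> {0..1}" unfolding \<C>(2) using I ab by auto
    obtain S D where "finite S" "continuous_on ({a..b} - S) (speed A g \<gamma>)"
      using speed_piece[OF \<gamma> c(1) sub c(2)] by metis
    then show ?thesis using ab by auto
  qed
  then obtain S where S: "\<And>I. I \<in> \<C> \<Longrightarrow> finite (S I)"
    "\<And>I. I \<in> \<C> \<Longrightarrow> continuous_on ({fst I..snd I} - S I) (speed A g \<gamma>)" by metis
  define F where "F = (\<Union>I\<in>\<C>. S I)"
  have F: "finite F" using S \<C> by (simp add: F_def)
  define \<X> where "\<X> = insert (- {0..1}) ((\<lambda>I. {fst I..snd I} - S I) ` \<C> \<union> (\<lambda>t. {t}) ` F)"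
  show ?thesis
  proof (rule measurable_piecewise_restrict[of \<X>])
    show "countable \<X>" using \<C> F by (auto simp: \<X>_def intro: countable_finite)
    show "space borel \<subseteq> \<Union>\<X>"
    proof
      fix t :: real
      show "t \<in> \<Union>\<X>"
      proof (cases "t \<in> {0..1} - F")
        case True
        then obtain I where "I \<in> \<C>" "t \<in> {fst I..snd I}" unfolding \<C>(2) by auto
        then show ?thesis using True by (auto simp: \<X>_def F_def)
      qed (auto simp: \<X>_def)
    qed
    fix \<Omega> assume \<Omega>: "\<Omega> \<in> \<X>"
    then consider "\<Omega> = - {0..1}" | I where "I \<in> \<C>" "\<Omega> = {fst I..snd I} - S I" | t where "\<Omega> = {t}"
      by (auto simp: \<X>_def)
    note cs = this
    show "\<Omega> \<inter> space borel \<in> sets borel"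
      using cs
    proof cases
      case (2 I)
      then have "S I \<in> sets borel" using S(1) by (intro borel_closed finite_imp_closed)
      then show ?thesis using 2 by auto
    qed auto
    show "(\<lambda>t. indicator {0..1} t * ennreal (speed A g \<gamma> t)) \<in> borel_measurable (restrict_space borel \<Omega>)"
      using cs
    proof cases
      case 1
      have "continuous_on \<Omega> (\<lambda>t. 0 :: ennreal)" by simp
      then have "continuous_on \<Omega> (\<lambda>t. indicator {0..1} t * ennreal (speed A g \<gamma> t))"
        by (rule continuous_on_eq) (use 1 in auto)
      then show ?thesis by (rule borel_measurable_continuous_on_restrict)
    next
      case (2 I)
      have "continuous_on \<Omega> (\<lambda>t. ennreal (speed A g \<gamma> t))"
        unfolding 2 by (intro continuous_on_compose2[OF continuous_on_ennreal] S(2)[OF 2(1)] continuous_on_id) auto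
      moreover have "\<Omega> \<subseteq> {0..1}" unfolding \<C>(2) using 2 by auto
      ultimately have "continuous_on \<Omega> (\<lambda>t. indicator {0..1} t * ennreal (speed A g \<gamma> t))"
        by (elim continuous_on_eq) auto
      then show ?thesis by (rule borel_measurable_continuous_on_restrict)
    next
      case (3 t)
      then have "continuous_on \<Omega> (\<lambda>t. indicator {0..1} t * ennreal (speed A g \<gamma> t))" by simp
      then show ?thesis by (rule borel_measurable_continuous_on_restrict)
    qed
  qed
qed

text \<open>Two-sided derivatives off a finite set are what the chain rule takes when a curve is
  reversed or joined to another one.\<close>

lemma curve_regular:
  assumes \<gamma>: "piecewise_C1_curve M A \<gamma>"
  obtains S where "finite S" "\<And>t. t \<in> {0..1} - S \<Longrightarrow> \<exists>c\<in>A. \<exists>w. \<gamma> t \<in> fst c \<and> ((snd c \<circ> \<gamma>) has_vector_derivative w) (at t)"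
proof -
  obtain \<C> where \<C>: "finite \<C>" "{0..1} = (\<Union>(a, b)\<in>\<C>. {a..b})"
    "\<And>a b. (a, b) \<in> \<C> \<Longrightarrow> \<exists>c\<in>A. \<gamma> ` {a..b} \<subseteq> fst c" using curve_cover[OF \<gamma>] by blast
  have "\<exists>S. finite S \<and> (\<forall>t\<in>{fst I..snd I} - S. \<exists>c\<in>A. \<exists>w. \<gamma> t \<in> fst c \<and> ((snd c \<circ> \<gamma>) has_vector_derivative w) (at t))"
    if I: "I \<in> \<C>" for I
  proof -
    obtain a b where ab: "I = (a, b)" by (cases I)
    obtain c where c: "c \<in> A" "\<gamma> ` {a..b} \<subseteq> fst c" using \<C>(3) I ab by blast
    have sub: "{a..b} \<subseteq> {0..1}" unfolding \<C>(2) using I ab by auto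
    obtain S D where "finite S" "\<And>t. t \<in> {a..b} - S \<Longrightarrow> ((snd c \<circ> \<gamma>) has_vector_derivative D t) (at t)"
      using speed_piece[OF \<gamma> c(1) sub c(2)] by metis
    then show ?thesis using ab c by (intro exI[of _ S]) fastforce
  qed
  then obtain S where S: "\<And>I. I \<in> \<C> \<Longrightarrow> finite (S I)"
    "\<And>I t. I \<in> \<C> \<Longrightarrow> t \<in> {fst I..snd I} - S I \<Longrightarrow> \<exists>c\<in>A. \<exists>w. \<gamma> t \<in> fst c \<and> ((snd c \<circ> \<gamma>) has_vector_derivative w) (at t)"
    by metis
  show ?thesis
  proof (rule that[of "\<Union>I\<in>\<C>. S I"])
    fix t assume t: "t \<in> {0..1} - (\<Union>I\<in>\<C>. S I)"
    then obtain I where "I \<in> \<C>" "t \<in> {fst I..snd I}" unfolding \<C>(2) by auto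
    then show "\<exists>c\<in>A. \<exists>w. \<gamma> t \<in> fst c \<and> ((snd c \<circ> \<gamma>) has_vector_derivative w) (at t)"
      using t by (intro S(2)) auto
  qed (use S \<C> in auto)
qed

lemma curve_length_eq:
  "curve_length A g \<gamma> = (\<integral>\<^sup>+t. indicator {0..1} t * ennreal (speed A g \<gamma> t) \<partial>lborel)"
  unfolding curve_length_def by (simp add: mult.commute)

lemma AE_finite: "finite S \<Longrightarrow> AE t in lborel. t \<notin> (S :: real set)"
  by (intro AE_not_in finite_imp_null_set_lborel)

lemma reverse_curve:
  assumes \<gamma>: "piecewise_C1_curve M A \<gamma>"
  shows "piecewise_C1_curve M A (reversepath \<gamma>)" "curve_length A g (reversepath \<gamma>) = curve_length A g \<gamma>"
proof -
  have rev: "reversepath \<gamma> = \<gamma> \<circ> (\<lambda>t. (-1) *\<^sub>R t + 1)" by (auto simp: reversepath_def o_def)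
  show 1: "piecewise_C1_curve M A (reversepath \<gamma>)"
    unfolding piecewise_C1_curve_def
  proof (intro conjI ballI allI impI)
    fix c a b assume c: "c \<in> A" and ab: "{a..b} \<subseteq> {0..1::real} \<and> reversepath \<gamma> ` {a..b} \<subseteq> fst c"
    have im: "(\<lambda>t. (-1) * t + 1) ` {a..b} = {1 - b..1 - a}"
      by (auto simp: image_iff intro!: bexI[of _ "1 - _"])
    have "(snd c \<circ> \<gamma>) piecewise_C1_differentiable_on {1 - b..1 - a}"
    proof (rule curveD(3)[OF \<gamma> c])
      show "{1 - b..1 - a} \<subseteq> {0..1}"
        using ab by (cases "a \<le> b") auto
      show "\<gamma> ` {1 - b..1 - a} \<subseteq> fst c"
      proof (rule image_subsetI)
        fix x assume "x \<in> {1 - b..1 - a}"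
        then have "1 - x \<in> {a..b}" by auto
        then have "reversepath \<gamma> (1 - x) \<in> fst c" using ab by blast
        then show "\<gamma> x \<in> fst c" by (simp add: reversepath_def)
      qed
    qed
    then have "(snd c \<circ> \<gamma> \<circ> (\<lambda>t. (-1) *\<^sub>R t + 1)) piecewise_C1_differentiable_on {a..b}"
      by (intro piecewise_C1_differentiable_affine) (simp only: im)
    then show "(snd c \<circ> reversepath \<gamma>) piecewise_C1_differentiable_on {a..b}" by (simp add: rev comp_assoc)
  qed (use curveD(1,2)[OF \<gamma>] in auto)
  obtain S where S: "finite S" "\<And>t. t \<in> {0..1} - S \<Longrightarrow> \<exists>c\<in>A. \<exists>w. \<gamma> t \<in> fst c \<and> ((snd c \<circ> \<gamma>) has_vector_derivative w) (at t)"
    using curve_regular[OF \<gamma>] by blast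
  have sp: "speed A g (reversepath \<gamma>) t = speed A g \<gamma> (1 - t)" if t: "t \<in> {0..1}" "1 - t \<notin> S" for t
  proof -
    obtain c w where c: "c \<in> A" "\<gamma> (1 - t) \<in> fst c" "((snd c \<circ> \<gamma>) has_vector_derivative w) (at (1 - t))"
      using S(2)[of "1 - t"] t by auto
    have "((\<lambda>t. 1 - t) has_vector_derivative (-1 :: real)) (at t)"
      by (auto intro!: derivative_eq_intros)
    then have "((snd c \<circ> \<gamma> \<circ> (\<lambda>t. 1 - t)) has_vector_derivative (-1) *\<^sub>R w) (at t)"
      using c(3) by (rule vector_diff_chain_at)
    then have rd: "((snd c \<circ> reversepath \<gamma>) has_vector_derivative (-1) *\<^sub>R w) (at t)"
      by (simp add: reversepath_def o_def)
    have "speed A g (reversepath \<gamma>) t = sqrt (Q c (reversepath \<gamma> t) ((-1) *\<^sub>R w))"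
    proof (rule speed_eq[OF curveD(1,2)[OF 1] t(1) c(1) _ has_vector_derivative_at_within[OF rd]])
      show "reversepath \<gamma> t \<in> fst c" using c(2) by (simp add: reversepath_def)
    qed
    also have "\<dots> = sqrt (Q c (\<gamma> (1 - t)) w)" unfolding Q_scale by (simp add: reversepath_def)
    also have "\<dots> = speed A g \<gamma> (1 - t)"
      by (rule speed_eq[symmetric, OF curveD(1,2)[OF \<gamma>] _ c(1,2) has_vector_derivative_at_within[OF c(3)]]) (use t in simp)
    finally show ?thesis .
  qed
  have "curve_length A g \<gamma> = (\<integral>\<^sup>+t. indicator {0..1} (1 + (-1) * t) * ennreal (speed A g \<gamma> (1 + (-1) * t)) \<partial>lborel)"
    unfolding curve_length_eq using nn_integral_real_affine[OF speed_measurable[OF \<gamma>], of "-1" 1] by simp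
  also have "\<dots> = curve_length A g (reversepath \<gamma>)"
    unfolding curve_length_eq
  proof (rule nn_integral_cong_AE)
    have "finite ((\<lambda>t. 1 - t) ` S)" using S by simp
    from AE_finite[OF this]
    show "AE t in lborel. indicator {0..1} (1 + (-1) * t) * ennreal (speed A g \<gamma> (1 + (-1) * t)) =
       indicator {0..1} t * ennreal (speed A g (reversepath \<gamma>) t)"
    proof eventually_elim
      case (elim t)
      have "1 - t \<notin> S"
      proof
        assume "1 - t \<in> S"
        then have "1 - (1 - t) \<in> (\<lambda>t. 1 - t) ` S" by (rule imageI)
        then show False using elim by simp
      qed
      then show ?case using sp[of t] by (auto simp: indicator_def)
    qed
  qed
  finally show "curve_length A g (reversepath \<gamma>) = curve_length A g \<gamma>" by simp
qed

end

text \<open>The derivatives in \<open>C1_differentiable_on\<close> are two-sided even at the ends of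
  an interval, so the functions have to agree on an open set around \<open>I\<close>.\<close>

lemma piecewise_C1_cong_open:
  assumes f: "f piecewise_C1_differentiable_on I" and W: "open W" "I \<subseteq> W" "\<And>t. t \<in> W \<Longrightarrow> f t = h t"
  shows "h piecewise_C1_differentiable_on I"
proof -
  obtain S where S: "finite S" "f C1_differentiable_on (I - S)" "continuous_on I f"
    using f by (auto simp: piecewise_C1_differentiable_on_def)
  obtain D where D: "\<And>t. t \<in> I - S \<Longrightarrow> (f has_vector_derivative D t) (at t)" "continuous_on (I - S) D"
    using S(2) unfolding C1_differentiable_on_def by metis
  have "(h has_vector_derivative D t) (at t)" if "t \<in> I - S" for t
    using has_vector_derivative_transform_within_open[OF D(1)[OF that] W(1)] W that by blast
  then have "h C1_differentiable_on (I - S)" using D(2) unfolding C1_differentiable_on_def by blast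
  moreover have "continuous_on I h" using W by (intro continuous_on_eq[OF S(3)]) auto
  ultimately show ?thesis using S(1) by (auto simp: piecewise_C1_differentiable_on_def)
qed

lemma le_INF_add_INF:
  fixes f :: "'a \<Rightarrow> ennreal" and h :: "'b \<Rightarrow> ennreal"
  assumes "\<And>i j. i \<in> I \<Longrightarrow> j \<in> J \<Longrightarrow> c \<le> f i + h j"
  shows "c \<le> (INF i\<in>I. f i) + (INF j\<in>J. h j)"
proof (cases "(INF i\<in>I. f i) = top \<or> (INF j\<in>J. h j) = top")
  case False
  then obtain a b where ab: "(INF i\<in>I. f i) = ennreal a" "(INF j\<in>J. h j) = ennreal b" "0 \<le> a" "0 \<le> b"
    by (cases "INF i\<in>I. f i"; cases "INF j\<in>J. h j"; simp)
  show ?thesis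
  proof (rule ennreal_le_epsilon)
    fix e :: real assume e: "0 < e"
    have "(INF i\<in>I. f i) < ennreal (a + e / 2)" unfolding ab using ab e by (intro ennreal_lessI) auto
    then obtain i where i: "i \<in> I" "f i < ennreal (a + e / 2)" unfolding INF_less_iff by blast
    have "(INF j\<in>J. h j) < ennreal (b + e / 2)" unfolding ab using ab e by (intro ennreal_lessI) auto
    then obtain j where j: "j \<in> J" "h j < ennreal (b + e / 2)" unfolding INF_less_iff by blast
    have "c \<le> f i + h j" using i j assms by blast
    also have "\<dots> \<le> ennreal (a + e / 2) + ennreal (b + e / 2)" using i j by (intro add_mono) auto
    also have "\<dots> = ennreal a + ennreal b + ennreal e"
      using ab e by (simp add: ennreal_plus[symmetric] algebra_simps del: ennreal_plus)
    finally show "c \<le> (INF i\<in>I. f i) + (INF j\<in>J. h j) + ennreal e" by (simp only: ab)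
  qed
qed auto

lemma quadratic_form_bound:
  fixes G :: "real^'n::finite^'n"
  shows "\<bar>v \<bullet> (G *v v)\<bar> \<le> (\<Sum>i\<in>UNIV. \<Sum>j\<in>UNIV. \<bar>G $ i $ j\<bar>) * (norm v)\<^sup>2"
proof -
  have "\<bar>v \<bullet> (G *v v)\<bar> = \<bar>\<Sum>i\<in>UNIV. \<Sum>j\<in>UNIV. v $ i * (G $ i $ j * v $ j)\<bar>"
    by (simp add: inner_vec_def matrix_vector_mult_def sum_distrib_left)
  also have "\<dots> \<le> (\<Sum>i\<in>UNIV. \<bar>\<Sum>j\<in>UNIV. v $ i * (G $ i $ j * v $ j)\<bar>)" by (rule sum_abs)
  also have "\<dots> \<le> (\<Sum>i\<in>UNIV. \<Sum>j\<in>UNIV. \<bar>v $ i * (G $ i $ j * v $ j)\<bar>)" by (intro sum_mono sum_abs)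
  also have "\<dots> \<le> (\<Sum>i\<in>UNIV. \<Sum>j\<in>UNIV. \<bar>G $ i $ j\<bar> * (norm v)\<^sup>2)"
  proof (intro sum_mono)
    fix i j
    have "\<bar>v $ i\<bar> * \<bar>v $ j\<bar> \<le> norm v * norm v" by (intro mult_mono component_le_norm_cart) auto
    then have "\<bar>G $ i $ j\<bar> * (\<bar>v $ i\<bar> * \<bar>v $ j\<bar>) \<le> \<bar>G $ i $ j\<bar> * (norm v * norm v)" by (intro mult_left_mono) auto
    then show "\<bar>v $ i * (G $ i $ j * v $ j)\<bar> \<le> \<bar>G $ i $ j\<bar> * (norm v)\<^sup>2"
      by (simp add: abs_mult power2_eq_square ac_simps)
  qed
  finally show ?thesis by (simp add: sum_distrib_right)
qed

section \<open>The extended distance: metric properties and topology\<close>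

context riem_manifold
begin

text \<open>The infimum before \<open>enn2real\<close> is applied. It is \<infinity> between
  different components, so the triangle inequality holds without exception; with the value 0 of
  \<open>riemannian_dist\<close> it would fail for a detour through another component.\<close>

definition dst :: "'m \<Rightarrow> 'm \<Rightarrow> ennreal" where
  "dst x y = (INF \<gamma>\<in>{\<gamma>. piecewise_C1_curve M A \<gamma> \<and> pathstart \<gamma> = x \<and> pathfinish \<gamma> = y}. curve_length A g \<gamma>)"

lemma riemannian_dist_eq: "riemannian_dist M A g x y = enn2real (dst x y)"
  by (simp add: riemannian_dist_def dst_def)

lemma dst_le: "piecewise_C1_curve M A \<gamma> \<Longrightarrow> pathstart \<gamma> = x \<Longrightarrow> pathfinish \<gamma> = y \<Longrightarrow> dst x y \<le> curve_length A g \<gamma>"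
  unfolding dst_def by (intro INF_lower) auto

lemma dst_greatest:
  "(\<And>\<gamma>. piecewise_C1_curve M A \<gamma> \<Longrightarrow> pathstart \<gamma> = x \<Longrightarrow> pathfinish \<gamma> = y \<Longrightarrow> l \<le> curve_length A g \<gamma>) \<Longrightarrow> l \<le> dst x y"
  unfolding dst_def by (intro INF_greatest) auto

lemma dst_sym: "dst x y = dst y x"
proof -
  have "dst x y \<le> dst y x" for x y
  proof (rule dst_greatest)
    fix \<gamma> assume "piecewise_C1_curve M A \<gamma>" "pathstart \<gamma> = y" "pathfinish \<gamma> = x"
    then show "dst x y \<le> curve_length A g \<gamma>"
      using dst_le[OF reverse_curve(1)] reverse_curve(2) by force
  qed
  then show ?thesis by (simp add: antisym)
qed

text \<open>Each half is an affine reparametrization of one of the curves. An interval mapped into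
  one chart may lie on either side of 1/2 or contain it; in the last case the two coordinate curves
  are glued there. For the lengths, doubled speed is balanced by halved parameter, up to finitely
  many times.\<close>

lemma join_curve:
  assumes \<gamma>: "piecewise_C1_curve M A \<gamma>\<^sub>1" "piecewise_C1_curve M A \<gamma>\<^sub>2" and meet: "pathfinish \<gamma>\<^sub>1 = pathstart \<gamma>\<^sub>2"
  shows "piecewise_C1_curve M A (\<gamma>\<^sub>1 +++ \<gamma>\<^sub>2)"
    and "curve_length A g (\<gamma>\<^sub>1 +++ \<gamma>\<^sub>2) = curve_length A g \<gamma>\<^sub>1 + curve_length A g \<gamma>\<^sub>2"
proof -
  let ?\<gamma> = "\<gamma>\<^sub>1 +++ \<gamma>\<^sub>2"
  have l: "?\<gamma> t = \<gamma>\<^sub>1 (2 * t)" if "t \<le> 1 / 2" for t using that by (simp add: joinpaths_def)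
  have r: "?\<gamma> t = \<gamma>\<^sub>2 (2 * t - 1)" if "1 / 2 \<le> t" for t
  proof (cases "t = 1 / 2")
    case True
    show ?thesis unfolding True using meet by (simp add: joinpaths_def pathfinish_def pathstart_def)
  qed (use that in \<open>auto simp: joinpaths_def\<close>)
  show 1: "piecewise_C1_curve M A ?\<gamma>"
    unfolding piecewise_C1_curve_def
  proof (intro conjI ballI allI impI)
    show "path ?\<gamma>" using curveD(1)[OF \<gamma>(1)] curveD(1)[OF \<gamma>(2)] meet by simp
    show "path_image ?\<gamma> \<subseteq> M"
      using curveD(2)[OF \<gamma>(1)] curveD(2)[OF \<gamma>(2)] by (rule subset_path_image_join)
    fix c and a b :: real assume c: "c \<in> A" and ab: "{a..b} \<subseteq> {0..1} \<and> ?\<gamma> ` {a..b} \<subseteq> fst c"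
    define f where "f = snd c \<circ> \<gamma>\<^sub>1 \<circ> (\<lambda>t. 2 *\<^sub>R t + 0)"
    define h where "h = snd c \<circ> \<gamma>\<^sub>2 \<circ> (\<lambda>t. 2 *\<^sub>R t + (-1))"
    have im: "(\<lambda>t. 2 * t + e) ` {u..v} = {2 * u + e..2 * v + e}" for u v e :: real
    proof -
      have "x \<in> (\<lambda>t. 2 * t + e) ` {u..v}" if "x \<in> {2 * u + e..2 * v + e}" for x
        using that by (intro image_eqI[of _ _ "(x - e) / 2"]) (auto simp: field_simps)
      then show ?thesis by auto
    qed
    have fpw: "f piecewise_C1_differentiable_on {u..v}" if uv: "{u..v} \<subseteq> {a..b}" "v \<le> 1 / 2" for u v
    proof -
      have "(snd c \<circ> \<gamma>\<^sub>1) piecewise_C1_differentiable_on {2 * u + 0..2 * v + 0}"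
      proof (rule curveD(3)[OF \<gamma>(1) c])
        show "{2 * u + 0..2 * v + 0} \<subseteq> {0..1}" using uv ab by (cases "u \<le> v") auto
        show "\<gamma>\<^sub>1 ` {2 * u + 0..2 * v + 0} \<subseteq> fst c"
        proof (rule image_subsetI)
          fix x assume "x \<in> {2 * u + 0..2 * v + 0}"
          then have x: "x / 2 \<in> {u..v}" by auto
          then have "?\<gamma> (x / 2) \<in> fst c" using uv ab by blast
          then show "\<gamma>\<^sub>1 x \<in> fst c" using l[of "x / 2"] x uv(2) by auto
        qed
      qed
      then show ?thesis unfolding f_def by (intro piecewise_C1_differentiable_affine) (simp only: im)
    qed
    have hpw: "h piecewise_C1_differentiable_on {u..v}" if uv: "{u..v} \<subseteq> {a..b}" "1 / 2 \<le> u" for u v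
    proof -
      have "(snd c \<circ> \<gamma>\<^sub>2) piecewise_C1_differentiable_on {2 * u + (-1)..2 * v + (-1)}"
      proof (rule curveD(3)[OF \<gamma>(2) c])
        show "{2 * u + (-1)..2 * v + (-1)} \<subseteq> {0..1}" using uv ab by (cases "u \<le> v") auto
        show "\<gamma>\<^sub>2 ` {2 * u + (-1)..2 * v + (-1)} \<subseteq> fst c"
        proof (rule image_subsetI)
          fix x assume "x \<in> {2 * u + (-1)..2 * v + (-1)}"
          then have x: "(x + 1) / 2 \<in> {u..v}" by auto
          then have "?\<gamma> ((x + 1) / 2) \<in> fst c" using uv ab by blast
          moreover have "2 * ((x + 1) / 2) - 1 = x" by (simp add: field_simps)
          ultimately show "\<gamma>\<^sub>2 x \<in> fst c" using r[of "(x + 1) / 2"] x uv(2) by simp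
        qed
      qed
      then show ?thesis unfolding h_def by (intro piecewise_C1_differentiable_affine) (simp only: im)
    qed
    consider "b < 1 / 2" | "1 / 2 < a" | "a \<le> 1 / 2" "1 / 2 \<le> b" by linarith
    then show "(snd c \<circ> ?\<gamma>) piecewise_C1_differentiable_on {a..b}"
    proof cases
      case 1
      then show ?thesis
        by (intro piecewise_C1_cong_open[OF fpw[of a b], of "{..<1/2}"]) (auto simp: f_def l)
    next
      case 2
      then show ?thesis
        by (intro piecewise_C1_cong_open[OF hpw[of a b], of "{1/2<..}"]) (auto simp: h_def r)
    next
      case 3
      have "(\<lambda>t. if t \<le> 1 / 2 then f t else h t) piecewise_C1_differentiable_on {a..b}"
      proof (rule piecewise_C1_differentiable_cases[OF fpw hpw 3])
        show "f (1 / 2) = h (1 / 2)" using meet by (simp add: f_def h_def pathfinish_def pathstart_def)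
      qed (use 3 in auto)
      moreover have "(\<lambda>t. if t \<le> 1 / 2 then f t else h t) = snd c \<circ> ?\<gamma>"
        by (auto simp: f_def h_def joinpaths_def)
      ultimately show ?thesis by simp
    qed
  qed
  obtain S where S: "finite S" "\<And>t. t \<in> {0..1} - S \<Longrightarrow> \<exists>c\<in>A. \<exists>w. \<gamma>\<^sub>1 t \<in> fst c \<and> ((snd c \<circ> \<gamma>\<^sub>1) has_vector_derivative w) (at t)"
    using curve_regular[OF \<gamma>(1)] by metis
  obtain S' where S': "finite S'" "\<And>t. t \<in> {0..1} - S' \<Longrightarrow> \<exists>c\<in>A. \<exists>w. \<gamma>\<^sub>2 t \<in> fst c \<and> ((snd c \<circ> \<gamma>\<^sub>2) has_vector_derivative w) (at t)"
    using curve_regular[OF \<gamma>(2)] by metis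
  have two: "sqrt (Q c x (2 *\<^sub>R w)) = 2 * sqrt (Q c x w)" for c x w
    unfolding Q_scale by (simp add: real_sqrt_mult)
  have sl: "speed A g ?\<gamma> t = 2 * speed A g \<gamma>\<^sub>1 (2 * t)" if t: "0 \<le> t" "t < 1 / 2" "2 * t \<notin> S" for t
  proof -
    obtain c w where c: "c \<in> A" "\<gamma>\<^sub>1 (2 * t) \<in> fst c" "((snd c \<circ> \<gamma>\<^sub>1) has_vector_derivative w) (at (2 * t))"
      using S(2)[of "2 * t"] t by auto
    have "((\<lambda>t. 2 * t) has_vector_derivative (2 :: real)) (at t)" by (auto intro!: derivative_eq_intros)
    then have "((snd c \<circ> \<gamma>\<^sub>1 \<circ> (\<lambda>t. 2 * t)) has_vector_derivative 2 *\<^sub>R w) (at t)"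
      using c(3) by (rule vector_diff_chain_at)
    then have d: "((snd c \<circ> ?\<gamma>) has_vector_derivative 2 *\<^sub>R w) (at t)"
      by (rule has_vector_derivative_transform_within_open[of _ _ _ "{..<1/2}"]) (use t in \<open>auto simp: l\<close>)
    have "speed A g ?\<gamma> t = sqrt (Q c (?\<gamma> t) (2 *\<^sub>R w))"
      by (rule speed_eq[OF curveD(1,2)[OF 1] _ c(1) _ has_vector_derivative_at_within[OF d]]) (use c(2) t l in auto)
    also have "\<dots> = 2 * sqrt (Q c (\<gamma>\<^sub>1 (2 * t)) w)" unfolding two using t l by simp
    also have "sqrt (Q c (\<gamma>\<^sub>1 (2 * t)) w) = speed A g \<gamma>\<^sub>1 (2 * t)"
      by (rule speed_eq[symmetric, OF curveD(1,2)[OF \<gamma>(1)] _ c(1,2) has_vector_derivative_at_within[OF c(3)]]) (use t in simp)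
    finally show ?thesis .
  qed
  have sr: "speed A g ?\<gamma> t = 2 * speed A g \<gamma>\<^sub>2 (2 * t - 1)" if t: "1 / 2 < t" "t \<le> 1" "2 * t - 1 \<notin> S'" for t
  proof -
    obtain c w where c: "c \<in> A" "\<gamma>\<^sub>2 (2 * t - 1) \<in> fst c" "((snd c \<circ> \<gamma>\<^sub>2) has_vector_derivative w) (at (2 * t - 1))"
      using S'(2)[of "2 * t - 1"] t by auto
    have "((\<lambda>t. 2 * t - 1) has_vector_derivative (2 :: real)) (at t)" by (auto intro!: derivative_eq_intros)
    then have "((snd c \<circ> \<gamma>\<^sub>2 \<circ> (\<lambda>t. 2 * t - 1)) has_vector_derivative 2 *\<^sub>R w) (at t)"
      using c(3) by (rule vector_diff_chain_at)
    then have d: "((snd c \<circ> ?\<gamma>) has_vector_derivative 2 *\<^sub>R w) (at t)"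
      by (rule has_vector_derivative_transform_within_open[of _ _ _ "{1/2<..}"]) (use t in \<open>auto simp: r\<close>)
    have "speed A g ?\<gamma> t = sqrt (Q c (?\<gamma> t) (2 *\<^sub>R w))"
      by (rule speed_eq[OF curveD(1,2)[OF 1] _ c(1) _ has_vector_derivative_at_within[OF d]]) (use c(2) t r in auto)
    also have "\<dots> = 2 * sqrt (Q c (\<gamma>\<^sub>2 (2 * t - 1)) w)" unfolding two using t r by simp
    also have "sqrt (Q c (\<gamma>\<^sub>2 (2 * t - 1)) w) = speed A g \<gamma>\<^sub>2 (2 * t - 1)"
      by (rule speed_eq[symmetric, OF curveD(1,2)[OF \<gamma>(2)] _ c(1,2) has_vector_derivative_at_within[OF c(3)]]) (use t in simp)
    finally show ?thesis .
  qed
  define f1 where "f1 t = indicator {0..1} t * ennreal (speed A g \<gamma>\<^sub>1 t)" for t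
  define f2 where "f2 t = indicator {0..1} t * ennreal (speed A g \<gamma>\<^sub>2 t)" for t
  have [measurable]: "f1 \<in> borel_measurable borel" "f2 \<in> borel_measurable borel"
    unfolding f1_def[abs_def] f2_def[abs_def] using speed_measurable \<gamma> by auto
  have "curve_length A g \<gamma>\<^sub>1 + curve_length A g \<gamma>\<^sub>2
     = ennreal 2 * (\<integral>\<^sup>+t. f1 (0 + 2 * t) \<partial>lborel) + ennreal 2 * (\<integral>\<^sup>+t. f2 (-1 + 2 * t) \<partial>lborel)"
    unfolding curve_length_eq f1_def[symmetric] f2_def[symmetric]
    using nn_integral_real_affine[of f1 2 0] nn_integral_real_affine[of f2 2 "-1"] by simp
  also have "\<dots> = (\<integral>\<^sup>+t. ennreal 2 * f1 (0 + 2 * t) + ennreal 2 * f2 (-1 + 2 * t) \<partial>lborel)"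
    by (simp add: nn_integral_add nn_integral_cmult)
  also have "\<dots> = curve_length A g ?\<gamma>"
    unfolding curve_length_eq
  proof (rule nn_integral_cong_AE)
    have "finite ((\<lambda>t. t / 2) ` S \<union> (\<lambda>t. (t + 1) / 2) ` S' \<union> {1 / 2})" using S S' by simp
    from AE_finite[OF this]
    show "AE t in lborel. ennreal 2 * f1 (0 + 2 * t) + ennreal 2 * f2 (-1 + 2 * t) = indicator {0..1} t * ennreal (speed A g ?\<gamma> t)"
    proof eventually_elim
      case (elim t)
      have e: "2 * t \<notin> S" "2 * t - 1 \<notin> S'" "t \<noteq> 1 / 2"
        using elim imageI[of "2 * t" S "\<lambda>t. t / 2"] imageI[of "2 * t - 1" S' "\<lambda>t. (t + 1) / 2"] by auto
      have m2: "ennreal (2 * z) = ennreal 2 * ennreal z" for z by (rule ennreal_mult') simp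
      consider "t < 0" | "0 \<le> t" "t < 1 / 2" | "1 / 2 < t" "t \<le> 1" | "1 < t" using e(3) by linarith
      then show ?case
      proof cases
        case 2 then show ?thesis using sl[of t] e by (simp add: f1_def f2_def m2)
      next
        case 3 then show ?thesis using sr[of t] e by (simp add: f1_def f2_def m2)
      qed (auto simp: f1_def f2_def)
    qed
  qed
  finally show "curve_length A g ?\<gamma> = curve_length A g \<gamma>\<^sub>1 + curve_length A g \<gamma>\<^sub>2" by simp
qed

lemma dst_tri: "dst x z \<le> dst x y + dst y z"
  unfolding dst_def[of x y] dst_def[of y z]
proof (rule le_INF_add_INF)
  fix \<gamma>\<^sub>1 \<gamma>\<^sub>2
  assume "\<gamma>\<^sub>1 \<in> {\<gamma>. piecewise_C1_curve M A \<gamma> \<and> pathstart \<gamma> = x \<and> pathfinish \<gamma> = y}"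
    and "\<gamma>\<^sub>2 \<in> {\<gamma>. piecewise_C1_curve M A \<gamma> \<and> pathstart \<gamma> = y \<and> pathfinish \<gamma> = z}"
  then show "dst x z \<le> curve_length A g \<gamma>\<^sub>1 + curve_length A g \<gamma>\<^sub>2"
    using join_curve[of \<gamma>\<^sub>1 \<gamma>\<^sub>2] dst_le[of "\<gamma>\<^sub>1 +++ \<gamma>\<^sub>2" x z] by simp
qed

text \<open>The coordinate segment from z0 to z is a curve on the manifold. The entries of the
  metric are bounded on a compact ball, so its speed is at most sqrt B |z - z0|. This ties
  \<open>dst\<close> to the topology of M.\<close>

lemma segment_bound:
  assumes c: "c \<in> A" and z0: "z0 \<in> snd c ` fst c"
  obtains r K where "0 < r" "0 \<le> K" "ball z0 r \<subseteq> snd c ` fst c"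
    "\<And>z. z \<in> ball z0 r \<Longrightarrow> dst (chart_inv c z0) (chart_inv c z) \<le> ennreal (K * dist z0 z)"
proof -
  obtain r where r: "0 < r" "cball z0 r \<subseteq> snd c ` fst c"
    using open_contains_cball chartD(3)[OF c] z0 by blast
  define N where "N z = (\<Sum>i\<in>UNIV. \<Sum>j\<in>UNIV. \<bar>g c (chart_inv c z) $ i $ j\<bar>)" for z
  have "continuous_on (cball z0 r) (\<lambda>z. g c (chart_inv c z))" using g_continuous[OF c] r(2) by (rule continuous_on_subset)
  then have "continuous_on (cball z0 r) N" unfolding N_def by (intro continuous_intros)
  then have "compact (N ` cball z0 r)" by (intro compact_continuous_image) auto
  then obtain B where B: "\<And>z. z \<in> cball z0 r \<Longrightarrow> \<bar>N z\<bar> \<le> B" using compact_imp_bounded bounded_iff by (metis image_eqI real_norm_def)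
  have B0: "0 \<le> B" using B[of z0] r by simp
  show ?thesis
  proof (rule that[of r "sqrt B"])
    show "ball z0 r \<subseteq> snd c ` fst c" using r by (meson ball_subset_cball order_trans)
    fix z assume z: "z \<in> ball z0 r"
    define \<sigma> where "\<sigma> t = z0 + t *\<^sub>R (z - z0)" for t :: real
    define \<gamma> where "\<gamma> = chart_inv c \<circ> \<sigma>"
    have \<sigma>c: "continuous_on X \<sigma>" for X unfolding \<sigma>_def by (intro continuous_intros)
    have \<sigma>d: "(\<sigma> has_vector_derivative (z - z0)) (at t)" for t
      unfolding \<sigma>_def by (auto intro!: derivative_eq_intros)
    have \<sigma>r: "\<sigma> t \<in> cball z0 r" if "t \<in> {0..1}" for t
    proof -
      have "dist z0 (\<sigma> t) = \<bar>t\<bar> * norm (z - z0)" by (simp add: \<sigma>_def dist_norm)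
      also have "\<dots> \<le> 1 * norm (z - z0)" using that by (intro mult_right_mono) auto
      finally show ?thesis using z by (simp add: dist_norm norm_minus_commute)
    qed
    have \<sigma>im: "\<sigma> t \<in> snd c ` fst c" if "t \<in> {0..1}" for t using \<sigma>r[OF that] r by blast
    have \<gamma>c: "\<gamma> t \<in> fst c" if "t \<in> {0..1}" for t using chartD(8)[OF c \<sigma>im[OF that]] by (simp add: \<gamma>_def)
    have curve: "piecewise_C1_curve M A \<gamma>"
      unfolding piecewise_C1_curve_def
    proof (intro conjI ballI allI impI)
      show "path \<gamma>" unfolding path_def \<gamma>_def
        by (intro continuous_on_compose \<sigma>c continuous_on_subset[OF chartD(5)[OF c]]) (use \<sigma>im in auto)
      show "path_image \<gamma> \<subseteq> M" using \<gamma>c chartD(2)[OF c] by (auto simp: path_image_def)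
      fix d and a b :: real assume d: "d \<in> A" and ab: "{a..b} \<subseteq> {0..1} \<and> \<gamma> ` {a..b} \<subseteq> fst d"
      have in_O: "\<sigma> t \<in> snd c ` (fst c \<inter> fst d)" if t: "t \<in> {a..b}" for t
      proof -
        have t01: "t \<in> {0..1}" using t ab by blast
        have "\<gamma> t \<in> fst c \<inter> fst d" using \<gamma>c[OF t01] t ab by blast
        moreover have "snd c (\<gamma> t) = \<sigma> t" using chartD(7)[OF c \<sigma>im[OF t01]] by (simp add: \<gamma>_def)
        ultimately show ?thesis by (metis imageI)
      qed
      \<comment> \<open>In another chart the segment is read through a transition map, which is
        continuously differentiable; so the curve is admissible for every chart of the
        atlas.\<close>
      have eq: "snd d \<circ> \<gamma> = transition_map c d \<circ> \<sigma>" by (simp add: \<gamma>_def transition_map_def comp_assoc)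
      have "(snd d \<circ> \<gamma>) C1_differentiable_on {a..b}"
        unfolding C1_differentiable_on_def eq
      proof (intro exI[of _ "\<lambda>t. jac c d (\<sigma> t) (z - z0)"] conjI ballI)
        fix t assume "t \<in> {a..b}"
        then show "((transition_map c d \<circ> \<sigma>) has_vector_derivative jac c d (\<sigma> t) (z - z0)) (at t)"
          using vector_derivative_diff_chain_within[OF \<sigma>d[of t], of "transition_map c d" "jac c d (\<sigma> t)"]
            transition(2)[OF c d in_O] by (auto intro: has_derivative_at_withinI)
      next
        show "continuous_on {a..b} (\<lambda>t. jac c d (\<sigma> t) (z - z0))"
          by (rule continuous_on_compose2[OF transition(4)[OF c d] \<sigma>c]) (use in_O in auto)
      qed
      then show "(snd d \<circ> \<gamma>) piecewise_C1_differentiable_on {a..b}" by (rule C1_differentiable_imp_piecewise)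
    qed
    have sp: "speed A g \<gamma> t \<le> sqrt B * dist z0 z" if t: "t \<in> {0..1}" for t
    proof -
      have "(\<sigma> has_vector_derivative (z - z0)) (at t within {0..1})" by (rule has_vector_derivative_at_within[OF \<sigma>d])
      then have "((snd c \<circ> \<gamma>) has_vector_derivative (z - z0)) (at t within {0..1})"
        by (rule has_vector_derivative_transform_within[of _ _ _ _ 1]) (use t \<sigma>im chartD(7)[OF c] in \<open>auto simp: \<gamma>_def\<close>)
      then have "speed A g \<gamma> t = sqrt (Q c (\<gamma> t) (z - z0))"
        by (rule speed_eq[OF curveD(1,2)[OF curve] t c \<gamma>c[OF t]])
      also have "Q c (\<gamma> t) (z - z0) \<le> N (\<sigma> t) * (norm (z - z0))\<^sup>2"
        using quadratic_form_bound[of "z - z0" "g c (\<gamma> t)"] by (simp add: Q_def N_def \<gamma>_def)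
      also have "\<dots> \<le> B * (norm (z - z0))\<^sup>2" using B[OF \<sigma>r[OF t]] by (intro mult_right_mono) auto
      finally show ?thesis by (simp add: real_sqrt_mult dist_norm norm_minus_commute)
    qed
    have "dst (chart_inv c z0) (chart_inv c z) \<le> curve_length A g \<gamma>"
      by (rule dst_le[OF curve]) (auto simp: pathstart_def pathfinish_def \<gamma>_def \<sigma>_def)
    also have "\<dots> \<le> (\<integral>\<^sup>+t. ennreal (sqrt B * dist z0 z) * indicator {0..1::real} t \<partial>lborel)"
      unfolding curve_length_eq by (intro nn_integral_mono) (auto simp: indicator_def intro!: ennreal_leI sp)
    also have "\<dots> = ennreal (sqrt B * dist z0 z)" by (simp add: nn_integral_cmult_indicator)
    finally show "dst (chart_inv c z0) (chart_inv c z) \<le> ennreal (sqrt B * dist z0 z)" .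
  qed (use r B0 in auto)
qed

lemma dst_refl:
  assumes "x \<in> M" shows "dst x x = 0"
proof -
  obtain c where c: "c \<in> A" "x \<in> fst c" using chart_ex assms by blast
  obtain r K where r: "0 < r" "0 \<le> K" "ball (snd c x) r \<subseteq> snd c ` fst c"
    "\<And>z. z \<in> ball (snd c x) r \<Longrightarrow> dst (chart_inv c (snd c x)) (chart_inv c z) \<le> ennreal (K * dist (snd c x) z)"
    using segment_bound[OF c(1), of "snd c x"] c(2) by blast
  from r(4)[of "snd c x"] show ?thesis using r(1) chartD(6)[OF c] by simp
qed

text \<open>By \<open>segment_bound\<close> and the triangle inequality, a small coordinate ball
  around a point of the distance ball stays inside it. Openness yields measurability of the balls
  and, with compactness, the finite covers.\<close>

lemma dst_ball_open:
  assumes x: "x \<in> M"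
  shows "openin (top_of_set M) {y \<in> M. dst x y < e}"
proof (subst openin_subopen, intro ballI)
  fix y assume y: "y \<in> {y \<in> M. dst x y < e}"
  then obtain c where c: "c \<in> A" "y \<in> fst c" using chart_ex by blast
  obtain r K where r: "0 < r" "0 \<le> K" "ball (snd c y) r \<subseteq> snd c ` fst c"
    "\<And>z. z \<in> ball (snd c y) r \<Longrightarrow> dst (chart_inv c (snd c y)) (chart_inv c z) \<le> ennreal (K * dist (snd c y) z)"
    using segment_bound[OF c(1), of "snd c y"] c(2) by blast
  obtain e' where e': "0 < e'" "dst x y + ennreal e' < e"
  proof -
    obtain a where a: "dst x y = ennreal a" "0 \<le> a" using y by (cases "dst x y") auto
    show ?thesis
    proof (cases e)
      case (real b)
      then have "a < b" using y a by (simp add: ennreal_less_iff)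
      then show ?thesis using a real that[of "(b - a) / 2"]
        by (simp add: ennreal_plus[symmetric] ennreal_less_iff field_simps del: ennreal_plus)
    qed (use a that[of 1] in auto)
  qed
  define \<rho> where "\<rho> = min r (e' / (K + 1))"
  have \<rho>: "0 < \<rho>" using r e' by (simp add: \<rho>_def)
  define U where "U = {w \<in> fst c. snd c w \<in> ball (snd c y) \<rho>}"
  have "openin (top_of_set (fst c)) (fst c \<inter> snd c -` ball (snd c y) \<rho>)"
    by (rule continuous_openin_preimage_gen[OF chartD(4)[OF c(1)]]) simp
  moreover have "U = fst c \<inter> snd c -` ball (snd c y) \<rho>" by (auto simp: U_def)
  ultimately have Uo: "openin (top_of_set M) U" using chartD(1)[OF c(1)] openin_trans by metis
  have "U \<subseteq> {y \<in> M. dst x y < e}"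
  proof
    fix w assume w: "w \<in> U"
    then have wc: "w \<in> fst c" "dist (snd c y) (snd c w) < \<rho>" by (auto simp: U_def)
    then have "dst (chart_inv c (snd c y)) (chart_inv c (snd c w)) \<le> ennreal (K * dist (snd c y) (snd c w))"
      by (intro r(4)) (auto simp: \<rho>_def)
    then have 1: "dst y w \<le> ennreal (K * dist (snd c y) (snd c w))" using chartD(6)[OF c(1)] c(2) wc by simp
    have "K * dist (snd c y) (snd c w) \<le> K * (e' / (K + 1))"
      using wc r by (intro mult_left_mono) (auto simp: \<rho>_def)
    also have "\<dots> \<le> e'" using r e' by (auto simp: field_simps)
    finally have "dst y w \<le> ennreal e'" using 1 by (meson ennreal_leI order_trans)
    then have "dst x w \<le> dst x y + ennreal e'" using dst_tri[of x w y] by (meson add_left_mono order_trans)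
    then show "w \<in> {y \<in> M. dst x y < e}" using e' wc chartD(2)[OF c(1)] by (auto intro: le_less_trans)
  qed
  moreover have "y \<in> U" using c \<rho> by (simp add: U_def)
  ultimately show "\<exists>T. openin (top_of_set M) T \<and> y \<in> T \<and> T \<subseteq> {y \<in> M. dst x y < e}" using Uo by blast
qed

end

subsection \<open>Comparison with the Euclidean distance in normalized coordinates\<close>

text \<open>Gram-Schmidt for the inner product defined by \<open>G\<close>.\<close>

lemma gram_factor:
  fixes G :: "real^'n::finite^'n"
  assumes sym: "transpose G = G" and pos: "\<And>v. v \<noteq> 0 \<Longrightarrow> 0 < v \<bullet> (G *v v)"
  obtains L :: "real^'n^'n" where "G = transpose L ** L" "invertible L"
proof -
  define ip where "ip u v = u \<bullet> (G *v v)" for u v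
  have ips: "ip u v = ip v u" for u v
  proof -
    have "ip u v = (transpose G *v u) \<bullet> v" by (simp add: ip_def dot_lmul_matrix[symmetric] matrix_vector_mul_component)
    then show ?thesis by (simp add: sym ip_def inner_commute)
  qed
  have ipadd: "ip u (v + w) = ip u v + ip u w" "ip u (r *\<^sub>R v) = r * ip u v" "ip u (v - w) = ip u v - ip u w" for u v w r
    by (simp_all add: ip_def matrix_vector_right_distrib matrix_vector_mult_scaleR inner_add_right matrix_vector_mult_diff_distrib inner_diff_right)
  have ip0: "ip u 0 = 0" for u by (simp add: ip_def)
  have ipsum: "ip u (\<Sum>i\<in>I. f i) = (\<Sum>i\<in>I. ip u (f i))" for u I and f :: "'i \<Rightarrow> real^'n"
    by (induction I rule: infinite_finite_induct) (auto simp: ipadd ip0)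
  have ex: "\<exists>B. finite B \<and> card B = k \<and> (\<forall>u\<in>B. \<forall>v\<in>B. ip u v = (if u = v then 1 else 0))" if "k \<le> CARD('n)" for k
    using that
  proof (induction k)
    case (Suc k)
    then obtain B where B: "finite B" "card B = k" "\<forall>u\<in>B. \<forall>v\<in>B. ip u v = (if u = v then 1 else 0)" by auto
    \<comment> \<open>Fewer vectors than the dimension do not span, so some vector outside the span
      can be orthogonalized and normalized.\<close>
    have "dim B \<le> k" using dim_le_card'[OF B(1)] B(2) by simp
    then have "span B \<noteq> UNIV" using Suc.prems by (metis DIM_cart DIM_real dim_UNIV dim_span mult.right_neutral not_less_eq_eq)
    then obtain v where v: "v \<notin> span B" by blast
    define w where "w = v - (\<Sum>u\<in>B. ip u v *\<^sub>R u)"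
    have "(\<Sum>u\<in>B. ip u v *\<^sub>R u) \<in> span B" by (intro span_sum span_scale span_base)
    then have "w \<noteq> 0" using v unfolding w_def by auto
    then have w: "0 < ip w w" using pos by (simp add: ip_def)
    have uw: "ip u w = 0" if u: "u \<in> B" for u
    proof -
      have "(\<Sum>u'\<in>B. ip u' v * ip u u') = (\<Sum>u'\<in>B. if u' = u then ip u v else 0)"
        using B(3) u by (intro sum.cong) auto
      also have "\<dots> = ip u v" using u B(1) by simp
      finally show ?thesis by (simp add: w_def ipadd ipsum)
    qed
    define e where "e = (1 / sqrt (ip w w)) *\<^sub>R w"
    have ue: "ip u e = 0" "ip e u = 0" if "u \<in> B" for u
      using uw[OF that] ips[of e u] by (simp_all add: e_def ipadd)
    have "ip e e = (1 / sqrt (ip w w)) * ((1 / sqrt (ip w w)) * ip w w)"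
      unfolding e_def by (simp only: ipadd ips[of "(1 / sqrt (ip w w)) *\<^sub>R w" w])
    also have "\<dots> = 1" using w by (simp add: field_simps)
    finally have ee: "ip e e = 1" .
    have "e \<notin> B" using ue ee by fastforce
    then show ?case using B ue ee by (intro exI[of _ "insert e B"]) auto
  qed auto
  obtain B where B: "finite B" "card B = CARD('n)" "\<forall>u\<in>B. \<forall>v\<in>B. ip u v = (if u = v then 1 else 0)"
    using ex[OF order_refl] by blast
  obtain f where f: "bij_betw f (UNIV :: 'n set) B"
    using finite_same_card_bij[of "UNIV :: 'n set" B] B by auto
  have fip: "ip (f i) (f j) = (if i = j then 1 else 0)" for i j
    using B(3) f by (auto simp: bij_betw_def inj_def)
  \<comment> \<open>\<open>P\<close> carries the standard basis to one that is orthonormal for G;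
    its inverse is the factor L.\<close>
  define P where "P w = (\<Sum>i\<in>UNIV. w $ i *\<^sub>R f i)" for w
  have Plin: "linear P" by (auto intro!: linearI simp: P_def scaleR_left_distrib sum.distrib scaleR_sum_right)
  have Pip: "ip (P u) (P w) = u \<bullet> w" for u w
  proof -
    have "ip (f j) (P u) = u $ j" for j u
      by (simp add: P_def ipsum ipadd fip if_distrib cong: if_cong)
    moreover have "ip (P u) (P w) = (\<Sum>i\<in>UNIV. w $ i * ip (f i) (P u))"
      by (subst (2) P_def) (simp add: ipsum ipadd ips[of "P u"])
    ultimately show ?thesis by (simp add: inner_vec_def mult.commute)
  qed
  have Pinj: "inj P"
  proof (subst linear_injective_0[OF Plin], intro allI impI)
    fix a assume "P a = 0"
    then have "a \<bullet> a = 0" using Pip[of a a] by (simp add: ip0)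
    then show "a = 0" by simp
  qed
  obtain h where h: "linear h" "\<And>x. h (P x) = x" "\<And>x. P (h x) = x"
    using linear_injective_isomorphism[OF Plin Pinj] by blast
  define L where "L = matrix h"
  have L: "L *v x = h x" for x unfolding L_def using h(1) by (simp add: matrix_works)
  show ?thesis
  proof (rule that[of L])
    have "transpose L ** L *v x = G *v x" for x
    proof (rule vector_eq_ldot[THEN iffD1, rule_format])
      fix u
      have "u \<bullet> (transpose L ** L *v x) = (L *v u) \<bullet> (L *v x)"
        by (simp only: matrix_vector_mul_assoc[symmetric]) (metis dot_lmul_matrix inner_commute transpose_transpose vector_transpose_matrix)
      also have "\<dots> = ip u x" using Pip[of "h u" "h x"] by (simp add: L h)
      finally show "u \<bullet> (transpose L ** L *v x) = u \<bullet> (G *v x)" by (simp add: ip_def)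
    qed
    then show "G = transpose L ** L" by (metis matrix_eq)
    have "L ** matrix P = mat 1"
      by (subst matrix_eq) (simp add: matrix_vector_mul_assoc[symmetric] L h matrix_works Plin)
    then show "invertible L" using invertible_right_inverse by blast
  qed
qed

text \<open>The fundamental theorem with finitely many exceptional points gives a gauge integral of
  D. When the right side is finite, D is Lebesgue integrable with the same integral, and the norm
  may be taken inside.\<close>

lemma norm_le_nn_integral_derivative:
  fixes f :: "real \<Rightarrow> 'a::euclidean_space"
  assumes "a \<le> b" "finite S" "\<And>t. t \<in> {a<..<b} - S \<Longrightarrow> (f has_vector_derivative D t) (at t)" "continuous_on {a..b} f"
  shows "ennreal (norm (f b - f a)) \<le> (\<integral>\<^sup>+t. indicator {a..b} t * ennreal (norm (D t)) \<partial>lborel)"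
proof (cases "(\<integral>\<^sup>+t. indicator {a..b} t * ennreal (norm (D t)) \<partial>lborel) = \<infinity>")
  case False
  have hi: "(D has_integral (f b - f a)) {a..b}"
    by (rule fundamental_theorem_of_calculus_interior_strong[OF assms(2,1,3,4)])
  define h where "h t = indicator {a..b} t *\<^sub>R D t" for t
  have hm: "h \<in> borel_measurable lebesgue"
    unfolding h_def[abs_def] by (rule has_integral_implies_lebesgue_measurable[OF hi])
  have hn: "(\<integral>\<^sup>+t. ennreal (norm (h t)) \<partial>lebesgue) = (\<integral>\<^sup>+t. indicator {a..b} t * ennreal (norm (D t)) \<partial>lborel)"
    unfolding nn_integral_completion by (intro nn_integral_cong) (auto simp: h_def indicator_def)
  have hint: "integrable lebesgue h"
    by (rule integrableI_bounded[OF hm]) (use False hn in \<open>simp add: less_top\<close>)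
  have "h = (\<lambda>t. if t \<in> {a..b} then D t else 0)" by (auto simp: h_def indicator_def)
  then have "(h has_integral (f b - f a)) UNIV" using hi by (simp only: has_integral_restrict_UNIV)
  then have "f b - f a = integral\<^sup>L lebesgue h"
    using has_integral_unique has_integral_integral_lebesgue[OF hint] by blast
  also have "norm \<dots> \<le> (\<integral>t. norm (h t) \<partial>lebesgue)" by (rule integral_norm_bound)
  finally have "ennreal (norm (f b - f a)) \<le> ennreal (\<integral>t. norm (h t) \<partial>lebesgue)" by (rule ennreal_leI)
  also have "\<dots> = (\<integral>\<^sup>+t. ennreal (norm (h t)) \<partial>lebesgue)"
    using hint by (intro nn_integral_eq_integral[symmetric]) auto
  finally show ?thesis by (simp add: hn)
qed simp

lemma det_gram:
  fixes L :: "real^'n::finite^'n"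
  shows "G = transpose L ** L \<Longrightarrow> sqrt (det G) = \<bar>det L\<bar>"
  by (simp add: det_mul)

context riem_manifold
begin

text \<open>Normalized coordinates around the point of \<open>c\<close> with coordinates \<open>z0\<close>: there \<open>g\<close> is
  \<open>\<epsilon>\<close>-close to the constant form \<open>|L v|\<^sup>2\<close>.\<close>

definition normalized :: "('m, 'n) chart \<Rightarrow> real^'n \<Rightarrow> real^'n^'n \<Rightarrow> real \<Rightarrow> real \<Rightarrow> bool" where
  "normalized c z0 L \<epsilon> R \<longleftrightarrow> c \<in> A \<and> invertible L \<and> 0 < R \<and> 0 < \<epsilon> \<and> \<epsilon> < 1 \<and>
    {z. norm (L *v (z - z0)) \<le> R} \<subseteq> snd c ` fst c \<and>
    (\<forall>z v. norm (L *v (z - z0)) \<le> R \<longrightarrow> (1 - \<epsilon>) * norm (L *v v) \<le> sqrt (Q c (chart_inv c z) v)) \<and>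
    (\<forall>z. norm (L *v (z - z0)) \<le> R \<longrightarrow> (1 - \<epsilon>) * \<bar>det L\<bar> \<le> sqrt (det (g c (chart_inv c z))) \<and>
        sqrt (det (g c (chart_inv c z))) \<le> (1 + \<epsilon>) * \<bar>det L\<bar>)"

lemma invertible_bound:
  fixes L :: "real^'n^'n"
  assumes "invertible L"
  obtains b where "0 < b" "\<And>v. b * norm v \<le> norm (L *v v)"
proof -
  have "inj ((*v) L)" using assms by (simp add: inj_matrix_vector_mult)
  then show ?thesis using linear_inj_bounded_below_pos[of "(*v) L"] that by auto
qed

text \<open>With L the Gram factor of the metric at x, |L v|^2 is the metric there. If b |v| <= |L
  v|, an entrywise perturbation of size at most \<epsilon> b^2 lowers the quadratic form by at most
  \<epsilon> |L v|^2; the factor 1 - \<epsilon> is then weakened to its square, which gives 1 -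
  \<epsilon> after the root. The density is compared with its value |det L| at x by
  continuity.\<close>

lemma ex_normalized:
  assumes x: "x \<in> M" and \<epsilon>: "0 < \<epsilon>" "\<epsilon> < 1"
  obtains c and L :: "real^'n^'n" and R where "x \<in> fst c" "normalized c (snd c x) L \<epsilon> R"
proof -
  obtain c where c: "c \<in> A" "x \<in> fst c" using chart_ex x by blast
  define z0 where "z0 = snd c x"
  have z0: "z0 \<in> snd c ` fst c" "chart_inv c z0 = x" using c chartD(6)[OF c(1)] by (auto simp: z0_def)
  have "transpose (g c x) = g c x" "\<And>v. v \<noteq> 0 \<Longrightarrow> 0 < v \<bullet> (g c x *v v)"
    using metric_g c by (auto simp: riemannian_metric_def)
  then obtain L :: "real^'n^'n" where L: "g c x = transpose L ** L" "invertible L" using gram_factor by metis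
  obtain b where b: "0 < b" "\<And>v. b * norm v \<le> norm (L *v v)" using invertible_bound[OF L(2)] by blast
  have dL: "0 < \<bar>det L\<bar>" using L(2) by (simp add: invertible_det_nz)
  define N where "N z = (\<Sum>i\<in>UNIV. \<Sum>j\<in>UNIV. \<bar>(g c (chart_inv c z) - g c x) $ i $ j\<bar>)" for z
  define \<rho> where "\<rho> z = sqrt (det (g c (chart_inv c z)))" for z
  have gc: "continuous_on (snd c ` fst c) (\<lambda>z. g c (chart_inv c z))" by (rule g_continuous[OF c(1)])
  have "continuous_on (snd c ` fst c) N" unfolding N_def by (intro continuous_intros gc)
  then have "isCont N z0" using z0(1) chartD(3)[OF c(1)] by (metis continuous_on_eq_continuous_at)
  moreover have "N z0 = 0" by (simp add: N_def z0)
  ultimately have "N \<midarrow>z0\<rightarrow> 0" by (simp add: isCont_def)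
  moreover have "0 < \<epsilon> * b\<^sup>2" using \<epsilon> b by simp
  ultimately obtain d1 where d1: "0 < d1" "\<And>z. z \<noteq> z0 \<Longrightarrow> dist z z0 < d1 \<Longrightarrow> N z < \<epsilon> * b\<^sup>2"
    using order_tendstoD(2)[of N 0 "at z0" "\<epsilon> * b\<^sup>2"] unfolding eventually_at by blast
  have "continuous_on (snd c ` fst c) \<rho>" unfolding \<rho>_def det_def by (intro continuous_intros gc)
  then have "isCont \<rho> z0" using z0(1) chartD(3)[OF c(1)] by (metis continuous_on_eq_continuous_at)
  moreover have \<rho>0: "\<rho> z0 = \<bar>det L\<bar>" by (simp add: \<rho>_def z0 det_gram[OF L(1)])
  ultimately have "\<rho> \<midarrow>z0\<rightarrow> \<bar>det L\<bar>" by (simp add: isCont_def)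
  then obtain d2 where d2: "0 < d2" "\<And>z. z \<noteq> z0 \<Longrightarrow> dist z z0 < d2 \<Longrightarrow> dist (\<rho> z) \<bar>det L\<bar> < \<epsilon> * \<bar>det L\<bar>"
    using tendstoD[of \<rho> "\<bar>det L\<bar>" "at z0" "\<epsilon> * \<bar>det L\<bar>"] \<epsilon> dL unfolding eventually_at by (metis UNIV_I mult_pos_pos)
  obtain d3 where d3: "0 < d3" "ball z0 d3 \<subseteq> snd c ` fst c"
    using open_contains_ball chartD(3)[OF c(1)] z0 by blast
  \<comment> \<open>The factor b turns |L (z - z0)| <= R into |z - z0| at most half the smallest of
    the three radii, hence strictly below each.\<close>
  define R where "R = b * (min d1 (min d2 d3) / 2)"
  have R: "0 < R" using b d1 d2 d3 by (simp add: R_def)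
  have close: "dist z z0 < min d1 (min d2 d3)" if "norm (L *v (z - z0)) \<le> R" for z
  proof -
    have "b * norm (z - z0) \<le> b * (min d1 (min d2 d3) / 2)" using b(2)[of "z - z0"] that by (simp add: R_def)
    then have "norm (z - z0) \<le> min d1 (min d2 d3) / 2" using b by simp
    moreover have "0 < min d1 (min d2 d3)" using d1 d2 d3 by simp
    ultimately show ?thesis by (simp only: dist_norm)
  qed
  have "normalized c z0 L \<epsilon> R"
    unfolding normalized_def
  proof (intro conjI allI impI)
    show "{z. norm (L *v (z - z0)) \<le> R} \<subseteq> snd c ` fst c"
      using close d3 by (force simp: dist_commute)
    fix z assume z: "norm (L *v (z - z0)) \<le> R"
    have Nz: "N z \<le> \<epsilon> * b\<^sup>2"
      using d1(2)[of z] close[OF z] \<open>N z0 = 0\<close> \<epsilon> by (cases "z = z0") auto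
    show "(1 - \<epsilon>) * norm (L *v v) \<le> sqrt (Q c (chart_inv c z) v)" for v
    proof (rule real_le_rsqrt)
      have "v \<bullet> (g c x *v v) = (norm (L *v v))\<^sup>2"
        unfolding L(1) matrix_vector_mul_assoc[symmetric] dot_transpose by (simp add: power2_norm_eq_inner)
      then have "(norm (L *v v))\<^sup>2 - Q c (chart_inv c z) v = - (v \<bullet> ((g c (chart_inv c z) - g c x) *v v))"
        by (simp add: Q_def matrix_vector_mult_diff_rdistrib inner_diff_right)
      also have "\<dots> \<le> \<bar>v \<bullet> ((g c (chart_inv c z) - g c x) *v v)\<bar>" by simp
      also have "\<dots> \<le> N z * (norm v)\<^sup>2" unfolding N_def by (rule quadratic_form_bound)
      also have "\<dots> \<le> \<epsilon> * b\<^sup>2 * (norm v)\<^sup>2" using Nz by (intro mult_right_mono) auto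
      also have "\<dots> = \<epsilon> * (b * norm v)\<^sup>2" by (simp add: power_mult_distrib)
      also have "\<dots> \<le> \<epsilon> * (norm (L *v v))\<^sup>2"
        using b \<epsilon> by (intro mult_left_mono power_mono) auto
      finally have 1: "(1 - \<epsilon>) * (norm (L *v v))\<^sup>2 \<le> Q c (chart_inv c z) v" by (simp add: algebra_simps)
      have "(1 - \<epsilon>) * (1 - \<epsilon>) \<le> (1 - \<epsilon>) * 1" using \<epsilon> by (intro mult_left_mono) auto
      then have "(1 - \<epsilon>)\<^sup>2 * (norm (L *v v))\<^sup>2 \<le> (1 - \<epsilon>) * (norm (L *v v))\<^sup>2"
        by (intro mult_right_mono) (auto simp: power2_eq_square)
      then show "((1 - \<epsilon>) * norm (L *v v))\<^sup>2 \<le> Q c (chart_inv c z) v" using 1 by (simp add: power_mult_distrib)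
    qed
    have "\<bar>\<rho> z - \<bar>det L\<bar>\<bar> \<le> \<epsilon> * \<bar>det L\<bar>"
      using d2(2)[of z] close[OF z] \<rho>0 \<epsilon> dL by (cases "z = z0") (auto simp: dist_real_def)
    then show "(1 - \<epsilon>) * \<bar>det L\<bar> \<le> sqrt (det (g c (chart_inv c z)))"
      "sqrt (det (g c (chart_inv c z))) \<le> (1 + \<epsilon>) * \<bar>det L\<bar>"
      by (simp_all add: \<rho>_def abs_le_iff algebra_simps)
  qed (use c L R \<epsilon> in auto)
  then show ?thesis using that c by (simp add: z0_def)
qed

text \<open>As long as the curve stays in the closed ellipsoid, its coordinates under (1 -
  \<epsilon>) L move at most as fast as the speed, so their total increment is at most the
  length.\<close>

lemma length_inside:
  assumes n: "normalized c z0 L \<epsilon> R" and \<gamma>: "piecewise_C1_curve M A \<gamma>" and s: "0 \<le> s" "s \<le> 1"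
    and im: "\<And>t. t \<in> {0..s} \<Longrightarrow> \<gamma> t \<in> fst c \<and> norm (L *v (snd c (\<gamma> t) - z0)) \<le> R"
  shows "ennreal ((1 - \<epsilon>) * norm (L *v (snd c (\<gamma> s) - z0) - L *v (snd c (\<gamma> 0) - z0))) \<le> curve_length A g \<gamma>"
proof -
  have c: "c \<in> A" and \<epsilon>: "0 < \<epsilon>" "\<epsilon> < 1" using n by (auto simp: normalized_def)
  have sub: "{0..s} \<subseteq> {0..1}" and im': "\<gamma> ` {0..s} \<subseteq> fst c" using s im by auto
  obtain S D where S: "finite S" "\<And>t. t \<in> {0..s} - S \<Longrightarrow> ((snd c \<circ> \<gamma>) has_vector_derivative D t) (at t)"
    "\<And>t. t \<in> {0..s} - S \<Longrightarrow> speed A g \<gamma> t = sqrt (Q c (\<gamma> t) (D t))"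
    using speed_piece[OF \<gamma> c sub im'] by metis
  define f where "f t = (1 - \<epsilon>) *\<^sub>R (L *v (snd c \<circ> \<gamma>) t)" for t
  have cont: "continuous_on {0..s} (snd c \<circ> \<gamma>)"
    using curveD(3)[OF \<gamma> c sub im'] by (simp add: piecewise_C1_differentiable_on_def)
  have "ennreal (norm (f s - f 0)) \<le> (\<integral>\<^sup>+t. indicator {0..s} t * ennreal (norm ((1 - \<epsilon>) *\<^sub>R (L *v D t))) \<partial>lborel)"
  proof (rule norm_le_nn_integral_derivative[OF s(1) S(1)])
    show "continuous_on {0..s} f" unfolding f_def
      by (intro continuous_on_scaleR continuous_on_const continuous_on_compose2[OF matrix_vector_mult_linear_continuous_on cont]) auto
    fix t assume t: "t \<in> {0<..<s} - S"
    have "((\<lambda>t. L *v (snd c \<circ> \<gamma>) t) has_vector_derivative L *v D t) (at t)"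
      by (rule bounded_linear.has_vector_derivative[OF matrix_vector_mul_bounded_linear]) (use S(2)[of t] t in \<open>simp add: o_def\<close>)
    then show "(f has_vector_derivative (1 - \<epsilon>) *\<^sub>R (L *v D t)) (at t)"
      unfolding f_def by (rule bounded_linear.has_vector_derivative[OF bounded_linear_scaleR_right])
  qed
  also have "\<dots> \<le> curve_length A g \<gamma>"
    unfolding curve_length_eq
  proof (rule nn_integral_mono_AE, use AE_finite[OF S(1)] in eventually_elim)
    case (elim t)
    show ?case
    proof (cases "t \<in> {0..s}")
      case True
      then have t: "t \<in> {0..s} - S" using elim by simp
      have cg: "chart_inv c (snd c (\<gamma> t)) = \<gamma> t" using chartD(6)[OF c] im[OF True] by simp
      have "(1 - \<epsilon>) * norm (L *v D t) \<le> sqrt (Q c (chart_inv c (snd c (\<gamma> t))) (D t))"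
        using n im[OF True] by (auto simp: normalized_def)
      then have "(1 - \<epsilon>) * norm (L *v D t) \<le> speed A g \<gamma> t" using S(3)[OF t] cg by simp
      then have "ennreal (norm ((1 - \<epsilon>) *\<^sub>R (L *v D t))) \<le> ennreal (speed A g \<gamma> t)"
        using \<epsilon> by (simp add: ennreal_leI)
      then show ?thesis using True sub by auto
    qed simp
  qed
  finally have "ennreal (norm (f s - f 0)) \<le> curve_length A g \<gamma>" .
  moreover have "f s - f 0 = (1 - \<epsilon>) *\<^sub>R (L *v (snd c (\<gamma> s) - z0) - L *v (snd c (\<gamma> 0) - z0))"
    by (simp add: f_def matrix_vector_mult_diff_distrib scaleR_diff_right)
  ultimately show ?thesis using \<epsilon> by simp
qed

text \<open>\<open>length_inside\<close> is applied up to the first exit time s, the least element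
  of the closed set of times outside. By then the norm has grown from its initial value to at least
  R.\<close>

lemma length_exit:
  assumes n: "normalized c z0 L \<epsilon> R" and \<gamma>: "piecewise_C1_curve M A \<gamma>"
    and x: "\<gamma> 0 \<in> fst c" "norm (L *v (snd c (\<gamma> 0) - z0)) < R"
    and t: "t \<in> {0..1}" "\<not> (\<gamma> t \<in> fst c \<and> norm (L *v (snd c (\<gamma> t) - z0)) < R)"
  shows "ennreal ((1 - \<epsilon>) * (R - norm (L *v (snd c (\<gamma> 0) - z0)))) \<le> curve_length A g \<gamma>"
proof -
  have c: "c \<in> A" and \<epsilon>: "0 < \<epsilon>" "\<epsilon> < 1" and inv: "invertible L"
    and sub: "{z. norm (L *v (z - z0)) \<le> R} \<subseteq> snd c ` fst c" using n by (auto simp: normalized_def)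
  define U where "U = {y \<in> fst c. norm (L *v (snd c y - z0)) < R}"
  have Lc: "continuous_on X (\<lambda>z. norm (L *v (z - z0)))" for X
    by (intro continuous_on_norm continuous_on_compose2[OF matrix_vector_mult_linear_continuous_on[of UNIV]] continuous_intros) auto
  have "openin (top_of_set (fst c)) (fst c \<inter> snd c -` {z. norm (L *v (z - z0)) < R})"
    by (intro continuous_openin_preimage_gen[OF chartD(4)[OF c]] open_Collect_less Lc continuous_on_const)
  moreover have "U = fst c \<inter> snd c -` {z. norm (L *v (z - z0)) < R}" by (auto simp: U_def)
  ultimately have Uo: "openin (top_of_set M) U" using chartD(1)[OF c] openin_trans by metis
  have gc: "continuous_on {0..1} \<gamma>" and gM: "\<gamma> ` {0..1} \<subseteq> M" using curveD(1,2)[OF \<gamma>] by (auto simp: path_def path_image_def)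
  define T where "T = {t \<in> {0..1}. \<gamma> t \<notin> U}"
  have "openin (top_of_set {0..1}) ({0..1} \<inter> \<gamma> -` U)"
    using continuous_openin_preimage[OF gc _ Uo] gM by auto
  then have "closedin (top_of_set {0..1}) ({0..1} - ({0..1} \<inter> \<gamma> -` U))" by (simp add: closedin_diff)
  moreover have "{0..1} - ({0..1} \<inter> \<gamma> -` U) = T" by (auto simp: T_def)
  ultimately have Tc: "closed T" using closedin_closed_trans by auto
  have Tne: "T \<noteq> {}" using t by (auto simp: T_def U_def)
  have Tb: "bdd_below T" by (auto simp: T_def intro: bdd_belowI[of _ 0])
  define s where "s = Inf T"
  have sT: "s \<in> T" unfolding s_def by (rule closed_contains_Inf[OF Tne Tb Tc])
  then have s01: "0 \<le> s" "s \<le> 1" "\<gamma> s \<notin> U" by (auto simp: T_def)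
  have "s \<noteq> 0" using s01(3) x by (auto simp: U_def)
  then have s0: "0 < s" using s01 by simp
  have before: "\<gamma> u \<in> U" if "u \<in> {0..<s}" for u
  proof (rule ccontr)
    assume "\<gamma> u \<notin> U"
    then have "u \<in> T" using that s01 by (auto simp: T_def)
    then have "s \<le> u" unfolding s_def by (rule cInf_lower[OF _ Tb])
    then show False using that by simp
  qed
  define Z where "Z = {z. norm (L *v (z - z0)) \<le> R}"
  obtain b where b: "0 < b" "\<And>v. b * norm v \<le> norm (L *v v)" using invertible_bound[OF inv] by blast
  have "bounded Z"
  proof (rule bounded_subset[OF bounded_cball])
    show "Z \<subseteq> cball z0 (R / b)"
    proof
      fix z assume "z \<in> Z"
      then have "b * norm (z - z0) \<le> R" using b(2)[of "z - z0"] by (auto simp: Z_def)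
      then show "z \<in> cball z0 (R / b)" using b by (simp add: dist_norm norm_minus_commute field_simps)
    qed
  qed
  moreover have "closed Z" unfolding Z_def by (intro closed_Collect_le Lc continuous_on_const)
  ultimately have "compact Z" by (simp add: compact_eq_bounded_closed)
  then have "compact (chart_inv c ` Z)"
    using sub by (intro compact_continuous_image continuous_on_subset[OF chartD(5)[OF c]]) (auto simp: Z_def)
  \<comment> \<open>Compact in a Hausdorff space, hence closed. It follows that the curve at time s
    is still in the chart domain: it cannot leave the domain without meeting the boundary of the
    ellipsoid.\<close>
  then have K: "closed (chart_inv c ` Z)" by (rule compact_imp_closed)
  have UK: "U \<subseteq> chart_inv c ` Z"
  proof
    fix y assume "y \<in> U"
    then show "y \<in> chart_inv c ` Z"
      using chartD(6)[OF c, of y] by (intro image_eqI[of _ _ "snd c y"]) (auto simp: U_def Z_def)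
  qed
  have "closed ({0..1} \<inter> \<gamma> -` (chart_inv c ` Z))"
    by (rule continuous_closed_preimage[OF gc _ K]) simp
  moreover have "{0..<s} \<subseteq> {0..1} \<inter> \<gamma> -` (chart_inv c ` Z)"
    using subsetD[OF UK before] s01 by auto
  ultimately have "closure {0..<s} \<subseteq> {0..1} \<inter> \<gamma> -` (chart_inv c ` Z)" by (rule closure_minimal[rotated])
  then have in_K: "\<gamma> u \<in> chart_inv c ` Z" if "u \<in> {0..s}" for u using that s0 by auto
  have KU: "y \<in> fst c \<and> norm (L *v (snd c y - z0)) \<le> R" if y: "y \<in> chart_inv c ` Z" for y
  proof -
    obtain z where z: "z \<in> Z" "y = chart_inv c z" using y by blast
    then have "z \<in> snd c ` fst c" using sub by (auto simp: Z_def)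
    then show ?thesis using z chartD(7,8)[OF c] by (auto simp: Z_def)
  qed
  have "ennreal ((1 - \<epsilon>) * norm (L *v (snd c (\<gamma> s) - z0) - L *v (snd c (\<gamma> 0) - z0))) \<le> curve_length A g \<gamma>"
    by (rule length_inside[OF n \<gamma> s01(1,2)]) (use in_K KU in blast)
  moreover have "R \<le> norm (L *v (snd c (\<gamma> s) - z0))"
    using s01(3) KU[OF in_K[of s]] s01 by (auto simp: U_def)
  then have "R - norm (L *v (snd c (\<gamma> 0) - z0)) \<le> norm (L *v (snd c (\<gamma> s) - z0) - L *v (snd c (\<gamma> 0) - z0))"
    using norm_triangle_ineq2[of "L *v (snd c (\<gamma> s) - z0)" "L *v (snd c (\<gamma> 0) - z0)"] by linarith
  then have "ennreal ((1 - \<epsilon>) * (R - norm (L *v (snd c (\<gamma> 0) - z0))))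
    \<le> ennreal ((1 - \<epsilon>) * norm (L *v (snd c (\<gamma> s) - z0) - L *v (snd c (\<gamma> 0) - z0)))"
    using \<epsilon> by (intro ennreal_leI mult_left_mono) auto
  ultimately show ?thesis by (rule order_trans[rotated])
qed

text \<open>By \<open>length_exit\<close>, curves shorter than the threshold remain in the
  ellipsoid, where \<open>length_inside\<close> bounds them from below. Longer ones are covered by
  the minimum with the threshold, which drops out because dst x y lies under it.\<close>

lemma dst_lower_bound:
  assumes n: "normalized c z0 L \<epsilon> R" and x: "x \<in> fst c" "norm (L *v (snd c x - z0)) < R"
    and d: "dst x y < ennreal ((1 - \<epsilon>) * (R - norm (L *v (snd c x - z0))))"
  shows "y \<in> fst c" "norm (L *v (snd c y - z0)) < R"
    and "ennreal ((1 - \<epsilon>) * norm (L *v (snd c x - snd c y))) \<le> dst x y"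
proof -
  define l where "l = ennreal ((1 - \<epsilon>) * (R - norm (L *v (snd c x - z0))))"
  have stay: "\<gamma> t \<in> fst c \<and> norm (L *v (snd c (\<gamma> t) - z0)) < R"
    if "piecewise_C1_curve M A \<gamma>" "pathstart \<gamma> = x" "curve_length A g \<gamma> < l" "t \<in> {0..1}" for \<gamma> t
    using length_exit[OF n that(1) _ _ that(4)] that x by (force simp: pathstart_def l_def)
  obtain \<gamma> where \<gamma>: "piecewise_C1_curve M A \<gamma>" "pathstart \<gamma> = x" "pathfinish \<gamma> = y" "curve_length A g \<gamma> < l"
    using d unfolding dst_def l_def[symmetric] INF_less_iff by blast
  show "y \<in> fst c" "norm (L *v (snd c y - z0)) < R"
    using stay[OF \<gamma>(1,2,4), of 1] \<gamma>(3) by (auto simp: pathfinish_def)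
  have "min l (ennreal ((1 - \<epsilon>) * norm (L *v (snd c x - snd c y)))) \<le> dst x y"
  proof (rule dst_greatest)
    fix \<gamma> assume \<gamma>: "piecewise_C1_curve M A \<gamma>" "pathstart \<gamma> = x" "pathfinish \<gamma> = y"
    show "min l (ennreal ((1 - \<epsilon>) * norm (L *v (snd c x - snd c y)))) \<le> curve_length A g \<gamma>"
    proof (cases "curve_length A g \<gamma> < l")
      case True
      have "ennreal ((1 - \<epsilon>) * norm (L *v (snd c (\<gamma> 1) - z0) - L *v (snd c (\<gamma> 0) - z0))) \<le> curve_length A g \<gamma>"
        by (rule length_inside[OF n \<gamma>(1)]) (use stay[OF \<gamma>(1,2) True] in \<open>force intro: less_imp_le\<close>)+
      moreover have "L *v (snd c (\<gamma> 1) - z0) - L *v (snd c (\<gamma> 0) - z0) = - (L *v (snd c x - snd c y))"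
        using \<gamma> by (simp add: pathstart_def pathfinish_def matrix_vector_mult_diff_distrib)
      ultimately show ?thesis by (simp add: min.coboundedI2)
    qed (simp add: min.coboundedI1)
  qed
  then show "ennreal ((1 - \<epsilon>) * norm (L *v (snd c x - snd c y))) \<le> dst x y"
    using d unfolding l_def[symmetric] by (auto simp: min_le_iff_disj not_le[symmetric])
qed

end

section \<open>The Riemannian volume\<close>

locale compact_riem = riem_manifold M A g
  for M :: "'m::t2_space set" and A :: "('m, 'n::finite) chart set" and g +
  assumes compact_M: "compact M"
begin

abbreviation bM :: "'m measure" where "bM \<equiv> restrict_space borel M"

section \<open>The volume of a set within one chart\<close>

definition dens :: "('m, 'n) chart \<Rightarrow> real^'n \<Rightarrow> ennreal" where
  "dens c z = ennreal (sqrt (det (g c (chart_inv c z))))"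

definition chart_vol :: "('m, 'n) chart \<Rightarrow> 'm set \<Rightarrow> ennreal" where
  "chart_vol c B = (\<integral>\<^sup>+z. dens c z * indicator (snd c ` B) z \<partial>lborel)"

lemma space_bM [simp]: "space bM = M" by (simp add: space_restrict_space)

lemma openin_sets_bM:
  assumes "openin (top_of_set M) U" shows "U \<in> sets bM"
proof -
  obtain W where "open W" "U = M \<inter> W" using assms by (auto simp: openin_open)
  then show ?thesis unfolding sets_restrict_space by (intro image_eqI[of _ _ W]) auto
qed

lemma chart_sets: "c \<in> A \<Longrightarrow> fst c \<in> sets bM"
  using chartD(1) openin_sets_bM by blast

lemma chart_inv_measurable:
  assumes "c \<in> A" shows "chart_inv c \<in> borel_measurable (restrict_space borel (snd c ` fst c))"
  using chartD(5)[OF assms] by (rule borel_measurable_continuous_on_restrict)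

text \<open>The image is a preimage under the inverse chart, which is continuous on an open
  set.\<close>

lemma chart_image_borel:
  assumes c: "c \<in> A" and B: "B \<in> sets bM" "B \<subseteq> fst c"
  shows "snd c ` B \<in> sets borel"
proof -
  obtain B' where B': "B' \<in> sets borel" "B = M \<inter> B'" using B(1) by (auto simp: sets_restrict_space)
  have "snd c ` B = chart_inv c -` B' \<inter> space (restrict_space borel (snd c ` fst c))"
  proof (rule antisym; rule subsetI)
    fix z assume "z \<in> snd c ` B"
    then show "z \<in> chart_inv c -` B' \<inter> space (restrict_space borel (snd c ` fst c))"
      using B B' chartD(6)[OF c] by (auto simp: space_restrict_space)
  next
    fix z assume z: "z \<in> chart_inv c -` B' \<inter> space (restrict_space borel (snd c ` fst c))"
    then have zi: "z \<in> snd c ` fst c" by (simp add: space_restrict_space)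
    then have "chart_inv c z \<in> B" using z chartD(2,8)[OF c] B' by auto
    then show "z \<in> snd c ` B" using chartD(7)[OF c zi] by (metis imageI)
  qed
  moreover have "\<dots> \<in> sets (restrict_space borel (snd c ` fst c))"
    by (rule measurable_sets[OF chart_inv_measurable[OF c] B'(1)])
  ultimately show ?thesis using chartD(3)[OF c] by (auto simp: sets_restrict_space)
qed

lemma dens_measurable:
  assumes "c \<in> A"
  shows "(\<lambda>z. indicator (snd c ` fst c) z * dens c z) \<in> borel_measurable borel"
proof -
  have "continuous_on (snd c ` fst c) (\<lambda>z. sqrt (det (g c (chart_inv c z))))"
    unfolding det_def by (intro continuous_intros g_continuous assms)
  then have "(\<lambda>z. indicator (snd c ` fst c) z *\<^sub>R sqrt (det (g c (chart_inv c z)))) \<in> borel_measurable borel"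
    using chartD(3)[OF assms] by (intro borel_measurable_continuous_on_indicator) auto
  then have "(\<lambda>z. ennreal (indicator (snd c ` fst c) z *\<^sub>R sqrt (det (g c (chart_inv c z))))) \<in> borel_measurable borel"
    by measurable
  moreover have "(\<lambda>z. ennreal (indicator (snd c ` fst c) z *\<^sub>R sqrt (det (g c (chart_inv c z)))))
     = (\<lambda>z. indicator (snd c ` fst c) z * dens c z)" by (auto simp: dens_def indicator_def)
  ultimately show ?thesis by simp
qed

lemma dens_measurable':
  assumes "c \<in> A" "B \<in> sets bM" "B \<subseteq> fst c"
  shows "(\<lambda>z. dens c z * indicator (snd c ` B) z) \<in> borel_measurable borel"
proof -
  have [measurable]: "snd c ` B \<in> sets borel" using assms by (rule chart_image_borel)
  have "(\<lambda>z. (indicator (snd c ` fst c) z * dens c z) * indicator (snd c ` B) z) \<in> borel_measurable borel"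
    using dens_measurable[OF assms(1)] by measurable
  moreover have "(\<lambda>z. (indicator (snd c ` fst c) z * dens c z) * indicator (snd c ` B) z) = (\<lambda>z. dens c z * indicator (snd c ` B) z)"
    using image_mono[OF assms(3), of "snd c"] by (intro ext) (auto simp: indicator_def)
  ultimately show ?thesis by simp
qed

text \<open>Change of variables along the transition map: taking determinants in the transformation
  law, sqrt (det g) in the chart c is |det J| times that in d, which is the Jacobian factor.\<close>

lemma chart_vol_overlap:
  assumes c: "c \<in> A" and d: "d \<in> A" and B: "B \<in> sets bM" "B \<subseteq> fst c \<inter> fst d"
  shows "chart_vol c B = chart_vol d B"
proof -
  let ?O = "snd c ` (fst c \<inter> fst d)" and ?S = "snd c ` B" and ?f = "transition_map c d"
  have S: "?S \<in> sets borel" using chart_image_borel[OF c B(1)] B(2) by auto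
  have SO: "?S \<subseteq> ?O" using B by auto
  have fS: "?f ` ?S = snd d ` B"
    using transition(1)[OF c d] B(2) by (force simp: image_image)
  have dB: "snd d ` B \<in> sets borel" using chart_image_borel[OF d B(1)] B(2) by auto
  have "continuous_on ?O (\<lambda>z. \<bar>det (matrix (jac c d z))\<bar>)"
    unfolding det_def matrix_def by (simp, intro continuous_intros transition(4)[OF c d])
  then have "(\<lambda>z. indicator ?S z *\<^sub>R \<bar>det (matrix (jac c d z))\<bar>) \<in> borel_measurable borel"
    using S SO by (intro borel_measurable_continuous_on_indicator) (auto intro: continuous_on_subset)
  then have meas: "(\<lambda>z. indicator ?S z * \<bar>det (matrix (jac c d z))\<bar>) \<in> borel_measurable borel" by simp
  have "chart_vol d B = (\<integral>\<^sup>+y. indicator (?f ` ?S) y * (indicator (snd d ` fst d) y * dens d y) \<partial>lborel)"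
    unfolding chart_vol_def fS using B(2) by (intro nn_integral_cong) (auto simp: indicator_def)
  also have "\<dots> = (\<integral>\<^sup>+x. ennreal (indicator ?S x * \<bar>det (matrix (jac c d x))\<bar>) * (indicator (snd d ` fst d) (?f x) * dens d (?f x)) \<partial>lborel)"
  proof (rule nn_integral_change_of_variables[OF S _ _ _ meas dens_measurable[OF d]])
    show "(?f has_derivative jac c d x) (at x within ?S)" if "x \<in> ?S" for x
      using transition(2)[OF c d, of x] SO that by (auto intro: has_derivative_at_withinI)
    show "inj_on ?f ?S"
    proof (rule inj_onI)
      fix z w assume zw: "z \<in> ?S" "w \<in> ?S" "?f z = ?f w"
      then obtain x y where xy: "x \<in> B" "y \<in> B" "z = snd c x" "w = snd c y" by auto
      then have "snd d x = snd d y" using zw transition(1)[OF c d] B(2) by (metis subsetD)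
      then have "x = y" using chartD(9)[OF d] xy B(2) by (auto dest: inj_onD)
      then show "z = w" using xy by simp
    qed
    show "?f ` ?S \<in> sets borel" unfolding fS by (rule dB)
  qed
  also have "\<dots> = chart_vol c B"
    unfolding chart_vol_def
  proof (rule nn_integral_cong)
    fix z
    show "ennreal (indicator ?S z * \<bar>det (matrix (jac c d z))\<bar>) * (indicator (snd d ` fst d) (?f z) * dens d (?f z)) = dens c z * indicator ?S z"
    proof (cases "z \<in> ?S")
      case True
      then obtain x where x: "x \<in> B" "z = snd c x" by auto
      have xcd: "x \<in> fst c \<inter> fst d" using x B by auto
      have fz: "?f z = snd d x" using transition(1)[OF c d xcd] x by simp
      define J where "J = matrix (jac c d z)"
      have "g c x = transpose J ** g d x ** J"
        using metric_g c d xcd unfolding riemannian_metric_def J_def Let_def x(2) by blast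
      then have "det (g c x) = (det J)\<^sup>2 * det (g d x)" by (simp add: det_mul power2_eq_square)
      then have "sqrt (det (g c x)) = \<bar>det J\<bar> * sqrt (det (g d x))" by (simp add: real_sqrt_mult)
      then have "dens c z = ennreal \<bar>det J\<bar> * dens d (snd d x)"
        using x xcd chartD(6)[OF c] chartD(6)[OF d] by (simp add: dens_def ennreal_mult')
      then show ?thesis using True fz xcd by (simp add: J_def)
    qed simp
  qed
  finally show ?thesis by simp
qed

lemma chart_vol_suminf:
  fixes B :: "nat \<Rightarrow> 'm set"
  assumes c: "c \<in> A" and B: "\<And>i. B i \<in> sets bM" "\<And>i. B i \<subseteq> fst c" "disjoint_family B"
  shows "(\<Sum>i. chart_vol c (B i)) = chart_vol c (\<Union>i. B i)"
proof -
  have "disjoint_family (\<lambda>i. snd c ` B i)"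
    unfolding disjoint_family_on_def
  proof (intro ballI impI)
    fix i j :: nat assume "i \<noteq> j"
    then have "B i \<inter> B j = {}" using B(3) by (auto simp: disjoint_family_on_def)
    then show "snd c ` B i \<inter> snd c ` B j = {}"
      using inj_on_image_Int[OF chartD(9)[OF c] B(2) B(2), of i j] by simp
  qed
  then have s: "(\<Sum>i. indicator (snd c ` B i) z) = (indicator (\<Union>i. snd c ` B i) z :: ennreal)" for z
    by (rule suminf_indicator)
  have "(\<Sum>i. chart_vol c (B i)) = (\<integral>\<^sup>+z. (\<Sum>i. dens c z * indicator (snd c ` B i) z) \<partial>lborel)"
    unfolding chart_vol_def using dens_measurable'[OF c B(1,2)] by (intro nn_integral_suminf[symmetric]) auto
  also have "\<dots> = chart_vol c (\<Union>i. B i)"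
    unfolding chart_vol_def by (simp add: s image_UN)
  finally show ?thesis .
qed

lemma chart_vol_empty [simp]: "chart_vol c {} = 0" by (simp add: chart_vol_def)

lemma openin_cover_finite:
  assumes "\<And>x. x \<in> M \<Longrightarrow> openin (top_of_set M) (U x) \<and> x \<in> U x"
  obtains F where "finite F" "F \<subseteq> M" "M \<subseteq> (\<Union>x\<in>F. U x)"
proof -
  have "\<exists>\<D>\<subseteq>U ` M. finite \<D> \<and> M \<subseteq> \<Union>\<D>"
    using compact_M[unfolded compact_eq_openin_cover, rule_format, of "U ` M"] assms by blast
  then obtain \<D> where \<D>: "\<D> \<subseteq> U ` M" "finite \<D>" "M \<subseteq> \<Union>\<D>" by blast
  then obtain F where "F \<subseteq> M" "finite F" "\<D> = U ` F" by (meson finite_subset_image)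
  then show ?thesis using that \<D> by blast
qed

text \<open>Compactness selects finitely many chart domains, and \<open>disjointed\<close> cuts them
  into disjoint Borel cells. The sequence continues with empty sets so that countable additivity can
  be quoted.\<close>

lemma ex_cells:
  obtains f :: "nat \<Rightarrow> ('m, 'n) chart" and m E where "\<And>i. i < m \<Longrightarrow> f i \<in> A"
    "\<And>i. E i \<in> sets bM" "\<And>i. i < m \<Longrightarrow> E i \<subseteq> fst (f i)" "\<And>i. \<not> i < m \<Longrightarrow> E i = {}"
    "disjoint_family E" "(\<Union>i. E i) = M"
proof -
  have "\<forall>x\<in>M. \<exists>c. c \<in> A \<and> x \<in> fst c" using chart_ex by blast
  then obtain ch where ch: "\<And>x. x \<in> M \<Longrightarrow> ch x \<in> A \<and> x \<in> fst (ch x)" by metis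
  obtain F where F: "finite F" "F \<subseteq> M" "M \<subseteq> (\<Union>x\<in>F. fst (ch x))"
    using openin_cover_finite[of "\<lambda>x. fst (ch x)"] ch chartD(1) by metis
  obtain h where h: "bij_betw h {..<card F} F" using ex_bij_betw_nat_finite[OF F(1)] by (auto simp: atLeast0LessThan)
  define U where "U i = (if i < card F then fst (ch (h i)) else {})" for i
  have hA: "ch (h i) \<in> A" if "i < card F" for i using h that F(2) ch by (auto simp: bij_betw_def)
  have Us: "U i \<in> sets bM" for i using hA chart_sets by (auto simp: U_def)
  show ?thesis
  proof (rule that[of "card F" "\<lambda>i. ch (h i)" "disjointed U"])
    show "disjointed U i \<in> sets bM" for i
      using sets.range_disjointed_sets[of U bM] Us by auto
    show "disjointed U i \<subseteq> fst (ch (h i))" if "i < card F" for i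
      using disjointed_subset[of U i] that by (simp add: U_def)
    show "disjointed U i = {}" if "\<not> i < card F" for i
      using disjointed_subset[of U i] that by (simp add: U_def)
    show "(\<Union>i. disjointed U i) = M"
    proof -
      have "(\<Union>i. disjointed U i) = (\<Union>i. U i)" by (rule UN_disjointed_eq)
      also have "\<dots> = (\<Union>i\<in>{..<card F}. fst (ch (h i)))" by (auto simp: U_def split: if_splits)
      also have "\<dots> = (\<Union>x\<in>h ` {..<card F}. fst (ch x))" by simp
      also have "h ` {..<card F} = F" using h by (rule bij_betw_imp_surj_on)
      also have "(\<Union>x\<in>F. fst (ch x)) = M" using F ch chartD(2) by blast
      finally show ?thesis .
    qed
  qed (use hA in \<open>auto simp: disjoint_family_disjointed\<close>)
qed

section \<open>Existence, uniqueness and finiteness of the volume measure\<close>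

definition is_vol :: "'m measure \<Rightarrow> bool" where
  "is_vol V \<longleftrightarrow> space V = M \<and> sets V = sets bM \<and>
     (\<forall>c\<in>A. \<forall>B\<in>sets V. B \<subseteq> fst c \<longrightarrow> emeasure V B = chart_vol c B)"

text \<open>Each cell lies in one chart, where the defining formula determines the measure; the
  cells partition M.\<close>

lemma is_vol_unique:
  assumes "is_vol V" "is_vol V'" shows "V = V'"
proof (rule measure_eqI)
  show "sets V = sets V'" using assms by (simp add: is_vol_def)
  fix B assume B: "B \<in> sets V"
  obtain f :: "nat \<Rightarrow> ('m, 'n) chart" and m E where E: "\<And>i. i < m \<Longrightarrow> f i \<in> A"
    "\<And>i. E i \<in> sets bM" "\<And>i. i < m \<Longrightarrow> E i \<subseteq> fst (f i)" "\<And>i. \<not> i < m \<Longrightarrow> E i = {}"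
    "disjoint_family E" "(\<Union>i. E i) = M" by (rule ex_cells, rule that)
  have Bs: "B \<in> sets bM" using B assms by (simp add: is_vol_def)
  have BE: "B \<inter> E i \<in> sets bM" for i using Bs E(2) by auto
  have un: "(\<Union>i. B \<inter> E i) = B" using sets.sets_into_space[OF Bs] E(6) by auto
  have dis: "disjoint_family (\<lambda>i. B \<inter> E i)" using E(5) by (auto simp: disjoint_family_on_def)
  have cell: "emeasure V (B \<inter> E i) = emeasure V' (B \<inter> E i)" for i
  proof (cases "i < m")
    case True
    then show ?thesis using assms E(1,3)[OF True] BE[of i] unfolding is_vol_def by (metis le_infI2)
  qed (simp add: E(4))
  have s: "sets V = sets bM" "sets V' = sets bM" using assms by (auto simp: is_vol_def)
  have rs: "range (\<lambda>i. B \<inter> E i) \<subseteq> sets V" "range (\<lambda>i. B \<inter> E i) \<subseteq> sets V'" using BE s by auto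
  have "emeasure V B = (\<Sum>i. emeasure V (B \<inter> E i))"
    using suminf_emeasure[OF rs(1) dis] un by simp
  also have "\<dots> = (\<Sum>i. emeasure V' (B \<inter> E i))" by (simp add: cell)
  also have "\<dots> = emeasure V' B"
    using suminf_emeasure[OF rs(2) dis] un by simp
  finally show "emeasure V B = emeasure V' B" .
qed

text \<open>The measure adds up, over the cells, the volume of the part in each cell, computed in
  the chart of that cell. For a set inside one chart, \<open>chart_vol_overlap\<close> moves all
  terms to that chart and \<open>chart_vol_suminf\<close> reassembles them.\<close>

lemma ex_is_vol: "\<exists>V. is_vol V"
proof -
  obtain f :: "nat \<Rightarrow> ('m, 'n) chart" and m E where E: "\<And>i. i < m \<Longrightarrow> f i \<in> A"
    "\<And>i. E i \<in> sets bM" "\<And>i. i < m \<Longrightarrow> E i \<subseteq> fst (f i)" "\<And>i. \<not> i < m \<Longrightarrow> E i = {}"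
    "disjoint_family E" "(\<Union>i. E i) = M" by (rule ex_cells, rule that)
  define \<mu> where "\<mu> B = (\<Sum>i<m. chart_vol (f i) (B \<inter> E i))" for B
  define V where "V = measure_of M (sets bM) \<mu>"
  have sV: "sets V = sets bM" "space V = M"
    using sets.sets_measure_of_eq[of bM] sets.space_measure_of_eq[of bM] by (auto simp: V_def)
  have ca: "countably_additive (sets bM) \<mu>"
    unfolding countably_additive_def
  proof (intro allI impI)
    fix B :: "nat \<Rightarrow> 'm set" assume B: "range B \<subseteq> sets bM" "disjoint_family B" "\<Union>(range B) \<in> sets bM"
    have "(\<Sum>j. \<mu> (B j)) = (\<Sum>i<m. \<Sum>j. chart_vol (f i) (B j \<inter> E i))"
      unfolding \<mu>_def by (rule suminf_sum) simp
    also have "\<dots> = (\<Sum>i<m. chart_vol (f i) (\<Union>j. B j \<inter> E i))"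
    proof (rule sum.cong[OF refl], rule chart_vol_suminf)
      fix i assume i: "i \<in> {..<m}"
      show "f i \<in> A" using E i by simp
      show "B j \<inter> E i \<in> sets bM" for j using B E by auto
      show "B j \<inter> E i \<subseteq> fst (f i)" for j using E(3) i by auto
      show "disjoint_family (\<lambda>j. B j \<inter> E i)" using B(2) by (auto simp: disjoint_family_on_def)
    qed
    also have "\<dots> = \<mu> (\<Union>(range B))" by (simp add: \<mu>_def)
    finally show "(\<Sum>j. \<mu> (B j)) = \<mu> (\<Union>(range B))" .
  qed
  have em: "emeasure V B = \<mu> B" if "B \<in> sets bM" for B
    unfolding V_def
    by (rule emeasure_measure_of_sigma[OF _ _ ca that])
       (use sets.sigma_algebra_axioms[of bM] in \<open>auto simp: positive_def \<mu>_def\<close>)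
  have "is_vol V"
    unfolding is_vol_def sV
  proof (intro conjI ballI impI)
    fix c B assume c: "c \<in> A" and B: "B \<in> sets bM" "B \<subseteq> fst c"
    have "emeasure V B = (\<Sum>i<m. chart_vol c (B \<inter> E i))"
      unfolding em[OF B(1)] \<mu>_def
    proof (rule sum.cong[OF refl], rule chart_vol_overlap)
      fix i assume i: "i \<in> {..<m}"
      show "f i \<in> A" using E i by simp
      show "B \<inter> E i \<in> sets bM" using B E by auto
      show "B \<inter> E i \<subseteq> fst (f i) \<inter> fst c" using E(3) i B by auto
    qed (rule c)
    also have "\<dots> = (\<Sum>i. chart_vol c (B \<inter> E i))"
      by (rule suminf_finite[symmetric]) (auto simp: E(4))
    also have "\<dots> = chart_vol c (\<Union>i. B \<inter> E i)"
    proof (rule chart_vol_suminf[OF c])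
      show "B \<inter> E i \<in> sets bM" for i using B E by auto
      show "B \<inter> E i \<subseteq> fst c" for i using B by auto
      show "disjoint_family (\<lambda>i. B \<inter> E i)" using E(5) by (auto simp: disjoint_family_on_def)
    qed
    also have "(\<Union>i. B \<inter> E i) = B" using sets.sets_into_space[OF B(1)] E(6) by auto
    finally show "emeasure V B = chart_vol c B" .
  qed auto
  then show ?thesis by blast
qed

abbreviation vol :: "'m measure" where "vol \<equiv> riemannian_volume M A g"

lemma vol_is_vol: "is_vol vol"
proof -
  have "vol = (THE V. is_vol V)"
    unfolding riemannian_volume_def is_vol_def chart_vol_def dens_def ..
  then show ?thesis using theI'[of is_vol] ex_is_vol is_vol_unique by metis
qed

lemma vol_basic [simp]: "space vol = M" "sets vol = sets bM"
  using vol_is_vol by (auto simp: is_vol_def)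

lemma emeasure_vol: "c \<in> A \<Longrightarrow> B \<in> sets bM \<Longrightarrow> B \<subseteq> fst c \<Longrightarrow> emeasure vol B = chart_vol c B"
  using vol_is_vol by (auto simp: is_vol_def)

text \<open>The volume restricted to B and the push-forward of the density on its coordinate image
  agree on measurable sets. \<open>h\<close> completes the inverse chart by a fixed point of B
  outside that image, where the density has been cut to 0.\<close>

lemma nn_integral_vol:
  assumes c: "c \<in> A" and B: "B \<in> sets bM" "B \<subseteq> fst c" and F[measurable]: "F \<in> borel_measurable vol"
  shows "(\<integral>\<^sup>+x. indicator B x * F x \<partial>vol) = (\<integral>\<^sup>+z. dens c z * indicator (snd c ` B) z * F (chart_inv c z) \<partial>lborel)"
proof (cases "B = {}")
  case False
  then obtain x0 where x0: "x0 \<in> B" by blast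
  have x0M: "x0 \<in> M" using x0 sets.sets_into_space[OF B(1)] by auto
  define h where "h z = (if z \<in> snd c ` B then chart_inv c z else x0)" for z
  have cB: "snd c ` B \<in> sets borel" by (rule chart_image_borel[OF c B])
  have hB: "h z \<in> B" for z using x0 chartD(6)[OF c] B(2) by (auto simp: h_def)
  have [measurable]: "h \<in> measurable borel vol"
  proof -
    have "chart_inv c \<in> borel_measurable (restrict_space borel (snd c ` B))"
      using continuous_on_subset[OF chartD(5)[OF c]] B(2) by (intro borel_measurable_continuous_on_restrict) blast
    then have "h \<in> borel_measurable borel"
      unfolding h_def[abs_def] using cB by (subst measurable_If_restrict_space_iff) auto
    then have "h \<in> measurable borel bM"
      by (rule measurable_restrict_space2[rotated]) (use hB sets.sets_into_space[OF B(1)] in auto)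
    then show ?thesis by (subst measurable_cong_sets[OF refl vol_basic(2)])
  qed
  define w where "w z = dens c z * indicator (snd c ` B) z" for z
  have [measurable]: "w \<in> borel_measurable borel" unfolding w_def[abs_def] by (rule dens_measurable'[OF c B])
  have "density vol (indicator B) = distr (density lborel w) vol h"
  proof (rule measure_eqI)
    fix E assume "E \<in> sets (density vol (indicator B))"
    then have E: "E \<in> sets bM" by simp
    have [measurable]: "B \<in> sets vol" using B by simp
    have BE: "B \<inter> E \<in> sets bM" "B \<inter> E \<subseteq> fst c" using B E by auto
    have "emeasure (density vol (indicator B)) E = emeasure vol (B \<inter> E)"
      using E BE(1) by (simp add: emeasure_density indicator_inter_arith[symmetric])
    also have "\<dots> = (\<integral>\<^sup>+z. dens c z * indicator (snd c ` (B \<inter> E)) z \<partial>lborel)"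
      using emeasure_vol[OF c BE] by (simp add: chart_vol_def)
    also have "\<dots> = (\<integral>\<^sup>+z. w z * indicator (h -` E) z \<partial>lborel)"
    proof (rule nn_integral_cong)
      fix z
      have "z \<in> snd c ` (B \<inter> E) \<longleftrightarrow> z \<in> snd c ` B \<and> h z \<in> E"
        using chartD(6)[OF c] B(2) by (force simp: h_def)
      then show "dens c z * indicator (snd c ` (B \<inter> E)) z = w z * indicator (h -` E) z"
        by (auto simp: w_def indicator_def)
    qed
    also have "\<dots> = emeasure (distr (density lborel w) vol h) E"
      using E measurable_sets[OF \<open>h \<in> measurable borel vol\<close>, of E] by (simp add: emeasure_distr emeasure_density)
    finally show "emeasure (density vol (indicator B)) E = emeasure (distr (density lborel w) vol h) E" .
  qed simp
  then have "(\<integral>\<^sup>+x. F x \<partial>density vol (indicator B)) = (\<integral>\<^sup>+x. F x \<partial>distr (density lborel w) vol h)" by simp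
  moreover have "(\<integral>\<^sup>+x. F x \<partial>density vol (indicator B)) = (\<integral>\<^sup>+x. indicator B x * F x \<partial>vol)"
  proof (rule nn_integral_density)
    have "B \<in> sets vol" using B by simp
    then show "indicator B \<in> borel_measurable vol" by (rule borel_measurable_indicator)
  qed (rule F)
  moreover have "(\<integral>\<^sup>+x. F x \<partial>distr (density lborel w) vol h) = (\<integral>\<^sup>+z. w z * F (h z) \<partial>lborel)"
    by (simp add: nn_integral_density nn_integral_distr)
  ultimately have "(\<integral>\<^sup>+x. indicator B x * F x \<partial>vol) = (\<integral>\<^sup>+z. w z * F (h z) \<partial>lborel)" by simp
  also have "\<dots> = (\<integral>\<^sup>+z. w z * F (chart_inv c z) \<partial>lborel)"
    by (intro nn_integral_cong) (auto simp: h_def w_def)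
  finally show ?thesis by (simp add: w_def)
qed simp

text \<open>Normalized coordinates with \<epsilon> = 1/2 bound the density by 3/2 |det L| on a
  bounded ellipsoid around each point; finitely many such neighbourhoods cover M.\<close>

lemma vol_finite: "finite_measure vol"
proof
  have loc: "\<exists>U. openin (top_of_set M) U \<and> x \<in> U \<and> emeasure vol U < top" if x: "x \<in> M" for x
  proof -
    have half: "0 < (1 / 2 :: real)" "(1 / 2 :: real) < 1" by auto
    obtain c and L :: "real^'n^'n" and R where c: "x \<in> fst c" "normalized c (snd c x) L (1/2) R"
      by (rule ex_normalized[OF x half], rule that)
    have cA: "c \<in> A" and R: "0 < R" and inv: "invertible L"
      and up: "\<And>z. norm (L *v (z - snd c x)) \<le> R \<Longrightarrow> sqrt (det (g c (chart_inv c z))) \<le> (1 + 1 / 2) * \<bar>det L\<bar>"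
      using c(2) by (auto simp: normalized_def)
    obtain b where b: "0 < b" "\<And>v. b * norm v \<le> norm (L *v v)" using invertible_bound[OF inv] by blast
    define U where "U = {y \<in> fst c. norm (L *v (snd c y - snd c x)) < R}"
    have "openin (top_of_set (fst c)) (fst c \<inter> snd c -` {z. norm (L *v (z - snd c x)) < R})"
      by (intro continuous_openin_preimage_gen[OF chartD(4)[OF cA]] open_Collect_less continuous_on_norm
          continuous_on_compose2[OF matrix_vector_mult_linear_continuous_on[of UNIV]] continuous_intros) auto
    moreover have "U = fst c \<inter> snd c -` {z. norm (L *v (z - snd c x)) < R}" by (auto simp: U_def)
    ultimately have Uo: "openin (top_of_set M) U" using chartD(1)[OF cA] openin_trans by metis
    have "emeasure vol U = (\<integral>\<^sup>+z. dens c z * indicator (snd c ` U) z \<partial>lborel)"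
      using emeasure_vol[OF cA openin_sets_bM[OF Uo]] by (simp add: chart_vol_def U_def)
    also have "\<dots> \<le> (\<integral>\<^sup>+z. ennreal ((1 + 1 / 2) * \<bar>det L\<bar>) * indicator (cball (snd c x) (R / b)) z \<partial>lborel)"
    proof (rule nn_integral_mono)
      fix z
      show "dens c z * indicator (snd c ` U) z \<le> ennreal ((1 + 1 / 2) * \<bar>det L\<bar>) * indicator (cball (snd c x) (R / b)) z"
      proof (cases "z \<in> snd c ` U")
        case True
        then have zR: "norm (L *v (z - snd c x)) \<le> R" by (auto simp: U_def)
        then have "b * norm (z - snd c x) \<le> R" using b(2)[of "z - snd c x"] by simp
        then have "z \<in> cball (snd c x) (R / b)" using b by (simp add: dist_norm norm_minus_commute field_simps)
        then show ?thesis using True up[OF zR] by (simp add: dens_def ennreal_leI)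
      qed simp
    qed
    also have "\<dots> = ennreal ((1 + 1 / 2) * \<bar>det L\<bar>) * emeasure lborel (cball (snd c x) (R / b))"
      by (rule nn_integral_cmult_indicator) simp
    also have "\<dots> < top" using emeasure_lborel_cball_finite[of "snd c x" "R / b"] by (simp add: ennreal_mult_less_top)
    finally have "emeasure vol U < top" .
    moreover have "x \<in> U" using c R by (simp add: U_def)
    ultimately show ?thesis using Uo by blast
  qed
  then obtain U where U: "\<And>x. x \<in> M \<Longrightarrow> openin (top_of_set M) (U x) \<and> x \<in> U x \<and> emeasure vol (U x) < top" by metis
  obtain F where F: "finite F" "F \<subseteq> M" "M \<subseteq> (\<Union>x\<in>F. U x)"
    using openin_cover_finite[of U] U by metis
  have Us: "U x \<in> sets vol" if "x \<in> F" for x using U F(2) that openin_sets_bM by auto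
  have "emeasure vol M \<le> emeasure vol (\<Union>x\<in>F. U x)"
    using F Us by (intro emeasure_mono sets.finite_UN) auto
  also have "\<dots> \<le> (\<Sum>x\<in>F. emeasure vol (U x))" using F Us by (intro emeasure_subadditive_finite) auto
  also have "\<dots> < top" using F U by (subst ennreal_sum_less_top) auto
  finally show "emeasure vol (space vol) \<noteq> \<infinity>" by simp
qed

end

section \<open>The Euclidean inequality for nonnegative functions\<close>

text \<open>Dyadic shells: on the m-th one the kernel is at most 2^(s (m + 1)), and the ball
  containing it has volume proportional to 2^(-m n). The series is geometric with ratio 2^(s - n) <
  1.\<close>

lemma riesz_kernel_integrable:
  fixes s :: real
  assumes s: "0 < s" "s < real CARD('n)"
  shows "(\<integral>\<^sup>+w. ennreal (1 / norm w powr s) * indicator (ball 0 1) w \<partial>(lborel :: (real^'n::finite) measure)) < top"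
proof -
  let ?n = "CARD('n)"
  define \<omega> where "\<omega> = unit_ball_vol (real ?n)"
  have \<omega>: "0 \<le> \<omega>" by (simp add: \<omega>_def)
  define a where "a m = 2 powr (s * real (Suc m))" for m :: nat
  define r where "r m = (1 / 2 :: real) ^ m" for m :: nat
  have pw: "ennreal (1 / norm w powr s) * indicator (ball 0 1) w \<le> (\<Sum>m. ennreal (a m) * indicator (ball 0 (r m)) w)" for w :: "real^'n"
  proof (cases "w = 0 \<or> w \<notin> ball 0 1")
    case False
    then have w: "0 < norm w" "norm w < 1" by auto
    obtain k where k: "(1 / 2) ^ k < norm w" using real_arch_pow_inv[of "norm w" "1 / 2"] w by auto
    \<comment> \<open>The shell of w: 2^(-m-1) <= |w| < 2^(-m), the second inequality by minimality
      of m.\<close>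
    define m where "m = (LEAST k. (1 / 2) ^ Suc k \<le> norm w)"
    have "(1 / 2) ^ Suc k \<le> norm w" using k power_decreasing[of k "Suc k" "1 / 2 :: real"] by linarith
    then have m: "(1 / 2) ^ Suc m \<le> norm w" unfolding m_def by (rule LeastI)
    have "norm w < (1 / 2) ^ m"
    proof (cases m)
      case (Suc j)
      then have "\<not> (1 / 2) ^ Suc j \<le> norm w" unfolding m_def using not_less_Least[of j] by (metis lessI)
      then show ?thesis using Suc by simp
    qed (use w in simp)
    then have ind: "w \<in> ball 0 (r m)" by (simp add: r_def)
    have "(1 / 2) ^ Suc m = 2 powr (- real (Suc m))"
      by (simp only: powr_minus powr_realpow[OF zero_less_numeral] power_one_over inverse_eq_divide)
    then have "(2 powr (- real (Suc m))) powr s \<le> norm w powr s" using m s by (intro powr_mono2) auto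
    then have "1 / norm w powr s \<le> 1 / (2 powr (- real (Suc m))) powr s" by (intro divide_left_mono) (use w in auto)
    also have "(2 powr (- real (Suc m))) powr s = 2 powr (- (s * real (Suc m)))"
      by (simp only: powr_powr mult_minus_left mult_minus_right mult.commute)
    also have "1 / 2 powr (- (s * real (Suc m))) = a m" by (simp only: powr_minus_divide a_def divide_divide_eq_right mult_1)
    finally have "ennreal (1 / norm w powr s) * indicator (ball 0 1) w \<le> ennreal (a m) * indicator (ball 0 (r m)) w"
      using ind False by (simp add: ennreal_leI)
    also have "\<dots> \<le> (\<Sum>m. ennreal (a m) * indicator (ball 0 (r m)) w)"
    proof -
      define G where "G m = ennreal (a m) * indicator (ball 0 (r m)) w" for m
      have "sum G {m} \<le> suminf G" by (intro sum_le_suminf) auto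
      then show ?thesis by (simp add: G_def[symmetric])
    qed
    finally show ?thesis .
  qed auto
  define \<theta> where "\<theta> = (2 :: real) powr (s - real ?n)"
  have \<theta>: "0 < \<theta>" "\<theta> < 1" using s by (auto simp: \<theta>_def powr_less_one)
  have summand: "a m * (\<omega> * r m ^ ?n) = 2 powr s * \<omega> * \<theta> ^ m" for m
  proof -
    have "r m ^ ?n = 2 powr (- real ?n * real m)"
      by (simp add: r_def power_mult[symmetric] powr_minus powr_realpow power_one_over inverse_eq_divide mult.commute flip: of_nat_mult)
    moreover have "\<theta> ^ m = 2 powr ((s - real ?n) * real m)" by (simp add: \<theta>_def powr_power mult.commute)
    ultimately show ?thesis by (simp add: a_def powr_add[symmetric] algebra_simps)
  qed
  have "(\<integral>\<^sup>+w. ennreal (1 / norm w powr s) * indicator (ball 0 1) w \<partial>(lborel :: (real^'n) measure))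
     \<le> (\<integral>\<^sup>+w. (\<Sum>m. ennreal (a m) * indicator (ball 0 (r m)) w) \<partial>(lborel :: (real^'n) measure))"
    by (intro nn_integral_mono pw)
  also have "\<dots> = (\<Sum>m. \<integral>\<^sup>+w. ennreal (a m) * indicator (ball 0 (r m)) w \<partial>(lborel :: (real^'n) measure))"
  proof (intro nn_integral_suminf)
    fix m
    have [measurable]: "ball 0 (r m) \<in> sets (borel :: (real^'n) measure)" by auto
    show "(\<lambda>w. ennreal (a m) * indicator (ball 0 (r m)) w) \<in> borel_measurable (lborel :: (real^'n) measure)" by measurable
  qed
  also have "\<dots> = (\<Sum>m. ennreal (2 powr s * \<omega> * \<theta> ^ m))"
  proof (rule suminf_cong)
    fix m
    have "(\<integral>\<^sup>+w. ennreal (a m) * indicator (ball 0 (r m)) w \<partial>(lborel :: (real^'n) measure)) = ennreal (a m) * ennreal (\<omega> * r m ^ ?n)"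
      by (subst nn_integral_cmult_indicator) (auto simp: emeasure_ball r_def \<omega>_def)
    also have "\<dots> = ennreal (a m * (\<omega> * r m ^ ?n))" by (rule ennreal_mult'[symmetric]) (simp add: a_def)
    finally show "(\<integral>\<^sup>+w. ennreal (a m) * indicator (ball 0 (r m)) w \<partial>(lborel :: (real^'n) measure)) = ennreal (2 powr s * \<omega> * \<theta> ^ m)"
      by (simp only: summand)
  qed
  also have "\<dots> = ennreal (\<Sum>m. 2 powr s * \<omega> * \<theta> ^ m)"
    using \<theta> \<omega> by (intro suminf_ennreal_eq summable_sums summable_mult summable_geometric) auto
  finally show ?thesis by (rule le_less_trans) simp
qed

definition eucl_T :: "real \<Rightarrow> (real^'n::finite \<Rightarrow> ennreal) \<Rightarrow> real^'n \<Rightarrow> ennreal" where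
  "eucl_T s F z = (\<integral>\<^sup>+w. ennreal (1 / norm (z - w) powr s) * F w \<partial>lborel)"

lemma eucl_T_measurable [measurable]:
  assumes [measurable]: "F \<in> borel_measurable borel"
  shows "eucl_T s F \<in> borel_measurable borel"
  unfolding eucl_T_def[abs_def] by measurable

text \<open>Near z the kernel is integrable, and at distance at least 1 it is at most 1. Finiteness
  matters because a divergent integral would be 0 in \<open>riesz_potential\<close>.\<close>

lemma eucl_T_finite:
  fixes F :: "real^'n::finite \<Rightarrow> ennreal"
  assumes s: "0 < s" "s < real CARD('n)" and F: "\<And>w. F w \<le> ennreal b * indicator (ball 0 \<rho>) w"
  shows "eucl_T s F z < top"
proof -
  have [measurable]: "ball 0 1 \<in> sets (borel :: (real^'n) measure)" "ball 0 \<rho> \<in> sets (borel :: (real^'n) measure)" by auto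
  have "eucl_T s F z \<le> (\<integral>\<^sup>+w. ennreal b * (ennreal (1 / norm (z - w) powr s) * indicator (ball 0 1) (z - w)) + ennreal b * indicator (ball 0 \<rho>) w \<partial>lborel)"
    unfolding eucl_T_def
  proof (rule nn_integral_mono)
    fix w
    show "ennreal (1 / norm (z - w) powr s) * F w \<le> ennreal b * (ennreal (1 / norm (z - w) powr s) * indicator (ball 0 1) (z - w)) + ennreal b * indicator (ball 0 \<rho>) w"
    proof (cases "z - w \<in> ball 0 1")
      case True
      have "F w \<le> ennreal b" using F[of w] by (auto simp: indicator_def split: if_splits intro: order_trans)
      then have "ennreal (1 / norm (z - w) powr s) * F w \<le> ennreal (1 / norm (z - w) powr s) * ennreal b" by (intro mult_left_mono) auto
      then show ?thesis using True by (simp add: mult.commute add_increasing2)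
    next
      case False
      then have "1 powr s \<le> norm (z - w) powr s" using s by (intro powr_mono2) auto
      then have "1 / norm (z - w) powr s \<le> 1" by (auto simp: divide_le_eq)
      then have "ennreal (1 / norm (z - w) powr s) * F w \<le> 1 * F w" by (intro mult_right_mono) (auto simp: ennreal_le_1)
      then show ?thesis using F[of w] by (simp add: add_increasing)
    qed
  qed
  also have "\<dots> = ennreal b * (\<integral>\<^sup>+w. ennreal (1 / norm (z - w) powr s) * indicator (ball 0 1) (z - w) \<partial>lborel)
      + ennreal b * emeasure lborel (ball (0 :: real^'n) \<rho>)"
    by (subst nn_integral_add) (auto simp: nn_integral_cmult)
  also have "(\<integral>\<^sup>+w. ennreal (1 / norm (z - w) powr s) * indicator (ball 0 1) (z - w) \<partial>lborel)
     = (\<integral>\<^sup>+w. ennreal (1 / norm w powr s) * indicator (ball 0 1) w \<partial>(lborel :: (real^'n) measure))"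
  proof -
    have "(\<integral>\<^sup>+w. ennreal (1 / norm w powr s) * indicator (ball 0 1) w \<partial>(lborel :: (real^'n) measure))
      = (\<integral>\<^sup>+w. ennreal (1 / norm (z - w) powr s) * indicator (ball 0 1) (z - w) \<partial>lborel)"
    proof (subst lborel_affine[of "-1" z])
      show "(\<integral>\<^sup>+w. ennreal (1 / norm w powr s) * indicator (ball 0 1) w
          \<partial>density (distr lborel borel (\<lambda>x. z + (- 1) *\<^sub>R x)) (\<lambda>_. ennreal (\<bar>- 1\<bar> ^ DIM(real^'n))))
        = (\<integral>\<^sup>+w. ennreal (1 / norm (z - w) powr s) * indicator (ball 0 1) (z - w) \<partial>lborel)"
        by (simp add: nn_integral_density nn_integral_distr density_1)
    qed simp
    then show ?thesis by simp
  qed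
  finally show ?thesis
    by (rule le_less_trans) (use riesz_kernel_integrable[OF s] emeasure_lborel_ball_finite[of "0 :: real^'n" \<rho>] in \<open>simp add: ennreal_mult_less_top\<close>)
qed

lemma le_mult_of_divide_le:
  fixes a b c :: ennreal
  assumes "a / b \<le> c" "b \<noteq> 0" "b \<noteq> top"
  shows "a \<le> c * b"
proof -
  have "a = (a / b) * b" using assms(2,3) by (simp add: ennreal_divide_times ennreal_divide_self less_top)
  also have "\<dots> \<le> c * b" using assms(1) by (rule mult_right_mono) simp
  finally show ?thesis .
qed

lemma Lp_norm_eq_nrm:
  "Lp_norm p V f = nrm p V (\<lambda>x. ennreal \<bar>f x\<bar>)"
  by (simp add: Lp_norm_def nrm_def Let_def epow_def)

text \<open>\<open>HLS_constant\<close> is about real functions in L^p and the Bochner integral,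
  with default value 0 in case of divergence. The truncations min F k on the ball of radius k lie in
  L^p and have finite potentials, so the quotient bound applies to them; monotone convergence
  carries it to F.\<close>

lemma eucl_HLS:
  fixes F :: "real^'n::finite \<Rightarrow> ennreal"
  assumes \<alpha>: "0 < \<alpha>" "\<alpha> < real CARD('n)" and p: "1 < p" "1 < q"
    and C: "HLS_constant (lborel :: (real^'n) measure) dist CARD('n) \<alpha> p q \<le> ennreal C"
    and [measurable]: "F \<in> borel_measurable borel"
  shows "nrm q lborel (eucl_T (real CARD('n) - \<alpha>) F) \<le> ennreal C * nrm p lborel F"
proof -
  define s where "s = real CARD('n) - \<alpha>"
  have s: "0 < s" "s < real CARD('n)" using \<alpha> by (auto simp: s_def)
  define f where "f k w = enn2real (min (F w) (of_nat k)) * indicator (ball 0 (real k)) w" for k :: nat and w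
  have [measurable]: "f k \<in> borel_measurable borel" for k
  proof -
    have [measurable]: "ball 0 (real k) \<in> sets (borel :: (real^'n) measure)" by auto
    show ?thesis unfolding f_def[abs_def] by measurable
  qed
  have f0: "0 \<le> f k w" for k w by (simp add: f_def)
  have fF: "ennreal (f k w) = min (F w) (of_nat k) * indicator (ball 0 (real k)) w" for k w
  proof -
    have "min (F w) (of_nat k) < top" by (auto simp: min_less_iff_disj ennreal_of_nat_eq_real_of_nat)
    then show ?thesis by (simp add: f_def indicator_def)
  qed
  have one: "nrm q lborel (eucl_T s (\<lambda>w. ennreal (f k w))) \<le> ennreal C * nrm p lborel (\<lambda>w. ennreal (f k w))" for k
  \<comment> \<open>The supremum runs over nonzero functions, so truncations that vanish almost
    everywhere are treated apart.\<close>
  proof (cases "AE w in lborel. f k w = 0")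
    case True
    have "eucl_T s (\<lambda>w. ennreal (f k w)) z = 0" for z
    proof -
      have "eucl_T s (\<lambda>w. ennreal (f k w)) z = (\<integral>\<^sup>+w. 0 \<partial>(lborel :: (real^'n) measure))"
        unfolding eucl_T_def using True by (intro nn_integral_cong_AE) auto
      then show ?thesis by simp
    qed
    then show ?thesis by (simp add: nrm_def)
  next
    case False
    have fb: "ennreal (f k w) \<le> ennreal (real k) * indicator (ball 0 (real k)) w" for w
      unfolding fF by (auto simp: indicator_def ennreal_of_nat_eq_real_of_nat)
    have "(\<integral>\<^sup>+w. epow (ennreal (f k w)) p \<partial>lborel) \<le> (\<integral>\<^sup>+w. ennreal (real k powr p) * indicator (ball 0 (real k)) w \<partial>(lborel :: (real^'n) measure))"
    proof (rule nn_integral_mono)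
      fix w
      have "epow (ennreal (f k w)) p \<le> epow (ennreal (real k) * indicator (ball 0 (real k)) w) p"
        using fb p by (intro epow_mono) auto
      then show "epow (ennreal (f k w)) p \<le> ennreal (real k powr p) * indicator (ball 0 (real k)) w"
        by (auto simp: indicator_def)
    qed
    also have "\<dots> < top"
      using emeasure_lborel_ball_finite[of "0 :: real^'n" "real k"] by (simp add: nn_integral_cmult_indicator ennreal_mult_less_top)
    finally have fin: "nrm p lborel (\<lambda>w. ennreal (f k w)) < top" by (simp add: nrm_def)
    have Lp: "Lp_norm p lborel (f k) = nrm p lborel (\<lambda>w. ennreal (f k w))" by (simp add: Lp_norm_eq_nrm f0)
    have mem: "f k \<in> Lp_nonzero p lborel" using fin False by (simp add: Lp_nonzero_def Lp)
    have r: "riesz_potential lborel dist CARD('n) \<alpha> (f k) z = enn2real (eucl_T s (\<lambda>w. ennreal (f k w)) z)" for z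
    proof -
      have "riesz_potential lborel dist CARD('n) \<alpha> (f k) z = enn2real (\<integral>\<^sup>+w. ennreal (f k w / dist z w powr s) \<partial>lborel)"
        unfolding riesz_potential_def s_def[symmetric] using f0 by (intro integral_eq_nn_integral) auto
      also have "(\<integral>\<^sup>+w. ennreal (f k w / dist z w powr s) \<partial>lborel) = eucl_T s (\<lambda>w. ennreal (f k w)) z"
        unfolding eucl_T_def by (intro nn_integral_cong) (simp add: dist_norm f0 ennreal_mult'[symmetric])
      finally show ?thesis .
    qed
    have rr: "ennreal \<bar>riesz_potential lborel dist CARD('n) \<alpha> (f k) z\<bar> = eucl_T s (\<lambda>w. ennreal (f k w)) z" for z
      unfolding r using eucl_T_finite[OF s fb] by (simp add: less_top)
    have "HLS_quotient lborel dist CARD('n) \<alpha> p q (f k) \<le> ennreal C"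
      by (rule order_trans[OF SUP_upper[OF mem] C[unfolded HLS_constant_def]])
    then have q: "nrm q lborel (eucl_T s (\<lambda>w. ennreal (f k w))) / nrm p lborel (\<lambda>w. ennreal (f k w)) \<le> ennreal C"
      by (simp add: HLS_quotient_def Lp Lp_norm_eq_nrm[of q] rr)
    have nz: "nrm p lborel (\<lambda>w. ennreal (f k w)) \<noteq> 0"
    proof
      assume "nrm p lborel (\<lambda>w. ennreal (f k w)) = 0"
      then have "AE w in lborel. ennreal (f k w) = 0" using p by (subst (asm) nrm_eq_0_iff) auto
      then have "AE w in lborel. f k w = 0"
      proof eventually_elim
        case (elim w)
        then show ?case using f0[of k w] by (simp add: ennreal_eq_0_iff)
      qed
      then show False using False by simp
    qed
    show ?thesis using le_mult_of_divide_le[OF q nz] fin by simp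
  qed
  have inc: "incseq (\<lambda>k w. ennreal (f k w))"
    unfolding incseq_def le_fun_def
  proof (intro allI impI)
    fix k l :: nat and w :: "real^'n" assume "k \<le> l"
    then have "min (F w) (of_nat k) \<le> min (F w) (of_nat l)" by (intro min.mono) auto
    then show "ennreal (f k w) \<le> ennreal (f l w)" unfolding fF using \<open>k \<le> l\<close> by (auto simp: indicator_def)
  qed
  have sup: "(SUP k. ennreal (f k w)) = F w" for w
  proof (rule antisym)
    show "(SUP k. ennreal (f k w)) \<le> F w" unfolding fF by (intro SUP_least) (auto simp: indicator_def)
    obtain k0 where k0: "norm w < real k0" using reals_Archimedean2 by blast
    show "F w \<le> (SUP k. ennreal (f k w))"
    proof (cases "F w")
      case (real b)
      obtain k1 where k1: "b \<le> real k1" using real_arch_simple by blast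
      define k where "k = max k0 k1"
      have "F w = ennreal (f k w)"
        using k0 k1 real unfolding fF by (auto simp: k_def min_def ennreal_of_nat_eq_real_of_nat)
      then show ?thesis by (metis SUP_upper UNIV_I)
    next
      case top
      have "of_nat k \<le> (SUP k. ennreal (f k w))" for k
      proof -
        have "of_nat k \<le> (of_nat (max k k0) :: ennreal)" by simp
        also have "\<dots> = ennreal (f (max k k0) w)" unfolding fF using top k0 by (simp add: min_def ennreal_of_nat_eq_real_of_nat top_unique)
        also have "\<dots> \<le> (SUP k. ennreal (f k w))" by (rule SUP_upper) simp
        finally show ?thesis .
      qed
      then have "(SUP k. of_nat k) \<le> (SUP k. ennreal (f k w))" by (rule SUP_least)
      then show ?thesis using top ennreal_SUP_of_nat_eq_top by metis
    qed
  qed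
  have "nrm q lborel (eucl_T s F) = nrm q lborel (\<lambda>z. SUP k. eucl_T s (\<lambda>w. ennreal (f k w)) z)"
  proof (rule nrm_cong)
    fix z
    have "(\<integral>\<^sup>+w. ennreal (1 / norm (z - w) powr s) * F w \<partial>lborel) = (\<integral>\<^sup>+w. (SUP k. ennreal (1 / norm (z - w) powr s) * ennreal (f k w)) \<partial>lborel)"
      unfolding SUP_mult_left_ennreal[symmetric] sup ..
    also have "\<dots> = (SUP k. \<integral>\<^sup>+w. ennreal (1 / norm (z - w) powr s) * ennreal (f k w) \<partial>lborel)"
    proof (rule nn_integral_monotone_convergence_SUP)
      show "incseq (\<lambda>k w. ennreal (1 / norm (z - w) powr s) * ennreal (f k w))"
        using inc unfolding incseq_def le_fun_def by (intro allI impI mult_left_mono) auto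
    qed measurable
    finally show "eucl_T s F z = (SUP k. eucl_T s (\<lambda>w. ennreal (f k w)) z)" unfolding eucl_T_def .
  qed
  also have "\<dots> = (SUP k. nrm q lborel (eucl_T s (\<lambda>w. ennreal (f k w))))"
  proof (rule nrm_SUP)
    show "incseq (\<lambda>k. eucl_T s (\<lambda>w. ennreal (f k w)))"
      using inc unfolding incseq_def le_fun_def eucl_T_def by (intro allI impI nn_integral_mono mult_left_mono) auto
  qed (use p in auto)
  also have "\<dots> \<le> ennreal C * nrm p lborel F"
  proof (rule SUP_least)
    fix k
    have "ennreal (f k w) \<le> F w" for w using sup[of w] by (metis SUP_upper UNIV_I)
    then have "nrm p lborel (\<lambda>w. ennreal (f k w)) \<le> nrm p lborel F" using p by (intro nrm_mono) auto
    then show "nrm q lborel (eucl_T s (\<lambda>w. ennreal (f k w))) \<le> ennreal C * nrm p lborel F"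
      using one[of k] by (meson mult_left_mono order_trans zero_le)
  qed
  finally show ?thesis by (simp add: s_def)
qed

lemma nn_integral_linear_image:
  fixes L :: "real^'n::finite^'n"
  assumes L: "invertible L" and [measurable]: "H \<in> borel_measurable borel"
  shows "(\<integral>\<^sup>+y. H y \<partial>lborel) = ennreal \<bar>det L\<bar> * (\<integral>\<^sup>+x. H (L *v x) \<partial>lborel)"
proof -
  have bij: "bij ((*v) L)" using L invertible_eq_bij by blast
  have im: "range ((*v) L) = UNIV" using bij by (simp add: bij_is_surj)
  have [measurable]: "(*v) L \<in> borel_measurable borel"
    by (intro borel_measurable_continuous_onI matrix_vector_mult_linear_continuous_on)
  have "(\<integral>\<^sup>+y. indicator (range ((*v) L)) y * H y \<partial>lborel)
    = (\<integral>\<^sup>+x. ennreal (indicator UNIV x * \<bar>det (matrix ((*v) L))\<bar>) * H (L *v x) \<partial>lborel)"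
  proof (rule nn_integral_change_of_variables)
    show "((*v) L has_derivative (*v) L) (at x within UNIV)" for x
      by (rule bounded_linear_imp_has_derivative[OF matrix_vector_mul_bounded_linear])
    show "inj_on ((*v) L) UNIV" using bij by (simp add: bij_is_inj)
  qed (auto simp: im)
  then show ?thesis by (simp add: im nn_integral_cmult)
qed

text \<open>The Euclidean inequality for the flat metric |L v|^2, with distance |L (z - w)| and
  volume density |det L|. The substitution y = L w turns it into the standard one, so the constant
  is unchanged.\<close>

lemma eucl_HLS_linear:
  fixes F :: "real^'n::finite \<Rightarrow> ennreal" and L :: "real^'n^'n"
  assumes HLS: "\<And>F :: real^'n \<Rightarrow> ennreal. F \<in> borel_measurable borel \<Longrightarrow> nrm q lborel (eucl_T s F) \<le> ennreal C * nrm p lborel F"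
    and L: "invertible L" and p: "1 < p" "1 < q" and [measurable]: "F \<in> borel_measurable borel"
  defines "E \<equiv> \<lambda>z. \<integral>\<^sup>+w. ennreal (1 / norm (L *v (z - w)) powr s) * F w * ennreal \<bar>det L\<bar> \<partial>lborel"
  shows "epow (ennreal \<bar>det L\<bar> * (\<integral>\<^sup>+z. epow (E z) q \<partial>lborel)) (1 / q)
    \<le> ennreal C * epow (ennreal \<bar>det L\<bar> * (\<integral>\<^sup>+w. epow (F w) p \<partial>lborel)) (1 / p)"
proof -
  obtain L' where L': "L' ** L = mat 1" "L ** L' = mat 1" using L unfolding invertible_def by blast
  have inv: "L' *v (L *v z) = z" for z by (simp add: matrix_vector_mul_assoc L')
  have [measurable]: "(*v) L' \<in> borel_measurable borel"
    by (intro borel_measurable_continuous_onI matrix_vector_mult_linear_continuous_on)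
  define F' where "F' y = F (L' *v y)" for y
  have [measurable]: "F' \<in> borel_measurable borel" unfolding F'_def[abs_def] by measurable
  have E: "E z = eucl_T s F' (L *v z)" for z
  proof -
    have "eucl_T s F' (L *v z) = ennreal \<bar>det L\<bar> * (\<integral>\<^sup>+w. ennreal (1 / norm (L *v z - L *v w) powr s) * F' (L *v w) \<partial>lborel)"
      unfolding eucl_T_def by (rule nn_integral_linear_image[OF L]) measurable
    also have "\<dots> = (\<integral>\<^sup>+w. ennreal \<bar>det L\<bar> * (ennreal (1 / norm (L *v z - L *v w) powr s) * F w) \<partial>lborel)"
    proof -
      have [measurable]: "(*v) L \<in> borel_measurable borel"
        by (intro borel_measurable_continuous_onI matrix_vector_mult_linear_continuous_on)
      show ?thesis unfolding F'_def inv by (rule nn_integral_cmult[symmetric]) measurable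
    qed
    finally show ?thesis
      by (simp add: E_def matrix_vector_mult_diff_distrib mult.commute mult.left_commute)
  qed
  have q1: "ennreal \<bar>det L\<bar> * (\<integral>\<^sup>+z. epow (E z) q \<partial>lborel) = (\<integral>\<^sup>+y. epow (eucl_T s F' y) q \<partial>lborel)"
    unfolding E by (rule nn_integral_linear_image[OF L, symmetric]) measurable
  have p1: "ennreal \<bar>det L\<bar> * (\<integral>\<^sup>+w. epow (F w) p \<partial>lborel) = (\<integral>\<^sup>+y. epow (F' y) p \<partial>lborel)"
    by (subst nn_integral_linear_image[OF L]) (auto simp: F'_def inv)
  show ?thesis unfolding q1 p1 using HLS[of F'] by (simp add: nrm_def)
qed

section \<open>The local estimate on the manifold\<close>

text \<open>The loss in passing from the flat metric to the manifold: (1 - e)^(-s) for the kernel, 1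
  + e for the density in the potential, (1 + e)^(1/q) for the density in the L^q norm and (1 -
  e)^(-1/p) for that in the L^p norm. Their product tends to 1 as e tends to 0, and C > N leaves
  room.\<close>

lemma small_distortion:
  fixes N C s p q :: real
  assumes "0 \<le> N" "N < C" "0 < p" "0 < q"
  obtains e where "0 < e" "e < 1"
    "(1 - e) powr (- s) * (1 + e) * (1 + e) powr (1 / q) * N * (1 - e) powr (- 1 / p) \<le> C"
proof -
  define \<phi> where "\<phi> e = (1 - e) powr (- s) * (1 + e) * (1 + e) powr (1 / q) * N * (1 - e) powr (- 1 / p)" for e :: real
  have "(\<phi> \<longlongrightarrow> (1 - 0) powr (- s) * (1 + 0) * (1 + 0) powr (1 / q) * N * (1 - 0) powr (- 1 / p)) (at_right 0)"
    unfolding \<phi>_def by (intro tendsto_intros) auto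
  then have "(\<phi> \<longlongrightarrow> N) (at_right 0)" by simp
  then have "eventually (\<lambda>e. \<phi> e < C) (at_right 0)" using assms(2) by (rule order_tendstoD)
  moreover have "eventually (\<lambda>e::real. 0 < e \<and> e < 1) (at_right 0)"
    by (auto simp: eventually_at_right_field intro!: exI[of _ 1])
  ultimately have "eventually (\<lambda>e. \<phi> e < C \<and> 0 < e \<and> e < 1) (at_right 0)" by (rule eventually_conj)
  then obtain e where "\<phi> e < C" "0 < e" "e < 1" by (auto dest: eventually_happens)
  then show ?thesis by (intro that[of e]) (auto simp: \<phi>_def)
qed

context compact_riem
begin

lemma dst_ball_sets: "x \<in> M \<Longrightarrow> {y \<in> M. dst x y < e} \<in> sets bM"
  using dst_ball_open by (rule openin_sets_bM)

lemma dst_ball_cover: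
  assumes "\<And>x. x \<in> M \<Longrightarrow> 0 < \<rho> x"
  shows "\<exists>F. finite F \<and> F \<subseteq> M \<and> (\<forall>x\<in>M. \<exists>y\<in>F. dst y x < ennreal (\<rho> y))"
proof -
  have o: "openin (top_of_set M) {y \<in> M. dst x y < ennreal (\<rho> x)} \<and> x \<in> {y \<in> M. dst x y < ennreal (\<rho> x)}" if "x \<in> M" for x
    using dst_ball_open[OF that] dst_refl[OF that] assms[OF that] that by simp
  obtain F where F: "finite F" "F \<subseteq> M" "M \<subseteq> (\<Union>x\<in>F. {y \<in> M. dst x y < ennreal (\<rho> x)})"
    using openin_cover_finite[OF o] by blast
  then show ?thesis by (intro exI[of _ F]) blast
qed

lemma chart_map_measurable:
  assumes c: "c \<in> A" and B: "B \<in> sets bM" "B \<subseteq> fst c"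
  shows "(\<lambda>y. if y \<in> B then snd c y else 0) \<in> borel_measurable vol"
proof -
  have BM: "B \<subseteq> M" using sets.sets_into_space[OF B(1)] by simp
  have "snd c \<in> borel_measurable (restrict_space borel B)"
    by (rule borel_measurable_continuous_on_restrict) (rule continuous_on_subset[OF chartD(4)[OF c] B(2)])
  moreover have "sets (restrict_space bM B) = sets (restrict_space borel B)"
    by (simp add: sets_restrict_space image_image Int_assoc[symmetric] Int_absorb2[OF BM])
  ultimately have "snd c \<in> borel_measurable (restrict_space bM B)"
    using measurable_cong_sets by blast
  then have "(\<lambda>y. if y \<in> B then snd c y else 0) \<in> borel_measurable bM"
    using B(1) BM by (subst measurable_If_restrict_space_iff) (simp_all add: Collect_conj_eq Int_absorb1 Int_absorb2)
  then show ?thesis by (subst measurable_cong_sets[OF vol_basic(2) refl])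
qed

text \<open>In normalized coordinates at x0, kernel and density are compared with those of the flat
  metric |L v|^2, for which \<open>eucl_HLS_linear\<close> holds with the constant N. The factors
  collected on the way are those of \<open>small_distortion\<close>.\<close>

lemma local_estimate:
  fixes s p q N C :: real
  assumes HLS: "\<And>F :: real^'n \<Rightarrow> ennreal. F \<in> borel_measurable borel \<Longrightarrow> nrm q lborel (eucl_T s F) \<le> ennreal N * nrm p lborel F"
    and NC: "0 \<le> N" "N < C" and p: "1 < p" "1 < q" and s: "0 < s" and x0: "x0 \<in> M"
  shows "\<exists>r>0. \<forall>f\<in>borel_measurable vol. (\<forall>y\<in>space vol. ennreal r \<le> dst x0 y \<longrightarrow> f y = 0) \<longrightarrow>
      nrm q vol (\<lambda>z. indicator {z \<in> space vol. dst x0 z < ennreal r} z *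
          (\<integral>\<^sup>+y. ennreal (1 / enn2real (dst z y) powr s) * f y \<partial>vol)) \<le> ennreal C * nrm p vol f"
proof -
  obtain e where e: "0 < e" "e < 1"
    "(1 - e) powr (- s) * (1 + e) * (1 + e) powr (1 / q) * N * (1 - e) powr (- 1 / p) \<le> C"
    using small_distortion[OF NC, of p q] p by auto
  define u where "u = 1 + e"
  have u: "0 < u" using e by (simp add: u_def)
  obtain c and L :: "real^'n^'n" and R where xc: "x0 \<in> fst c" and n: "normalized c (snd c x0) L e R"
    by (rule ex_normalized[OF x0 e(1,2)], rule that)
  have c: "c \<in> A" and R: "0 < R" and inv: "invertible L" using n by (auto simp: normalized_def)
  have dens: "(1 - e) * \<bar>det L\<bar> \<le> sqrt (det (g c x))" "sqrt (det (g c x)) \<le> u * \<bar>det L\<bar>"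
    if "x \<in> fst c" "norm (L *v (snd c x - snd c x0)) < R" for x
    using n that chartD(6)[OF c that(1)] by (auto simp: normalized_def u_def dest!: spec[of _ "snd c x"])
  have detL: "0 < \<bar>det L\<bar>" using inv by (simp add: invertible_det_nz)
  \<comment> \<open>Points of the r-ball have |L (z - z0)| < R / 4, and two of them are at distance
    less than 2 r = (1 - e) R / 2 < (1 - e) (R - R / 4). Hence \<open>dst_lower_bound\<close>
    applies from each of them, not only from the centre.\<close>
  define r where "r = (1 - e) * R / 4"
  have r: "0 < r" using R e by (simp add: r_def)
  define B where "B = {z \<in> M. dst x0 z < ennreal r}"
  have BM: "B \<in> sets bM" unfolding B_def by (rule dst_ball_sets[OF x0])
  have inB: "x \<in> fst c" "norm (L *v (snd c x - snd c x0)) < R / 4" if "x \<in> B" for x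
  proof -
    have d: "dst x0 x < ennreal ((1 - e) * (R - norm (L *v (snd c x0 - snd c x0))))"
    proof -
      have "dst x0 x < ennreal r" using that by (simp add: B_def)
      also have "r \<le> (1 - e) * R" using R e by (simp add: r_def)
      then have "ennreal r \<le> ennreal ((1 - e) * (R - norm (L *v (snd c x0 - snd c x0))))" by (intro ennreal_leI) simp
      finally show ?thesis .
    qed
    have z: "norm (L *v (snd c x0 - snd c x0)) < R" using R by simp
    show "x \<in> fst c" by (rule dst_lower_bound(1)[OF n xc z d])
    have "ennreal ((1 - e) * norm (L *v (snd c x0 - snd c x))) \<le> dst x0 x" by (rule dst_lower_bound(3)[OF n xc z d])
    also have "dst x0 x < ennreal r" using that by (simp add: B_def)
    finally have "(1 - e) * norm (L *v (snd c x0 - snd c x)) < (1 - e) * (R / 4)" using r e by (subst (asm) ennreal_less_iff) (auto simp: r_def)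
    then have "norm (L *v (snd c x0 - snd c x)) < R / 4" using e by simp
    moreover have "L *v (snd c x - snd c x0) = - (L *v (snd c x0 - snd c x))" by (simp add: matrix_vector_mult_diff_distrib)
    ultimately show "norm (L *v (snd c x - snd c x0)) < R / 4" by simp
  qed
  have Bc: "B \<subseteq> fst c" using inB by blast
  have ker: "1 / enn2real (dst x y) powr s \<le> (1 - e) powr (- s) * (1 / norm (L *v (snd c x - snd c y)) powr s)"
    if x: "x \<in> B" and y: "y \<in> B" for x y
  proof (cases "x = y")
    case True
    then show ?thesis using dst_refl x by (simp add: B_def)
  next
    case False
    have "dst x y \<le> dst x0 x + dst x0 y" using dst_tri[of x y x0] dst_sym[of x x0] by simp
    also have "\<dots> < ennreal r + ennreal r" using x y by (intro add_strict_mono) (auto simp: B_def)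
    also have "\<dots> = ennreal (2 * r)" using r by (simp add: ennreal_plus[symmetric] del: ennreal_plus)
    finally have d2: "dst x y < ennreal (2 * r)" .
    have nx: "norm (L *v (snd c x - snd c x0)) < R" using inB(2)[OF x] R by simp
    have "2 * r \<le> (1 - e) * (R - norm (L *v (snd c x - snd c x0)))"
    proof -
      have "(1 - e) * (R / 2) \<le> (1 - e) * (R - norm (L *v (snd c x - snd c x0)))"
        using inB(2)[OF x] R e by (intro mult_left_mono) linarith+
      then show ?thesis by (simp add: r_def mult.commute)
    qed
    then have "dst x y < ennreal ((1 - e) * (R - norm (L *v (snd c x - snd c x0))))"
      using d2 by (meson ennreal_leI less_le_trans)
    then have lb: "ennreal ((1 - e) * norm (L *v (snd c x - snd c y))) \<le> dst x y"
      using dst_lower_bound(3)[OF n inB(1)[OF x] nx] by blast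
    have "dst x y < top" using d2 by (rule less_trans) simp
    then have lb': "(1 - e) * norm (L *v (snd c x - snd c y)) \<le> enn2real (dst x y)"
      using enn2real_mono[OF lb] e by simp
    have "snd c x \<noteq> snd c y" using False inB(1)[OF x] inB(1)[OF y] chartD(9)[OF c] by (auto dest: inj_onD)
    moreover obtain b where "0 < b" "\<And>v. b * norm v \<le> norm (L *v v)" using invertible_bound[OF inv] by blast
    ultimately have pos: "0 < norm (L *v (snd c x - snd c y))"
      by (smt (verit) mult_pos_pos norm_ge_zero norm_eq_zero right_minus_eq)
    have "((1 - e) * norm (L *v (snd c x - snd c y))) powr s \<le> enn2real (dst x y) powr s"
      using lb' e s by (intro powr_mono2) auto
    then have "1 / enn2real (dst x y) powr s \<le> 1 / ((1 - e) * norm (L *v (snd c x - snd c y))) powr s"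
      using pos e by (intro divide_left_mono) (auto intro!: mult_pos_pos)
    also have "\<dots> = (1 - e) powr (- s) * (1 / norm (L *v (snd c x - snd c y)) powr s)"
      using e by (simp add: powr_mult powr_minus_divide)
    finally show ?thesis .
  qed
  have dens_up: "dens c z * indicator (snd c ` B) z \<le> ennreal u * ennreal \<bar>det L\<bar> * indicator (snd c ` B) z"
    and dens_low: "ennreal (1 - e) * ennreal \<bar>det L\<bar> * indicator (snd c ` B) z \<le> dens c z * indicator (snd c ` B) z" for z
  proof -
    have "sqrt (det (g c (chart_inv c z))) \<le> u * \<bar>det L\<bar>" "(1 - e) * \<bar>det L\<bar> \<le> sqrt (det (g c (chart_inv c z)))"
      if zB: "z \<in> snd c ` B"
    proof -
      obtain x where x: "x \<in> B" "z = snd c x" using zB by blast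
      have "norm (L *v (snd c x - snd c x0)) < R" using inB(2)[OF x(1)] R by simp
      then show "sqrt (det (g c (chart_inv c z))) \<le> u * \<bar>det L\<bar>" "(1 - e) * \<bar>det L\<bar> \<le> sqrt (det (g c (chart_inv c z)))"
        using dens[OF inB(1)[OF x(1)]] x chartD(6)[OF c inB(1)[OF x(1)]] by auto
    qed
    then show "dens c z * indicator (snd c ` B) z \<le> ennreal u * ennreal \<bar>det L\<bar> * indicator (snd c ` B) z"
      "ennreal (1 - e) * ennreal \<bar>det L\<bar> * indicator (snd c ` B) z \<le> dens c z * indicator (snd c ` B) z"
      using e u by (auto simp: indicator_def dens_def ennreal_mult'[symmetric] intro!: ennreal_leI)
  qed
  have cB[measurable]: "snd c ` B \<in> sets borel" by (rule chart_image_borel[OF c BM Bc])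
  show ?thesis
  proof (intro exI[of _ r] conjI ballI impI)
    show "0 < r" by (rule r)
    fix f :: "'m \<Rightarrow> ennreal" assume f[measurable]: "f \<in> borel_measurable vol" and out: "\<forall>y\<in>space vol. ennreal r \<le> dst x0 y \<longrightarrow> f y = 0"
    have Bvol[measurable]: "B \<in> sets vol" using BM by simp
    \<comment> \<open>The coordinate expression of f; extending it by 0 loses nothing as f vanishes
      outside B.\<close>
    define F where "F z = (if z \<in> snd c ` B then f (chart_inv c z) else 0)" for z
    have [measurable]: "F \<in> borel_measurable borel"
    proof -
      have "chart_inv c \<in> measurable (restrict_space borel (snd c ` B)) bM"
      proof (rule measurable_restrict_space2)
        show "chart_inv c \<in> space (restrict_space borel (snd c ` B)) \<rightarrow> M"
          using Bc chartD(2,8)[OF c] by (auto simp: space_restrict_space)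
        show "chart_inv c \<in> borel_measurable (restrict_space borel (snd c ` B))"
          using continuous_on_subset[OF chartD(5)[OF c]] Bc by (intro borel_measurable_continuous_on_restrict) blast
      qed
      then have "chart_inv c \<in> measurable (restrict_space borel (snd c ` B)) vol"
        by (subst measurable_cong_sets[OF refl vol_basic(2)])
      then have "(\<lambda>z. f (chart_inv c z)) \<in> borel_measurable (restrict_space borel (snd c ` B))"
        by (rule measurable_compose) (rule f)
      then show ?thesis unfolding F_def[abs_def] by (subst measurable_If_restrict_space_iff) auto
    qed
    define E where "E z = (\<integral>\<^sup>+w. ennreal (1 / norm (L *v (z - w)) powr s) * F w * ennreal \<bar>det L\<bar> \<partial>lborel)" for z
    have [measurable]: "(*v) L \<in> borel_measurable borel"
      by (intro borel_measurable_continuous_onI matrix_vector_mult_linear_continuous_on)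
    have [measurable]: "E \<in> borel_measurable borel" unfolding E_def[abs_def] by measurable
    \<comment> \<open>The factor (1 - e)^(-s) comes from the kernel, u = 1 + e from the density of
      the inner integral.\<close>
    define a where "a = (1 - e) powr (- s) * u"
    have a0: "0 < a" using e u by (simp add: a_def)
    define Tf where "Tf x = (\<integral>\<^sup>+y. ennreal (1 / enn2real (dst x y) powr s) * f y \<partial>vol)" for x
    have Tf: "Tf x \<le> ennreal a * E (snd c x)" if x: "x \<in> B" for x
    proof -
      have "Tf x \<le> (\<integral>\<^sup>+y. indicator B y * (ennreal ((1 - e) powr (- s)) * (ennreal (1 / norm (L *v (snd c x - snd c y)) powr s) * f y)) \<partial>vol)"
        unfolding Tf_def
      proof (rule nn_integral_mono)
        fix y assume y: "y \<in> space vol"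
        show "ennreal (1 / enn2real (dst x y) powr s) * f y
          \<le> indicator B y * (ennreal ((1 - e) powr (- s)) * (ennreal (1 / norm (L *v (snd c x - snd c y)) powr s) * f y))"
        proof (cases "y \<in> B")
          case True
          have "ennreal (1 / enn2real (dst x y) powr s) \<le> ennreal ((1 - e) powr (- s)) * ennreal (1 / norm (L *v (snd c x - snd c y)) powr s)"
            using ker[OF x True] by (simp add: ennreal_mult'[symmetric] ennreal_leI)
          then show ?thesis using True by (simp add: mult.assoc[symmetric] mult_right_mono)
        next
          case False
          then show ?thesis using out y by (auto simp: B_def not_less)
        qed
      qed
      also have "\<dots> = (\<integral>\<^sup>+y. indicator B y * (ennreal ((1 - e) powr (- s)) * (ennreal (1 / norm (L *v (snd c x - (if y \<in> B then snd c y else 0))) powr s) * f y)) \<partial>vol)"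
        by (intro nn_integral_cong) (auto simp: indicator_def)
      also have "\<dots> = (\<integral>\<^sup>+w. dens c w * indicator (snd c ` B) w * (ennreal ((1 - e) powr (- s)) *
           (ennreal (1 / norm (L *v (snd c x - (if chart_inv c w \<in> B then snd c (chart_inv c w) else 0))) powr s) * f (chart_inv c w))) \<partial>lborel)"
      proof (rule nn_integral_vol[OF c BM Bc])
        note chart_map_measurable[OF c BM Bc]
        then show "(\<lambda>y. ennreal ((1 - e) powr (- s)) * (ennreal (1 / norm (L *v (snd c x - (if y \<in> B then snd c y else 0))) powr s) * f y)) \<in> borel_measurable vol"
          by measurable
      qed
      also have "\<dots> \<le> (\<integral>\<^sup>+w. ennreal a * (ennreal (1 / norm (L *v (snd c x - w)) powr s) * F w * ennreal \<bar>det L\<bar>) \<partial>lborel)"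
      proof (rule nn_integral_mono)
        fix w
        show "dens c w * indicator (snd c ` B) w * (ennreal ((1 - e) powr (- s)) *
           (ennreal (1 / norm (L *v (snd c x - (if chart_inv c w \<in> B then snd c (chart_inv c w) else 0))) powr s) * f (chart_inv c w)))
           \<le> ennreal a * (ennreal (1 / norm (L *v (snd c x - w)) powr s) * F w * ennreal \<bar>det L\<bar>)"
        proof (cases "w \<in> snd c ` B")
          case True
          then obtain y where y: "y \<in> B" "w = snd c y" by blast
          have iw: "chart_inv c w = y" using y chartD(6)[OF c] Bc by auto
          have "dens c w * (ennreal ((1 - e) powr (- s)) * (ennreal (1 / norm (L *v (snd c x - w)) powr s) * F w))
            \<le> ennreal u * ennreal \<bar>det L\<bar> * (ennreal ((1 - e) powr (- s)) * (ennreal (1 / norm (L *v (snd c x - w)) powr s) * F w))"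
            using dens_up[of w] True by (intro mult_right_mono) auto
          also have "\<dots> = ennreal a * (ennreal (1 / norm (L *v (snd c x - w)) powr s) * F w * ennreal \<bar>det L\<bar>)"
            using e u by (simp add: a_def ennreal_mult ac_simps)
          finally show ?thesis using True y iw by (simp add: F_def)
        qed simp
      qed
      also have "\<dots> = ennreal a * E (snd c x)" unfolding E_def by (rule nn_integral_cmult) measurable
      finally show ?thesis .
    qed
    define H where "H = ennreal \<bar>det L\<bar> * (\<integral>\<^sup>+z. epow (E z) q \<partial>lborel)"
    define G where "G = ennreal \<bar>det L\<bar> * (\<integral>\<^sup>+w. epow (F w) p \<partial>lborel)"
    have HG: "epow H (1 / q) \<le> ennreal N * epow G (1 / p)"
      unfolding H_def G_def E_def by (rule eucl_HLS_linear[OF _ inv p \<open>F \<in> borel_measurable borel\<close>]) (rule HLS)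
    have "(\<integral>\<^sup>+x. epow (indicator B x * Tf x) q \<partial>vol) \<le> (\<integral>\<^sup>+x. indicator B x * epow (ennreal a * E (if x \<in> B then snd c x else 0)) q \<partial>vol)"
    proof (rule nn_integral_mono)
      fix x
      show "epow (indicator B x * Tf x) q \<le> indicator B x * epow (ennreal a * E (if x \<in> B then snd c x else 0)) q"
        using Tf[of x] p by (cases "x \<in> B") (auto intro: epow_mono)
    qed
    also have "\<dots> = (\<integral>\<^sup>+z. dens c z * indicator (snd c ` B) z * epow (ennreal a * E (if chart_inv c z \<in> B then snd c (chart_inv c z) else 0)) q \<partial>lborel)"
    proof (rule nn_integral_vol[OF c BM Bc])
      note chart_map_measurable[OF c BM Bc]
      then show "(\<lambda>x. epow (ennreal a * E (if x \<in> B then snd c x else 0)) q) \<in> borel_measurable vol" by measurable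
    qed
    also have "\<dots> \<le> (\<integral>\<^sup>+z. (ennreal u * ennreal (a powr q) * ennreal \<bar>det L\<bar>) * epow (E z) q \<partial>lborel)"
    proof (rule nn_integral_mono)
      fix z
      show "dens c z * indicator (snd c ` B) z * epow (ennreal a * E (if chart_inv c z \<in> B then snd c (chart_inv c z) else 0)) q
        \<le> (ennreal u * ennreal (a powr q) * ennreal \<bar>det L\<bar>) * epow (E z) q"
      proof (cases "z \<in> snd c ` B")
        case True
        then obtain y where y: "y \<in> B" "z = snd c y" by blast
        have iw: "chart_inv c z = y" using y chartD(6)[OF c] Bc by auto
        have "dens c z * epow (ennreal a * E z) q \<le> ennreal u * ennreal \<bar>det L\<bar> * epow (ennreal a * E z) q"
          using dens_up[of z] True by (intro mult_right_mono) auto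
        also have "\<dots> = (ennreal u * ennreal (a powr q) * ennreal \<bar>det L\<bar>) * epow (E z) q"
          using a0 p by (simp add: epow_mult ac_simps)
        finally show ?thesis using True y iw by simp
      qed simp
    qed
    also have "\<dots> = ennreal u * ennreal (a powr q) * H"
      unfolding H_def by (subst nn_integral_cmult) (auto simp: mult.assoc)
    finally have "nrm q vol (\<lambda>x. indicator B x * Tf x) \<le> epow (ennreal u * ennreal (a powr q) * H) (1 / q)"
      unfolding nrm_def using p by (intro epow_mono) auto
    also have "\<dots> = ennreal (u powr (1 / q)) * ennreal a * epow H (1 / q)"
      using p u a0 by (simp add: epow_mult powr_powr)
    also have "\<dots> \<le> ennreal (u powr (1 / q)) * ennreal a * (ennreal N * epow G (1 / p))"
      by (intro mult_left_mono HG) auto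
    finally have 1: "nrm q vol (\<lambda>x. indicator B x * Tf x) \<le> ennreal (u powr (1 / q)) * ennreal a * (ennreal N * epow G (1 / p))" .
    \<comment> \<open>Here the lower density bound leads from the flat L^p norm of F back to the
      norm of f on the manifold.\<close>
    have "ennreal (1 - e) * G = (\<integral>\<^sup>+w. ennreal (1 - e) * ennreal \<bar>det L\<bar> * epow (F w) p \<partial>lborel)"
      unfolding G_def by (subst nn_integral_cmult) (auto simp: mult.assoc)
    also have "\<dots> \<le> (\<integral>\<^sup>+w. dens c w * indicator (snd c ` B) w * epow (f (chart_inv c w)) p \<partial>lborel)"
    proof (rule nn_integral_mono)
      fix w
      show "ennreal (1 - e) * ennreal \<bar>det L\<bar> * epow (F w) p \<le> dens c w * indicator (snd c ` B) w * epow (f (chart_inv c w)) p"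
      proof (cases "w \<in> snd c ` B")
        case True
        then show ?thesis using mult_right_mono[OF dens_low[of w], of "epow (F w) p"] by (simp add: F_def)
      qed (simp add: F_def)
    qed
    also have "\<dots> = (\<integral>\<^sup>+x. indicator B x * epow (f x) p \<partial>vol)"
      by (rule nn_integral_vol[OF c BM Bc, symmetric]) measurable
    also have "\<dots> \<le> (\<integral>\<^sup>+x. epow (f x) p \<partial>vol)" by (intro nn_integral_mono) (auto simp: indicator_def)
    finally have "ennreal (1 - e) * G \<le> (\<integral>\<^sup>+x. epow (f x) p \<partial>vol)" .
    then have "epow (ennreal (1 - e) * G) (1 / p) \<le> nrm p vol f" unfolding nrm_def using p by (intro epow_mono) auto
    then have "ennreal ((1 - e) powr (1 / p)) * epow G (1 / p) \<le> nrm p vol f" using p e by (simp add: epow_mult)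
    then have "ennreal ((1 - e) powr (- 1 / p)) * (ennreal ((1 - e) powr (1 / p)) * epow G (1 / p)) \<le> ennreal ((1 - e) powr (- 1 / p)) * nrm p vol f"
      by (rule mult_left_mono) simp
    moreover have "ennreal ((1 - e) powr (- 1 / p)) * (ennreal ((1 - e) powr (1 / p)) * epow G (1 / p)) = epow G (1 / p)"
      using e by (simp add: mult.assoc[symmetric] ennreal_mult'[symmetric] powr_add[symmetric])
    ultimately have 2: "epow G (1 / p) \<le> ennreal ((1 - e) powr (- 1 / p)) * nrm p vol f" by simp
    have "nrm q vol (\<lambda>x. indicator B x * Tf x)
       \<le> ennreal (u powr (1 / q)) * ennreal a * (ennreal N * (ennreal ((1 - e) powr (- 1 / p)) * nrm p vol f))"
      using 1 2 by (meson mult_left_mono order_trans zero_le)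
    also have "\<dots> = ennreal ((1 - e) powr (- s) * u * u powr (1 / q) * N * (1 - e) powr (- 1 / p)) * nrm p vol f"
      using a0 NC e u by (simp add: a_def ennreal_mult ac_simps)
    also have "\<dots> \<le> ennreal C * nrm p vol f" using e(3)[folded u_def] by (intro mult_right_mono ennreal_leI) auto
    finally show "nrm q vol (\<lambda>z. indicator {z \<in> space vol. dst x0 z < ennreal r} z *
          (\<integral>\<^sup>+y. ennreal (1 / enn2real (dst z y) powr s) * f y \<partial>vol)) \<le> ennreal C * nrm p vol f"
      by (simp add: Tf_def B_def)
  qed
qed

end

section \<open>Attainment of the sharp constant\<close>

theorem theorem1p3:
  fixes M :: "'m::t2_space set"
    and A :: "('m, 'n::finite) chart set"
    and g :: "('m, 'n) metric_tensor"
    and \<alpha> p q :: real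
  assumes "compact M"
    and "riemannian_manifold M A g"
    and "0 < \<alpha>" and "\<alpha> < real CARD('n)"
    and "1 < p" and "p < real CARD('n) / \<alpha>"
    and "1 / q = 1 / p - \<alpha> / real CARD('n)"
    and "HLS_constant (riemannian_volume M A g) (riemannian_dist M A g) CARD('n) \<alpha> p q
         > HLS_constant (lborel :: (real ^ 'n) measure) dist CARD('n) \<alpha> p q"
  shows "\<exists>f \<in> Lp_nonzero p (riemannian_volume M A g).
           HLS_constant (riemannian_volume M A g) (riemannian_dist M A g) CARD('n) \<alpha> p q
           = HLS_quotient (riemannian_volume M A g) (riemannian_dist M A g) CARD('n) \<alpha> p q f"
proof -
  interpret compact_riem M A g using assms(1,2) by unfold_locales
  define s where "s = real CARD('n) - \<alpha>"
  define NM where "NM = HLS_constant vol (riemannian_dist M A g) CARD('n) \<alpha> p q"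
  define NE where "NE = HLS_constant (lborel :: (real ^ 'n) measure) dist CARD('n) \<alpha> p q"
  have s: "0 < s" using assms by (simp add: s_def)
  have n: "0 < real CARD('n)" using assms by linarith
  \<comment> \<open>The condition p < n / \<alpha> makes 1 / q positive, and \<alpha> > 0 makes it
    smaller than 1 / p; hence 1 < p < q.\<close>
  have "\<alpha> / real CARD('n) < 1 / p" using assms(3,5,6) n by (simp add: field_simps)
  then have iq: "0 < 1 / q" using assms(7) by simp
  have "1 / q < 1 / p" using assms(3,7) n by simp
  then have pq: "p < q" using iq assms(5) by (simp add: field_simps zero_less_divide_iff split: if_splits)
  have q: "1 < q" using pq assms(5) by simp
  have NEM: "NE < NM" using assms(8) by (simp add: NE_def NM_def)
  \<comment> \<open>Being strictly below \<open>NM\<close>, the Euclidean constant is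
    finite.\<close>
  then obtain ne where ne: "NE = ennreal ne" "0 \<le> ne" by (cases NE) auto
  \<comment> \<open>At this stage \<open>NM\<close> may still be \<infinity>; once the local
    estimate with C is available, \<open>R.T_bounded\<close> makes it finite.\<close>
  obtain C where C: "ne < C" "ennreal C < NM"
  proof (cases NM)
    case (real b)
    then have "ne < b" using NEM ne by (simp add: ennreal_less_iff)
    then show ?thesis using real ne that[of "(ne + b) / 2"] by (simp add: ennreal_less_iff)
  next
    case top
    then show ?thesis using that[of "ne + 1"] by simp
  qed
  have HLS: "nrm q lborel (eucl_T s F) \<le> ennreal ne * nrm p lborel F" if "F \<in> borel_measurable borel" for F :: "real^'n \<Rightarrow> ennreal"
    unfolding s_def using eucl_HLS[OF assms(3,4,5) q _ that, of ne] ne(1) unfolding NE_def by simp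
  interpret R: riesz_space vol dst s p q C
  proof (intro riesz_space.intro[OF vol_finite] riesz_space_axioms.intro)
    show "dst x z \<le> dst x y + dst y z" for x y z by (rule dst_tri)
    show "\<exists>F. finite F \<and> F \<subseteq> space vol \<and> (\<forall>x\<in>space vol. \<exists>y\<in>F. dst y x < ennreal (\<rho> y))"
      if "\<And>x. x \<in> space vol \<Longrightarrow> 0 < \<rho> x" for \<rho>
      using dst_ball_cover[of \<rho>] that by simp
    show "\<exists>r>0. \<forall>f\<in>borel_measurable vol. (\<forall>y\<in>space vol. ennreal r \<le> dst x y \<longrightarrow> f y = 0) \<longrightarrow>
      nrm q vol (\<lambda>z. indicator {z \<in> space vol. dst x z < ennreal r} z *
          (\<integral>\<^sup>+y. ennreal (1 / enn2real (dst z y) powr s) * f y \<partial>vol)) \<le> ennreal C * nrm p vol f"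
      if "x \<in> space vol" for x
      using local_estimate[OF HLS ne(2) C(1) assms(5) q s] that by simp
  qed (use s assms(5) pq ne C dst_sym dst_refl dst_ball_sets in auto)
  define riesz where "riesz = riesz_potential vol (riemannian_dist M A g) CARD('n) \<alpha>"
  have kf: "f y / riemannian_dist M A g x y powr (real CARD('n) - \<alpha>) = R.k x y * f y" for f :: "'m \<Rightarrow> real" and x y
    unfolding s_def[symmetric] by (simp add: R.k_def riemannian_dist_eq)
  \<comment> \<open>If the integrand is not integrable, the Bochner integral has the default value 0
    and the inequality is trivial.\<close>
  have riesz_le: "ennreal \<bar>riesz f x\<bar> \<le> R.T (\<lambda>y. ennreal \<bar>f y\<bar>) x" for f x
  proof (cases "integrable vol (\<lambda>y. R.k x y * f y)")
    case True
    have "ennreal \<bar>riesz f x\<bar> \<le> (\<integral>\<^sup>+y. ennreal \<bar>R.k x y * f y\<bar> \<partial>vol)"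
      using integral_norm_bound_ennreal[OF True] by (simp add: riesz_def riesz_potential_def kf)
    then show ?thesis by (simp add: R.T_def abs_mult ennreal_mult)
  next
    case False
    then show ?thesis by (simp add: riesz_def riesz_potential_def kf not_integrable_integral_eq)
  qed
  have riesz_eq: "riesz f x = enn2real (R.T (\<lambda>y. ennreal (f y)) x)"
    if "f \<in> borel_measurable vol" "\<And>y. 0 \<le> f y" "x \<in> M" for f x
  proof -
    have [measurable]: "f \<in> borel_measurable vol" "x \<in> space vol" using that by auto
    have "riesz f x = enn2real (\<integral>\<^sup>+y. ennreal (R.k x y * f y) \<partial>vol)"
      unfolding riesz_def riesz_potential_def kf using that(2)
      by (intro integral_eq_nn_integral) auto
    then show ?thesis using that(2) by (simp add: R.T_def ennreal_mult)
  qed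
  have quot: "HLS_quotient vol (riemannian_dist M A g) CARD('n) \<alpha> p q f
    = nrm q vol (\<lambda>x. ennreal \<bar>riesz f x\<bar>) / nrm p vol (\<lambda>x. ennreal \<bar>f x\<bar>)" for f
    by (simp add: HLS_quotient_def Lp_norm_eq_nrm riesz_def)
  have quot_le: "HLS_quotient vol (riemannian_dist M A g) CARD('n) \<alpha> p q f
    \<le> nrm q vol (R.T (\<lambda>x. ennreal \<bar>f x\<bar>)) / nrm p vol (\<lambda>x. ennreal \<bar>f x\<bar>)" for f
    unfolding quot using q riesz_le by (intro divide_right_mono_ennreal nrm_mono) auto
  have nonzeroD: "f \<in> borel_measurable vol" "nrm p vol (\<lambda>x. ennreal \<bar>f x\<bar>) < top" "nrm p vol (\<lambda>x. ennreal \<bar>f x\<bar>) \<noteq> 0"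
    if "f \<in> Lp_nonzero p vol" for f
  proof -
    show [measurable]: "f \<in> borel_measurable vol" "nrm p vol (\<lambda>x. ennreal \<bar>f x\<bar>) < top"
      using that by (auto simp: Lp_nonzero_def Lp_norm_eq_nrm)
    have "\<not> (AE x in vol. f x = 0)" using that by (simp add: Lp_nonzero_def)
    then show "nrm p vol (\<lambda>x. ennreal \<bar>f x\<bar>) \<noteq> 0"
      using assms(5) by (subst nrm_eq_0_iff) (auto simp: ennreal_eq_0_iff)
  qed
  obtain B where B: "0 \<le> B" "\<And>f. f \<in> borel_measurable vol \<Longrightarrow> nrm q vol (R.T f) \<le> ennreal B * nrm p vol f"
    using R.T_bounded by blast
  have "NM \<le> ennreal B"
    unfolding NM_def HLS_constant_def
  proof (rule SUP_least)
    fix f assume f: "f \<in> Lp_nonzero p vol"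
    have [measurable]: "f \<in> borel_measurable vol" by (rule nonzeroD[OF f])
    have "nrm q vol (R.T (\<lambda>x. ennreal \<bar>f x\<bar>)) / nrm p vol (\<lambda>x. ennreal \<bar>f x\<bar>) \<le> ennreal B"
      using B(2)[of "\<lambda>x. ennreal \<bar>f x\<bar>"] nonzeroD(2,3)[OF f] by (intro divide_le_posI_ennreal) (auto simp: zero_less_iff_neq_zero mult.commute)
    then show "HLS_quotient vol (riemannian_dist M A g) CARD('n) \<alpha> p q f \<le> ennreal B"
      using quot_le order_trans by blast
  qed
  then obtain N where N: "NM = ennreal N" "0 \<le> N" by (cases NM) (auto simp: top_unique)
  have CN: "C < N" using C N ne by (simp add: ennreal_less_iff)
  have N0: "0 < N" using CN C ne by simp
  \<comment> \<open>The potential of a nonnegative function in L^p is finite almost everywhere, so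
    there the default value of the real integral does not interfere and both norms agree.\<close>
  have fin_quot: "nrm q vol (\<lambda>x. ennreal \<bar>riesz f x\<bar>) = nrm q vol (R.T (\<lambda>x. ennreal (f x)))"
    if f[measurable]: "f \<in> borel_measurable vol" "\<And>x. 0 \<le> f x" "nrm p vol (\<lambda>x. ennreal (f x)) < top" for f
  proof -
    have "nrm q vol (R.T (\<lambda>x. ennreal (f x))) \<le> ennreal B * nrm p vol (\<lambda>x. ennreal (f x))" by (rule B) measurable
    also have "\<dots> < top" using f(3) by (simp add: ennreal_mult_less_top)
    finally have "(\<integral>\<^sup>+x. epow (R.T (\<lambda>x. ennreal (f x)) x) q \<partial>vol) < top" by (simp add: nrm_def)
    then have "AE x in vol. epow (R.T (\<lambda>x. ennreal (f x)) x) q \<noteq> \<infinity>" by (intro nn_integral_PInf_AE) auto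
    then have eq: "AE x in vol. ennreal \<bar>riesz f x\<bar> = R.T (\<lambda>x. ennreal (f x)) x"
      using AE_space
    proof eventually_elim
      case (elim x)
      then show ?case using riesz_eq[OF f(1,2), of x] by (simp add: less_top)
    qed
    show ?thesis by (rule antisym; rule nrm_mono_AE) (use q eq in \<open>auto elim: AE_mp\<close>)
  qed
  have bound: "nrm q vol (R.T f) \<le> ennreal N * nrm p vol f" if f[measurable]: "f \<in> borel_measurable vol" for f
  proof -
    consider "nrm p vol f = 0" | "nrm p vol f = top" | "nrm p vol f \<noteq> 0" "nrm p vol f < top"
      by (metis less_top)
    then show ?thesis
    proof cases
      case 1
      then show ?thesis using B(2)[OF f] by simp
    next
      case 2
      then show ?thesis using N0 by (simp add: ennreal_mult_top)
    next
      case 3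
      \<comment> \<open>An extended function of finite norm is finite almost everywhere, so it has a
        real representative, which competes in the supremum.\<close>
      define h where "h x = enn2real (f x)" for x
      have [measurable]: "h \<in> borel_measurable vol" unfolding h_def[abs_def] by measurable
      have "(\<integral>\<^sup>+x. epow (f x) p \<partial>vol) < top" using 3 by (simp add: nrm_def)
      then have "AE x in vol. epow (f x) p \<noteq> \<infinity>" by (intro nn_integral_PInf_AE) auto
      then have hf: "AE x in vol. ennreal (h x) = f x" by eventually_elim (simp add: h_def less_top)
      have nh: "nrm p vol (\<lambda>x. ennreal (h x)) = nrm p vol f"
        by (rule antisym; rule nrm_mono_AE) (use assms(5) hf in \<open>auto elim: AE_mp\<close>)
      have Th: "R.T (\<lambda>x. ennreal (h x)) = R.T f" by (rule ext, rule R.T_cong_AE, rule hf)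
      have h0: "0 \<le> h x" for x by (simp add: h_def)
      have "\<not> (AE x in vol. h x = 0)"
      proof
        assume "AE x in vol. h x = 0"
        then have "AE x in vol. ennreal (h x) = 0" by eventually_elim simp
        then have "nrm p vol (\<lambda>x. ennreal (h x)) = 0" using assms(5) by (subst nrm_eq_0_iff) auto
        then show False using 3 nh by simp
      qed
      then have hL: "h \<in> Lp_nonzero p vol" using 3 nh h0 by (simp add: Lp_nonzero_def Lp_norm_eq_nrm)
      have "HLS_quotient vol (riemannian_dist M A g) CARD('n) \<alpha> p q h \<le> ennreal N"
        unfolding N(1)[symmetric] NM_def HLS_constant_def by (rule SUP_upper[OF hL])
      then have "nrm q vol (R.T f) / nrm p vol f \<le> ennreal N"
        unfolding quot using fin_quot[of h] h0 nh 3 Th by simp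
      then show ?thesis using 3 by (intro le_mult_of_divide_le) auto
    qed
  qed
  \<comment> \<open>Replacing f by |f| divided by its norm does not decrease the quotient, by
    \<open>quot_le\<close>.\<close>
  have sup: "\<exists>f\<in>borel_measurable vol. nrm p vol f = 1 \<and> ennreal (N - e) \<le> nrm q vol (R.T f)" if e: "0 < e" for e
  proof -
    have "ennreal (N - e) < NM" unfolding N(1) using N0 e by (simp add: ennreal_lessI)
    then obtain f where f: "f \<in> Lp_nonzero p vol" "ennreal (N - e) < HLS_quotient vol (riemannian_dist M A g) CARD('n) \<alpha> p q f"
      unfolding NM_def HLS_constant_def less_SUP_iff by blast
    note fm[measurable] = nonzeroD(1)[OF f(1)]
    obtain a where a: "nrm p vol (\<lambda>x. ennreal \<bar>f x\<bar>) = ennreal a" "0 < a"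
      using nonzeroD(2,3)[OF f(1)] by (cases "nrm p vol (\<lambda>x. ennreal \<bar>f x\<bar>)") (auto simp: less_le)
    define h where "h x = ennreal (1 / a) * ennreal \<bar>f x\<bar>" for x
    have [measurable]: "h \<in> borel_measurable vol" unfolding h_def[abs_def] by measurable
    have "nrm p vol h = ennreal (1 / a) * ennreal a"
      unfolding h_def[abs_def] using assms(5) a by (subst nrm_cmult) auto
    then have h1: "nrm p vol h = 1" using a by (simp add: ennreal_mult'[symmetric])
    have "nrm q vol (R.T h) = nrm q vol (\<lambda>x. ennreal (1 / a) * R.T (\<lambda>x. ennreal \<bar>f x\<bar>) x)"
    proof (rule nrm_cong)
      fix x assume [measurable]: "x \<in> space vol"
      show "R.T h x = ennreal (1 / a) * R.T (\<lambda>x. ennreal \<bar>f x\<bar>) x"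
        unfolding R.T_def h_def by (subst nn_integral_cmult[symmetric]) (auto simp: mult.left_commute)
    qed
    also have "\<dots> = ennreal (1 / a) * nrm q vol (R.T (\<lambda>x. ennreal \<bar>f x\<bar>))" using q by (intro nrm_cmult) auto
    also have "\<dots> = nrm q vol (R.T (\<lambda>x. ennreal \<bar>f x\<bar>)) / ennreal a"
      using a by (simp add: divide_ennreal_def inverse_ennreal mult.commute divide_inverse)
    finally have "nrm q vol (R.T h) = nrm q vol (R.T (\<lambda>x. ennreal \<bar>f x\<bar>)) / ennreal a" .
    then have "ennreal (N - e) \<le> nrm q vol (R.T h)"
      using f(2) quot_le[of f] a by (simp add: less_imp_le)
    then show ?thesis using h1 by (intro bexI[of _ h]) auto
  qed
  obtain f where f: "f \<in> borel_measurable vol" "\<And>x. 0 \<le> f x" "0 < nrm p vol (\<lambda>x. ennreal (f x))"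
    "nrm p vol (\<lambda>x. ennreal (f x)) < top" "nrm q vol (R.T (\<lambda>x. ennreal (f x))) = ennreal N * nrm p vol (\<lambda>x. ennreal (f x))"
    using R.maximizer_exists[OF N(2) bound sup CN] by blast
  note [measurable] = f(1)
  have "\<not> (AE x in vol. f x = 0)"
  proof
    assume "AE x in vol. f x = 0"
    then have "AE x in vol. ennreal (f x) = 0" by eventually_elim simp
    then have "nrm p vol (\<lambda>x. ennreal (f x)) = 0" using assms(5) by (subst nrm_eq_0_iff) auto
    then show False using f(3) by simp
  qed
  then have "f \<in> Lp_nonzero p vol" using f by (simp add: Lp_nonzero_def Lp_norm_eq_nrm)
  moreover have "HLS_quotient vol (riemannian_dist M A g) CARD('n) \<alpha> p q f = NM"
  proof -
    have "HLS_quotient vol (riemannian_dist M A g) CARD('n) \<alpha> p q f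
      = ennreal N * nrm p vol (\<lambda>x. ennreal (f x)) / nrm p vol (\<lambda>x. ennreal (f x))"
      unfolding quot using fin_quot[OF f(1,2,4)] f(2,5) by simp
    also have "\<dots> = ennreal N" using f(3,4) by (intro ennreal_mult_divide_eq) (auto simp: less_top)
    finally show ?thesis by (simp add: N)
  qed
  ultimately show ?thesis by (intro bexI[of _ f]) (auto simp: NM_def)
qed

end
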